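(* Let $(R,\mathfrak m)$ be a commutative Artinian local ring and $I\subsetneq R$ a nonzero ideal such that $\mathfrak m^2I=0$ and $\lambda(R)<2sh$, where $s=\lambda(R/I)$ and $h=b_0(I)$. Let $M$ be a finitely generated nonzero $R$-module with $\mathfrak m I M=0$ and let $N$ be a finitely generated non-free $R$-module. Let $j>1$ be an integer such that $M_t$ and $N_t$ are $I$-free for $t=j,j+1,j+2$. Set $\beta=\max\{\log_2(b_1(M))+1,\ \log_2(b_1(N))+1,\ j+2\}$. If $\operatorname{Tor}^R_i(M,N)=0$ for all integers $i\in[1,\beta]$, then $M$ or $N$ is free.
   Context: $\lambda(-)$ denotes length. For a finitely generated $R$-module $L$, $b_i(L)$ is the $i$-th Betti number (rank of the $i$-th free module in the minimal free resolution of $L$), so $b_0(L)$ is the minimal number of generators. $L_i$ is the $i$-th syzygy of $L$ in its minimal free resolution: $L_0=L$, and for $i\ge1$ there is an exact sequence $0\to L_i\to R^{b_{i-1}(L)}\to L_{i-1}\to 0$ with $L_i\subset \mathfrak m R^{b_{i-1}(L)}$. $L$ is called $I$-free if $L/IL$ is a free $R/I$-module. If $b_1(M)=0$, the term $\log_2(b_1(M))+1$ is read as $-\infty$. *)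

theory Defs
  imports Complex_Main "HOL-Algebra.QuotRing" "HOL-Algebra.Ideal_Product" "HOL-Algebra.Module"
    "HOL-Library.Extended_Real"
begin

text \<open>
  Modules are records of type \<^typ>\<open>('a, 'b, 'k) module_scheme\<close>.  These extend ring records, but
  the locale \<^locale>\<open>Module.module\<close> puts no condition on the fields \<^const>\<open>monoid.mult\<close> and
  \<^const>\<open>monoid.one\<close>; they are left \<^const>\<open>undefined\<close> in the constructions below.  A submodule \<open>H\<close>
  of \<open>M\<close>, regarded as a module, is \<open>M\<lparr>carrier := H\<rparr>\<close>.
\<close>

section \<open>Artinian local rings\<close>

definition local_ring :: "('a, 'r) ring_scheme \<Rightarrow> 'a set \<Rightarrow> bool" where
  "local_ring R m \<longleftrightarrow> cring R \<and> maximalideal m R \<and> (\<forall>J. maximalideal J R \<longrightarrow> J = m)"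

definition artinian_ring :: "('a, 'r) ring_scheme \<Rightarrow> bool" where
  "artinian_ring R \<longleftrightarrow> ring R \<and>
     (\<forall>J :: nat \<Rightarrow> 'a set. (\<forall>n. ideal (J n) R \<and> J (Suc n) \<subseteq> J n) \<longrightarrow>
        (\<exists>k. \<forall>n\<ge>k. J n = J k))"


section \<open>Modules\<close>

definition regular_module :: "('a, 'r) ring_scheme \<Rightarrow> ('a, 'a) module" where
  "regular_module R =
     \<lparr>carrier = carrier R, monoid.mult = undefined, monoid.one = undefined,
      ring.zero = \<zero>\<^bsub>R\<^esub>, ring.add = ring.add R, smult = (\<otimes>\<^bsub>R\<^esub>)\<rparr>"

definition module_span ::
    "('a, 'r) ring_scheme \<Rightarrow> ('a, 'b, 'k) module_scheme \<Rightarrow> 'b set \<Rightarrow> 'b set" where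
  "module_span R M S = \<Inter> {H. submodule H R M \<and> S \<subseteq> H}"

definition finitely_generated ::
    "('a, 'r) ring_scheme \<Rightarrow> ('a, 'b, 'k) module_scheme \<Rightarrow> bool" where
  "finitely_generated R M \<longleftrightarrow>
     (\<exists>S. finite S \<and> S \<subseteq> carrier M \<and> module_span R M S = carrier M)"

definition lin_indep ::
    "('a, 'r) ring_scheme \<Rightarrow> ('a, 'b, 'k) module_scheme \<Rightarrow> 'b set \<Rightarrow> bool" where
  "lin_indep R M B \<longleftrightarrow>
     (\<forall>A c. finite A \<and> A \<subseteq> B \<and> c \<in> A \<rightarrow> carrier R \<and>
        (\<Oplus>\<^bsub>M\<^esub>x\<in>A. c x \<odot>\<^bsub>M\<^esub> x) = \<zero>\<^bsub>M\<^esub> \<longrightarrow> (\<forall>x\<in>A. c x = \<zero>\<^bsub>R\<^esub>))"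

definition is_free :: "('a, 'r) ring_scheme \<Rightarrow> ('a, 'b, 'k) module_scheme \<Rightarrow> bool" where
  "is_free R M \<longleftrightarrow>
     (\<exists>B. B \<subseteq> carrier M \<and> lin_indep R M B \<and> module_span R M B = carrier M)"

text \<open>The submodule \<open>J M\<close> for an ideal \<open>J\<close>.\<close>

definition ideal_smult ::
    "('a, 'r) ring_scheme \<Rightarrow> 'a set \<Rightarrow> ('a, 'b, 'k) module_scheme \<Rightarrow> 'b set" where
  "ideal_smult R J M = module_span R M {a \<odot>\<^bsub>M\<^esub> x | a x. a \<in> J \<and> x \<in> carrier M}"

text \<open>The length: the supremum of the lengths \<open>n\<close> of chains \<open>C 0 \<subset> \<dots> \<subset> C n\<close> of submodules.\<close>

definition module_length ::
    "('a, 'r) ring_scheme \<Rightarrow> ('a, 'b, 'k) module_scheme \<Rightarrow> enat" where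
  "module_length R M =
     Sup {enat n | n. \<exists>C :: nat \<Rightarrow> 'b set.
            (\<forall>i\<le>n. submodule (C i) R M) \<and> (\<forall>i<n. C i \<subset> C (Suc i))}"

definition module_hom ::
    "('a, 'r) ring_scheme \<Rightarrow> ('a, 'b, 'k) module_scheme \<Rightarrow> ('a, 'c, 'l) module_scheme \<Rightarrow>
     ('b \<Rightarrow> 'c) set" where
  "module_hom R M N =
     {f. f \<in> carrier M \<rightarrow> carrier N \<and>
         (\<forall>x\<in>carrier M. \<forall>y\<in>carrier M. f (x \<oplus>\<^bsub>M\<^esub> y) = f x \<oplus>\<^bsub>N\<^esub> f y) \<and>
         (\<forall>a\<in>carrier R. \<forall>x\<in>carrier M. f (a \<odot>\<^bsub>M\<^esub> x) = a \<odot>\<^bsub>N\<^esub> f x)}"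

text \<open>
  The quotient \<open>M/H\<close>.  For a submodule \<open>H\<close> the union in the scalar multiplication is a union of
  equal cosets, cf. \<^const>\<open>rcoset_mult\<close>.
\<close>

definition quot_module :: "('a, 'b, 'k) module_scheme \<Rightarrow> 'b set \<Rightarrow> ('a, 'b set) module" where
  "quot_module M H =
     \<lparr>carrier = a_rcosets\<^bsub>M\<^esub> H, monoid.mult = undefined, monoid.one = undefined,
      ring.zero = H, ring.add = set_add M,
      smult = (\<lambda>a X. \<Union>x\<in>X. H +>\<^bsub>M\<^esub> (a \<odot>\<^bsub>M\<^esub> x))\<rparr>"

text \<open>\<open>M/JM\<close> as a module over \<open>R/J\<close>; the scalars are cosets of \<open>J\<close>.\<close>

definition reduction ::
    "('a, 'r) ring_scheme \<Rightarrow> 'a set \<Rightarrow> ('a, 'b, 'k) module_scheme \<Rightarrow> ('a set, 'b set) module" where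
  "reduction R J M =
     \<lparr>carrier = carrier (quot_module M (ideal_smult R J M)),
      monoid.mult = undefined, monoid.one = undefined,
      ring.zero = ring.zero (quot_module M (ideal_smult R J M)),
      ring.add = ring.add (quot_module M (ideal_smult R J M)),
      smult = (\<lambda>A X. \<Union>a\<in>A. a \<odot>\<^bsub>quot_module M (ideal_smult R J M)\<^esub> X)\<rparr>"

definition ideal_free ::
    "('a, 'r) ring_scheme \<Rightarrow> 'a set \<Rightarrow> ('a, 'b, 'k) module_scheme \<Rightarrow> bool" where
  "ideal_free R J M \<longleftrightarrow> is_free (R Quot J) (reduction R J M)"

text \<open>The free module on a set \<open>X\<close>; in particular \<open>R\<^sup>n\<close> is \<open>free_module R {..<n}\<close>.\<close>

definition free_module :: "('a, 'r) ring_scheme \<Rightarrow> 'x set \<Rightarrow> ('a, 'x \<Rightarrow> 'a) module" where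
  "free_module R X =
     \<lparr>carrier = {u \<in> X \<rightarrow>\<^sub>E carrier R. finite {x \<in> X. u x \<noteq> \<zero>\<^bsub>R\<^esub>}},
      monoid.mult = undefined, monoid.one = undefined,
      ring.zero = (\<lambda>x\<in>X. \<zero>\<^bsub>R\<^esub>),
      ring.add = (\<lambda>u v. \<lambda>x\<in>X. u x \<oplus>\<^bsub>R\<^esub> v x),
      smult = (\<lambda>a u. \<lambda>x\<in>X. a \<otimes>\<^bsub>R\<^esub> u x)\<rparr>"

definition free_gen :: "('a, 'r) ring_scheme \<Rightarrow> 'x set \<Rightarrow> 'x \<Rightarrow> 'x \<Rightarrow> 'a" where
  "free_gen R X x = (\<lambda>y\<in>X. if y = x then \<one>\<^bsub>R\<^esub> else \<zero>\<^bsub>R\<^esub>)"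


section \<open>Tensor products\<close>

definition tensor_relations ::
    "('a, 'r) ring_scheme \<Rightarrow> ('a, 'b, 'k) module_scheme \<Rightarrow> ('a, 'c, 'l) module_scheme \<Rightarrow>
     ('b \<times> 'c \<Rightarrow> 'a) set" where
  "tensor_relations R M N =
     (let X = carrier M \<times> carrier N; F = free_module R X; g = free_gen R X in
        {g (x \<oplus>\<^bsub>M\<^esub> x', y) \<ominus>\<^bsub>F\<^esub> (g (x, y) \<oplus>\<^bsub>F\<^esub> g (x', y)) | x x' y.
           x \<in> carrier M \<and> x' \<in> carrier M \<and> y \<in> carrier N} \<union>
        {g (x, y \<oplus>\<^bsub>N\<^esub> y') \<ominus>\<^bsub>F\<^esub> (g (x, y) \<oplus>\<^bsub>F\<^esub> g (x, y')) | x y y'.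
           x \<in> carrier M \<and> y \<in> carrier N \<and> y' \<in> carrier N} \<union>
        {g (a \<odot>\<^bsub>M\<^esub> x, y) \<ominus>\<^bsub>F\<^esub> a \<odot>\<^bsub>F\<^esub> g (x, y) | a x y.
           a \<in> carrier R \<and> x \<in> carrier M \<and> y \<in> carrier N} \<union>
        {g (x, a \<odot>\<^bsub>N\<^esub> y) \<ominus>\<^bsub>F\<^esub> a \<odot>\<^bsub>F\<^esub> g (x, y) | a x y.
           a \<in> carrier R \<and> x \<in> carrier M \<and> y \<in> carrier N})"

definition tensor_kernel ::
    "('a, 'r) ring_scheme \<Rightarrow> ('a, 'b, 'k) module_scheme \<Rightarrow> ('a, 'c, 'l) module_scheme \<Rightarrow>
     ('b \<times> 'c \<Rightarrow> 'a) set" where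
  "tensor_kernel R M N =
     module_span R (free_module R (carrier M \<times> carrier N)) (tensor_relations R M N)"

definition tensor ::
    "('a, 'r) ring_scheme \<Rightarrow> ('a, 'b, 'k) module_scheme \<Rightarrow> ('a, 'c, 'l) module_scheme \<Rightarrow>
     ('a, ('b \<times> 'c \<Rightarrow> 'a) set) module" where
  "tensor R M N =
     quot_module (free_module R (carrier M \<times> carrier N)) (tensor_kernel R M N)"

definition pure_tensor ::
    "('a, 'r) ring_scheme \<Rightarrow> ('a, 'b, 'k) module_scheme \<Rightarrow> ('a, 'c, 'l) module_scheme \<Rightarrow>
     'b \<Rightarrow> 'c \<Rightarrow> ('b \<times> 'c \<Rightarrow> 'a) set" where
  "pure_tensor R M N x y =
     tensor_kernel R M N +>\<^bsub>free_module R (carrier M \<times> carrier N)\<^esub>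
       free_gen R (carrier M \<times> carrier N) (x, y)"

text \<open>
  \<open>f \<otimes> N\<close> for a homomorphism \<open>f : M \<rightarrow> M'\<close>.  The choice is only of the values outside the carrier
  of \<open>M \<otimes> N\<close>, since pure tensors generate.
\<close>

definition tensor_map ::
    "('a, 'r) ring_scheme \<Rightarrow> ('a, 'b, 'k) module_scheme \<Rightarrow> ('a, 'd, 'l) module_scheme \<Rightarrow>
     ('a, 'c, 'p) module_scheme \<Rightarrow> ('b \<Rightarrow> 'd) \<Rightarrow>
     ('b \<times> 'c \<Rightarrow> 'a) set \<Rightarrow> ('d \<times> 'c \<Rightarrow> 'a) set" where
  "tensor_map R M M' N f =
     (SOME g. g \<in> module_hom R (tensor R M N) (tensor R M' N) \<and>
        (\<forall>x\<in>carrier M. \<forall>y\<in>carrier N. g (pure_tensor R M N x y) = pure_tensor R M' N (f x) y))"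


section \<open>Free resolutions, Betti numbers and syzygies\<close>

text \<open>
  The data of an augmented complex of free modules of finite rank over \<open>L\<close>: the term in degree
  \<open>i\<close> has rank \<open>rk F i\<close>, the map \<open>dif F i\<close> goes from degree \<open>i + 1\<close> to degree \<open>i\<close>, and \<open>aug F\<close> goes
  from degree \<open>0\<close> to \<open>L\<close>.
\<close>

record ('a, 'b) resolution =
  rk :: "nat \<Rightarrow> nat"
  dif :: "nat \<Rightarrow> (nat \<Rightarrow> 'a) \<Rightarrow> (nat \<Rightarrow> 'a)"
  aug :: "(nat \<Rightarrow> 'a) \<Rightarrow> 'b"

abbreviation res_term ::
    "('a, 'r) ring_scheme \<Rightarrow> ('a, 'b) resolution \<Rightarrow> nat \<Rightarrow> ('a, nat \<Rightarrow> 'a) module" where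
  "res_term R F i \<equiv> free_module R {..<rk F i}"

text \<open>The kernel of the map leaving the term in degree \<open>i\<close> of the augmented complex.\<close>

definition res_kernel ::
    "('a, 'r) ring_scheme \<Rightarrow> ('a, 'b, 'k) module_scheme \<Rightarrow> ('a, 'b) resolution \<Rightarrow> nat \<Rightarrow>
     (nat \<Rightarrow> 'a) set" where
  "res_kernel R L F i =
     (case i of
        0 \<Rightarrow> a_kernel (res_term R F 0) L (aug F)
      | Suc k \<Rightarrow> a_kernel (res_term R F (Suc k)) (res_term R F k) (dif F k))"

text \<open>
  Resolutions by free modules of finite rank; over a Noetherian ring every finitely generated
  module has one.
\<close>

definition free_resolution ::
    "('a, 'r) ring_scheme \<Rightarrow> ('a, 'b, 'k) module_scheme \<Rightarrow> ('a, 'b) resolution \<Rightarrow> bool" where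
  "free_resolution R L F \<longleftrightarrow>
     aug F \<in> module_hom R (res_term R F 0) L \<and>
     aug F ` carrier (res_term R F 0) = carrier L \<and>
     (\<forall>i. dif F i \<in> module_hom R (res_term R F (Suc i)) (res_term R F i) \<and>
          dif F i ` carrier (res_term R F (Suc i)) = res_kernel R L F i)"

definition minimal_free_resolution ::
    "('a, 'r) ring_scheme \<Rightarrow> 'a set \<Rightarrow> ('a, 'b, 'k) module_scheme \<Rightarrow>
     ('a, 'b) resolution \<Rightarrow> bool" where
  "minimal_free_resolution R m L F \<longleftrightarrow>
     free_resolution R L F \<and>
     (\<forall>i. res_kernel R L F i \<subseteq> ideal_smult R m (res_term R F i))"

text \<open>
  Minimal free resolutions exist for finitely generated modules over a Noetherian local ring
  \<open>(R, m)\<close> and are unique up to isomorphism, so the choice is immaterial up to isomorphism.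
\<close>

definition min_res ::
    "('a, 'r) ring_scheme \<Rightarrow> 'a set \<Rightarrow> ('a, 'b, 'k) module_scheme \<Rightarrow> ('a, 'b) resolution" where
  "min_res R m L = (SOME F. minimal_free_resolution R m L F)"

definition betti ::
    "('a, 'r) ring_scheme \<Rightarrow> 'a set \<Rightarrow> ('a, 'b, 'k) module_scheme \<Rightarrow> nat \<Rightarrow> nat" where
  "betti R m L i = rk (min_res R m L) i"

text \<open>
  The syzygy \<open>L\<^sub>t\<close> for \<open>t \<ge> 1\<close>, as a submodule of the term in degree \<open>t - 1\<close>.  The value at
  \<open>t = 0\<close> is not specified, because \<open>L\<^sub>0 = L\<close> has elements of a different type.
\<close>

definition syzygy ::
    "('a, 'r) ring_scheme \<Rightarrow> 'a set \<Rightarrow> ('a, 'b, 'k) module_scheme \<Rightarrow> nat \<Rightarrow>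
     ('a, nat \<Rightarrow> 'a) module" where
  "syzygy R m L t =
     (case t of
        0 \<Rightarrow> undefined
      | Suc k \<Rightarrow> (res_term R (min_res R m L) k)
                   \<lparr>carrier := res_kernel R L (min_res R m L) k\<rparr>)"


section \<open>Tor\<close>

text \<open>The homology in degree \<open>i\<close> of the complex \<open>F \<otimes> N\<close> (with the augmentation removed).\<close>

definition tensor_cycles ::
    "('a, 'r) ring_scheme \<Rightarrow> ('a, 'b) resolution \<Rightarrow> ('a, 'c, 'l) module_scheme \<Rightarrow> nat \<Rightarrow>
     ((nat \<Rightarrow> 'a) \<times> 'c \<Rightarrow> 'a) set set" where
  "tensor_cycles R F N i =
     (case i of
        0 \<Rightarrow> carrier (tensor R (res_term R F 0) N)
      | Suc k \<Rightarrow> a_kernel (tensor R (res_term R F (Suc k)) N) (tensor R (res_term R F k) N)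
                   (tensor_map R (res_term R F (Suc k)) (res_term R F k) N (dif F k)))"

definition tensor_boundaries ::
    "('a, 'r) ring_scheme \<Rightarrow> ('a, 'b) resolution \<Rightarrow> ('a, 'c, 'l) module_scheme \<Rightarrow> nat \<Rightarrow>
     ((nat \<Rightarrow> 'a) \<times> 'c \<Rightarrow> 'a) set set" where
  "tensor_boundaries R F N i =
     tensor_map R (res_term R F (Suc i)) (res_term R F i) N (dif F i) `
       carrier (tensor R (res_term R F (Suc i)) N)"

definition tensor_homology ::
    "('a, 'r) ring_scheme \<Rightarrow> ('a, 'b) resolution \<Rightarrow> ('a, 'c, 'l) module_scheme \<Rightarrow> nat \<Rightarrow>
     ('a, ((nat \<Rightarrow> 'a) \<times> 'c \<Rightarrow> 'a) set set) module" where
  "tensor_homology R F N i =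
     quot_module ((tensor R (res_term R F i) N)\<lparr>carrier := tensor_cycles R F N i\<rparr>)
       (tensor_boundaries R F N i)"

text \<open>
  \<open>Tor\<^sub>i(M, N)\<close> for finitely generated \<open>M\<close> over a Noetherian ring, computed from an arbitrary free
  resolution of \<open>M\<close> (up to isomorphism it does not depend on the choice).
\<close>

definition Tor ::
    "('a, 'r) ring_scheme \<Rightarrow> ('a, 'b, 'k) module_scheme \<Rightarrow> ('a, 'c, 'l) module_scheme \<Rightarrow> nat \<Rightarrow>
     ('a, ((nat \<Rightarrow> 'a) \<times> 'c \<Rightarrow> 'a) set set) module" where
  "Tor R M N i = tensor_homology R (SOME F. free_resolution R M F) N i"

definition zero_module :: "('a, 'b, 'k) module_scheme \<Rightarrow> bool" where
  "zero_module M \<longleftrightarrow> carrier M = {\<zero>\<^bsub>M\<^esub>}"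


section \<open>The logarithmic bound\<close>

text \<open>\<open>log\<^sub>2 b + 1\<close>, read as \<open>-\<infinity>\<close> when \<open>b = 0\<close> (whereas \<^const>\<open>log\<close> gives \<open>log 2 0 = 0\<close>).\<close>

definition log2_plus_one :: "nat \<Rightarrow> ereal" where
  "log2_plus_one b = (if b = 0 then -\<infinity> else ereal (log 2 (real b) + 1))"

end

theory Submission
  imports Defs
begin

text \<open>
  Let \<open>e\<^sub>i : R\<^bsup>b(i+1)\<^esup> \<rightarrow> R\<^bsup>b(i)\<^esup>\<close> be the maps of the minimal resolution of \<open>N\<close>.  Since \<open>Tor\<close> is balanced, the
  sequences \<open>M\<^bsup>b(i+1)\<^esup> \<rightarrow> M\<^bsup>b(i)\<^esup> \<rightarrow> M\<^bsup>b(i-1)\<^esup>\<close> are exact for \<open>1 \<le> i \<le> j + 2\<close>.  A syzygy is \<open>I\<close>-free only if the entries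
  of the next map lie in \<open>I\<close>; hence \<open>\<mm>M \<subseteq> IM\<close>, \<open>\<mm>\<^sup>2M = 0\<close> and \<open>\<mm>\<^sup>2 \<subseteq> \<mm>I\<close>.

  This forces \<open>I = \<mm>\<close>.  Otherwise choose an ideal \<open>J \<supseteq> I\<close> maximal among those properly contained in \<open>\<mm>\<close>, and
  \<open>x\<close> in \<open>\<mm>\<close> but not in \<open>J\<close>.  As \<open>x\<^sup>2\<close> lies in \<open>\<mm>I\<close>, there is a square matrix \<open>S\<close> with \<open>S\<^sup>2 = 0\<close> which is
  triangular modulo \<open>J\<close> with diagonal \<open>\<plusminus>x\<close>.  On the tensor product of the minimal resolutions of \<open>M\<close> and of
  the first syzygy of \<open>N\<close>, which is exact in low degrees, \<open>S\<close> has a system of higher null homotopies, and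
  these show that a functional whose coboundary is zero modulo \<open>J\<close> takes its values in \<open>\<mm>\<close>.  But
  functionals on the two resolutions with \<open>\<theta> d = \<plusminus>x \<theta>\<close> modulo \<open>J\<close> combine to one which does not.

  If \<open>I = \<mm>\<close>, comparing lengths determines the length of \<open>\<mm>M\<close> and shows that the projective cover of \<open>M\<close>
  has no kernel.
\<close>

section \<open>Homomorphisms and products of modules\<close>

text \<open>Three choices shape the argument for I = \<mm>. The ideal J is maximal below \<mm>, so
  \<mm>/J is spanned by x; a functional composed with a minimal differential is then x times another
  functional modulo J. The resulting chain of functionals must stop by degree j, where I-freeness
  puts the entries of the differential into I. The matrix S is a Clifford type square root: -x^2 is
  a sum of products v w with v in I and w in \<mm>, and S squares to x^2 plus that sum. The syzygy
  N_1 replaces N because Tor_1 = 0 embeds M \<otimes> N_1 into a power of M, with image in the power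
  of \<mm>M, which \<mm> kills; hence S, with entries in \<mm>, is zero on the homology in degree 0
  and a first null homotopy exists.

  When I = \<mm>, s is 1 and the length hypothesis reads 1 + e + w < 2e, where e and w are the
  lengths of \<mm>/\<mm>^2 and \<mm>^2. The ratio of consecutive Betti numbers of N is a rational
  root of t^2 - et + w, hence an integer, and the inequality leaves only t = e and w = 0.\<close>

lemma module_homI:
  assumes "\<And>x. x \<in> carrier M \<Longrightarrow> f x \<in> carrier N"
    and "\<And>x y. x \<in> carrier M \<Longrightarrow> y \<in> carrier M \<Longrightarrow> f (x \<oplus>\<^bsub>M\<^esub> y) = f x \<oplus>\<^bsub>N\<^esub> f y"
    and "\<And>a x. a \<in> carrier R \<Longrightarrow> x \<in> carrier M \<Longrightarrow> f (a \<odot>\<^bsub>M\<^esub> x) = a \<odot>\<^bsub>N\<^esub> f x"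
  shows "f \<in> module_hom R M N"
  using assms by (auto simp: module_hom_def)

lemma module_homD:
  assumes "f \<in> module_hom R M N"
  shows module_hom_closed: "x \<in> carrier M \<Longrightarrow> f x \<in> carrier N"
    and module_hom_add: "x \<in> carrier M \<Longrightarrow> y \<in> carrier M \<Longrightarrow> f (x \<oplus>\<^bsub>M\<^esub> y) = f x \<oplus>\<^bsub>N\<^esub> f y"
    and module_hom_smult: "a \<in> carrier R \<Longrightarrow> x \<in> carrier M \<Longrightarrow> f (a \<odot>\<^bsub>M\<^esub> x) = a \<odot>\<^bsub>N\<^esub> f x"
  using assms by (auto simp: module_hom_def)

lemma module_hom_comp:
  assumes "f \<in> module_hom R M N" and "g \<in> module_hom R N P"
  shows "(\<lambda>x. g (f x)) \<in> module_hom R M P"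
  using assms by (intro module_homI) (simp_all add: module_homD)

lemma module_hom_id: "(\<lambda>x. x) \<in> module_hom R M M"
  by (simp add: module_hom_def)

lemma module_hom_cong:
  assumes "Module.module R M" and "f \<in> module_hom R M N" and "\<And>x. x \<in> carrier M \<Longrightarrow> g x = f x"
  shows "g \<in> module_hom R M N"
proof -
  interpret M: Module.module R M by fact
  show ?thesis using assms(2,3) by (intro module_homI) (simp_all add: module_homD)
qed

lemma module_hom_zero:
  assumes "Module.module R M" and "Module.module R N" and f: "f \<in> module_hom R M N"
  shows "f \<zero>\<^bsub>M\<^esub> = \<zero>\<^bsub>N\<^esub>"
proof -
  interpret M: Module.module R M by fact
  interpret N: Module.module R N by fact
  have "f (\<zero>\<^bsub>R\<^esub> \<odot>\<^bsub>M\<^esub> \<zero>\<^bsub>M\<^esub>) = \<zero>\<^bsub>R\<^esub> \<odot>\<^bsub>N\<^esub> f \<zero>\<^bsub>M\<^esub>"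
    by (rule module_hom_smult[OF f]) simp_all
  then show ?thesis using module_hom_closed[OF f] by simp
qed

lemma module_hom_a_inv:
  assumes "Module.module R M" and "Module.module R N" and f: "f \<in> module_hom R M N" and x: "x \<in> carrier M"
  shows "f (\<ominus>\<^bsub>M\<^esub> x) = \<ominus>\<^bsub>N\<^esub> f x"
proof -
  interpret M: Module.module R M by fact
  interpret N: Module.module R N by fact
  have "f (\<ominus>\<^bsub>M\<^esub> x) \<oplus>\<^bsub>N\<^esub> f x = f (\<ominus>\<^bsub>M\<^esub> x \<oplus>\<^bsub>M\<^esub> x)"
    using x by (simp add: module_hom_add[OF f])
  also have "\<dots> = \<zero>\<^bsub>N\<^esub>" using x module_hom_zero[OF assms(1-3)] by (simp add: M.M.l_neg)
  finally show ?thesis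
    using x module_hom_closed[OF f] by (metis M.M.a_inv_closed N.M.minus_equality)
qed

lemma module_hom_minus:
  assumes "Module.module R M" and "Module.module R N" and f: "f \<in> module_hom R M N"
    and x: "x \<in> carrier M" and y: "y \<in> carrier M"
  shows "f (x \<ominus>\<^bsub>M\<^esub> y) = f x \<ominus>\<^bsub>N\<^esub> f y"
proof -
  interpret M: Module.module R M by fact
  interpret N: Module.module R N by fact
  show ?thesis
    using x y module_hom_closed[OF f] module_hom_a_inv[OF assms(1-3)]
    by (simp add: a_minus_def module_hom_add[OF f])
qed

lemma module_hom_finsum:
  assumes "Module.module R M" and "Module.module R N" and f: "f \<in> module_hom R M N"
    and "finite A" and "g \<in> A \<rightarrow> carrier M"
  shows "f (\<Oplus>\<^bsub>M\<^esub>i\<in>A. g i) = (\<Oplus>\<^bsub>N\<^esub>i\<in>A. f (g i))"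
proof -
  interpret M: Module.module R M by fact
  interpret N: Module.module R N by fact
  show ?thesis using assms(4,5)
  proof (induction)
    case empty
    then show ?case using module_hom_zero[OF assms(1-3)] by simp
  next
    case (insert a A)
    then have "g \<in> A \<rightarrow> carrier M" "g a \<in> carrier M" by auto
    then show ?case using insert module_hom_closed[OF f]
      by (simp add: module_hom_add[OF f] Pi_def)
  qed
qed

lemma module_hom_plus:
  assumes "Module.module R M" and "Module.module R N" and f: "f \<in> module_hom R M N" and g: "g \<in> module_hom R M N"
  shows "(\<lambda>x. f x \<oplus>\<^bsub>N\<^esub> g x) \<in> module_hom R M N"
proof -
  interpret M: Module.module R M by fact
  interpret N: Module.module R N by fact
  show ?thesis
    using module_hom_closed[OF f] module_hom_closed[OF g]
    by (intro module_homI)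
      (simp_all add: module_hom_add[OF f] module_hom_add[OF g] module_hom_smult[OF f]
        module_hom_smult[OF g] N.smult_r_distr N.M.a_ac)
qed

lemma module_hom_neg:
  assumes "Module.module R M" and "Module.module R N" and f: "f \<in> module_hom R M N"
  shows "(\<lambda>x. \<ominus>\<^bsub>N\<^esub> f x) \<in> module_hom R M N"
proof -
  interpret M: Module.module R M by fact
  interpret N: Module.module R N by fact
  show ?thesis
    using module_hom_closed[OF f]
    by (intro module_homI)
      (simp_all add: module_hom_add[OF f] module_hom_smult[OF f] N.smult_r_minus N.M.minus_add)
qed

lemma (in abelian_group) diff_eq_zero_iff:
  assumes "x \<in> carrier G" and "y \<in> carrier G"
  shows "x \<ominus> y = \<zero> \<longleftrightarrow> x = y"
proof
  assume "x \<ominus> y = \<zero>"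
  then have "(x \<ominus> y) \<oplus> y = y" using assms by simp
  then show "x = y" using assms by (simp add: a_minus_def a_assoc l_neg)
qed (use assms in \<open>simp add: a_minus_def r_neg\<close>)

lemma module_hom_diff:
  assumes "Module.module R M" and "Module.module R N" and f: "f \<in> module_hom R M N" and g: "g \<in> module_hom R M N"
  shows "(\<lambda>x. f x \<ominus>\<^bsub>N\<^esub> g x) \<in> module_hom R M N"
  unfolding a_minus_def by (rule module_hom_plus[OF assms(1,2) f module_hom_neg[OF assms(1,2) g]])

lemma module_hom_const_zero:
  assumes "Module.module R M" and "Module.module R N"
  shows "(\<lambda>x. \<zero>\<^bsub>N\<^esub>) \<in> module_hom R M N"
proof -
  interpret M: Module.module R M by fact
  interpret N: Module.module R N by fact
  show ?thesis by (intro module_homI) simp_all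
qed

lemma module_hom_sum:
  assumes "Module.module R M" and "Module.module R N" and "finite A" and "\<And>i. i \<in> A \<Longrightarrow> f i \<in> module_hom R M N"
  shows "(\<lambda>x. \<Oplus>\<^bsub>N\<^esub>i\<in>A. f i x) \<in> module_hom R M N"
  using assms(3,4)
proof (induction)
  case empty
  interpret N: Module.module R N by fact
  show ?case using module_hom_const_zero[OF assms(1,2)] by simp
next
  case (insert a A)
  interpret N: Module.module R N by fact
  have "(\<lambda>x. f a x \<oplus>\<^bsub>N\<^esub> (\<Oplus>\<^bsub>N\<^esub>i\<in>A. f i x)) \<in> module_hom R M N"
    by (rule module_hom_plus[OF assms(1,2)]) (simp_all add: insert)
  moreover have "(\<Oplus>\<^bsub>N\<^esub>i\<in>insert a A. f i x) = f a x \<oplus>\<^bsub>N\<^esub> (\<Oplus>\<^bsub>N\<^esub>i\<in>A. f i x)" if "x \<in> carrier M" for x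
  proof (rule N.M.finsum_insert)
    show "(\<lambda>i. f i x) \<in> A \<rightarrow> carrier N" "f a x \<in> carrier N"
      using that by (auto intro!: module_hom_closed[OF insert.prems])
  qed (use insert in simp_all)
  ultimately show ?case by (rule module_hom_cong[OF assms(1)])
qed

lemma module_hom_scalar:
  assumes "Module.module R M" and "a \<in> carrier R"
  shows "(\<lambda>x. a \<odot>\<^bsub>M\<^esub> x) \<in> module_hom R M M"
proof -
  interpret M: Module.module R M by fact
  show ?thesis
  proof (intro module_homI)
    fix b x assume "b \<in> carrier R" "x \<in> carrier M"
    then show "a \<odot>\<^bsub>M\<^esub> (b \<odot>\<^bsub>M\<^esub> x) = b \<odot>\<^bsub>M\<^esub> (a \<odot>\<^bsub>M\<^esub> x)"
      using assms(2) M.R.m_comm M.smult_assoc1 by metis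
  qed (use assms(2) in \<open>simp_all add: M.smult_r_distr\<close>)
qed

section \<open>The regular module and products of modules\<close>

lemma regular_module_simps [simp]:
  "carrier (regular_module R) = carrier R"
  "\<zero>\<^bsub>regular_module R\<^esub> = \<zero>\<^bsub>R\<^esub>"
  "x \<oplus>\<^bsub>regular_module R\<^esub> y = x \<oplus>\<^bsub>R\<^esub> y"
  "a \<odot>\<^bsub>regular_module R\<^esub> x = a \<otimes>\<^bsub>R\<^esub> x"
  by (simp_all add: regular_module_def)

lemma module_regular:
  assumes "cring R"
  shows "Module.module R (regular_module R)"
proof -
  interpret cring R by fact
  show ?thesis
  proof (intro moduleI abelian_groupI cring_axioms)
    fix x assume "x \<in> carrier (regular_module R)"
    then show "\<exists>y\<in>carrier (regular_module R). y \<oplus>\<^bsub>regular_module R\<^esub> x = \<zero>\<^bsub>regular_module R\<^esub>"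
      by (intro bexI[of _ "\<ominus>\<^bsub>R\<^esub> x"]) (simp_all add: l_neg)
  qed (simp_all add: a_ac l_distr r_distr m_assoc)
qed

lemma (in cring) regular_minus:
  assumes "z \<in> carrier R" and "w \<in> carrier R"
  shows "z \<ominus>\<^bsub>regular_module R\<^esub> w = z \<ominus> w"
proof -
  interpret L: Module.module R "regular_module R" by (rule module_regular[OF cring_axioms])
  have "\<ominus>\<^bsub>regular_module R\<^esub> w = \<ominus> w"
    using assms L.M.minus_equality[of "\<ominus> w" w] by (simp add: l_neg)
  then show ?thesis by (simp add: a_minus_def)
qed

text \<open>The factors may vary with the index because total complexes need this; constant families
  give the powers M^X, and powers of the regular module give R^n. Elements are extensional
  functions, so equality is tested on \<open>X\<close> alone.\<close>

definition dprod :: "'x set \<Rightarrow> ('x \<Rightarrow> ('a, 'b, 'k) module_scheme) \<Rightarrow> ('a, 'x \<Rightarrow> 'b) module" where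
  "dprod X Mf =
     \<lparr>carrier = (\<Pi>\<^sub>E x\<in>X. carrier (Mf x)), monoid.mult = undefined, monoid.one = undefined,
      ring.zero = (\<lambda>x\<in>X. \<zero>\<^bsub>Mf x\<^esub>), ring.add = (\<lambda>u v. \<lambda>x\<in>X. u x \<oplus>\<^bsub>Mf x\<^esub> v x),
      smult = (\<lambda>a u. \<lambda>x\<in>X. a \<odot>\<^bsub>Mf x\<^esub> u x)\<rparr>"

lemma dprod_simps:
  "carrier (dprod X Mf) = (\<Pi>\<^sub>E x\<in>X. carrier (Mf x))"
  "\<zero>\<^bsub>dprod X Mf\<^esub> = (\<lambda>x\<in>X. \<zero>\<^bsub>Mf x\<^esub>)"
  "u \<oplus>\<^bsub>dprod X Mf\<^esub> v = (\<lambda>x\<in>X. u x \<oplus>\<^bsub>Mf x\<^esub> v x)"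
  "a \<odot>\<^bsub>dprod X Mf\<^esub> u = (\<lambda>x\<in>X. a \<odot>\<^bsub>Mf x\<^esub> u x)"
  by (simp_all add: dprod_def)

lemma module_dprod:
  assumes "cring R" and mods: "\<And>x. x \<in> X \<Longrightarrow> Module.module R (Mf x)"
  shows "Module.module R (dprod X Mf)"
proof -
  interpret cring R by fact
  have 1: "abelian_group (Mf x)" if "x \<in> X" for x using mods[OF that] by (rule Module.module.axioms(2))
  have am: "abelian_monoid (Mf x)" if "x \<in> X" for x using 1[OF that] by (simp add: abelian_group_def)
  show ?thesis
  proof (intro moduleI abelian_groupI cring_axioms, unfold dprod_simps)
    fix u assume u: "u \<in> (\<Pi>\<^sub>E x\<in>X. carrier (Mf x))"
    then have um: "u x \<in> carrier (Mf x)" if "x \<in> X" for x using that by auto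
    show "\<exists>v\<in>\<Pi>\<^sub>E x\<in>X. carrier (Mf x). (\<lambda>x\<in>X. v x \<oplus>\<^bsub>Mf x\<^esub> u x) = (\<lambda>x\<in>X. \<zero>\<^bsub>Mf x\<^esub>)"
      by (rule bexI[of _ "\<lambda>x\<in>X. \<ominus>\<^bsub>Mf x\<^esub> u x"])
        (use u 1 in \<open>auto intro!: restrict_ext abelian_group.l_neg abelian_group.a_inv_closed simp: PiE_mem\<close>)
    show "(\<lambda>x\<in>X. (\<lambda>x\<in>X. \<zero>\<^bsub>Mf x\<^esub>) x \<oplus>\<^bsub>Mf x\<^esub> u x) = u"
      by (rule PiE_ext[of _ X]) (use u um am in \<open>auto simp: PiE_mem abelian_monoid.l_zero abelian_monoid.zero_closed\<close>)
    show "(\<lambda>x\<in>X. \<one>\<^bsub>R\<^esub> \<odot>\<^bsub>Mf x\<^esub> u x) = u"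
      by (rule PiE_ext[of _ X]) (use u um mods in \<open>auto simp: PiE_mem module.smult_one\<close>)
    show "(\<lambda>x\<in>X. a \<odot>\<^bsub>Mf x\<^esub> u x) \<in> (\<Pi>\<^sub>E x\<in>X. carrier (Mf x))" if "a \<in> carrier R" for a
      using um that by (auto intro!: module.smult_closed[OF mods])
    show "(\<lambda>x\<in>X. (a \<oplus>\<^bsub>R\<^esub> b) \<odot>\<^bsub>Mf x\<^esub> u x) =
      (\<lambda>x\<in>X. (\<lambda>x\<in>X. a \<odot>\<^bsub>Mf x\<^esub> u x) x \<oplus>\<^bsub>Mf x\<^esub> (\<lambda>x\<in>X. b \<odot>\<^bsub>Mf x\<^esub> u x) x)"
      if "a \<in> carrier R" "b \<in> carrier R" for a b
      using u um mods that by (intro restrict_ext) (simp add: PiE_mem module.smult_l_distr)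
    show "(\<lambda>x\<in>X. (a \<otimes>\<^bsub>R\<^esub> b) \<odot>\<^bsub>Mf x\<^esub> u x) = (\<lambda>x\<in>X. a \<odot>\<^bsub>Mf x\<^esub> (\<lambda>x\<in>X. b \<odot>\<^bsub>Mf x\<^esub> u x) x)"
      if "a \<in> carrier R" "b \<in> carrier R" for a b
      using u um mods that by (intro restrict_ext) (simp add: PiE_mem module.smult_assoc1)
    fix v assume v: "v \<in> (\<Pi>\<^sub>E x\<in>X. carrier (Mf x))"
    then have vm: "v x \<in> carrier (Mf x)" if "x \<in> X" for x using that by auto
    show "(\<lambda>x\<in>X. u x \<oplus>\<^bsub>Mf x\<^esub> v x) \<in> (\<Pi>\<^sub>E x\<in>X. carrier (Mf x))"
      using u v um vm am by (auto simp: PiE_mem abelian_monoid.a_closed)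
    show "(\<lambda>x\<in>X. u x \<oplus>\<^bsub>Mf x\<^esub> v x) = (\<lambda>x\<in>X. v x \<oplus>\<^bsub>Mf x\<^esub> u x)"
      using u v um vm am by (intro restrict_ext) (simp add: PiE_mem abelian_monoid.a_comm)
    show "(\<lambda>x\<in>X. a \<odot>\<^bsub>Mf x\<^esub> (\<lambda>x\<in>X. u x \<oplus>\<^bsub>Mf x\<^esub> v x) x) =
      (\<lambda>x\<in>X. (\<lambda>x\<in>X. a \<odot>\<^bsub>Mf x\<^esub> u x) x \<oplus>\<^bsub>Mf x\<^esub> (\<lambda>x\<in>X. a \<odot>\<^bsub>Mf x\<^esub> v x) x)"
      if "a \<in> carrier R" for a
      using u v um vm mods that by (intro restrict_ext) (simp add: module.smult_r_distr[OF mods])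
    show "(\<lambda>x\<in>X. (\<lambda>x\<in>X. u x \<oplus>\<^bsub>Mf x\<^esub> v x) x \<oplus>\<^bsub>Mf x\<^esub> w x) =
      (\<lambda>x\<in>X. u x \<oplus>\<^bsub>Mf x\<^esub> (\<lambda>x\<in>X. v x \<oplus>\<^bsub>Mf x\<^esub> w x) x)"
      if "w \<in> (\<Pi>\<^sub>E x\<in>X. carrier (Mf x))" for w
    proof (rule restrict_ext)
      fix x assume x: "x \<in> X"
      have wm: "w x \<in> carrier (Mf x)" using that x by auto
      show "(\<lambda>x\<in>X. u x \<oplus>\<^bsub>Mf x\<^esub> v x) x \<oplus>\<^bsub>Mf x\<^esub> w x = u x \<oplus>\<^bsub>Mf x\<^esub> (\<lambda>x\<in>X. v x \<oplus>\<^bsub>Mf x\<^esub> w x) x"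
        using abelian_monoid.a_assoc[OF am[OF x] um[OF x] vm[OF x] wm] x by simp
    qed
  qed (use am in \<open>auto simp: abelian_monoid.zero_closed\<close>)
qed

abbreviation pow_module :: "'x set \<Rightarrow> ('a, 'b, 'k) module_scheme \<Rightarrow> ('a, 'x \<Rightarrow> 'b) module" where
  "pow_module X M \<equiv> dprod X (\<lambda>_. M)"

text \<open>The condition of finite support is void for finite \<open>X\<close>, so everything known
  about products applies to R^n.\<close>

lemma free_module_eq_dprod:
  "finite X \<Longrightarrow> free_module R X = pow_module X (regular_module R)"
  by (auto simp: free_module_def dprod_def)

lemma module_free: "cring R \<Longrightarrow> finite X \<Longrightarrow> Module.module R (free_module R X)"
  by (simp add: free_module_eq_dprod module_dprod module_regular)

lemma dprod_proj_hom:
  assumes "x \<in> X"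
  shows "(\<lambda>u. u x) \<in> module_hom R (dprod X Mf) (Mf x)"
  using assms by (intro module_homI) (auto simp: dprod_simps PiE_mem)

lemma dprod_hom:
  assumes "\<And>x. x \<in> X \<Longrightarrow> f x \<in> module_hom R M (Mf x)"
  shows "(\<lambda>u. \<lambda>x\<in>X. f x u) \<in> module_hom R M (dprod X Mf)"
proof (intro module_homI)
  show "(\<lambda>x\<in>X. f x u) \<in> carrier (dprod X Mf)" if "u \<in> carrier M" for u
    using module_hom_closed[OF assms that] by (auto simp: dprod_simps)
  show "(\<lambda>x\<in>X. f x (u \<oplus>\<^bsub>M\<^esub> v)) = (\<lambda>x\<in>X. f x u) \<oplus>\<^bsub>dprod X Mf\<^esub> (\<lambda>x\<in>X. f x v)"
    if "u \<in> carrier M" "v \<in> carrier M" for u v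
    using module_hom_add[OF assms that] by (auto simp: dprod_simps)
  show "(\<lambda>x\<in>X. f x (a \<odot>\<^bsub>M\<^esub> u)) = a \<odot>\<^bsub>dprod X Mf\<^esub> (\<lambda>x\<in>X. f x u)"
    if "a \<in> carrier R" "u \<in> carrier M" for a u
    using module_hom_smult[OF assms that] by (auto simp: dprod_simps)
qed

lemma dprod_finsum:
  assumes "cring R" and mods: "\<And>x. x \<in> X \<Longrightarrow> Module.module R (Mf x)"
    and "finite A" and "g \<in> A \<rightarrow> carrier (dprod X Mf)"
  shows "(\<Oplus>\<^bsub>dprod X Mf\<^esub>i\<in>A. g i) = (\<lambda>x\<in>X. \<Oplus>\<^bsub>Mf x\<^esub>i\<in>A. g i x)"
proof (rule ext)
  fix x
  interpret P: Module.module R "dprod X Mf" using assms by (intro module_dprod)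
  have "(\<Oplus>\<^bsub>dprod X Mf\<^esub>i\<in>A. g i) \<in> carrier (dprod X Mf)" using assms by simp
  then show "(\<Oplus>\<^bsub>dprod X Mf\<^esub>i\<in>A. g i) x = (\<lambda>x\<in>X. \<Oplus>\<^bsub>Mf x\<^esub>i\<in>A. g i x) x"
    using module_hom_finsum[OF P.module_axioms mods dprod_proj_hom assms(3,4)]
    by (cases "x \<in> X") (auto simp: dprod_simps PiE_def extensional_def)
qed

section \<open>Matrices acting on powers of a module\<close>

text \<open>As a function of \<open>u\<close> this is the map from the free module on
  \<open>X\<close> that sends the generators to \<open>x\<close>; as a function of \<open>x\<close>
  it is one row of a matrix acting on M^X.\<close>

definition comb :: "('a, 'b, 'k) module_scheme \<Rightarrow> 'x set \<Rightarrow> ('x \<Rightarrow> 'b) \<Rightarrow> ('x \<Rightarrow> 'a) \<Rightarrow> 'b" where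
  "comb M X x u = (\<Oplus>\<^bsub>M\<^esub>i\<in>X. u i \<odot>\<^bsub>M\<^esub> x i)"

lemma carrier_free: "finite X \<Longrightarrow> carrier (free_module R X) = X \<rightarrow>\<^sub>E carrier R"
  by (simp add: free_module_def)

lemma free_simps:
  "\<zero>\<^bsub>free_module R X\<^esub> = (\<lambda>x\<in>X. \<zero>\<^bsub>R\<^esub>)"
  "u \<oplus>\<^bsub>free_module R X\<^esub> v = (\<lambda>x\<in>X. u x \<oplus>\<^bsub>R\<^esub> v x)"
  "a \<odot>\<^bsub>free_module R X\<^esub> u = (\<lambda>x\<in>X. a \<otimes>\<^bsub>R\<^esub> u x)"
  by (simp_all add: free_module_def)

lemma pow_proj_hom: "x \<in> X \<Longrightarrow> (\<lambda>u. u x) \<in> module_hom R (pow_module X M) M"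
  by (rule dprod_proj_hom)

lemma free_proj_hom:
  "finite X \<Longrightarrow> x \<in> X \<Longrightarrow> (\<lambda>u. u x) \<in> module_hom R (free_module R X) (regular_module R)"
  unfolding free_module_eq_dprod by (rule pow_proj_hom)

lemma free_mem: "finite X \<Longrightarrow> u \<in> carrier (free_module R X) \<Longrightarrow> x \<in> X \<Longrightarrow> u x \<in> carrier R"
  by (auto simp: carrier_free)

lemma free_gen_closed:
  assumes "cring R" and "finite X" shows "free_gen R X x \<in> carrier (free_module R X)"
proof -
  interpret cring R by fact
  show ?thesis using assms by (auto simp: carrier_free free_gen_def)
qed

lemma comb_closed:
  assumes "Module.module R M" and "x \<in> X \<rightarrow> carrier M" and "u \<in> X \<rightarrow> carrier R"
  shows "comb M X x u \<in> carrier M"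
proof -
  interpret M: Module.module R M by fact
  show ?thesis using assms(2,3) unfolding comb_def by (intro M.M.finsum_closed) auto
qed

lemma comb_hom:
  assumes "Module.module R M" and X: "finite X" and x: "x \<in> X \<rightarrow> carrier M"
  shows "comb M X x \<in> module_hom R (free_module R X) M"
proof -
  interpret M: Module.module R M by fact
  show ?thesis
  proof (intro module_homI)
    fix u assume u: "u \<in> carrier (free_module R X)"
    then have u': "u \<in> X \<rightarrow> carrier R" using X by (auto simp: carrier_free)
    show "comb M X x u \<in> carrier M" by (rule comb_closed[OF assms(1) x u'])
    show "comb M X x (a \<odot>\<^bsub>free_module R X\<^esub> u) = a \<odot>\<^bsub>M\<^esub> comb M X x u" if a: "a \<in> carrier R" for a
    proof -
      have "comb M X x (a \<odot>\<^bsub>free_module R X\<^esub> u) = (\<Oplus>\<^bsub>M\<^esub>i\<in>X. a \<odot>\<^bsub>M\<^esub> (u i \<odot>\<^bsub>M\<^esub> x i))"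
        unfolding comb_def by (rule M.M.finsum_cong') (use a u' x in \<open>auto simp: free_simps M.smult_assoc1 Pi_def\<close>)
      also have "\<dots> = a \<odot>\<^bsub>M\<^esub> comb M X x u"
        unfolding comb_def using a u' x X by (intro M.finsum_smult_ldistr[symmetric]) auto
      finally show ?thesis .
    qed
    fix v assume v: "v \<in> carrier (free_module R X)"
    then have v': "v \<in> X \<rightarrow> carrier R" using X by (auto simp: carrier_free)
    have "comb M X x (u \<oplus>\<^bsub>free_module R X\<^esub> v) = (\<Oplus>\<^bsub>M\<^esub>i\<in>X. u i \<odot>\<^bsub>M\<^esub> x i \<oplus>\<^bsub>M\<^esub> v i \<odot>\<^bsub>M\<^esub> x i)"
      unfolding comb_def by (rule M.M.finsum_cong') (use v' u' x in \<open>auto simp: free_simps M.smult_l_distr Pi_def\<close>)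
    also have "\<dots> = comb M X x u \<oplus>\<^bsub>M\<^esub> comb M X x v"
      unfolding comb_def using u' v' x by (intro M.M.finsum_addf) auto
    finally show "comb M X x (u \<oplus>\<^bsub>free_module R X\<^esub> v) = comb M X x u \<oplus>\<^bsub>M\<^esub> comb M X x v" .
  qed
qed

lemma comb_gen:
  assumes "Module.module R M" and X: "finite X" and x: "x \<in> X \<rightarrow> carrier M" and i: "i \<in> X"
  shows "comb M X x (free_gen R X i) = x i"
proof -
  interpret M: Module.module R M by fact
  have "comb M X x (free_gen R X i) = (\<Oplus>\<^bsub>M\<^esub>k\<in>X. if i = k then x k else \<zero>\<^bsub>M\<^esub>)"
    unfolding comb_def by (rule M.M.finsum_cong') (use x in \<open>auto simp: free_gen_def Pi_def\<close>)
  also have "\<dots> = x i" using M.M.finsum_singleton[OF i X x] by simp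
  finally show ?thesis .
qed

lemma comb_cong:
  assumes "Module.module R M" and "\<And>i. i \<in> X \<Longrightarrow> x i = y i" "\<And>i. i \<in> X \<Longrightarrow> u i = v i"
    "y \<in> X \<rightarrow> carrier M" "v \<in> X \<rightarrow> carrier R"
  shows "comb M X x u = comb M X y v"
proof -
  interpret M: Module.module R M by fact
  show ?thesis unfolding comb_def by (rule M.M.finsum_cong') (use assms in auto)
qed

lemma comb_natural:
  assumes "Module.module R M" and "Module.module R N" and g: "g \<in> module_hom R M N"
    and X: "finite X" and x: "x \<in> X \<rightarrow> carrier M" and u: "u \<in> X \<rightarrow> carrier R"
  shows "g (comb M X x u) = comb N X (\<lambda>i. g (x i)) u"
proof -
  interpret M: Module.module R M by fact
  interpret N: Module.module R N by fact
  have "g (comb M X x u) = (\<Oplus>\<^bsub>N\<^esub>i\<in>X. g (u i \<odot>\<^bsub>M\<^esub> x i))"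
    unfolding comb_def using x u by (intro module_hom_finsum[OF assms(1,2) g X]) auto
  also have "\<dots> = comb N X (\<lambda>i. g (x i)) u"
    unfolding comb_def by (rule N.M.finsum_cong')
      (use x u in \<open>auto simp: Pi_def module_hom_smult[OF g] module_hom_closed[OF g]\<close>)
  finally show ?thesis .
qed

lemma free_expand:
  assumes "cring R" and X: "finite X" and u: "u \<in> carrier (free_module R X)"
  shows "comb (free_module R X) X (free_gen R X) u = u"
proof -
  interpret cring R by fact
  let ?F = "pow_module X (regular_module R)"
  have g: "(\<lambda>i. u i \<odot>\<^bsub>?F\<^esub> free_gen R X i) \<in> X \<rightarrow> carrier ?F"
    using free_gen_closed[OF assms(1,2)] free_mem[OF X u] Module.module.smult_closed[OF module_free[OF assms(1,2)]]
    by (auto simp: free_module_eq_dprod[OF X])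
  have "comb ?F X (free_gen R X) u = (\<lambda>x\<in>X. \<Oplus>\<^bsub>regular_module R\<^esub>i\<in>X. (u i \<odot>\<^bsub>?F\<^esub> free_gen R X i) x)"
    unfolding comb_def by (rule dprod_finsum[OF assms(1) module_regular[OF assms(1)] X g])
  also have "\<dots> = u"
  proof (rule PiE_ext[of _ X])
    show "u \<in> X \<rightarrow>\<^sub>E carrier R" using u X by (simp add: carrier_free)
    show "(\<lambda>x\<in>X. \<Oplus>\<^bsub>regular_module R\<^esub>i\<in>X. (u i \<odot>\<^bsub>?F\<^esub> free_gen R X i) x) x = u x" if x: "x \<in> X" for x
    proof -
      interpret L: Module.module R "regular_module R" by (rule module_regular) fact
      have "(\<Oplus>\<^bsub>regular_module R\<^esub>i\<in>X. (u i \<odot>\<^bsub>?F\<^esub> free_gen R X i) x) = (\<Oplus>\<^bsub>regular_module R\<^esub>i\<in>X. if x = i then u i else \<zero>\<^bsub>regular_module R\<^esub>)"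
        by (rule L.M.finsum_cong') (use x free_mem[OF X u] in \<open>auto simp: dprod_simps free_gen_def\<close>)
      also have "\<dots> = u x" using free_mem[OF X u] by (intro L.M.finsum_singleton[OF x X]) auto
      finally show ?thesis using x by simp
    qed
    show "(\<lambda>x\<in>X. \<Oplus>\<^bsub>regular_module R\<^esub>i\<in>X. (u i \<odot>\<^bsub>?F\<^esub> free_gen R X i) x) \<in> X \<rightarrow>\<^sub>E carrier R"
    proof -
      interpret L: Module.module R "regular_module R" by (rule module_regular) fact
      have "(\<lambda>i. (u i \<odot>\<^bsub>?F\<^esub> free_gen R X i) x) \<in> X \<rightarrow> carrier (regular_module R)" if "x \<in> X" for x
        using g that by (auto simp: dprod_simps Pi_def PiE_def)
      from L.M.finsum_closed[OF this] show ?thesis by auto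
    qed
  qed
  finally show ?thesis by (simp add: free_module_eq_dprod[OF X])
qed

lemma hom_free_eq:
  assumes "cring R" and "Module.module R M" and X: "finite X"
    and f: "f \<in> module_hom R (free_module R X) M" and u: "u \<in> carrier (free_module R X)"
  shows "f u = comb M X (\<lambda>i. f (free_gen R X i)) u"
proof -
  have "f u = f (comb (free_module R X) X (free_gen R X) u)" by (simp add: free_expand[OF assms(1) X u])
  also have "\<dots> = comb M X (\<lambda>i. f (free_gen R X i)) u"
    using free_mem[OF X u] free_gen_closed[OF assms(1) X]
    by (intro comb_natural[OF module_free assms(2) f X] assms(1) X) auto
  finally show ?thesis .
qed

text \<open>This is \<open>f\<close> \<otimes> M read as a map from M^X to M^Y; the coordinates
  \<open>f (free_gen R X x) y\<close> are the matrix entries of \<open>f\<close>. Exactness of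
  tensored complexes is expressed with it, which keeps the quotients that define tensor products out
  of the calculations.\<close>

definition act :: "('a, 'r) ring_scheme \<Rightarrow> ('a, 'b, 'k) module_scheme \<Rightarrow> 'x set \<Rightarrow> 'y set \<Rightarrow>
    (('x \<Rightarrow> 'a) \<Rightarrow> 'y \<Rightarrow> 'a) \<Rightarrow> ('x \<Rightarrow> 'b) \<Rightarrow> 'y \<Rightarrow> 'b" where
  "act R M X Y f u = (\<lambda>y\<in>Y. comb M X u (\<lambda>x\<in>X. f (free_gen R X x) y))"

context
  fixes R :: "('a, 'r) ring_scheme" and X :: "'x set" and Y :: "'y set"
    and f :: "('x \<Rightarrow> 'a) \<Rightarrow> 'y \<Rightarrow> 'a"
  assumes R: "cring R" and X: "finite X" and Y: "finite Y"
    and f: "f \<in> module_hom R (free_module R X) (free_module R Y)"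
begin

lemma row_closed: "y \<in> Y \<Longrightarrow> (\<lambda>x\<in>X. f (free_gen R X x) y) \<in> carrier (free_module R X)"
  using module_hom_closed[OF f free_gen_closed[OF R X]] X Y by (auto simp: carrier_free)

lemma row_closed': "y \<in> Y \<Longrightarrow> (\<lambda>x\<in>X. f (free_gen R X x) y) \<in> X \<rightarrow> carrier R"
  using row_closed X by (auto simp: carrier_free)

lemma act_hom:
  assumes M: "Module.module R M"
  shows "act R M X Y f \<in> module_hom R (pow_module X M) (pow_module Y M)"
proof -
  interpret M: Module.module R M by fact
  have "(\<lambda>u. comb M X u (\<lambda>x\<in>X. f (free_gen R X x) y)) \<in> module_hom R (pow_module X M) M" if y: "y \<in> Y" for y
    unfolding comb_def
  proof (rule module_hom_sum[OF module_dprod M X])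
    fix i assume "i \<in> X"
    then show "(\<lambda>u. (\<lambda>x\<in>X. f (free_gen R X x) y) i \<odot>\<^bsub>M\<^esub> u i) \<in> module_hom R (pow_module X M) M"
      using row_closed'[OF y]
      by (intro module_hom_comp[OF pow_proj_hom module_hom_scalar[OF M]]) (auto simp: Pi_def)
  qed (use R M in auto)
  from dprod_hom[of Y, OF this] show ?thesis unfolding act_def[abs_def] .
qed

text \<open>Each coordinate of the action is a linear combination, and \<open>g\<close> preserves
  those. Matrices over R therefore commute with \<open>g\<close> applied coordinatewise, whether
  \<open>g\<close> is a differential, an augmentation or a functional.\<close>

lemma act_natural:
  assumes M: "Module.module R M" and N: "Module.module R N" and g: "g \<in> module_hom R M N"
    and u: "u \<in> X \<rightarrow> carrier M"
  shows "act R N X Y f (\<lambda>x\<in>X. g (u x)) = (\<lambda>y\<in>Y. g (act R M X Y f u y))"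
  unfolding act_def
proof (rule restrict_ext)
  fix y assume y: "y \<in> Y"
  have "g (comb M X u (\<lambda>x\<in>X. f (free_gen R X x) y)) = comb N X (\<lambda>i. g (u i)) (\<lambda>x\<in>X. f (free_gen R X x) y)"
    by (rule comb_natural[OF M N g X u row_closed'[OF y]])
  also have "\<dots> = comb N X (\<lambda>x\<in>X. g (u x)) (\<lambda>x\<in>X. f (free_gen R X x) y)"
    using u module_hom_closed[OF g] row_closed'[OF y] by (intro comb_cong[OF N]) auto
  finally show "comb N X (\<lambda>x\<in>X. g (u x)) (\<lambda>x\<in>X. f (free_gen R X x) y) =
      g ((\<lambda>y\<in>Y. comb M X u (\<lambda>x\<in>X. f (free_gen R X x) y)) y)" using y by simp
qed

text \<open>Expanding \<open>u\<close> in the generators yields the same products as the row of the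
  matrix, with the factors in the other order; commutativity of R reconciles them.\<close>

lemma act_regular:
  assumes u: "u \<in> carrier (free_module R X)"
  shows "act R (regular_module R) X Y f u = f u"
proof (rule PiE_ext[of _ Y])
  interpret cring R by fact
  interpret L: Module.module R "regular_module R" by (rule module_regular[OF R])
  show fu: "f u \<in> Y \<rightarrow>\<^sub>E carrier R" using module_hom_closed[OF f u] Y by (simp add: carrier_free)
  show act: "act R (regular_module R) X Y f u \<in> Y \<rightarrow>\<^sub>E carrier R"
    using module_hom_closed[OF act_hom[OF L.module_axioms], of u] u X by (simp add: dprod_simps carrier_free)
  fix y assume y: "y \<in> Y"
  have "f u y = comb (regular_module R) X (\<lambda>i. f (free_gen R X i) y) u"
    by (rule hom_free_eq[OF R L.module_axioms X _ u])
      (rule module_hom_comp[OF f free_proj_hom[OF Y y]])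
  also have "\<dots> = act R (regular_module R) X Y f u y"
    using y free_mem[OF X u] row_closed'[OF y]
    unfolding act_def comb_def by (auto intro!: L.M.finsum_cong' simp: m_comm Pi_def)
  finally show "act R (regular_module R) X Y f u y = f u y" by simp
qed

text \<open>The coordinate projections of R^L are homomorphisms, so \<open>act_natural\<close>
  applies to them: on (R^L)^X the map \<open>f\<close> acts on each column \<open>l\<close>
  separately.\<close>

lemma act_free:
  assumes L: "finite L" and u: "u \<in> carrier (pow_module X (free_module R L))" and y: "y \<in> Y" and l: "l \<in> L"
  shows "act R (free_module R L) X Y f u y l = f (\<lambda>x\<in>X. u x l) y"
proof -
  have ul: "(\<lambda>x\<in>X. u x l) \<in> carrier (free_module R X)"
    using u l X L by (auto simp: dprod_simps carrier_free PiE_def Pi_def)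
  have pr: "(\<lambda>v. v l) \<in> module_hom R (free_module R L) (regular_module R)"
    by (rule free_proj_hom[OF L l])
  have "f (\<lambda>x\<in>X. u x l) y = act R (regular_module R) X Y f (\<lambda>x\<in>X. u x l) y"
    by (simp add: act_regular[OF ul])
  also have "\<dots> = act R (free_module R L) X Y f u y l"
    using act_natural[OF module_free[OF R L] module_regular[OF R] pr, of u] u y by (auto simp: dprod_simps PiE_def Pi_def)
  finally show ?thesis by simp
qed

end

text \<open>Functoriality of tensoring with M, that is, matrix multiplication: row \<open>z\<close>
  of the composite combines the rows of \<open>f\<close> with the coefficients in row
  \<open>z\<close> of \<open>g\<close>.\<close>

lemma act_comp:
  assumes R: "cring R" and X: "finite X" and Y: "finite Y" and Z: "finite Z" and M: "Module.module R M"
    and f: "f \<in> module_hom R (free_module R X) (free_module R Y)"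
    and g: "g \<in> module_hom R (free_module R Y) (free_module R Z)"
    and u: "u \<in> carrier (pow_module X M)"
  shows "act R M Y Z g (act R M X Y f u) = act R M X Z (\<lambda>v. g (f v)) u"
proof (rule ext)
  fix z
  interpret cring R by fact
  interpret L: Module.module R "regular_module R" by (rule module_regular[OF R])
  interpret F: Module.module R "free_module R X" by (rule module_free[OF R X])
  have u': "u \<in> X \<rightarrow> carrier M" using u by (auto simp: dprod_simps)
  note gf = module_hom_comp[OF f g]
  show "act R M Y Z g (act R M X Y f u) z = act R M X Z (\<lambda>v. g (f v)) u z"
  proof (cases "z \<in> Z")
    case z: True
    let ?rg = "\<lambda>y\<in>Y. g (free_gen R Y y) z"
    let ?rf = "\<lambda>y. \<lambda>x\<in>X. f (free_gen R X x) y"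
    have "act R M Y Z g (act R M X Y f u) z = comb M Y (act R M X Y f u) ?rg"
      using z by (simp add: act_def)
    also have "\<dots> = comb M Y (\<lambda>y. comb M X u (?rf y)) ?rg"
      using row_closed'[OF R Y Z g z] row_closed'[OF R X Y f] comb_closed[OF M u']
      by (intro comb_cong[OF M]) (auto simp: act_def)
    also have "\<dots> = comb M X u (comb (free_module R X) Y ?rf ?rg)"
      using row_closed'[OF R Y Z g z] row_closed[OF R X Y f]
      by (intro comb_natural[OF F.module_axioms M comb_hom[OF M X u'] Y, symmetric]) auto
    also have "comb (free_module R X) Y ?rf ?rg = (\<lambda>x\<in>X. g (f (free_gen R X x)) z)"
    proof (rule PiE_ext[of _ X])
      show "comb (free_module R X) Y ?rf ?rg \<in> X \<rightarrow>\<^sub>E carrier R"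
        using comb_closed[OF F.module_axioms, of ?rf Y ?rg] row_closed'[OF R Y Z g z] row_closed[OF R X Y f]
        by (auto simp: carrier_free[OF X])
      show "(\<lambda>x\<in>X. g (f (free_gen R X x)) z) \<in> X \<rightarrow>\<^sub>E carrier R"
        using row_closed[OF R X Z gf z] by (simp add: carrier_free[OF X])
      fix x assume x: "x \<in> X"
      have pr: "(\<lambda>v. v x) \<in> module_hom R (free_module R X) (regular_module R)"
        by (rule free_proj_hom[OF X x])
      have fx: "f (free_gen R X x) \<in> carrier (free_module R Y)"
        by (rule module_hom_closed[OF f free_gen_closed[OF R X]])
      have "comb (free_module R X) Y ?rf ?rg x = comb (regular_module R) Y (\<lambda>y. ?rf y x) ?rg"
        using row_closed'[OF R Y Z g z] row_closed[OF R X Y f]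
        by (intro comb_natural[OF F.module_axioms L.module_axioms pr Y]) auto
      also have "\<dots> = comb (regular_module R) Y (f (free_gen R X x)) ?rg"
        using x row_closed'[OF R Y Z g z] free_mem[OF Y fx] by (intro comb_cong[OF L.module_axioms]) auto
      also have "\<dots> = act R (regular_module R) Y Z g (f (free_gen R X x)) z" using z by (simp add: act_def)
      also have "\<dots> = g (f (free_gen R X x)) z" by (simp add: act_regular[OF R Y Z g fx])
      finally show "comb (free_module R X) Y ?rf ?rg x = (\<lambda>x\<in>X. g (f (free_gen R X x)) z) x" using x by simp
    qed
    also have "comb M X u \<dots> = act R M X Z (\<lambda>v. g (f v)) u z" using z by (simp add: act_def)
    finally show ?thesis .
  qed (simp add: act_def)
qed

section \<open>Square-zero endomorphisms of complexes\<close>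

text \<open>The lifting property of a projective module, for one map \<open>g\<close> only.
  Comparing images in B avoids turning the image of \<open>g\<close> into a module of its
  own.\<close>

definition liftable ::
    "('a, 'r) ring_scheme \<Rightarrow> ('a, 'p, 'k) module_scheme \<Rightarrow> ('a, 'b, 'l) module_scheme \<Rightarrow>
     ('a, 'c, 'm) module_scheme \<Rightarrow> ('b \<Rightarrow> 'c) \<Rightarrow> bool" where
  "liftable R P A B g \<longleftrightarrow>
     (\<forall>f\<in>module_hom R P B. f ` carrier P \<subseteq> g ` carrier A \<longrightarrow>
        (\<exists>h\<in>module_hom R P A. \<forall>x\<in>carrier P. g (h x) = f x))"

text \<open>A preimage \<open>a\<close> of the value at 1 determines the lift r \<mapsto> r
  a.\<close>

lemma liftable_regular:
  assumes R: "cring R" and A: "Module.module R A" and g: "g \<in> module_hom R A B"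
  shows "liftable R (regular_module R) A B g"
  unfolding liftable_def
proof (intro ballI impI)
  interpret cring R by fact
  interpret A: Module.module R A by fact
  fix f assume f: "f \<in> module_hom R (regular_module R) B"
    and im: "f ` carrier (regular_module R) \<subseteq> g ` carrier A"
  then obtain a where a: "a \<in> carrier A" "g a = f \<one>\<^bsub>R\<^esub>"
    by (metis image_iff image_subset_iff one_closed regular_module_simps(1))
  show "\<exists>h\<in>module_hom R (regular_module R) A. \<forall>x\<in>carrier (regular_module R). g (h x) = f x"
  proof (intro bexI ballI)
    show "(\<lambda>r. r \<odot>\<^bsub>A\<^esub> a) \<in> module_hom R (regular_module R) A"
      using a by (intro module_homI) (simp_all add: A.smult_l_distr A.smult_assoc1)
    fix x assume x: "x \<in> carrier (regular_module R)"
    show "g (x \<odot>\<^bsub>A\<^esub> a) = f x"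
      using module_hom_smult[OF g, of x a] module_hom_smult[OF f, of x "\<one>\<^bsub>R\<^esub>"] a x by simp
  qed
qed

definition inj_at :: "'x set \<Rightarrow> ('x \<Rightarrow> ('a, 'b, 'k) module_scheme) \<Rightarrow> 'x \<Rightarrow> 'b \<Rightarrow> 'x \<Rightarrow> 'b" where
  "inj_at X Mf x v = (\<lambda>y\<in>X. if y = x then v else \<zero>\<^bsub>Mf y\<^esub>)"

lemma inj_at_hom:
  assumes mods: "\<And>x. x \<in> X \<Longrightarrow> Module.module R (Mf x)" and x: "x \<in> X"
  shows "inj_at X Mf x \<in> module_hom R (Mf x) (dprod X Mf)"
proof -
  have "(\<lambda>v. if y = x then v else \<zero>\<^bsub>Mf y\<^esub>) \<in> module_hom R (Mf x) (Mf y)" if y: "y \<in> X" for y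
  proof (cases "y = x")
    case True
    then show ?thesis using module_hom_id by auto
  next
    case False
    then show ?thesis using module_hom_const_zero[OF mods[OF x] mods[OF y]] by simp
  qed
  from dprod_hom[of X, OF this] show ?thesis unfolding inj_at_def[abs_def] .
qed

lemma dprod_expand:
  assumes R: "cring R" and mods: "\<And>x. x \<in> X \<Longrightarrow> Module.module R (Mf x)" and X: "finite X"
    and u: "u \<in> carrier (dprod X Mf)"
  shows "(\<Oplus>\<^bsub>dprod X Mf\<^esub>x\<in>X. inj_at X Mf x (u x)) = u"
proof -
  have um: "u x \<in> carrier (Mf x)" if "x \<in> X" for x using u that by (auto simp: dprod_simps)
  have g: "(\<lambda>x. inj_at X Mf x (u x)) \<in> X \<rightarrow> carrier (dprod X Mf)"
    by (intro Pi_I module_hom_closed[OF inj_at_hom[where Mf = Mf, OF mods] um]) auto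
  have "(\<Oplus>\<^bsub>dprod X Mf\<^esub>x\<in>X. inj_at X Mf x (u x)) = (\<lambda>y\<in>X. \<Oplus>\<^bsub>Mf y\<^esub>x\<in>X. inj_at X Mf x (u x) y)"
    by (rule dprod_finsum[OF R mods X g])
  also have "\<dots> = (\<lambda>y\<in>X. u y)"
  proof (rule restrict_ext)
    fix y assume y: "y \<in> X"
    interpret My: Module.module R "Mf y" by (rule mods[OF y])
    have "(\<Oplus>\<^bsub>Mf y\<^esub>x\<in>X. inj_at X Mf x (u x) y) = (\<Oplus>\<^bsub>Mf y\<^esub>x\<in>X. if y = x then u y else \<zero>\<^bsub>Mf y\<^esub>)"
      using y um[OF y] by (intro My.M.finsum_cong') (auto simp: inj_at_def)
    also have "\<dots> = u y" using um[OF y] by (intro My.M.finsum_singleton[OF y X, of "\<lambda>_. u y"]) auto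
    finally show "(\<Oplus>\<^bsub>Mf y\<^esub>x\<in>X. inj_at X Mf x (u x) y) = u y" .
  qed
  also have "\<dots> = u" using u by (auto simp: dprod_simps PiE_def extensional_restrict)
  finally show ?thesis .
qed

text \<open>A homomorphism out of a finite product is the sum of its restrictions to the factors,
  and these are lifted one by one.\<close>

lemma liftable_dprod:
  assumes R: "cring R" and mods: "\<And>x. x \<in> X \<Longrightarrow> Module.module R (Mf x)" and X: "finite X"
    and A: "Module.module R A" and B: "Module.module R B" and g: "g \<in> module_hom R A B"
    and l: "\<And>x. x \<in> X \<Longrightarrow> liftable R (Mf x) A B g"
  shows "liftable R (dprod X Mf) A B g"
  unfolding liftable_def
proof (intro ballI impI)
  let ?P = "dprod X Mf"
  interpret P: Module.module R ?P by (rule module_dprod[OF R mods])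
  interpret A: Module.module R A by fact
  interpret B: Module.module R B by fact
  fix f assume f: "f \<in> module_hom R ?P B" and im: "f ` carrier ?P \<subseteq> g ` carrier A"
  have "\<exists>h. h \<in> module_hom R (Mf x) A \<and> (\<forall>v\<in>carrier (Mf x). g (h v) = f (inj_at X Mf x v))"
    if x: "x \<in> X" for x
  proof -
    have hom: "(\<lambda>v. f (inj_at X Mf x v)) \<in> module_hom R (Mf x) B"
      by (rule module_hom_comp[OF inj_at_hom[where Mf = Mf, OF mods x] f])
    have im': "(\<lambda>v. f (inj_at X Mf x v)) ` carrier (Mf x) \<subseteq> g ` carrier A"
    proof (rule image_subsetI)
      fix v assume v: "v \<in> carrier (Mf x)"
      have "inj_at X Mf x v \<in> carrier ?P" by (rule module_hom_closed[OF inj_at_hom[where Mf = Mf, OF mods x] v])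
      then show "f (inj_at X Mf x v) \<in> g ` carrier A" using im by (rule subsetD[OF _ imageI, rotated])
    qed
    show ?thesis
      using l[OF x, unfolded liftable_def, rule_format, OF hom im'] by (simp add: Bex_def)
  qed
  then obtain h where h: "\<And>x. x \<in> X \<Longrightarrow> h x \<in> module_hom R (Mf x) A"
    and gh: "\<And>x v. x \<in> X \<Longrightarrow> v \<in> carrier (Mf x) \<Longrightarrow> g (h x v) = f (inj_at X Mf x v)"
    by metis
  show "\<exists>h\<in>module_hom R ?P A. \<forall>u\<in>carrier ?P. g (h u) = f u"
  proof (intro bexI ballI)
    show "(\<lambda>u. \<Oplus>\<^bsub>A\<^esub>x\<in>X. h x (u x)) \<in> module_hom R ?P A"
    proof (rule module_hom_sum[OF P.module_axioms A.module_axioms X])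
      fix x assume x: "x \<in> X"
      show "(\<lambda>u. h x (u x)) \<in> module_hom R ?P A"
        by (rule module_hom_comp[OF dprod_proj_hom[where Mf = Mf, OF x] h[OF x]])
    qed
    fix u assume u: "u \<in> carrier ?P"
    have um: "u x \<in> carrier (Mf x)" if "x \<in> X" for x using u that by (auto simp: dprod_simps)
    have "g (\<Oplus>\<^bsub>A\<^esub>x\<in>X. h x (u x)) = (\<Oplus>\<^bsub>B\<^esub>x\<in>X. g (h x (u x)))"
      using module_hom_closed[OF h] um by (intro module_hom_finsum[OF A.module_axioms B.module_axioms g X]) auto
    also have "\<dots> = (\<Oplus>\<^bsub>B\<^esub>x\<in>X. f (inj_at X Mf x (u x)))"
    proof (rule B.M.finsum_cong')
      show "(\<lambda>x. f (inj_at X Mf x (u x))) \<in> X \<rightarrow> carrier B"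
        by (intro Pi_I module_hom_closed[OF f] module_hom_closed[OF inj_at_hom[where Mf = Mf, OF mods] um])
    qed (use um gh in auto)
    also have "\<dots> = f (\<Oplus>\<^bsub>?P\<^esub>x\<in>X. inj_at X Mf x (u x))"
      by (intro module_hom_finsum[OF P.module_axioms B.module_axioms f X, symmetric] Pi_I
          module_hom_closed[OF inj_at_hom[where Mf = Mf, OF mods] um])
    also have "\<dots> = f u" by (simp add: dprod_expand[where Mf = Mf, OF R mods X u])
    finally show "g (\<Oplus>\<^bsub>A\<^esub>x\<in>X. h x (u x)) = f u" .
  qed
qed

lemma liftable_free:
  assumes R: "cring R" and X: "finite X"
    and A: "Module.module R A" and B: "Module.module R B" and g: "g \<in> module_hom R A B"
  shows "liftable R (free_module R X) A B g"
  unfolding free_module_eq_dprod[OF X]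
  by (rule liftable_dprod[OF R module_regular[OF R] X A B g liftable_regular[OF R A g]])

section \<open>Null homotopies of a square-zero endomorphism\<close>

text \<open>The assumption \<open>exact\<close> at index \<open>p\<close> concerns degree p + 1, so
  the complex is exact in degrees 1 to \<open>n\<close>; \<open>S0\<close> says that S is zero on
  the homology in degree 0. S is required to anticommute with \<open>d\<close>, so that d + S
  squares to zero.\<close>

locale square_zero_complex =
  fixes R :: "('a, 'r) ring_scheme" and G :: "nat \<Rightarrow> ('a, 'b, 'k) module_scheme"
    and d S :: "nat \<Rightarrow> 'b \<Rightarrow> 'b" and n :: nat
  assumes modG: "\<And>p. Module.module R (G p)"
    and dhom: "\<And>p. d p \<in> module_hom R (G (Suc p)) (G p)"
    and dd: "\<And>p x. x \<in> carrier (G (Suc (Suc p))) \<Longrightarrow> d p (d (Suc p) x) = \<zero>\<^bsub>G p\<^esub>"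
    and exact: "\<And>p x. p < n \<Longrightarrow> x \<in> carrier (G (Suc p)) \<Longrightarrow> d p x = \<zero>\<^bsub>G p\<^esub> \<Longrightarrow>
      x \<in> d (Suc p) ` carrier (G (Suc (Suc p)))"
    and Shom: "\<And>p. S p \<in> module_hom R (G p) (G p)"
    and SS: "\<And>p x. x \<in> carrier (G p) \<Longrightarrow> S p (S p x) = \<zero>\<^bsub>G p\<^esub>"
    and dS: "\<And>p x. x \<in> carrier (G (Suc p)) \<Longrightarrow> d p (S (Suc p) x) = \<ominus>\<^bsub>G p\<^esub> S p (d p x)"
    and S0: "\<And>x. x \<in> carrier (G 0) \<Longrightarrow> S 0 x \<in> d 0 ` carrier (G (Suc 0))"
    and lift: "\<And>p q. liftable R (G p) (G (Suc q)) (G q) (d q)"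
begin

text \<open>The comparison argument for a map of degree \<open>m\<close> out of a complex of
  projectives, carried out as long as the target degree p + m is at most \<open>n\<close>, the range
  of exactness. Beyond that range \<open>h\<close> is set to zero and nothing is claimed.\<close>

lemma null_homotopy:
  assumes f: "\<And>p. f p \<in> module_hom R (G p) (G (p + m))"
    and df: "\<And>p x. Suc p + m \<le> n \<Longrightarrow> x \<in> carrier (G (Suc p)) \<Longrightarrow>
      d (p + m) (f (Suc p) x) = \<ominus>\<^bsub>G (p + m)\<^esub> f p (d p x)"
    and f0: "\<And>x. m \<le> n \<Longrightarrow> x \<in> carrier (G 0) \<Longrightarrow> f 0 x \<in> d m ` carrier (G (Suc m))"
  shows "\<exists>h. (\<forall>p. h p \<in> module_hom R (G p) (G (Suc (p + m)))) \<and>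
    (m \<le> n \<longrightarrow> (\<forall>x\<in>carrier (G 0). f 0 x = d m (h 0 x))) \<and>
    (\<forall>p. Suc p + m \<le> n \<longrightarrow> (\<forall>x\<in>carrier (G (Suc p)).
       f (Suc p) x = d (Suc p + m) (h (Suc p) x) \<ominus>\<^bsub>G (Suc p + m)\<^esub> h p (d p x)))"
proof -
  \<comment> \<open>The recursive choice sees only the current \<open>h\<close>, so the invariant
    records \<open>f p = d h\<close> on the cycles of \<open>G p\<close>. Boundaries are cycles, and
    on them this equation makes \<open>f (Suc p) + h d\<close> a cycle, which exactness then
    lifts.\<close>
  let ?P = "\<lambda>p h. h \<in> module_hom R (G p) (G (Suc (p + m))) \<and>
    (p + m \<le> n \<longrightarrow> (\<forall>y\<in>carrier (G p). p = 0 \<or> d (p - 1) y = \<zero>\<^bsub>G (p - 1)\<^esub> \<longrightarrow> f p y = d (p + m) (h y)))"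
  let ?Q = "\<lambda>p h h'. Suc p + m \<le> n \<longrightarrow> (\<forall>x\<in>carrier (G (Suc p)).
       f (Suc p) x = d (Suc p + m) (h' x) \<ominus>\<^bsub>G (Suc p + m)\<^esub> h (d p x))"
  have "\<exists>h. \<forall>p. ?P p (h p) \<and> ?Q p (h p) (h (Suc p))"
  proof (rule dependent_nat_choice)
    show "\<exists>h. ?P 0 h"
    proof (cases "m \<le> n")
      case True
      then have "f 0 ` carrier (G 0) \<subseteq> d m ` carrier (G (Suc m))" using f0 by auto
      moreover have "f 0 \<in> module_hom R (G 0) (G m)" using f[of 0] by simp
      ultimately obtain h where "h \<in> module_hom R (G 0) (G (Suc m))" "\<forall>x\<in>carrier (G 0). d m (h x) = f 0 x"
        using lift[of 0 m] unfolding liftable_def by blast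
      then show ?thesis by (intro exI[of _ h]) auto
    next
      case False
      then show ?thesis using module_hom_const_zero[OF modG modG] by (intro exI) auto
    qed
  next
    fix h p assume P: "?P p h"
    interpret A: Module.module R "G (p + m)" by (rule modG)
    interpret B: Module.module R "G (Suc (p + m))" by (rule modG)
    show "\<exists>h'. ?P (Suc p) h' \<and> ?Q p h h'"
    proof (cases "Suc p + m \<le> n")
      case True
      let ?f = "\<lambda>x. f (Suc p) x \<oplus>\<^bsub>G (Suc p + m)\<^esub> h (d p x)"
      have hom: "?f \<in> module_hom R (G (Suc p)) (G (Suc p + m))"
        using P by (intro module_hom_plus[OF modG modG f] module_hom_comp[OF dhom]) simp
      have im: "?f ` carrier (G (Suc p)) \<subseteq> d (Suc p + m) ` carrier (G (Suc (Suc p + m)))"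
      proof (rule image_subsetI)
        fix x assume x: "x \<in> carrier (G (Suc p))"
        have dx: "d p x \<in> carrier (G p)" by (rule module_hom_closed[OF dhom x])
        have ddx: "p = 0 \<or> d (p - 1) (d p x) = \<zero>\<^bsub>G (p - 1)\<^esub>" using dd[of x "p - 1"] x by (cases p) auto
        have hx: "h (d p x) \<in> carrier (G (Suc p + m))" using module_hom_closed[of h _ "G p"] P dx by auto
        have fx: "f (Suc p) x \<in> carrier (G (Suc p + m))" by (rule module_hom_closed[OF f x])
        have "d (p + m) (?f x) = d (p + m) (f (Suc p) x) \<oplus>\<^bsub>G (p + m)\<^esub> d (p + m) (h (d p x))"
          using module_hom_add[OF dhom[of "p + m"]] fx hx by simp
        also have "\<dots> = \<ominus>\<^bsub>G (p + m)\<^esub> f p (d p x) \<oplus>\<^bsub>G (p + m)\<^esub> f p (d p x)"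
          using df[OF True x] P True dx ddx by auto
        also have "\<dots> = \<zero>\<^bsub>G (p + m)\<^esub>"
          using module_hom_closed[OF f dx] by (simp add: A.M.l_neg)
        finally have "d (p + m) (?f x) = \<zero>\<^bsub>G (p + m)\<^esub>" .
        then show "?f x \<in> d (Suc p + m) ` carrier (G (Suc (Suc p + m)))"
          using exact[of "p + m" "?f x"] True module_hom_closed[OF hom x] by simp
      qed
      obtain h' where h': "h' \<in> module_hom R (G (Suc p)) (G (Suc (Suc p + m)))"
        and dh': "\<And>x. x \<in> carrier (G (Suc p)) \<Longrightarrow> d (Suc p + m) (h' x) = ?f x"
        using lift[of "Suc p" "Suc p + m", unfolded liftable_def, rule_format, OF hom im] by blast
      have eq: "f (Suc p) x = d (Suc p + m) (h' x) \<ominus>\<^bsub>G (Suc p + m)\<^esub> h (d p x)" if x: "x \<in> carrier (G (Suc p))" for x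
      proof -
        have dx: "d p x \<in> carrier (G p)" by (rule module_hom_closed[OF dhom x])
        have hx: "h (d p x) \<in> carrier (G (Suc p + m))" using module_hom_closed[of h _ "G p"] P dx by auto
        show ?thesis
          using hx module_hom_closed[OF f x] unfolding dh'[OF x] a_minus_def
          by (simp add: B.M.a_assoc B.M.r_neg)
      qed
      have "f (Suc p) y = d (Suc p + m) (h' y)" if y: "y \<in> carrier (G (Suc p))" and "d p y = \<zero>\<^bsub>G p\<^esub>" for y
      proof -
        have "h (d p y) = \<zero>\<^bsub>G (Suc p + m)\<^esub>" using module_hom_zero[OF modG modG] P that(2) by auto
        then show ?thesis
          using eq[OF y] module_hom_closed[OF dhom module_hom_closed[OF h' y]] by (simp add: a_minus_def)
      qed
      then show ?thesis using h' eq by (intro exI[of _ h']) auto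
    next
      case False
      then show ?thesis using module_hom_const_zero[OF modG modG] by (intro exI) auto
    qed
  qed
  then obtain h where hh: "\<forall>p. ?P p (h p) \<and> ?Q p (h p) (h (Suc p))" by (rule exE)
  have h1: "?P p (h p)" for p by (rule conjunct1[OF spec[OF hh]])
  have h2: "?Q p (h p) (h (Suc p))" for p by (rule conjunct2[OF spec[OF hh]])
  show ?thesis
  proof (intro exI[of _ h] conjI allI impI ballI)
    show "h p \<in> module_hom R (G p) (G (Suc (p + m)))" for p by (rule conjunct1[OF h1])
    show "f 0 x = d m (h 0 x)" if "m \<le> n" "x \<in> carrier (G 0)" for x using h1[of 0] that by simp
    show "f (Suc p) x = d (Suc p + m) (h (Suc p) x) \<ominus>\<^bsub>G (Suc p + m)\<^esub> h p (d p x)"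
      if "Suc p + m \<le> n" "x \<in> carrier (G (Suc p))" for p x
      by (rule h2[rule_format, OF that])
  qed
qed

text \<open>Each s_(m+1) is a null homotopy of S s_m. The recursion continues because S squares to
  zero: applying S to the relation S s_m = d s_(m+1) - s_(m+1) d gives S d s_(m+1) = S s_(m+1) d, so
  S s_(m+1) anticommutes with d again and \<open>null_homotopy\<close> applies to it.\<close>

lemma higher_homotopies:
  "\<exists>s. (\<forall>m p. s m p \<in> module_hom R (G p) (G (p + m))) \<and> (\<forall>p. s 0 p = (\<lambda>x. x)) \<and>
    (\<forall>m. m \<le> n \<longrightarrow> (\<forall>x\<in>carrier (G 0). S m (s m 0 x) = d m (s (Suc m) 0 x))) \<and>
    (\<forall>m p. Suc p + m \<le> n \<longrightarrow> (\<forall>x\<in>carrier (G (Suc p)).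
       S (Suc p + m) (s m (Suc p) x) =
         d (Suc p + m) (s (Suc m) (Suc p) x) \<ominus>\<^bsub>G (Suc p + m)\<^esub> s (Suc m) p (d p x)))"
proof -
  let ?f = "\<lambda>m s p x. S (p + m) (s p x)"
  let ?P = "\<lambda>m s. (\<forall>p. s p \<in> module_hom R (G p) (G (p + m))) \<and> (m = 0 \<longrightarrow> s = (\<lambda>p x. x)) \<and>
    (\<forall>p x. Suc p + m \<le> n \<longrightarrow> x \<in> carrier (G (Suc p)) \<longrightarrow>
      d (p + m) (?f m s (Suc p) x) = \<ominus>\<^bsub>G (p + m)\<^esub> ?f m s p (d p x)) \<and>
    (\<forall>x. m \<le> n \<longrightarrow> x \<in> carrier (G 0) \<longrightarrow> ?f m s 0 x \<in> d m ` carrier (G (Suc m)))"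
  let ?Q = "\<lambda>m s s'. (m \<le> n \<longrightarrow> (\<forall>x\<in>carrier (G 0). S m (s 0 x) = d m (s' 0 x))) \<and>
    (\<forall>p. Suc p + m \<le> n \<longrightarrow> (\<forall>x\<in>carrier (G (Suc p)).
       S (Suc p + m) (s (Suc p) x) =
         d (Suc p + m) (s' (Suc p) x) \<ominus>\<^bsub>G (Suc p + m)\<^esub> s' p (d p x)))"
  have "\<exists>s. \<forall>m. ?P m (s m) \<and> ?Q m (s m) (s (Suc m))"
  proof (rule dependent_nat_choice)
    show "\<exists>s. ?P 0 s"
      by (rule exI[of _ "\<lambda>p x. x"]) (use dS S0 in \<open>simp add: module_hom_id\<close>)
  next
    fix s m assume P: "?P m s"
    then have s: "s p \<in> module_hom R (G p) (G (p + m))" for p by blast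
    have fh: "?f m s p \<in> module_hom R (G p) (G (p + m))" for p by (rule module_hom_comp[OF s Shom])
    have "\<exists>h. (\<forall>p. h p \<in> module_hom R (G p) (G (Suc (p + m)))) \<and>
      (m \<le> n \<longrightarrow> (\<forall>x\<in>carrier (G 0). ?f m s 0 x = d m (h 0 x))) \<and>
      (\<forall>p. Suc p + m \<le> n \<longrightarrow> (\<forall>x\<in>carrier (G (Suc p)).
         ?f m s (Suc p) x = d (Suc p + m) (h (Suc p) x) \<ominus>\<^bsub>G (Suc p + m)\<^esub> h p (d p x)))"
    proof (rule null_homotopy[of "?f m s" m])
      show "?f m s p \<in> module_hom R (G p) (G (p + m))" for p by (rule fh)
    qed (use P in blast)+
    then obtain h where h: "\<And>p. h p \<in> module_hom R (G p) (G (Suc (p + m)))"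
      and h0: "\<And>x. m \<le> n \<Longrightarrow> x \<in> carrier (G 0) \<Longrightarrow> S m (s 0 x) = d m (h 0 x)"
      and hS: "\<And>p x. Suc p + m \<le> n \<Longrightarrow> x \<in> carrier (G (Suc p)) \<Longrightarrow>
        S (Suc p + m) (s (Suc p) x) = d (Suc p + m) (h (Suc p) x) \<ominus>\<^bsub>G (Suc p + m)\<^esub> h p (d p x)"
      unfolding add_0 by blast
    have a1: "d (p + Suc m) (S (Suc p + Suc m) (h (Suc p) x)) = \<ominus>\<^bsub>G (p + Suc m)\<^esub> S (p + Suc m) (h p (d p x))"
      if le: "Suc p + Suc m \<le> n" and x: "x \<in> carrier (G (Suc p))" for p x
    proof -
      interpret A: Module.module R "G (Suc (p + m))" by (rule modG)
      have le': "Suc p + m \<le> n" using le by simp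
      have hx: "h (Suc p) x \<in> carrier (G (Suc (Suc p + m)))" by (rule module_hom_closed[OF h x])
      have hdx: "h p (d p x) \<in> carrier (G (Suc p + m))"
        using module_hom_closed[OF h module_hom_closed[OF dhom x]] by simp
      have sx: "S (Suc p + m) (s (Suc p) x) \<in> carrier (G (Suc p + m))" by (rule module_hom_closed[OF fh x])
      have dhx: "d (Suc p + m) (h (Suc p) x) \<in> carrier (G (Suc p + m))" by (rule module_hom_closed[OF dhom hx])
      have "d (Suc p + m) (h (Suc p) x) = S (Suc p + m) (s (Suc p) x) \<oplus>\<^bsub>G (Suc p + m)\<^esub> h p (d p x)"
        unfolding hS[OF le' x] a_minus_def using hdx dhx by (simp add: A.M.a_assoc A.M.l_neg)
      then have "S (Suc p + m) (d (Suc p + m) (h (Suc p) x)) = S (Suc p + m) (h p (d p x))"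
        using module_hom_add[OF Shom sx hdx] SS[OF module_hom_closed[OF s x]] module_hom_closed[OF Shom hdx] by simp
      then show ?thesis using dS[OF hx] by simp
    qed
    \<comment> \<open>For m = 0 the condition on the image in degree 0 was \<open>S0\<close>. For
      later maps it follows from exactness: d S h = -S d h = -S S s = 0 on \<open>G 0\<close>, so S
      h takes values in cycles, hence in boundaries.\<close>
    have a2: "S (Suc m) (h 0 x) \<in> d (Suc m) ` carrier (G (Suc (Suc m)))"
      if le: "Suc m \<le> n" and x: "x \<in> carrier (G 0)" for x
    proof (rule exact)
      interpret A: Module.module R "G m" by (rule modG)
      have hx: "h 0 x \<in> carrier (G (Suc m))" using module_hom_closed[OF h x] by simp
      show "S (Suc m) (h 0 x) \<in> carrier (G (Suc m))" by (rule module_hom_closed[OF Shom hx])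
      have "d m (S (Suc m) (h 0 x)) = \<ominus>\<^bsub>G m\<^esub> S m (S m (s 0 x))"
        using dS[OF hx] h0[OF _ x] le by simp
      also have "\<dots> = \<zero>\<^bsub>G m\<^esub>" using SS[of "s 0 x" m] module_hom_closed[OF s x] by simp
      finally show "d m (S (Suc m) (h 0 x)) = \<zero>\<^bsub>G m\<^esub>" .
    qed (use le in simp)
    show "\<exists>s'. ?P (Suc m) s' \<and> ?Q m s s'"
    proof (intro exI[of _ h] conjI allI impI ballI)
      show "h p \<in> module_hom R (G p) (G (p + Suc m))" for p using h by simp
      show "S (0 + Suc m) (h 0 x) \<in> d (Suc m) ` carrier (G (Suc (Suc m)))"
        if "Suc m \<le> n" "x \<in> carrier (G 0)" for x using a2[OF that] by simp
    qed (simp, (rule a1 h0 hS; assumption)+)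
  qed
  then obtain s where ss: "\<forall>m. ?P m (s m) \<and> ?Q m (s m) (s (Suc m))" by (rule exE)
  have s1: "?P m (s m)" for m by (rule conjunct1[OF spec[OF ss]])
  have s2: "?Q m (s m) (s (Suc m))" for m by (rule conjunct2[OF spec[OF ss]])
  show ?thesis
  proof (intro exI[of _ s] conjI allI impI ballI)
    show "s m p \<in> module_hom R (G p) (G (p + m))" for m p by (rule conjunct1[OF s1, rule_format])
    show "s 0 p = (\<lambda>x. x)" for p using s1[of 0] by simp
    show "S m (s m 0 x) = d m (s (Suc m) 0 x)" if "m \<le> n" "x \<in> carrier (G 0)" for m x
      by (rule conjunct1[OF s2, rule_format, OF that])
    show "S (Suc p + m) (s m (Suc p) x) = d (Suc p + m) (s (Suc m) (Suc p) x) \<ominus>\<^bsub>G (Suc p + m)\<^esub> s (Suc m) p (d p x)"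
      if "Suc p + m \<le> n" "x \<in> carrier (G (Suc p))" for m p x
      by (rule conjunct2[OF s2, rule_format, OF that])
  qed
qed

text \<open>The higher homotopies satisfy \<open>S s\<^sub>m = d s\<^sub>m\<^sub>+\<^sub>1 - s\<^sub>m\<^sub>+\<^sub>1 d\<close> and \<open>s\<^sub>0 = id\<close>; by downward induction on \<open>k\<close>
  the values of \<open>\<Theta> s\<^sub>k\<close> lie in \<open>m\<close>.\<close>

lemma cocycle_in:
  assumes T: "Module.module R T" and Th: "\<Theta> \<in> module_hom R (G n) T"
    and ST: "\<And>g. g \<in> carrier (G n) \<Longrightarrow> \<Theta> (S n g) = S' (\<Theta> g)"
    and cocycle: "\<And>g. g \<in> carrier (G (Suc n)) \<Longrightarrow> \<Theta> (d n g) \<in> J"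
    and J: "submodule J R T"
    and 1: "\<And>t. t \<in> carrier T \<Longrightarrow> S' t \<in> J \<Longrightarrow> t \<in> m"
    and 2: "\<And>p h g. h \<in> module_hom R (G p) T \<Longrightarrow> h ` carrier (G p) \<subseteq> m \<Longrightarrow> g \<in> carrier (G (Suc p)) \<Longrightarrow>
      h (d p g) \<in> J"
  shows "\<Theta> ` carrier (G n) \<subseteq> m"
proof -
  interpret T: Module.module R T by fact
  obtain s where s: "\<And>m p. s m p \<in> module_hom R (G p) (G (p + m))" and s0: "\<And>p. s 0 p = (\<lambda>x. x)"
    and sS0: "\<And>m x. m \<le> n \<Longrightarrow> x \<in> carrier (G 0) \<Longrightarrow> S m (s m 0 x) = d m (s (Suc m) 0 x)"
    and sS: "\<And>m p x. Suc p + m \<le> n \<Longrightarrow> x \<in> carrier (G (Suc p)) \<Longrightarrow>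
       S (Suc p + m) (s m (Suc p) x) =
         d (Suc p + m) (s (Suc m) (Suc p) x) \<ominus>\<^bsub>G (Suc p + m)\<^esub> s (Suc m) p (d p x)"
    using higher_homotopies by blast
  have "(\<lambda>x. \<Theta> (s (n - p) p x)) ` carrier (G p) \<subseteq> m" if "p \<le> n" for p
    using that
  proof (induction p)
    case 0
    show ?case
    proof (rule image_subsetI)
      fix x assume x: "x \<in> carrier (G 0)"
      have sx: "s n 0 x \<in> carrier (G n)" using module_hom_closed[OF s x, of n] by simp
      have "s (Suc n) 0 x \<in> carrier (G (Suc n))" using module_hom_closed[OF s x, of "Suc n"] by simp
      \<comment> \<open>On \<open>G 0\<close> the homotopy relation has no second term: it reads S
        s_n = d s_(n+1), so the cocycle condition alone is enough.\<close>
      from cocycle[OF this] have "S' (\<Theta> (s n 0 x)) \<in> J" using ST[OF sx] sS0[OF le_refl x] by simp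
      then show "\<Theta> (s (n - 0) 0 x) \<in> m" using 1 module_hom_closed[OF Th sx] by simp
    qed
  next
    case (Suc p)
    define k where "k = n - Suc p"
    have n: "n = Suc p + k" and np: "n - p = Suc k" using Suc.prems by (auto simp: k_def)
    show ?case
    proof (rule image_subsetI)
      fix x assume x: "x \<in> carrier (G (Suc p))"
      interpret Gn: Module.module R "G n" by (rule modG)
      have dx: "d p x \<in> carrier (G p)" by (rule module_hom_closed[OF dhom x])
      have sx: "s k (Suc p) x \<in> carrier (G n)" using module_hom_closed[OF s x, of k] by (simp add: n)
      have sx': "s (Suc k) (Suc p) x \<in> carrier (G (Suc n))" using module_hom_closed[OF s x, of "Suc k"] by (simp add: n)
      have sdx: "s (Suc k) p (d p x) \<in> carrier (G n)" using module_hom_closed[OF s dx, of "Suc k"] by (simp add: n)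
      \<comment> \<open>The induction hypothesis bounds \<Theta> s_(k+1) on \<open>G p\<close> by
        \<open>m\<close>; after one more \<open>d\<close> its values are in \<open>J\<close> by
        hypothesis 2. That disposes of the second term of the homotopy relation, and the cocycle
        condition of the first.\<close>
      have "(\<lambda>x. \<Theta> (s (Suc k) p x)) \<in> module_hom R (G p) T"
        using Th s[of "Suc k" p] by (intro module_hom_comp[OF _ Th]) (simp add: n)
      moreover have "(\<lambda>x. \<Theta> (s (Suc k) p x)) ` carrier (G p) \<subseteq> m" using Suc.IH Suc.prems np by simp
      ultimately have a: "\<Theta> (s (Suc k) p (d p x)) \<in> J" using 2 x by blast
      have "\<Theta> (S n (s k (Suc p) x)) = \<Theta> (d n (s (Suc k) (Suc p) x) \<ominus>\<^bsub>G n\<^esub> s (Suc k) p (d p x))"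
        using sS[of p k x] x by (simp add: n)
      also have "\<dots> = \<Theta> (d n (s (Suc k) (Suc p) x)) \<ominus>\<^bsub>T\<^esub> \<Theta> (s (Suc k) p (d p x))"
        by (rule module_hom_minus[OF modG T Th module_hom_closed[OF dhom sx'] sdx])
      also have "\<dots> \<in> J" unfolding a_minus_def
        using cocycle[OF sx'] a T.submoduleE(3,5)[OF J] by blast
      finally have "S' (\<Theta> (s k (Suc p) x)) \<in> J" using ST[OF sx] by simp
      then show "\<Theta> (s (n - Suc p) (Suc p) x) \<in> m" using 1 module_hom_closed[OF Th sx] by (simp add: k_def)
    qed
  qed
  from this[of n] show ?thesis by (simp add: s0)
qed

end

section \<open>Double complexes\<close>

text \<open>\<open>D\<close> lowers the first degree and \<open>E\<close> the second. The squares
  anticommute, so D + E is a differential on the total complex without extra signs.\<close>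

locale bicomplex =
  fixes R :: "('a, 'r) ring_scheme" and X :: "nat \<Rightarrow> nat \<Rightarrow> ('a, 'b, 'k) module_scheme"
    and D E :: "nat \<Rightarrow> nat \<Rightarrow> 'b \<Rightarrow> 'b"
  assumes modX: "\<And>p q. Module.module R (X p q)"
    and Dhom: "\<And>p q. D p q \<in> module_hom R (X (Suc p) q) (X p q)"
    and Ehom: "\<And>p q. E p q \<in> module_hom R (X p (Suc q)) (X p q)"
    and DD: "\<And>p q x. x \<in> carrier (X (Suc (Suc p)) q) \<Longrightarrow> D p q (D (Suc p) q x) = \<zero>\<^bsub>X p q\<^esub>"
    and EE: "\<And>p q x. x \<in> carrier (X p (Suc (Suc q))) \<Longrightarrow> E p q (E p (Suc q) x) = \<zero>\<^bsub>X p q\<^esub>"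
    and DE: "\<And>p q x. x \<in> carrier (X (Suc p) (Suc q)) \<Longrightarrow>
      D p q (E (Suc p) q x) = \<ominus>\<^bsub>X p q\<^esub> E p q (D p (Suc q) x)"
begin

text \<open>The sign convention is symmetric in the two directions; each statement about columns and
  the bottom edge therefore has a mirror image for rows and the left edge.\<close>

lemma swap: "bicomplex R (\<lambda>p q. X q p) (\<lambda>p q. E q p) (\<lambda>p q. D q p)"
proof (rule bicomplex.intro)
  fix p q x assume x: "x \<in> carrier (X (Suc q) (Suc p))"
  interpret M: Module.module R "X q p" by (rule modX)
  have "E q p (D q (Suc p) x) \<in> carrier (X q p)"
    by (rule module_hom_closed[OF Ehom module_hom_closed[OF Dhom x]])
  then show "E q p (D q (Suc p) x) = \<ominus>\<^bsub>X q p\<^esub> D q p (E (Suc q) p x)"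
    using DE[OF x] by simp
qed (rule modX Dhom Ehom DD EE; assumption?)+

text \<open>A total element of degree \<open>n\<close> is a family with \<open>g p\<close> in
  \<open>X p (n - p)\<close>. In degree 0 there is no cycle condition, so \<open>tot_exact 0\<close>
  asserts that every element is a boundary.\<close>

definition tot_exact :: "nat \<Rightarrow> bool" where
  "tot_exact n \<longleftrightarrow>
     (\<forall>g. (\<forall>p\<le>n. g p \<in> carrier (X p (n - p))) \<and>
        (\<forall>p<n. D p (n - Suc p) (g (Suc p)) \<oplus>\<^bsub>X p (n - Suc p)\<^esub> E p (n - Suc p) (g p) = \<zero>\<^bsub>X p (n - Suc p)\<^esub>) \<longrightarrow>
        (\<exists>h. (\<forall>p\<le>Suc n. h p \<in> carrier (X p (Suc n - p))) \<and>
          (\<forall>p\<le>n. g p = D p (n - p) (h (Suc p)) \<oplus>\<^bsub>X p (n - p)\<^esub> E p (n - p) (h p))))"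

definition col_exact :: bool where
  "col_exact \<longleftrightarrow> (\<forall>p q x. x \<in> carrier (X p (Suc q)) \<longrightarrow> E p q x = \<zero>\<^bsub>X p q\<^esub> \<longrightarrow>
     x \<in> E p (Suc q) ` carrier (X p (Suc (Suc q))))"

definition row_exact :: bool where
  "row_exact \<longleftrightarrow> (\<forall>p q x. x \<in> carrier (X (Suc p) q) \<longrightarrow> D p q x = \<zero>\<^bsub>X p q\<^esub> \<longrightarrow>
     x \<in> D (Suc p) q ` carrier (X (Suc (Suc p)) q))"

text \<open>Exactness in degree \<open>n\<close> of the complex of cokernels of the maps \<open>E p 0\<close>, stated in terms
  of representatives; \<open>left_exact\<close> is the same for the maps \<open>D 0 q\<close>.\<close>

definition bottom_exact :: "nat \<Rightarrow> bool" where
  "bottom_exact n \<longleftrightarrow> (\<forall>x\<in>carrier (X n 0). (\<forall>k. n = Suc k \<longrightarrow> D k 0 x \<in> E k 0 ` carrier (X k 1)) \<longrightarrow>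
     (\<exists>y\<in>carrier (X (Suc n) 0). \<exists>z\<in>carrier (X n 1). x = D n 0 y \<oplus>\<^bsub>X n 0\<^esub> E n 0 z))"

definition left_exact :: "nat \<Rightarrow> bool" where
  "left_exact n \<longleftrightarrow> (\<forall>x\<in>carrier (X 0 n). (\<forall>k. n = Suc k \<longrightarrow> E 0 k x \<in> D 0 k ` carrier (X 1 k)) \<longrightarrow>
     (\<exists>y\<in>carrier (X 0 (Suc n)). \<exists>z\<in>carrier (X 1 n). x = D 0 n z \<oplus>\<^bsub>X 0 n\<^esub> E 0 n y))"

text \<open>A staircase argument. The component in \<open>X n 0\<close> is handled by exactness of
  the bottom edge; then \<open>p\<close> decreases, and what remains of each component after
  subtracting \<open>D\<close> of the part already found is killed by \<open>E\<close>, hence lies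
  in the image of \<open>E\<close> because its column is exact.\<close>

lemma tot_exact_if_bottom_exact:
  assumes col: col_exact and bottom: "bottom_exact n"
  shows "tot_exact n"
  unfolding tot_exact_def
proof (intro allI impI, elim conjE)
  fix g assume g: "\<forall>p\<le>n. g p \<in> carrier (X p (n - p))"
    and cyc: "\<forall>p<n. D p (n - Suc p) (g (Suc p)) \<oplus>\<^bsub>X p (n - Suc p)\<^esub> E p (n - Suc p) (g p) = \<zero>\<^bsub>X p (n - Suc p)\<^esub>"
  have Eg: "E p (n - Suc p) (g p) = \<ominus>\<^bsub>X p (n - Suc p)\<^esub> D p (n - Suc p) (g (Suc p))" if p: "p < n" for p
  proof -
    interpret M: Module.module R "X p (n - Suc p)" by (rule modX)
    have np: "n - p = Suc (n - Suc p)" using p by simp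
    have gp: "g p \<in> carrier (X p (Suc (n - Suc p)))" using g[rule_format, of p] p np by simp
    have gS: "g (Suc p) \<in> carrier (X (Suc p) (n - Suc p))" using g[rule_format, of "Suc p"] p by simp
    show ?thesis
      using cyc[rule_format, OF p] module_hom_closed[OF Dhom gS] module_hom_closed[OF Ehom gp]
      by (metis M.M.a_comm M.M.minus_equality)
  qed
  have "\<exists>h. (\<forall>p\<le>Suc n. n - k \<le> p \<longrightarrow> h p \<in> carrier (X p (Suc n - p))) \<and>
      (\<forall>p\<le>n. n - k \<le> p \<longrightarrow> g p = D p (n - p) (h (Suc p)) \<oplus>\<^bsub>X p (n - p)\<^esub> E p (n - p) (h p))"
    if "k \<le> n" for k
    using that
  proof (induction k)
    case 0
    have gn: "g n \<in> carrier (X n 0)" using g by force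
    have "D k 0 (g n) \<in> E k 0 ` carrier (X k 1)" if n: "n = Suc k" for k
    proof -
      interpret M: Module.module R "X k 0" by (rule modX)
      interpret M1: Module.module R "X k 1" by (rule modX)
      have gk: "g k \<in> carrier (X k 1)" using g[rule_format, of k] n by simp
      have gS: "g (Suc k) \<in> carrier (X (Suc k) 0)" using gn n by simp
      have "E k 0 (g k) = \<ominus>\<^bsub>X k 0\<^esub> D k 0 (g n)" using Eg[of k] n by simp
      then have "D k 0 (g n) = \<ominus>\<^bsub>X k 0\<^esub> E k 0 (g k)" using module_hom_closed[OF Dhom gS] n by simp
      also have "\<dots> = E k 0 (\<ominus>\<^bsub>X k 1\<^esub> g k)"
        using module_hom_a_inv[OF modX modX Ehom, of "g k" k 0] gk by simp
      finally show ?thesis using M1.M.a_inv_closed[OF gk] by blast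
    qed
    then obtain y z where y: "y \<in> carrier (X (Suc n) 0)" and z: "z \<in> carrier (X n 1)"
      and eq: "g n = D n 0 y \<oplus>\<^bsub>X n 0\<^esub> E n 0 z"
      using bottom gn unfolding bottom_exact_def by blast
    show ?case
      by (rule exI[of _ "\<lambda>p. if p = n then z else y"]) (use y z eq in \<open>auto simp: le_Suc_eq\<close>)
  next
    case (Suc k)
    then obtain h where h: "\<And>p. p \<le> Suc n \<Longrightarrow> n - k \<le> p \<Longrightarrow> h p \<in> carrier (X p (Suc n - p))"
      and gh: "\<And>p. p \<le> n \<Longrightarrow> n - k \<le> p \<Longrightarrow>
        g p = D p (n - p) (h (Suc p)) \<oplus>\<^bsub>X p (n - p)\<^esub> E p (n - p) (h p)" by (meson Suc_leD)
    define p where "p = n - Suc k"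
    have nk: "n - k = Suc p" and np: "n - p = Suc k" "n - Suc p = k" and pn: "p < n"
      using Suc.prems by (auto simp: p_def)
    have hS: "h (Suc p) \<in> carrier (X (Suc p) (Suc k))" using h[of "Suc p"] nk np pn by simp
    have hSS: "h (Suc (Suc p)) \<in> carrier (X (Suc (Suc p)) k)" using h[of "Suc (Suc p)"] nk np pn by simp
    have gp: "g p \<in> carrier (X p (Suc k))" using g[rule_format, of p] np pn by simp
    interpret M: Module.module R "X p k" by (rule modX)
    interpret MS: Module.module R "X p (Suc k)" by (rule modX)
    interpret M': Module.module R "X (Suc p) k" by (rule modX)
    \<comment> \<open>This remainder is a cycle for \<open>E\<close>: the cycle condition and the
      formula for \<open>g (Suc p)\<close> give E g_p = -D g_(p+1) = -D E h_(p+1) = E D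
      h_(p+1).\<close>
    let ?x = "g p \<ominus>\<^bsub>X p (Suc k)\<^esub> D p (Suc k) (h (Suc p))"
    have Dh: "D p (Suc k) (h (Suc p)) \<in> carrier (X p (Suc k))" by (rule module_hom_closed[OF Dhom hS])
    have EDh: "E p k (D p (Suc k) (h (Suc p))) \<in> carrier (X p k)" by (rule module_hom_closed[OF Ehom Dh])
    have gSp: "g (Suc p) = D (Suc p) k (h (Suc (Suc p))) \<oplus>\<^bsub>X (Suc p) k\<^esub> E (Suc p) k (h (Suc p))"
      using gh[of "Suc p"] nk np pn by simp
    have "D p k (g (Suc p)) = D p k (D (Suc p) k (h (Suc (Suc p)))) \<oplus>\<^bsub>X p k\<^esub> D p k (E (Suc p) k (h (Suc p)))"
      unfolding gSp by (rule module_hom_add[OF Dhom module_hom_closed[OF Dhom hSS] module_hom_closed[OF Ehom hS]])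
    also have "\<dots> = \<ominus>\<^bsub>X p k\<^esub> E p k (D p (Suc k) (h (Suc p)))"
      using DD[OF hSS] DE[OF hS] EDh by simp
    finally have "E p k (g p) = E p k (D p (Suc k) (h (Suc p)))" using Eg[OF pn] np EDh by simp
    then have "E p k ?x = \<zero>\<^bsub>X p k\<^esub>"
      using module_hom_minus[OF modX modX Ehom gp Dh] EDh by (simp add: a_minus_def M.M.r_neg)
    then obtain z where z: "z \<in> carrier (X p (Suc (Suc k)))" "?x = E p (Suc k) z"
      using col gp Dh unfolding col_exact_def by (metis MS.M.minus_closed imageE)
    have Ez: "E p (Suc k) z \<in> carrier (X p (Suc k))" by (rule module_hom_closed[OF Ehom z(1)])
    have "g p = D p (Suc k) (h (Suc p)) \<oplus>\<^bsub>X p (Suc k)\<^esub> ?x"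
      using gp Dh unfolding a_minus_def by (metis MS.M.a_assoc MS.M.a_comm MS.M.a_inv_closed MS.M.r_neg MS.M.r_zero)
    then have eq: "g p = D p (n - p) (h (Suc p)) \<oplus>\<^bsub>X p (n - p)\<^esub> E p (n - p) z" using z np by simp
    show ?case
    proof (rule exI[of _ "h(p := z)"], intro conjI allI impI)
      fix i assume "i \<le> Suc n" "n - Suc k \<le> i"
      then show "(h(p := z)) i \<in> carrier (X i (Suc n - i))"
        using z h[of i] np pn nk by (cases "i = p") (auto simp: p_def Suc_diff_le)
    next
      fix i assume "i \<le> n" "n - Suc k \<le> i"
      then show "g i = D i (n - i) ((h(p := z)) (Suc i)) \<oplus>\<^bsub>X i (n - i)\<^esub> E i (n - i) ((h(p := z)) i)"
        using eq gh[of i] nk by (cases "i = p") (auto simp: p_def)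
    qed
  qed
  from this[of n] show "\<exists>h. (\<forall>p\<le>Suc n. h p \<in> carrier (X p (Suc n - p))) \<and>
      (\<forall>p\<le>n. g p = D p (n - p) (h (Suc p)) \<oplus>\<^bsub>X p (n - p)\<^esub> E p (n - p) (h p))" by simp
qed

text \<open>The element x is completed to a total cycle: \<open>E\<close> of each component is a
  boundary for \<open>D\<close>, and minus a preimage serves as the next component. The component at
  p = 0 of a family bounding this cycle is the required decomposition of x.\<close>

lemma left_exact_if_tot_exact:
  assumes row: row_exact and tot: "tot_exact n"
  shows "left_exact n"
  unfolding left_exact_def
proof (intro ballI impI)
  fix x assume x: "x \<in> carrier (X 0 n)" and Ex: "\<forall>k. n = Suc k \<longrightarrow> E 0 k x \<in> D 0 k ` carrier (X 1 k)"
  let ?P = "\<lambda>p y. (p = 0 \<longrightarrow> y = x) \<and> (p \<le> n \<longrightarrow> y \<in> carrier (X p (n - p)) \<and>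
    (p < n \<longrightarrow> E p (n - Suc p) y \<in> D p (n - Suc p) ` carrier (X (Suc p) (n - Suc p))))"
  let ?Q = "\<lambda>p y y'. p < n \<longrightarrow> D p (n - Suc p) y' \<oplus>\<^bsub>X p (n - Suc p)\<^esub> E p (n - Suc p) y = \<zero>\<^bsub>X p (n - Suc p)\<^esub>"
  have "\<exists>g. \<forall>p. ?P p (g p) \<and> ?Q p (g p) (g (Suc p))"
  proof (rule dependent_nat_choice)
    show "\<exists>y. ?P 0 y" using x Ex by (intro exI[of _ x]) (auto simp: gr0_conv_Suc)
  next
    fix y p assume P: "?P p y"
    show "\<exists>y'. ?P (Suc p) y' \<and> ?Q p y y'"
    proof (cases "p < n")
      case True
      define k where "k = n - Suc p"
      have np: "n - p = Suc k" using True by (simp add: k_def)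
      interpret M: Module.module R "X p k" by (rule modX)
      interpret M': Module.module R "X (Suc p) k" by (rule modX)
      have y: "y \<in> carrier (X p (Suc k))" using P True np by auto
      obtain w where w: "w \<in> carrier (X (Suc p) k)" "E p k y = D p k w" using P True by (auto simp: k_def)
      define y' where "y' = \<ominus>\<^bsub>X (Suc p) k\<^esub> w"
      have y': "y' \<in> carrier (X (Suc p) k)" using w by (simp add: y'_def)
      have Dy': "D p k y' = \<ominus>\<^bsub>X p k\<^esub> E p k y"
        unfolding y'_def w(2) by (rule module_hom_a_inv[OF modX modX Dhom w(1)])
      have Ey: "E p k y \<in> carrier (X p k)" by (rule module_hom_closed[OF Ehom y])
      \<comment> \<open>Anticommutation gives D E y' = -E D y' = E E y = 0, and the row is
        exact.\<close>
      have "E (Suc p) (n - Suc (Suc p)) y' \<in> D (Suc p) (n - Suc (Suc p)) ` carrier (X (Suc (Suc p)) (n - Suc (Suc p)))"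
        if "Suc p < n"
      proof -
        have "k \<noteq> 0" using that by (simp add: k_def)
        then obtain k' where k1: "k = Suc k'" by (cases k) auto
        then have k': "k = Suc k'" "n - Suc (Suc p) = k'" by (simp_all add: k_def)
        interpret Mk: Module.module R "X p k'" by (rule modX)
        interpret Mk1: Module.module R "X p (Suc k')" by (rule modX)
        have y'': "y' \<in> carrier (X (Suc p) (Suc k'))" and y2: "y \<in> carrier (X p (Suc (Suc k')))"
          using y' y k' by auto
        have "D p k' (E (Suc p) k' y') = \<ominus>\<^bsub>X p k'\<^esub> E p k' (\<ominus>\<^bsub>X p (Suc k')\<^esub> E p (Suc k') y)"
          using DE[OF y''] Dy' k' by simp
        also have "\<dots> = \<ominus>\<^bsub>X p k'\<^esub> (\<ominus>\<^bsub>X p k'\<^esub> E p k' (E p (Suc k') y))"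
          using module_hom_a_inv[OF modX modX Ehom, of "E p (Suc k') y" p k'] module_hom_closed[OF Ehom y2] by simp
        also have "\<dots> = \<zero>\<^bsub>X p k'\<^esub>" using EE[OF y2] by simp
        finally show ?thesis
          using row module_hom_closed[OF Ehom y''] unfolding row_exact_def k' by blast
      qed
      then show ?thesis using y' Dy' Ey
        by (intro exI[of _ y']) (auto simp: k_def M.M.l_neg[unfolded k_def])
    qed auto
  qed
  then obtain g where gg: "\<forall>p. ?P p (g p) \<and> ?Q p (g p) (g (Suc p))" by (rule exE)
  have g: "?P p (g p)" "?Q p (g p) (g (Suc p))" for p
    by (rule conjunct1[OF spec[OF gg]], rule conjunct2[OF spec[OF gg]])
  have "\<exists>h. (\<forall>p\<le>Suc n. h p \<in> carrier (X p (Suc n - p))) \<and>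
      (\<forall>p\<le>n. g p = D p (n - p) (h (Suc p)) \<oplus>\<^bsub>X p (n - p)\<^esub> E p (n - p) (h p))"
    using tot[unfolded tot_exact_def, rule_format, of g] g by blast
  then obtain h where h: "\<And>p. p \<le> Suc n \<Longrightarrow> h p \<in> carrier (X p (Suc n - p))"
    and gh: "g 0 = D 0 n (h (Suc 0)) \<oplus>\<^bsub>X 0 n\<^esub> E 0 n (h 0)" by (metis diff_zero le0)
  have "h 0 \<in> carrier (X 0 (Suc n))" "h (Suc 0) \<in> carrier (X 1 n)" using h[of 0] h[of 1] by simp_all
  moreover have "g 0 = x" using g(1)[of 0] by simp
  ultimately show "\<exists>y\<in>carrier (X 0 (Suc n)). \<exists>z\<in>carrier (X 1 n). x = D 0 n z \<oplus>\<^bsub>X 0 n\<^esub> E 0 n y"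
    using gh by auto
qed

end

text \<open>The mirror image of \<open>tot_exact_if_bottom_exact\<close>. Exchanging the gradings
  reverses a family from p to n - p; most of the proof checks this reindexing.\<close>

lemma (in bicomplex) tot_exact_if_left_exact:
  assumes row: row_exact and left: "left_exact n"
  shows "tot_exact n"
proof -
  interpret S: bicomplex R "\<lambda>p q. X q p" "\<lambda>p q. E q p" "\<lambda>p q. D q p" by (rule swap)
  have comm: "a \<oplus>\<^bsub>X p q\<^esub> b = b \<oplus>\<^bsub>X p q\<^esub> a" if "a \<in> carrier (X p q)" "b \<in> carrier (X p q)" for a b p q
  proof -
    interpret M: Module.module R "X p q" by (rule modX)
    show ?thesis using that by (rule M.M.a_comm)
  qed
  have "S.col_exact" using row unfolding S.col_exact_def row_exact_def by blast
  moreover have "S.bottom_exact n"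
    unfolding S.bottom_exact_def
  proof (intro ballI impI)
    fix x assume x: "x \<in> carrier (X 0 n)" and k: "\<forall>k. n = Suc k \<longrightarrow> E 0 k x \<in> D 0 k ` carrier (X 1 k)"
    then obtain y z where yz: "y \<in> carrier (X 0 (Suc n))" "z \<in> carrier (X 1 n)" "x = D 0 n z \<oplus>\<^bsub>X 0 n\<^esub> E 0 n y"
      using left unfolding left_exact_def by blast
    moreover have "D 0 n z \<oplus>\<^bsub>X 0 n\<^esub> E 0 n y = E 0 n y \<oplus>\<^bsub>X 0 n\<^esub> D 0 n z"
      using yz by (intro comm module_hom_closed[OF Dhom] module_hom_closed[OF Ehom]) auto
    ultimately show "\<exists>y\<in>carrier (X 0 (Suc n)). \<exists>z\<in>carrier (X 1 n). x = E 0 n y \<oplus>\<^bsub>X 0 n\<^esub> D 0 n z" by auto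
  qed
  ultimately have S: "S.tot_exact n" by (rule S.tot_exact_if_bottom_exact)
  show ?thesis
    unfolding tot_exact_def
  proof (intro allI impI, elim conjE)
    fix g assume g: "\<forall>p\<le>n. g p \<in> carrier (X p (n - p))"
      and cyc: "\<forall>p<n. D p (n - Suc p) (g (Suc p)) \<oplus>\<^bsub>X p (n - Suc p)\<^esub> E p (n - Suc p) (g p) = \<zero>\<^bsub>X p (n - Suc p)\<^esub>"
    have 1: "\<forall>p\<le>n. g (n - p) \<in> carrier (X (n - p) p)"
    proof (intro allI impI)
      fix p assume "p \<le> n"
      then show "g (n - p) \<in> carrier (X (n - p) p)" using g[rule_format, of "n - p"] by simp
    qed
    have 2: "\<forall>p<n. E (n - Suc p) p (g (n - Suc p)) \<oplus>\<^bsub>X (n - Suc p) p\<^esub> D (n - Suc p) p (g (n - p)) = \<zero>\<^bsub>X (n - Suc p) p\<^esub>"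
    proof (intro allI impI)
      fix p assume p: "p < n"
      define k where "k = n - Suc p"
      have k: "n - p = Suc k" "n - Suc k = p" "k < n" "n - k = Suc p" using p by (auto simp: k_def)
      have "g k \<in> carrier (X k (Suc p))" "g (Suc k) \<in> carrier (X (Suc k) p)"
        using g[rule_format, of k] g[rule_format, of "Suc k"] k by auto
      then have "E k p (g k) \<oplus>\<^bsub>X k p\<^esub> D k p (g (Suc k)) = D k p (g (Suc k)) \<oplus>\<^bsub>X k p\<^esub> E k p (g k)"
        by (intro comm module_hom_closed[OF Dhom] module_hom_closed[OF Ehom])
      then show "E (n - Suc p) p (g (n - Suc p)) \<oplus>\<^bsub>X (n - Suc p) p\<^esub> D (n - Suc p) p (g (n - p)) = \<zero>\<^bsub>X (n - Suc p) p\<^esub>"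
        using cyc[rule_format, OF k(3)] k by (simp flip: k_def)
    qed
    from S[unfolded S.tot_exact_def, rule_format, of "\<lambda>p. g (n - p)"] 1 2
    obtain h where h: "\<And>p. p \<le> Suc n \<Longrightarrow> h p \<in> carrier (X (Suc n - p) p)"
      and gh: "\<And>p. p \<le> n \<Longrightarrow> g (n - p) = E (n - p) p (h (Suc p)) \<oplus>\<^bsub>X (n - p) p\<^esub> D (n - p) p (h p)" by auto
    show "\<exists>h. (\<forall>p\<le>Suc n. h p \<in> carrier (X p (Suc n - p))) \<and>
          (\<forall>p\<le>n. g p = D p (n - p) (h (Suc p)) \<oplus>\<^bsub>X p (n - p)\<^esub> E p (n - p) (h p))"
    proof (rule exI[of _ "\<lambda>p. h (Suc n - p)"], intro conjI allI impI)
      fix p assume p: "p \<le> Suc n"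
      then show "h (Suc n - p) \<in> carrier (X p (Suc n - p))" using h[of "Suc n - p"] by simp
    next
      fix p assume p: "p \<le> n"
      have a: "h (Suc (n - p)) \<in> carrier (X p (Suc (n - p)))" "h (n - p) \<in> carrier (X (Suc p) (n - p))"
        using h[of "Suc (n - p)"] h[of "n - p"] p by (simp_all add: Suc_diff_le)
      have "g p = E p (n - p) (h (Suc (n - p))) \<oplus>\<^bsub>X p (n - p)\<^esub> D p (n - p) (h (n - p))"
        using gh[of "n - p"] p by simp
      also have "\<dots> = D p (n - p) (h (n - p)) \<oplus>\<^bsub>X p (n - p)\<^esub> E p (n - p) (h (Suc (n - p)))"
        using a by (intro comm module_hom_closed[OF Dhom] module_hom_closed[OF Ehom])
      finally show "g p = D p (n - p) (h (Suc n - Suc p)) \<oplus>\<^bsub>X p (n - p)\<^esub> E p (n - p) (h (Suc n - p))"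
        using p by (simp add: Suc_diff_le)
    qed
  qed
qed

section \<open>Local rings of finite length\<close>

lemma submodule_memD:
  assumes "Module.module R M" and "submodule H R M"
  shows submodule_carrier: "x \<in> H \<Longrightarrow> x \<in> carrier M"
    and submodule_zero: "\<zero>\<^bsub>M\<^esub> \<in> H"
    and submodule_add: "x \<in> H \<Longrightarrow> y \<in> H \<Longrightarrow> x \<oplus>\<^bsub>M\<^esub> y \<in> H"
    and submodule_neg: "x \<in> H \<Longrightarrow> \<ominus>\<^bsub>M\<^esub> x \<in> H"
    and submodule_diff: "x \<in> H \<Longrightarrow> y \<in> H \<Longrightarrow> x \<ominus>\<^bsub>M\<^esub> y \<in> H"
    and submodule_smult: "a \<in> carrier R \<Longrightarrow> x \<in> H \<Longrightarrow> a \<odot>\<^bsub>M\<^esub> x \<in> H"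
proof -
  interpret M: Module.module R M by fact
  note E = M.submoduleE[OF assms(2)]
  show "x \<in> H \<Longrightarrow> x \<in> carrier M" using E(1) by blast
  show z: "\<zero>\<^bsub>M\<^esub> \<in> H" using subgroup.one_closed[OF submodule.axioms(1)[OF assms(2)]] by simp
  show "x \<in> H \<Longrightarrow> y \<in> H \<Longrightarrow> x \<oplus>\<^bsub>M\<^esub> y \<in> H" "x \<in> H \<Longrightarrow> \<ominus>\<^bsub>M\<^esub> x \<in> H"
    "a \<in> carrier R \<Longrightarrow> x \<in> H \<Longrightarrow> a \<odot>\<^bsub>M\<^esub> x \<in> H" using E by blast+
  show "x \<in> H \<Longrightarrow> y \<in> H \<Longrightarrow> x \<ominus>\<^bsub>M\<^esub> y \<in> H" unfolding a_minus_def using E by blast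
qed

lemma submoduleI':
  assumes "Module.module R M" and "H \<subseteq> carrier M" and "\<zero>\<^bsub>M\<^esub> \<in> H"
    and "\<And>x y. x \<in> H \<Longrightarrow> y \<in> H \<Longrightarrow> x \<oplus>\<^bsub>M\<^esub> y \<in> H"
    and sm: "\<And>a x. a \<in> carrier R \<Longrightarrow> x \<in> H \<Longrightarrow> a \<odot>\<^bsub>M\<^esub> x \<in> H"
  shows "submodule H R M"
proof -
  interpret M: Module.module R M by fact
  show ?thesis
  proof (rule M.submoduleI[OF assms(2,3) _ assms(4) sm])
    fix x assume x: "x \<in> H"
    have "(\<ominus>\<^bsub>R\<^esub> \<one>\<^bsub>R\<^esub>) \<odot>\<^bsub>M\<^esub> x \<in> H" using x by (intro sm) auto
    then show "\<ominus>\<^bsub>M\<^esub> x \<in> H" using x assms(2) M.smult_l_minus[of "\<one>\<^bsub>R\<^esub>" x] by auto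
  qed
qed

lemma submodule_finsum:
  assumes "Module.module R M" and "submodule H R M" and "f \<in> A \<rightarrow> H"
  shows "(\<Oplus>\<^bsub>M\<^esub>i\<in>A. f i) \<in> H"
proof -
  interpret M: Module.module R M by fact
  show ?thesis using assms(3)
  proof (induction A rule: infinite_finite_induct)
    case (insert a A)
    then have "f a \<in> H" "f \<in> A \<rightarrow> H" by auto
    moreover have "f \<in> A \<rightarrow> carrier M" "f a \<in> carrier M"
      using calculation submodule_carrier[OF assms(1,2)] by auto
    ultimately show ?case using insert by (simp add: submodule_add[OF assms(1,2)])
  qed (simp_all add: submodule_zero[OF assms(1,2)] M.M.finsum_infinite)
qed

lemma submodule_image:
  assumes M: "Module.module R M" and N: "Module.module R N" and f: "f \<in> module_hom R M N" and H: "submodule H R M"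
  shows "submodule (f ` H) R N"
proof (rule submoduleI'[OF N])
  note c = submodule_carrier[OF M H]
  show "f ` H \<subseteq> carrier N" using module_hom_closed[OF f c] by auto
  show "\<zero>\<^bsub>N\<^esub> \<in> f ` H" using module_hom_zero[OF M N f] submodule_zero[OF M H] by (metis imageI)
  show "x \<oplus>\<^bsub>N\<^esub> y \<in> f ` H" if "x \<in> f ` H" "y \<in> f ` H" for x y
    using that by (auto simp: module_hom_add[OF f c c, symmetric] intro!: imageI submodule_add[OF M H])
  show "a \<odot>\<^bsub>N\<^esub> x \<in> f ` H" if "a \<in> carrier R" "x \<in> f ` H" for a x
    using that by (auto simp: module_hom_smult[OF f _ c, symmetric] intro!: imageI submodule_smult[OF M H])
qed

lemma submodule_vimage:
  assumes M: "Module.module R M" and N: "Module.module R N" and f: "f \<in> module_hom R M N" and K: "submodule K R N"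
  shows "submodule {x \<in> carrier M. f x \<in> K} R M"
proof -
  interpret M: Module.module R M by fact
  show ?thesis
    by (rule submoduleI'[OF M])
      (auto simp: module_hom_add[OF f] module_hom_smult[OF f] module_hom_zero[OF M N f]
        intro: submodule_add[OF N K] submodule_smult[OF N K] submodule_zero[OF N K])
qed

lemma carrier_submodule:
  assumes "Module.module R M" shows "submodule (carrier M) R M"
proof -
  interpret M: Module.module R M by fact
  show ?thesis by (rule submoduleI'[OF assms]) simp_all
qed

lemma zero_submodule: "Module.module R M \<Longrightarrow> submodule {\<zero>\<^bsub>M\<^esub>} R M"
proof -
  assume M: "Module.module R M"
  interpret M: Module.module R M by fact
  show ?thesis by (rule submoduleI'[OF M]) auto
qed

lemma submodule_Int:
  assumes "Module.module R M" and "submodule H R M" and "submodule K R M"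
  shows "submodule (H \<inter> K) R M"
  by (rule submoduleI'[OF assms(1)])
    (auto intro: submodule_carrier[OF assms(1,2)] submodule_zero[OF assms(1,2)] submodule_zero[OF assms(1,3)]
      submodule_add[OF assms(1,2)] submodule_add[OF assms(1,3)] submodule_smult[OF assms(1,2)] submodule_smult[OF assms(1,3)])

lemma a_kernel_eq: "a_kernel M N f = {x \<in> carrier M. f x = \<zero>\<^bsub>N\<^esub>}"
  by (simp add: a_kernel_def')

lemma submodule_kernel:
  assumes M: "Module.module R M" and N: "Module.module R N" and f: "f \<in> module_hom R M N"
  shows "submodule (a_kernel M N f) R M"
  using submodule_vimage[OF M N f zero_submodule[OF N]] by (simp add: a_kernel_eq)

lemma span_submodule:
  assumes M: "Module.module R M" and S: "S \<subseteq> carrier M"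
  shows "submodule (module_span R M S) R M"
proof -
  interpret M: Module.module R M by fact
  have c: "carrier M \<in> {H. submodule H R M \<and> S \<subseteq> H}" using S M.carrier_is_submodule by simp
  show ?thesis unfolding module_span_def
    by (rule submoduleI'[OF M])
      (use c in \<open>auto intro: submodule_zero[OF M] submodule_add[OF M] submodule_smult[OF M]\<close>)
qed

lemma span_incl: "S \<subseteq> module_span R M S"
  by (auto simp: module_span_def)

lemma span_least: "submodule H R M \<Longrightarrow> S \<subseteq> H \<Longrightarrow> module_span R M S \<subseteq> H"
  by (auto simp: module_span_def)

lemma span_mono: "S \<subseteq> T \<Longrightarrow> module_span R M S \<subseteq> module_span R M T"
  by (auto simp: module_span_def)

lemma span_image:
  assumes M: "Module.module R M" and N: "Module.module R N" and f: "f \<in> module_hom R M N" and S: "S \<subseteq> carrier M"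
  shows "f ` module_span R M S = module_span R N (f ` S)"
proof
  have fS: "f ` S \<subseteq> carrier N" using S module_hom_closed[OF f] by auto
  have "module_span R M S \<subseteq> {x \<in> carrier M. f x \<in> module_span R N (f ` S)}"
    using S span_incl[of "f ` S" R N]
    by (intro span_least submodule_vimage[OF M N f span_submodule[OF N fS]]) auto
  then show "f ` module_span R M S \<subseteq> module_span R N (f ` S)" by auto
  show "module_span R N (f ` S) \<subseteq> f ` module_span R M S"
    by (intro span_least submodule_image[OF M N f span_submodule[OF M S]] image_mono span_incl)
qed

lemma span_comb:
  assumes M: "Module.module R M" and X: "finite X" and x: "x \<in> X \<rightarrow> carrier M"
  shows "module_span R M (x ` X) = comb M X x ` carrier (free_module R X)"
proof
  interpret M: Module.module R M by fact
  note R = M.R.cring_axioms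
  interpret F: Module.module R "free_module R X" by (rule module_free[OF R X])
  have xc: "x ` X \<subseteq> carrier M" using x by auto
  show "module_span R M (x ` X) \<subseteq> comb M X x ` carrier (free_module R X)"
  proof (intro span_least submodule_image[OF F.module_axioms M comb_hom[OF M X x] F.carrier_is_submodule] image_subsetI)
    fix i assume "i \<in> X"
    then show "x i \<in> comb M X x ` carrier (free_module R X)"
      using comb_gen[OF M X x] free_gen_closed[OF R X] by (metis imageI)
  qed
  show "comb M X x ` carrier (free_module R X) \<subseteq> module_span R M (x ` X)"
  proof (rule image_subsetI)
    fix u assume u: "u \<in> carrier (free_module R X)"
    show "comb M X x u \<in> module_span R M (x ` X)" unfolding comb_def
    proof (rule submodule_finsum[OF M span_submodule[OF M xc]], rule Pi_I)
      fix i assume i: "i \<in> X"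
      then have "x i \<in> module_span R M (x ` X)" using span_incl[of "x ` X" R M] by auto
      then show "u i \<odot>\<^bsub>M\<^esub> x i \<in> module_span R M (x ` X)"
        by (rule submodule_smult[OF M span_submodule[OF M xc] free_mem[OF X u i]])
    qed
  qed
qed

text \<open>Ideals are treated as submodules of the regular module, so that spans, chains and
  lengths need a single theory.\<close>

lemma ideal_iff_submodule:
  assumes "cring R"
  shows "ideal I R \<longleftrightarrow> submodule I R (regular_module R)"
proof
  interpret cring R by fact
  note M = module_regular[OF assms]
  show "submodule I R (regular_module R)" if "ideal I R"
    using that additive_subgroup.zero_closed[OF ideal.axioms(1)[OF that]] additive_subgroup.a_subset[OF ideal.axioms(1)[OF that]]
    by (intro submoduleI'[OF M]) (auto simp: additive_subgroup.a_closed[OF ideal.axioms(1)] ideal.I_l_closed)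
  show "ideal I R" if s: "submodule I R (regular_module R)"
  proof (rule idealI)
    note cl = submodule_carrier[OF M s]
    have neg: "\<ominus>\<^bsub>R\<^esub> x \<in> I" if "x \<in> I" for x
      using submodule_smult[OF M s, of "\<ominus>\<^bsub>R\<^esub> \<one>\<^bsub>R\<^esub>" x] that cl[OF that] by (simp add: l_minus)
    show "subgroup I (add_monoid R)"
      using submodule_zero[OF M s] submodule_add[OF M s] cl neg
      by (intro add.subgroupI) (auto simp: a_inv_def)
    show "ring R" by (rule ring_axioms)
    show "x \<otimes>\<^bsub>R\<^esub> a \<in> I" if "a \<in> I" "x \<in> carrier R" for a x
      using submodule_smult[OF M s, of x a] that by simp
    show "a \<otimes>\<^bsub>R\<^esub> x \<in> I" if "a \<in> I" "x \<in> carrier R" for a x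
      using submodule_smult[OF M s, of x a] that cl[OF that(1)] by (simp add: m_comm)
  qed
qed

section \<open>Finite generation\<close>

text \<open>Stated inside the ambient module, so that images and kernels of maps can be discussed
  without changing carriers.\<close>

definition fg_sub :: "('a, 'r) ring_scheme \<Rightarrow> ('a, 'b, 'k) module_scheme \<Rightarrow> 'b set \<Rightarrow> bool" where
  "fg_sub R M H \<longleftrightarrow> (\<exists>S. finite S \<and> S \<subseteq> carrier M \<and> module_span R M S = H)"

lemma fg_sub_image:
  assumes M: "Module.module R M" and N: "Module.module R N" and f: "f \<in> module_hom R M N" and "fg_sub R M H"
  shows "fg_sub R N (f ` H)"
proof -
  obtain S where S: "finite S" "S \<subseteq> carrier M" "module_span R M S = H" using assms(4) by (auto simp: fg_sub_def)
  then show ?thesis unfolding fg_sub_def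
    using span_image[OF M N f S(2)] module_hom_closed[OF f] by (intro exI[of _ "f ` S"]) auto
qed

text \<open>Lifts of generators of the image, together with generators of the part of H in the
  kernel, generate H.\<close>

lemma fg_sub_extension:
  assumes M: "Module.module R M" and N: "Module.module R N" and f: "f \<in> module_hom R M N" and H: "submodule H R M"
    and im: "fg_sub R N (f ` H)" and ker: "fg_sub R M (H \<inter> a_kernel M N f)"
  shows "fg_sub R M H"
proof -
  interpret M: Module.module R M by fact
  interpret N: Module.module R N by fact
  obtain T where T: "finite T" "T \<subseteq> carrier N" "module_span R N T = f ` H" using im by (auto simp: fg_sub_def)
  obtain S where S: "finite S" "S \<subseteq> carrier M" "module_span R M S = H \<inter> a_kernel M N f" using ker by (auto simp: fg_sub_def)
  have "T \<subseteq> f ` H" using T(3) span_incl[of T R N] by simp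
  then obtain T' where T': "finite T'" "T' \<subseteq> H" "f ` T' = T" using T(1) by (metis finite_subset_image)
  have T'c: "T' \<subseteq> carrier M" using T' submodule_carrier[OF M H] by blast
  have SH: "S \<subseteq> H" using S span_incl[of S R M] by blast
  let ?P = "module_span R M (T' \<union> S)"
  have P: "submodule ?P R M" using T'c S by (intro span_submodule[OF M]) auto
  have "?P = H"
  proof
    show "?P \<subseteq> H" using T' SH by (intro span_least H) auto
    show "H \<subseteq> ?P"
    proof
      fix u assume u: "u \<in> H"
      then have "f u \<in> f ` module_span R M T'" using T T' span_image[OF M N f T'c] by auto
      then obtain v where v: "v \<in> module_span R M T'" "f u = f v" by auto
      have vH: "v \<in> H" using v span_least[OF H T'(2)] by blast
      have uc: "u \<in> carrier M" "v \<in> carrier M" using u vH submodule_carrier[OF M H] by auto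
      have "f (u \<ominus>\<^bsub>M\<^esub> v) = \<zero>\<^bsub>N\<^esub>"
        using module_hom_minus[OF M N f uc] v module_hom_closed[OF f uc(2)] by (simp add: a_minus_def N.M.r_neg)
      then have "u \<ominus>\<^bsub>M\<^esub> v \<in> module_span R M S"
        unfolding S(3) a_kernel_eq using submodule_diff[OF M H u vH] uc by auto
      then have "u \<ominus>\<^bsub>M\<^esub> v \<in> ?P" "v \<in> ?P" using v span_mono[of S "T' \<union> S"] span_mono[of T' "T' \<union> S"] by blast+
      then have "(u \<ominus>\<^bsub>M\<^esub> v) \<oplus>\<^bsub>M\<^esub> v \<in> ?P" by (rule submodule_add[OF M P])
      then show "u \<in> ?P" using uc by (simp add: a_minus_def M.M.a_assoc M.M.l_neg)
    qed
  qed
  then show ?thesis unfolding fg_sub_def using T' T'c S by (intro exI[of _ "T' \<union> S"]) auto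
qed

text \<open>Finite length bounds all chains of ideals. This supplies maximal members of families of
  ideals, and with them finite generation of ideals and units outside \<mm>.\<close>

locale finite_length_local_ring =
  fixes R :: "('a, 'r) ring_scheme" (structure) and \<mm> :: "'a set"
  assumes local: "local_ring R \<mm>"
    and finite_length: "module_length R (regular_module R) < \<infinity>"

sublocale finite_length_local_ring \<subseteq> cring R
  using local by (simp add: local_ring_def)

context finite_length_local_ring
begin

lemma cr: "cring R" by (rule cring_axioms)

lemma regular: "Module.module R (regular_module R)" by (rule module_regular[OF cr])

lemma maximal: "maximalideal \<mm> R" using local by (simp add: local_ring_def)

lemma mm_ideal: "ideal \<mm> R" by (rule maximalideal.axioms(1)[OF maximal])

lemma mm_sub: "submodule \<mm> R (regular_module R)" using mm_ideal ideal_iff_submodule[OF cr] by simp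

lemma mm_closed: "x \<in> \<mm> \<Longrightarrow> x \<in> carrier R"
  using submodule_carrier[OF regular mm_sub] by simp

lemma free: "finite X \<Longrightarrow> Module.module R (free_module R X)" by (rule module_free[OF cr])

lemma chain_bound: "\<exists>N. \<forall>k C. (\<forall>i\<le>k. submodule (C i) R (regular_module R)) \<and> (\<forall>i<k. C i \<subset> C (Suc i)) \<longrightarrow> k \<le> N"
proof -
  obtain N where N: "module_length R (regular_module R) = enat N"
    using finite_length by (cases "module_length R (regular_module R)") auto
  have "enat k \<le> enat N" if "(\<forall>i\<le>k. submodule (C i) R (regular_module R)) \<and> (\<forall>i<k. C i \<subset> C (Suc i))"
    for k and C :: "nat \<Rightarrow> 'a set"
    unfolding N[symmetric] module_length_def using that by (intro Sup_upper) blast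
  then show ?thesis by (intro exI[of _ N]) (auto simp: )
qed

text \<open>Without a maximal member one could choose a strictly ascending sequence, which is longer
  than the length of R permits.\<close>

lemma max_submodule:
  assumes "\<F> \<noteq> {}" and sub: "\<And>H. H \<in> \<F> \<Longrightarrow> submodule H R (regular_module R)"
  shows "\<exists>H\<in>\<F>. \<forall>K\<in>\<F>. H \<subseteq> K \<longrightarrow> K = H"
proof (rule ccontr)
  assume no: "\<not> ?thesis"
  have "\<exists>C. \<forall>i. C i \<in> \<F> \<and> C i \<subset> C (Suc i)"
  proof (rule dependent_nat_choice)
    show "\<exists>H. H \<in> \<F>" using assms(1) by auto
    show "\<exists>K. K \<in> \<F> \<and> H \<subset> K" if "H \<in> \<F>" for H using no that by blast
  qed
  then obtain C where C: "\<And>i. C i \<in> \<F>" "\<And>i. C i \<subset> C (Suc i)" by blast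
  obtain N where "\<And>k. (\<forall>i\<le>k. submodule (C i) R (regular_module R)) \<and> (\<forall>i<k. C i \<subset> C (Suc i)) \<Longrightarrow> k \<le> N"
    using chain_bound by blast
  from this[of "Suc N"] C sub show False by auto
qed

text \<open>Among the finitely generated ideals inside H a maximal one must be H, since any missing
  element could be added to its generators.\<close>

lemma fg_ideal:
  assumes H: "submodule H R (regular_module R)"
  shows "fg_sub R (regular_module R) H"
proof -
  let ?F = "{K. fg_sub R (regular_module R) K \<and> K \<subseteq> H}"
  have "module_span R (regular_module R) {} \<in> ?F"
    using span_least[OF H, of "{}"] by (auto simp: fg_sub_def)
  then have ne: "?F \<noteq> {}" by blast
  have sub: "submodule K R (regular_module R)" if "K \<in> ?F" for K
    using that span_submodule[OF regular] by (auto simp: fg_sub_def)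
  from max_submodule[OF ne sub] obtain K where K: "K \<in> ?F" and max: "\<forall>L\<in>?F. K \<subseteq> L \<longrightarrow> L = K" by (rule bexE)
  obtain S where S: "finite S" "S \<subseteq> carrier (regular_module R)" "module_span R (regular_module R) S = K"
    using K by (auto simp: fg_sub_def)
  have "H \<subseteq> K"
  proof
    fix x assume x: "x \<in> H"
    let ?L = "module_span R (regular_module R) (insert x S)"
    have xc: "x \<in> carrier R" using submodule_carrier[OF regular H x] by simp
    have "S \<subseteq> K" using S span_incl[of S R "regular_module R"] by simp
    then have "?L \<subseteq> H" using x K by (intro span_least[OF H]) auto
    moreover have "fg_sub R (regular_module R) ?L"
      using S xc unfolding fg_sub_def by (intro exI[of _ "insert x S"]) auto
    moreover have "K \<subseteq> ?L" using S(3) span_mono[of S "insert x S"] by auto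
    ultimately have "?L = K" using max by blast
    then show "x \<in> K" using span_incl[of "insert x S" R "regular_module R"] by auto
  qed
  then show ?thesis using K by (auto simp: subset_antisym)
qed

text \<open>Induction on the rank: the last coordinate maps H onto an ideal, and the elements with
  last coordinate zero form a submodule of a free module of smaller rank.\<close>

lemma fg_free:
  "submodule H R (free_module R {..<n::nat}) \<Longrightarrow> fg_sub R (free_module R {..<n}) H"
proof (induction n arbitrary: H)
  case 0
  note F = free[of "{..<0::nat}"]
  have c: "carrier (free_module R {..<0::nat}) = {\<zero>\<^bsub>free_module R {..<0::nat}\<^esub>}"
    by (auto simp: free_module_def)
  have "H = {\<zero>\<^bsub>free_module R {..<0::nat}\<^esub>}"
  proof
    show "H \<subseteq> {\<zero>\<^bsub>free_module R {..<0::nat}\<^esub>}" using submodule_carrier[OF F 0] c by blast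
    show "{\<zero>\<^bsub>free_module R {..<0::nat}\<^esub>} \<subseteq> H" using submodule_zero[OF F 0] by blast
  qed
  moreover have "module_span R (free_module R {..<0::nat}) H = H"
    by (rule subset_antisym[OF span_least[OF 0 subset_refl] span_incl])
  ultimately show ?case unfolding fg_sub_def using c by (intro exI[of _ H]) auto
next
  case (Suc n)
  let ?F = "free_module R {..<Suc n}" and ?G = "free_module R {..<n}"
  have F: "Module.module R ?F" and G: "Module.module R ?G" by (simp_all add: free)
  have p: "(\<lambda>u. u n) \<in> module_hom R ?F (regular_module R)" by (rule free_proj_hom) auto
  define \<iota> where "\<iota> = (\<lambda>u. \<lambda>x\<in>{..<Suc n}. if x < n then u x else \<zero>)"
  have i: "\<iota> \<in> module_hom R ?G ?F"
    by (rule module_homI) (auto simp: \<iota>_def carrier_free free_simps PiE_def Pi_def extensional_def)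
  let ?K = "H \<inter> a_kernel ?F (regular_module R) (\<lambda>u. u n)"
  have K: "submodule ?K R ?F" by (intro submodule_Int F Suc.prems submodule_kernel[OF F regular p])
  let ?L = "{v \<in> carrier ?G. \<iota> v \<in> ?K}"
  have "\<iota> ` ?L = ?K"
  proof
    show "?K \<subseteq> \<iota> ` ?L"
    proof
      fix u assume u: "u \<in> ?K"
      then have uc: "u \<in> {..<Suc n} \<rightarrow>\<^sub>E carrier R" and un: "u n = \<zero>" by (auto simp: a_kernel_eq carrier_free)
      have eq: "\<iota> (restrict u {..<n}) = u"
      proof (rule ext)
        fix x show "\<iota> (restrict u {..<n}) x = u x"
          using un PiE_arb[OF uc, of x] by (cases "x < n"; cases "x = n") (simp_all add: \<iota>_def)
      qed
      have "restrict u {..<n} \<in> carrier ?G"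
        using PiE_mem[OF uc] by (simp add: carrier_free restrict_PiE_iff)
      moreover have "\<iota> (restrict u {..<n}) \<in> ?K" unfolding eq by (rule u)
      ultimately have "restrict u {..<n} \<in> ?L" by (intro CollectI conjI)
      then show "u \<in> \<iota> ` ?L" by (intro image_eqI[where x = "restrict u {..<n}"] eq[symmetric])
    qed
  qed auto
  moreover have "fg_sub R ?F (\<iota> ` ?L)"
    by (intro fg_sub_image[OF G F i] Suc.IH submodule_vimage[OF G F i K])
  ultimately have "fg_sub R ?F ?K" by simp
  then show ?case
    by (intro fg_sub_extension[OF F regular p Suc.prems] fg_ideal submodule_image[OF F regular p Suc.prems])
qed

text \<open>If a is not a unit, an ideal maximal among those that contain a but not 1 is a maximal
  ideal, hence equals \<mm> and puts a into \<mm>.\<close>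

lemma unit_if_notin:
  assumes a: "a \<in> carrier R" "a \<notin> \<mm>"
  shows "a \<in> Units R"
proof (rule ccontr)
  assume nu: "a \<notin> Units R"
  let ?F = "{J. ideal J R \<and> a \<in> J \<and> \<one> \<notin> J}"
  have "\<one> \<notin> PIdl a"
  proof
    assume "\<one> \<in> PIdl a"
    then obtain x where "x \<in> carrier R" "\<one> = x \<otimes> a" by (auto simp: cgenideal_def)
    then show False using nu a m_comm by (auto simp: Units_def)
  qed
  then have ne: "?F \<noteq> {}" using cgenideal_ideal[OF a(1)] cgenideal_self[OF a(1)] by blast
  have sub: "submodule J R (regular_module R)" if "J \<in> ?F" for J using that ideal_iff_submodule[OF cr] by simp
  from max_submodule[OF ne sub] obtain J where J: "J \<in> ?F" and max: "\<forall>K\<in>?F. J \<subseteq> K \<longrightarrow> K = J" by (rule bexE)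
  have "maximalideal J R"
  proof (rule maximalidealI)
    show "carrier R \<noteq> J" using J by auto
    fix K assume K: "ideal K R" "J \<subseteq> K" "K \<subseteq> carrier R"
    show "K = J \<or> K = carrier R"
    proof (cases "\<one> \<in> K")
      case True
      then show ?thesis using ideal.one_imp_carrier[OF K(1)] by simp
    next
      case False
      then show ?thesis using max K J by auto
    qed
  qed (use J in simp)
  then have "J = \<mm>" using local by (simp add: local_ring_def)
  then show False using J a by simp
qed

lemma one_notin: "\<one> \<notin> \<mm>"
  using ideal.one_imp_carrier[OF mm_ideal] maximalideal.I_notcarr[OF maximal] by auto

lemma one_minus_unit: "c \<in> \<mm> \<Longrightarrow> \<one> \<ominus> c \<in> Units R"
proof (rule unit_if_notin)
  assume c: "c \<in> \<mm>"
  show "\<one> \<ominus> c \<in> carrier R" using mm_closed[OF c] by simp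
  show "\<one> \<ominus> c \<notin> \<mm>"
  proof
    assume "\<one> \<ominus> c \<in> \<mm>"
    then have "(\<one> \<ominus> c) \<oplus> c \<in> \<mm>" using submodule_add[OF regular mm_sub] c by simp
    then show False using one_notin mm_closed[OF c] by (simp add: a_minus_def a_assoc l_neg)
  qed
qed

section \<open>Nakayama's lemma\<close>

lemma span_insert_mm:
  assumes M: "Module.module R M" and A: "A \<subseteq> carrier M" and a: "a \<in> carrier M"
  shows "module_span R M (A \<union> {c \<odot>\<^bsub>M\<^esub> a | c. c \<in> \<mm>}) \<subseteq> {x \<oplus>\<^bsub>M\<^esub> c \<odot>\<^bsub>M\<^esub> a | x c. x \<in> module_span R M A \<and> c \<in> \<mm>}"
    (is "_ \<subseteq> ?B")
proof (rule span_least)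
  interpret M: Module.module R M by fact
  note S = span_submodule[OF M A]
  have mz: "\<zero> \<in> \<mm>" using submodule_zero[OF regular mm_sub] by simp
  have ma: "c \<oplus> d \<in> \<mm>" if "c \<in> \<mm>" "d \<in> \<mm>" for c d using submodule_add[OF regular mm_sub] that by simp
  have mm: "r \<otimes> c \<in> \<mm>" if "c \<in> \<mm>" "r \<in> carrier R" for c r using submodule_smult[OF regular mm_sub] that by simp
  note sc = submodule_carrier[OF M S]
  show "submodule ?B R M"
  proof (rule submoduleI'[OF M])
    show "?B \<subseteq> carrier M" using a sc mm_closed by auto
    show "\<zero>\<^bsub>M\<^esub> \<in> ?B" using a submodule_zero[OF M S] mz by (auto intro!: exI[of _ "\<zero>\<^bsub>M\<^esub>"] exI[of _ \<zero>])
    fix x y assume "x \<in> ?B" "y \<in> ?B"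
    then obtain s c t d where x: "x = s \<oplus>\<^bsub>M\<^esub> c \<odot>\<^bsub>M\<^esub> a" "s \<in> module_span R M A" "c \<in> \<mm>"
      and y: "y = t \<oplus>\<^bsub>M\<^esub> d \<odot>\<^bsub>M\<^esub> a" "t \<in> module_span R M A" "d \<in> \<mm>" by blast
    have "x \<oplus>\<^bsub>M\<^esub> y = (s \<oplus>\<^bsub>M\<^esub> t) \<oplus>\<^bsub>M\<^esub> (c \<oplus> d) \<odot>\<^bsub>M\<^esub> a"
      using x y sc[OF x(2)] sc[OF y(2)] mm_closed a by (simp add: M.smult_l_distr M.M.a_ac)
    then show "x \<oplus>\<^bsub>M\<^esub> y \<in> ?B" using submodule_add[OF M S x(2) y(2)] ma[OF x(3) y(3)] by blast
  next
    fix r x assume r: "r \<in> carrier R" and "x \<in> ?B"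
    then obtain s c where x: "x = s \<oplus>\<^bsub>M\<^esub> c \<odot>\<^bsub>M\<^esub> a" "s \<in> module_span R M A" "c \<in> \<mm>" by blast
    have "r \<odot>\<^bsub>M\<^esub> x = r \<odot>\<^bsub>M\<^esub> s \<oplus>\<^bsub>M\<^esub> (r \<otimes> c) \<odot>\<^bsub>M\<^esub> a"
      using x r sc[OF x(2)] mm_closed a by (simp add: M.smult_r_distr M.smult_assoc1)
    then show "r \<odot>\<^bsub>M\<^esub> x \<in> ?B" using submodule_smult[OF M S r x(2)] mm[OF x(3) r] by blast
  qed
  show "A \<union> {c \<odot>\<^bsub>M\<^esub> a | c. c \<in> \<mm>} \<subseteq> ?B"
  proof
    fix x assume "x \<in> A \<union> {c \<odot>\<^bsub>M\<^esub> a | c. c \<in> \<mm>}"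
    then show "x \<in> ?B"
    proof
      assume x: "x \<in> A"
      then have "x = x \<oplus>\<^bsub>M\<^esub> \<zero> \<odot>\<^bsub>M\<^esub> a" using A a by auto
      then show ?thesis using x span_incl[of A R M] mz by blast
    next
      assume "x \<in> {c \<odot>\<^bsub>M\<^esub> a | c. c \<in> \<mm>}"
      then obtain c where c: "x = c \<odot>\<^bsub>M\<^esub> a" "c \<in> \<mm>" by blast
      then have "x = \<zero>\<^bsub>M\<^esub> \<oplus>\<^bsub>M\<^esub> c \<odot>\<^bsub>M\<^esub> a" using a mm_closed by simp
      then show ?thesis using submodule_zero[OF M S] c by blast
    qed
  qed
qed

text \<open>Generators are eliminated one at a time: from a = x + c a with c in \<mm>, invertibility
  of 1 - c puts a into the span of the others. The form relative to a submodule \<open>L\<close> and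
  a finite set \<open>S\<close> is what makes the induction work.\<close>

lemma nakayama:
  assumes M: "Module.module R M" and L: "submodule L R M"
    and "finite S" and "S \<subseteq> carrier M"
    and "S \<subseteq> module_span R M (L \<union> {c \<odot>\<^bsub>M\<^esub> s | c s. c \<in> \<mm> \<and> s \<in> S})"
  shows "S \<subseteq> L"
  using assms(3-5)
proof (induction S)
  case (insert a S)
  interpret M: Module.module R M by fact
  let ?A = "L \<union> {c \<odot>\<^bsub>M\<^esub> s | c s. c \<in> \<mm> \<and> s \<in> S}"
  have a: "a \<in> carrier M" and S: "S \<subseteq> carrier M" using insert by auto
  have A: "?A \<subseteq> carrier M" using S mm_closed submodule_carrier[OF M L] by auto
  have eq: "L \<union> {c \<odot>\<^bsub>M\<^esub> s | c s. c \<in> \<mm> \<and> s \<in> insert a S} = ?A \<union> {c \<odot>\<^bsub>M\<^esub> a | c. c \<in> \<mm>}" by blast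
  have "a \<in> module_span R M (?A \<union> {c \<odot>\<^bsub>M\<^esub> a | c. c \<in> \<mm>})" using insert.prems(2) unfolding eq by blast
  then obtain x c where x: "x \<in> module_span R M ?A" "c \<in> \<mm>" "a = x \<oplus>\<^bsub>M\<^esub> c \<odot>\<^bsub>M\<^esub> a"
    using span_insert_mm[OF M A a] by blast
  have xc: "x \<in> carrier M" by (rule submodule_carrier[OF M span_submodule[OF M A] x(1)])
  have cc: "c \<in> carrier R" by (rule mm_closed[OF x(2)])
  have u: "\<one> \<ominus> c \<in> Units R" by (rule one_minus_unit[OF x(2)])
  have "(\<one> \<ominus> c) \<odot>\<^bsub>M\<^esub> a = a \<oplus>\<^bsub>M\<^esub> \<ominus>\<^bsub>M\<^esub> (c \<odot>\<^bsub>M\<^esub> a)"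
    using a cc by (simp add: a_minus_def M.smult_l_distr M.smult_l_minus)
  also have "\<dots> = (x \<oplus>\<^bsub>M\<^esub> c \<odot>\<^bsub>M\<^esub> a) \<oplus>\<^bsub>M\<^esub> \<ominus>\<^bsub>M\<^esub> (c \<odot>\<^bsub>M\<^esub> a)" using x(3) by simp
  also have "\<dots> = x" using xc a cc by (simp add: M.M.a_assoc M.M.r_neg)
  finally have e: "(\<one> \<ominus> c) \<odot>\<^bsub>M\<^esub> a = x" .
  have "inv (\<one> \<ominus> c) \<odot>\<^bsub>M\<^esub> ((\<one> \<ominus> c) \<odot>\<^bsub>M\<^esub> a) = (inv (\<one> \<ominus> c) \<otimes> (\<one> \<ominus> c)) \<odot>\<^bsub>M\<^esub> a"
    by (rule M.smult_assoc1[symmetric]) (use u a cc in auto)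
  then have "a = inv (\<one> \<ominus> c) \<odot>\<^bsub>M\<^esub> x" using u a e by simp
  moreover have "inv (\<one> \<ominus> c) \<odot>\<^bsub>M\<^esub> x \<in> module_span R M ?A"
    by (rule submodule_smult[OF M span_submodule[OF M A] Units_inv_closed[OF u] x(1)])
  ultimately have aA: "a \<in> module_span R M ?A" by simp
  have "module_span R M (?A \<union> {c \<odot>\<^bsub>M\<^esub> a | c. c \<in> \<mm>}) \<subseteq> module_span R M ?A"
    using span_incl[of ?A R M] aA mm_closed
    by (intro span_least span_submodule[OF M A]) (auto intro: submodule_smult[OF M span_submodule[OF M A]])
  then have "S \<subseteq> module_span R M ?A" using insert.prems(2) unfolding eq by blast
  then have SL: "S \<subseteq> L" using insert.IH S by blast
  then have "?A \<subseteq> L" using mm_closed by (auto intro: submodule_smult[OF M L])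
  then have "a \<in> L" using aA span_least[OF L] by blast
  then show ?case using SL by blast
qed simp

section \<open>Minimal covers and minimal resolutions\<close>

text \<open>Take the least possible number of generators. A relation with a coefficient outside
  \<mm> has a unit coefficient, and the corresponding generator could be dropped.\<close>

lemma minimal_generators:
  assumes M: "Module.module R M" and H: "fg_sub R M H"
  shows "\<exists>b f. f \<in> module_hom R (free_module R {..<b::nat}) M \<and> f ` carrier (free_module R {..<b}) = H \<and>
    (\<forall>u\<in>carrier (free_module R {..<b}). f u = \<zero>\<^bsub>M\<^esub> \<longrightarrow> (\<forall>i<b. u i \<in> \<mm>))"
proof -
  interpret M: Module.module R M by fact
  let ?P = "\<lambda>b x. x \<in> {..<b::nat} \<rightarrow> carrier M \<and> module_span R M (x ` {..<b}) = H"
  obtain S where S: "finite S" "S \<subseteq> carrier M" "module_span R M S = H" using H by (auto simp: fg_sub_def)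
  obtain g where g: "g ` {..<card S} = S"
    using ex_bij_betw_nat_finite[OF S(1)] by (metis bij_betw_imp_surj_on atLeast0LessThan)
  have "?P (card S) g" using g S by auto
  then have ex: "\<exists>b x. ?P b x" by blast
  define b where "b = (LEAST b. \<exists>x. ?P b x)"
  obtain x where x: "x \<in> {..<b} \<rightarrow> carrier M" "module_span R M (x ` {..<b}) = H"
    using LeastI_ex[OF ex] unfolding b_def by blast
  have min: "b \<le> k" if "?P k y" for k y unfolding b_def using that by (intro Least_le) blast
  let ?f = "comb M {..<b} x"
  have hom: "?f \<in> module_hom R (free_module R {..<b}) M" using x by (intro comb_hom[OF M]) auto
  have im: "?f ` carrier (free_module R {..<b}) = H" using span_comb[OF M _ x(1)] x(2) by simp
  have "u i \<in> \<mm>" if u: "u \<in> carrier (free_module R {..<b})" "?f u = \<zero>\<^bsub>M\<^esub>" and i: "i < b" for u i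
  proof (rule ccontr)
    assume "u i \<notin> \<mm>"
    have uc: "u j \<in> carrier R" if "j < b" for j using free_mem[OF _ u(1), of j] that by simp
    then have ui: "u i \<in> Units R" using \<open>u i \<notin> \<mm>\<close> i unit_if_notin by blast
    let ?X = "{..<b} - {i}"
    have X: "{..<b} = insert i ?X" using i by auto
    have xX: "x \<in> ?X \<rightarrow> carrier M" and xi: "x i \<in> carrier M" using x(1) i by auto
    have cX: "(\<Oplus>\<^bsub>M\<^esub>j\<in>?X. u j \<odot>\<^bsub>M\<^esub> x j) \<in> carrier M" using xX uc by (intro M.M.finsum_closed) auto
    note Sp = span_submodule[OF M, of "x ` ?X"]
    have xs: "x ` ?X \<subseteq> carrier M" using xX by auto
    have "(\<Oplus>\<^bsub>M\<^esub>j\<in>?X. u j \<odot>\<^bsub>M\<^esub> x j) \<in> module_span R M (x ` ?X)"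
      using span_incl[of "x ` ?X" R M] uc
      by (intro submodule_finsum[OF M Sp[OF xs]] Pi_I submodule_smult[OF M Sp[OF xs]]) auto
    moreover have "u i \<odot>\<^bsub>M\<^esub> x i \<oplus>\<^bsub>M\<^esub> (\<Oplus>\<^bsub>M\<^esub>j\<in>?X. u j \<odot>\<^bsub>M\<^esub> x j) = \<zero>\<^bsub>M\<^esub>"
    proof -
      have "(\<Oplus>\<^bsub>M\<^esub>j\<in>insert i ?X. u j \<odot>\<^bsub>M\<^esub> x j) = u i \<odot>\<^bsub>M\<^esub> x i \<oplus>\<^bsub>M\<^esub> (\<Oplus>\<^bsub>M\<^esub>j\<in>?X. u j \<odot>\<^bsub>M\<^esub> x j)"
        using xX xi uc i by (intro M.M.finsum_insert) auto
      then show ?thesis using u(2) unfolding comb_def X[symmetric] by simp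
    qed
    then have "u i \<odot>\<^bsub>M\<^esub> x i = \<ominus>\<^bsub>M\<^esub> (\<Oplus>\<^bsub>M\<^esub>j\<in>?X. u j \<odot>\<^bsub>M\<^esub> x j)"
      using cX xi uc i by (metis M.M.minus_equality M.smult_closed)
    ultimately have "u i \<odot>\<^bsub>M\<^esub> x i \<in> module_span R M (x ` ?X)" using submodule_neg[OF M Sp[OF xs]] by simp
    then have "inv (u i) \<odot>\<^bsub>M\<^esub> (u i \<odot>\<^bsub>M\<^esub> x i) \<in> module_span R M (x ` ?X)"
      by (rule submodule_smult[OF M Sp[OF xs] Units_inv_closed[OF ui]])
    moreover have "inv (u i) \<odot>\<^bsub>M\<^esub> (u i \<odot>\<^bsub>M\<^esub> x i) = (inv (u i) \<otimes> u i) \<odot>\<^bsub>M\<^esub> x i"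
      by (rule M.smult_assoc1[symmetric]) (use ui xi uc i in auto)
    ultimately have xiX: "x i \<in> module_span R M (x ` ?X)" using ui xi by simp
    have "module_span R M (x ` {..<b}) \<subseteq> module_span R M (x ` ?X)"
      using xiX span_incl[of "x ` ?X" R M] by (intro span_least Sp[OF xs]) (subst X, auto)
    then have sp: "module_span R M (x ` ?X) = H" using x(2) span_mono[of "x ` ?X" "x ` {..<b}"] by blast
    obtain h where h: "bij_betw h {..<b - 1} ?X"
      using ex_bij_betw_nat_finite[of ?X] i by (auto simp: atLeast0LessThan)
    have "(\<lambda>k. x (h k)) ` {..<b - 1} = x ` ?X" using h unfolding bij_betw_def by (metis image_image)
    moreover have "(\<lambda>k. x (h k)) \<in> {..<b - 1} \<rightarrow> carrier M" using h xX by (auto simp: bij_betw_def)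
    ultimately have "b \<le> b - 1" using sp by (intro min[where y = "\<lambda>k. x (h k)"]) simp
    then show False using i by simp
  qed
  then show ?thesis using hom im by (intro exI[of _ b] exI[of _ ?f]) auto
qed

lemma ideal_smult_free:
  assumes J: "ideal J R"
  shows "ideal_smult R J (free_module R {..<n::nat}) = {u \<in> carrier (free_module R {..<n}). \<forall>i<n. u i \<in> J}"
    (is "_ = ?B")
proof
  let ?F = "free_module R {..<n}"
  have F: "Module.module R ?F" by (rule free) simp
  interpret F: Module.module R ?F by fact
  have Js: "submodule J R (regular_module R)" using J ideal_iff_submodule[OF cr] by simp
  have B: "submodule ?B R ?F"
  proof (rule submoduleI'[OF F])
    show "\<zero>\<^bsub>?F\<^esub> \<in> ?B" using F.M.zero_closed submodule_zero[OF regular Js] by (simp add: free_simps)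
    show "x \<oplus>\<^bsub>?F\<^esub> y \<in> ?B" if "x \<in> ?B" "y \<in> ?B" for x y
      using that F.M.a_closed[of x y] submodule_add[OF regular Js] by (simp add: free_simps)
    show "a \<odot>\<^bsub>?F\<^esub> x \<in> ?B" if "a \<in> carrier R" "x \<in> ?B" for a x
      using that F.smult_closed[of a x] submodule_smult[OF regular Js] by (simp add: free_simps)
  qed auto
  show "ideal_smult R J ?F \<subseteq> ?B" unfolding ideal_smult_def
  proof (rule span_least[OF B], safe)
    fix a x assume a: "a \<in> J" and x: "x \<in> carrier ?F"
    have ac: "a \<in> carrier R" using submodule_carrier[OF regular Js a] by simp
    then show "a \<odot>\<^bsub>?F\<^esub> x \<in> carrier ?F" using x by simp
    show "(a \<odot>\<^bsub>?F\<^esub> x) i \<in> J" if "i < n" for i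
      using that a ideal.I_r_closed[OF J a] free_mem[OF _ x, of i] by (simp add: free_simps)
  qed
  show "?B \<subseteq> ideal_smult R J ?F"
  proof
    fix u assume u: "u \<in> ?B"
    let ?G = "{a \<odot>\<^bsub>?F\<^esub> x | a x. a \<in> J \<and> x \<in> carrier ?F}"
    have G: "?G \<subseteq> carrier ?F" using submodule_carrier[OF regular Js] by auto
    have "u = comb ?F {..<n} (free_gen R {..<n}) u"
      by (rule free_expand[OF cr, symmetric]) (use u in auto)
    also have "\<dots> \<in> module_span R ?F ?G" unfolding comb_def
    proof (rule submodule_finsum[OF F span_submodule[OF F G]], rule Pi_I)
      fix i assume "i \<in> {..<n}"
      then have "u i \<odot>\<^bsub>?F\<^esub> free_gen R {..<n} i \<in> ?G" using u free_gen_closed[OF cr, of "{..<n}" i] by auto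
      then show "u i \<odot>\<^bsub>?F\<^esub> free_gen R {..<n} i \<in> module_span R ?F ?G" by (rule subsetD[OF span_incl])
    qed
    finally show "u \<in> ideal_smult R J ?F" by (simp add: ideal_smult_def)
  qed
qed

lemma minimal_resolution_exists:
  assumes M: "Module.module R M" and fg: "finitely_generated R M"
  shows "\<exists>F. minimal_free_resolution R \<mm> M F"
proof -
  let ?F = "\<lambda>n. free_module R {..<n::nat}"
  have modF: "Module.module R (?F n)" for n by (rule free) simp
  let ?m = "\<lambda>n. {u \<in> carrier (?F n). \<forall>i<n. u i \<in> \<mm>}"
  have fgM: "fg_sub R M (carrier M)" using fg by (auto simp: fg_sub_def finitely_generated_def)
  obtain b0 f0 where f00: "f0 \<in> module_hom R (?F b0) M \<and> f0 ` carrier (?F b0) = carrier M \<and>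
      (\<forall>u\<in>carrier (?F b0). f0 u = \<zero>\<^bsub>M\<^esub> \<longrightarrow> (\<forall>i<b0. u i \<in> \<mm>))"
    using minimal_generators[OF M fgM] by (elim exE)
  then have f0: "f0 \<in> module_hom R (?F b0) M" "f0 ` carrier (?F b0) = carrier M" by simp_all
  have k0: "a_kernel (?F b0) M f0 \<subseteq> ?m b0" using f00 unfolding a_kernel_eq by auto
  \<comment> \<open>The recursion runs through pairs of a rank and the kernel found inside the free
    module of that rank. Minimality is the invariant that the kernel has all its coordinates in
    \<mm>; the next term is a minimal cover of the kernel.\<close>
  let ?P = "\<lambda>i (n, K). submodule K R (?F n) \<and> K \<subseteq> ?m n \<and> (i = 0 \<longrightarrow> n = b0 \<and> K = a_kernel (?F b0) M f0)"
  let ?Q = "\<lambda>i (n, K) (n', K'). \<exists>f. f \<in> module_hom R (?F n') (?F n) \<and> f ` carrier (?F n') = K \<and> K' = a_kernel (?F n') (?F n) f"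
  have "\<exists>g. \<forall>i. ?P i (g i) \<and> ?Q i (g i) (g (Suc i))"
  proof (rule dependent_nat_choice)
    show "\<exists>x. ?P 0 x" using k0 submodule_kernel[OF modF M f0(1)]
      by (intro exI[of _ "(b0, a_kernel (?F b0) M f0)"]) simp
  next
    fix x and i :: nat assume P: "?P i x"
    obtain n K where x: "x = (n, K)" by force
    have fgK: "fg_sub R (?F n) K" using P x by (intro fg_free) auto
    obtain n' f where ff: "f \<in> module_hom R (?F n') (?F n) \<and> f ` carrier (?F n') = K \<and>
        (\<forall>u\<in>carrier (?F n'). f u = \<zero>\<^bsub>?F n\<^esub> \<longrightarrow> (\<forall>i<n'. u i \<in> \<mm>))"
      using minimal_generators[OF modF fgK] by (elim exE)
    then have f: "f \<in> module_hom R (?F n') (?F n)" "f ` carrier (?F n') = K" by simp_all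
    have k: "a_kernel (?F n') (?F n) f \<subseteq> ?m n'" using ff unfolding a_kernel_eq by auto
    show "\<exists>y. ?P (Suc i) y \<and> ?Q i x y"
      using submodule_kernel[OF modF modF f(1)] x f k
      by (intro exI[of _ "(n', a_kernel (?F n') (?F n) f)"]) auto
  qed
  then obtain g where gg: "\<forall>i. ?P i (g i) \<and> ?Q i (g i) (g (Suc i))" by (rule exE)
  define r where "r i = fst (g i)" for i
  define K where "K i = snd (g i)" for i
  have g: "g i = (r i, K i)" for i by (simp add: r_def K_def)
  have K0: "r 0 = b0" "K 0 = a_kernel (?F b0) M f0" using gg[rule_format, of 0] by (simp_all add: g)
  have Km: "K i \<subseteq> ?m (r i)" for i using gg[rule_format, of i] by (simp add: g)
  have "\<exists>f. f \<in> module_hom R (?F (r (Suc i))) (?F (r i)) \<and> f ` carrier (?F (r (Suc i))) = K i \<and>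
      K (Suc i) = a_kernel (?F (r (Suc i))) (?F (r i)) f" for i
    using gg[rule_format, of i] by (simp add: g)
  then obtain f where f: "\<And>i. f i \<in> module_hom R (?F (r (Suc i))) (?F (r i))"
    "\<And>i. f i ` carrier (?F (r (Suc i))) = K i" "\<And>i. K (Suc i) = a_kernel (?F (r (Suc i))) (?F (r i)) (f i)"
    by metis
  define F where "F = \<lparr>rk = r, dif = f, aug = f0\<rparr>"
  have ker: "res_kernel R M F i = K i" for i
    by (cases i) (simp_all add: res_kernel_def F_def K0 f(3))
  have "minimal_free_resolution R \<mm> M F"
    unfolding minimal_free_resolution_def free_resolution_def ker ideal_smult_free[OF mm_ideal]
    using f Km f0 K0 by (simp add: F_def)
  then show ?thesis by blast
qed

lemma min_res:
  assumes "Module.module R M" and "finitely_generated R M"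
  shows "minimal_free_resolution R \<mm> M (min_res R \<mm> M)"
  unfolding min_res_def by (rule someI_ex[OF minimal_resolution_exists[OF assms]])

end

section \<open>Quotient modules\<close>

lemma quot_module_carrier: "carrier (quot_module M H) = {H +>\<^bsub>M\<^esub> x | x. x \<in> carrier M}"
  by (auto simp: quot_module_def A_RCOSETS_def' )

lemma quot_module_simps:
  "\<zero>\<^bsub>quot_module M H\<^esub> = H"
  "X \<oplus>\<^bsub>quot_module M H\<^esub> Y = X <+>\<^bsub>M\<^esub> Y"
  "a \<odot>\<^bsub>quot_module M H\<^esub> X = (\<Union>x\<in>X. H +>\<^bsub>M\<^esub> (a \<odot>\<^bsub>M\<^esub> x))"
  by (simp_all add: quot_module_def)

context
  fixes R :: "('a, 'r) ring_scheme" and M :: "('a, 'b, 'k) module_scheme" and H :: "'b set"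
  assumes M: "Module.module R M" and H: "submodule H R M"
begin

lemma coset_subgroup: "additive_subgroup H M"
  using H by (simp add: additive_subgroup_def submodule_def)

lemma coset_abelian_subgroup: "abelian_subgroup H M"
proof -
  interpret M: Module.module R M by (rule M)
  show ?thesis by (rule abelian_subgroupI3[OF coset_subgroup M.M.abelian_group_axioms])
qed

lemma mem_coset_self: "x \<in> carrier M \<Longrightarrow> x \<in> H +>\<^bsub>M\<^esub> x"
  by (rule abelian_subgroup.a_rcos_self[OF coset_abelian_subgroup])

lemma coset_mem: "x \<in> carrier M \<Longrightarrow> y \<in> H +>\<^bsub>M\<^esub> x \<longleftrightarrow> (\<exists>h\<in>H. y = h \<oplus>\<^bsub>M\<^esub> x)"
  by (auto simp: a_r_coset_def')

lemma coset_eq_iff: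
  assumes "x \<in> carrier M" and "y \<in> carrier M"
  shows "H +>\<^bsub>M\<^esub> x = H +>\<^bsub>M\<^esub> y \<longleftrightarrow> x \<ominus>\<^bsub>M\<^esub> y \<in> H"
proof -
  interpret M: Module.module R M by (rule M)
  interpret A: abelian_subgroup H M by (rule coset_abelian_subgroup)
  show ?thesis
  proof
    assume "H +>\<^bsub>M\<^esub> x = H +>\<^bsub>M\<^esub> y"
    then obtain h where h: "h \<in> H" "x = h \<oplus>\<^bsub>M\<^esub> y" using mem_coset_self[OF assms(1)] coset_mem[OF assms(2)] by auto
    then show "x \<ominus>\<^bsub>M\<^esub> y \<in> H"
      using assms submodule_carrier[OF M H h(1)] by (simp add: a_minus_def M.M.a_assoc M.M.r_neg)
  next
    assume h: "x \<ominus>\<^bsub>M\<^esub> y \<in> H"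
    have "x = (x \<ominus>\<^bsub>M\<^esub> y) \<oplus>\<^bsub>M\<^esub> y" using assms by (simp add: a_minus_def M.M.a_assoc M.M.l_neg)
    then have "x \<in> H +>\<^bsub>M\<^esub> y" using h coset_mem[OF assms(2)] by blast
    then show "H +>\<^bsub>M\<^esub> x = H +>\<^bsub>M\<^esub> y" using A.a_repr_independence'[OF _ assms(2)] by simp
  qed
qed

lemma coset_add:
  assumes "x \<in> carrier M" and "y \<in> carrier M"
  shows "(H +>\<^bsub>M\<^esub> x) <+>\<^bsub>M\<^esub> (H +>\<^bsub>M\<^esub> y) = H +>\<^bsub>M\<^esub> (x \<oplus>\<^bsub>M\<^esub> y)"
  by (rule abelian_subgroup.a_rcos_sum[OF coset_abelian_subgroup assms])

lemma coset_smult: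
  assumes a: "a \<in> carrier R" and x: "x \<in> carrier M"
  shows "(\<Union>y\<in>H +>\<^bsub>M\<^esub> x. H +>\<^bsub>M\<^esub> (a \<odot>\<^bsub>M\<^esub> y)) = H +>\<^bsub>M\<^esub> (a \<odot>\<^bsub>M\<^esub> x)"
proof -
  interpret M: Module.module R M by (rule M)
  have "H +>\<^bsub>M\<^esub> (a \<odot>\<^bsub>M\<^esub> y) = H +>\<^bsub>M\<^esub> (a \<odot>\<^bsub>M\<^esub> x)" if y: "y \<in> H +>\<^bsub>M\<^esub> x" for y
  proof -
    obtain h where h: "h \<in> H" "y = h \<oplus>\<^bsub>M\<^esub> x" using y coset_mem[OF x] by blast
    have hc: "h \<in> carrier M" by (rule submodule_carrier[OF M H h(1)])
    have "a \<odot>\<^bsub>M\<^esub> y \<ominus>\<^bsub>M\<^esub> a \<odot>\<^bsub>M\<^esub> x = a \<odot>\<^bsub>M\<^esub> h"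
      using h hc a x by (simp add: M.smult_r_distr a_minus_def M.M.a_assoc M.M.r_neg)
    then show ?thesis using coset_eq_iff[of "a \<odot>\<^bsub>M\<^esub> y" "a \<odot>\<^bsub>M\<^esub> x"] submodule_smult[OF M H a h(1)] h hc a x by simp
  qed
  then show ?thesis using mem_coset_self[OF x] by blast
qed

lemma module_quot: "Module.module R (quot_module M H)"
proof -
  interpret M: Module.module R M by (rule M)
  let ?c = "\<lambda>x. H +>\<^bsub>M\<^esub> x"
  let ?Q = "quot_module M H"
  have z: "\<zero>\<^bsub>?Q\<^esub> = ?c \<zero>\<^bsub>M\<^esub>"
    using coset_subgroup by (simp add: quot_module_simps M.M.a_coset_add_zero submodule_carrier[OF M H] subsetI)
  have a: "?c x \<oplus>\<^bsub>?Q\<^esub> ?c y = ?c (x \<oplus>\<^bsub>M\<^esub> y)" if "x \<in> carrier M" "y \<in> carrier M" for x y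
    using coset_add[OF that] by (simp add: quot_module_simps)
  have s: "r \<odot>\<^bsub>?Q\<^esub> ?c x = ?c (r \<odot>\<^bsub>M\<^esub> x)" if "r \<in> carrier R" "x \<in> carrier M" for r x
    using coset_smult[OF that] by (simp add: quot_module_simps)
  have c: "X \<in> carrier ?Q \<longleftrightarrow> (\<exists>x\<in>carrier M. X = ?c x)" for X by (auto simp: quot_module_carrier)
  have cc: "?c x \<in> carrier ?Q" if "x \<in> carrier M" for x using that c by blast
  show ?thesis
  proof (intro moduleI abelian_groupI M.R.cring_axioms)
    fix X assume "X \<in> carrier ?Q"
    then obtain x where x: "x \<in> carrier M" "X = ?c x" using c by blast
    show "\<zero>\<^bsub>?Q\<^esub> \<oplus>\<^bsub>?Q\<^esub> X = X" using x by (simp add: z a)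
    show "\<exists>Y\<in>carrier ?Q. Y \<oplus>\<^bsub>?Q\<^esub> X = \<zero>\<^bsub>?Q\<^esub>"
      using x by (intro bexI[of _ "?c (\<ominus>\<^bsub>M\<^esub> x)"] cc) (simp_all add: z a M.M.l_neg)
    show "\<one>\<^bsub>R\<^esub> \<odot>\<^bsub>?Q\<^esub> X = X" using x by (simp add: s)
    fix r assume r: "r \<in> carrier R"
    show "r \<odot>\<^bsub>?Q\<^esub> X \<in> carrier ?Q" using x r by (simp add: s cc)
    show "(r \<oplus>\<^bsub>R\<^esub> t) \<odot>\<^bsub>?Q\<^esub> X = r \<odot>\<^bsub>?Q\<^esub> X \<oplus>\<^bsub>?Q\<^esub> t \<odot>\<^bsub>?Q\<^esub> X" if "t \<in> carrier R" for t
      using x r that by (simp add: s a M.smult_l_distr)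
    show "(r \<otimes>\<^bsub>R\<^esub> t) \<odot>\<^bsub>?Q\<^esub> X = r \<odot>\<^bsub>?Q\<^esub> (t \<odot>\<^bsub>?Q\<^esub> X)" if "t \<in> carrier R" for t
      using x r that by (simp add: s M.smult_assoc1)
    fix Y assume "Y \<in> carrier ?Q"
    then obtain y where y: "y \<in> carrier M" "Y = ?c y" using c by blast
    show "r \<odot>\<^bsub>?Q\<^esub> (X \<oplus>\<^bsub>?Q\<^esub> Y) = r \<odot>\<^bsub>?Q\<^esub> X \<oplus>\<^bsub>?Q\<^esub> r \<odot>\<^bsub>?Q\<^esub> Y"
      using x y r by (simp add: s a M.smult_r_distr)
  next
    fix X Y assume "X \<in> carrier ?Q" "Y \<in> carrier ?Q"
    then obtain x y where x: "x \<in> carrier M" "X = ?c x" and y: "y \<in> carrier M" "Y = ?c y" unfolding c by (elim bexE)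
    show "X \<oplus>\<^bsub>?Q\<^esub> Y \<in> carrier ?Q" using x y by (simp add: a cc)
    show "X \<oplus>\<^bsub>?Q\<^esub> Y = Y \<oplus>\<^bsub>?Q\<^esub> X" using x y by (simp add: a M.M.a_comm)
    fix Z assume "Z \<in> carrier ?Q"
    then obtain w where w: "w \<in> carrier M" "Z = ?c w" using c by blast
    show "X \<oplus>\<^bsub>?Q\<^esub> Y \<oplus>\<^bsub>?Q\<^esub> Z = X \<oplus>\<^bsub>?Q\<^esub> (Y \<oplus>\<^bsub>?Q\<^esub> Z)" using x y w by (simp add: a M.M.a_assoc)
  next
    show "\<zero>\<^bsub>?Q\<^esub> \<in> carrier ?Q" by (simp add: z cc)
  qed
qed

lemma quot_proj_hom: "(\<lambda>x. H +>\<^bsub>M\<^esub> x) \<in> module_hom R M (quot_module M H)"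
  by (intro module_homI) (auto simp: quot_module_carrier quot_module_simps coset_add coset_smult)

lemma quot_proj_eq_zero:
  assumes "x \<in> carrier M"
  shows "H +>\<^bsub>M\<^esub> x = \<zero>\<^bsub>quot_module M H\<^esub> \<longleftrightarrow> x \<in> H"
proof -
  interpret M: Module.module R M by (rule M)
  have "\<zero>\<^bsub>quot_module M H\<^esub> = H +>\<^bsub>M\<^esub> \<zero>\<^bsub>M\<^esub>"
    using module_hom_zero[OF M module_quot quot_proj_hom] by simp
  moreover have "x \<ominus>\<^bsub>M\<^esub> \<zero>\<^bsub>M\<^esub> = x" using assms M.M.minus_equality[of "\<zero>\<^bsub>M\<^esub>" "\<zero>\<^bsub>M\<^esub>"] by (simp add: a_minus_def)
  ultimately show ?thesis using coset_eq_iff[OF assms M.M.zero_closed] by simp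
qed

text \<open>A representative of each coset is chosen; two representatives differ by an element of H,
  which \<open>f\<close> kills, so the value does not depend on the choice.\<close>

lemma quot_lift:
  assumes N: "Module.module R N" and f: "f \<in> module_hom R M N" and ker: "\<And>h. h \<in> H \<Longrightarrow> f h = \<zero>\<^bsub>N\<^esub>"
  shows "\<exists>g\<in>module_hom R (quot_module M H) N. \<forall>x\<in>carrier M. g (H +>\<^bsub>M\<^esub> x) = f x"
proof -
  interpret M: Module.module R M by (rule M)
  interpret N: Module.module R N by (rule N)
  let ?Q = "quot_module M H"
  define g where "g X = f (SOME x. x \<in> carrier M \<and> X = H +>\<^bsub>M\<^esub> x)" for X
  have g: "g (H +>\<^bsub>M\<^esub> x) = f x" if x: "x \<in> carrier M" for x
  proof -
    define y where "y = (SOME y. y \<in> carrier M \<and> H +>\<^bsub>M\<^esub> x = H +>\<^bsub>M\<^esub> y)"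
    have y: "y \<in> carrier M \<and> H +>\<^bsub>M\<^esub> x = H +>\<^bsub>M\<^esub> y"
      unfolding y_def by (rule someI[of _ x]) (use x in simp)
    then have "x \<ominus>\<^bsub>M\<^esub> y \<in> H" using coset_eq_iff[OF x, of y] by blast
    then have "f x \<ominus>\<^bsub>N\<^esub> f y = \<zero>\<^bsub>N\<^esub>" using ker[of "x \<ominus>\<^bsub>M\<^esub> y"] module_hom_minus[OF M N f x, of y] y by simp
    then have "f x = f y" using module_hom_closed[OF f] x y by (simp add: N.M.diff_eq_zero_iff)
    then show ?thesis by (simp add: g_def y_def)
  qed
  have c: "X \<in> carrier ?Q \<longleftrightarrow> (\<exists>x\<in>carrier M. X = H +>\<^bsub>M\<^esub> x)" for X by (auto simp: quot_module_carrier)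
  have "g \<in> module_hom R ?Q N"
  proof (rule module_homI)
    fix X assume "X \<in> carrier ?Q"
    then obtain x where x: "x \<in> carrier M" "X = H +>\<^bsub>M\<^esub> x" using c by blast
    show "g X \<in> carrier N" using x g module_hom_closed[OF f] by simp
    show "g (a \<odot>\<^bsub>?Q\<^esub> X) = a \<odot>\<^bsub>N\<^esub> g X" if "a \<in> carrier R" for a
      using x that by (simp add: g quot_module_simps coset_smult module_hom_smult[OF f])
    fix Y assume "Y \<in> carrier ?Q"
    then obtain y where y: "y \<in> carrier M" "Y = H +>\<^bsub>M\<^esub> y" using c by blast
    show "g (X \<oplus>\<^bsub>?Q\<^esub> Y) = g X \<oplus>\<^bsub>N\<^esub> g Y"
      using x y by (simp add: g quot_module_simps coset_add module_hom_add[OF f])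
  qed
  then show ?thesis using g by blast
qed

end

section \<open>Tensor products\<close>

text \<open>Tensor products are quotients of a free module on all pairs of elements, so infinite
  \<open>X\<close> must be allowed; the functions of finite support form a submodule of the full
  power.\<close>

lemma module_free_module:
  assumes R: "cring R"
  shows "Module.module R (free_module R X)"
proof -
  interpret cring R by fact
  let ?P = "pow_module X (regular_module R)"
  let ?H = "{u \<in> X \<rightarrow>\<^sub>E carrier R. finite {x \<in> X. u x \<noteq> \<zero>\<^bsub>R\<^esub>}}"
  have P: "Module.module R ?P" by (rule module_dprod[OF R module_regular[OF R]])
  interpret P: Module.module R ?P by (rule P)
  have "submodule ?H R ?P"
  proof (rule submoduleI'[OF P])
    show "?H \<subseteq> carrier ?P" by (auto simp: dprod_simps)
    show "\<zero>\<^bsub>?P\<^esub> \<in> ?H" by (auto simp: dprod_simps)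
    show "u \<oplus>\<^bsub>?P\<^esub> v \<in> ?H" if "u \<in> ?H" "v \<in> ?H" for u v
    proof -
      have "finite ({x \<in> X. u x \<noteq> \<zero>\<^bsub>R\<^esub>} \<union> {x \<in> X. v x \<noteq> \<zero>\<^bsub>R\<^esub>})" using that by simp
      then have "finite {x \<in> X. (u \<oplus>\<^bsub>?P\<^esub> v) x \<noteq> \<zero>\<^bsub>R\<^esub>}"
        by (rule rev_finite_subset) (auto simp: dprod_simps)
      then show ?thesis using that by (auto simp: dprod_simps PiE_def Pi_def)
    qed
    show "a \<odot>\<^bsub>?P\<^esub> u \<in> ?H" if a: "a \<in> carrier R" and u: "u \<in> ?H" for a u
    proof -
      have "finite {x \<in> X. u x \<noteq> \<zero>\<^bsub>R\<^esub>}" using u by simp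
      then have "finite {x \<in> X. (a \<odot>\<^bsub>?P\<^esub> u) x \<noteq> \<zero>\<^bsub>R\<^esub>}"
        by (rule rev_finite_subset) (use a in \<open>auto simp: dprod_simps\<close>)
      then show ?thesis using a u by (auto simp: dprod_simps PiE_def Pi_def)
    qed
  qed
  then have "Module.module R (?P\<lparr>carrier := ?H\<rparr>)"
    by (rule submodule.submodule_is_module) (rule P)
  then show ?thesis by (simp add: dprod_def free_module_def)
qed

lemma free_gen_in:
  assumes "cring R" and "x \<in> X" shows "free_gen R X x \<in> carrier (free_module R X)"
proof -
  interpret cring R by fact
  have "finite {y \<in> X. free_gen R X x y \<noteq> \<zero>\<^bsub>R\<^esub>}"
    by (rule finite_subset[of _ "{x}"]) (auto simp: free_gen_def)
  then show ?thesis by (auto simp: free_module_def free_gen_def)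
qed

text \<open>An induction principle, proved by removing one point of the support at a time.\<close>

lemma free_module_least:
  assumes R: "cring R" and H: "submodule H R (free_module R X)" and g: "\<And>x. x \<in> X \<Longrightarrow> free_gen R X x \<in> H"
    and u: "u \<in> carrier (free_module R X)"
  shows "u \<in> H"
proof -
  interpret cring R by fact
  note F = module_free_module[OF R, of X]
  have "finite A \<Longrightarrow> A \<subseteq> X \<Longrightarrow> u \<in> X \<rightarrow>\<^sub>E carrier R \<Longrightarrow> {x \<in> X. u x \<noteq> \<zero>\<^bsub>R\<^esub>} \<subseteq> A \<Longrightarrow> u \<in> H" for A u
  proof (induction A arbitrary: u rule: finite_induct)
    case empty
    then have "u = (\<lambda>x\<in>X. \<zero>\<^bsub>R\<^esub>)" by (intro PiE_ext[of u X]) auto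
    then show ?case using submodule_zero[OF F H] by (simp only: free_simps)
  next
    case (insert a A)
    have aX: "a \<in> X" using insert.prems by simp
    let ?v = "u(a := \<zero>\<^bsub>R\<^esub>)"
    have "?v \<in> X \<rightarrow>\<^sub>E carrier R" using insert.prems(2) aX by (auto simp: PiE_def extensional_def Pi_def)
    moreover have "{x \<in> X. ?v x \<noteq> \<zero>\<^bsub>R\<^esub>} \<subseteq> A" using insert.prems(3) by auto
    ultimately have v: "?v \<in> H" using insert.IH insert.prems(1) by blast
    have ua: "u a \<in> carrier R" using insert.prems(2) aX by auto
    have "u = ?v \<oplus>\<^bsub>free_module R X\<^esub> (u a \<odot>\<^bsub>free_module R X\<^esub> free_gen R X a)"
    proof (rule PiE_ext[of u X])
      show "u \<in> X \<rightarrow>\<^sub>E carrier R" by (rule insert.prems)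
      show "?v \<oplus>\<^bsub>free_module R X\<^esub> (u a \<odot>\<^bsub>free_module R X\<^esub> free_gen R X a) \<in> X \<rightarrow>\<^sub>E carrier R"
        using insert.prems(2) ua by (auto simp: free_simps free_gen_def PiE_def Pi_def)
      fix x assume "x \<in> X"
      moreover then have "u x \<in> carrier R" using insert.prems(2) by auto
      ultimately show "u x = (?v \<oplus>\<^bsub>free_module R X\<^esub> (u a \<odot>\<^bsub>free_module R X\<^esub> free_gen R X a)) x"
        using ua by (simp add: free_simps free_gen_def)
    qed
    moreover have "?v \<oplus>\<^bsub>free_module R X\<^esub> (u a \<odot>\<^bsub>free_module R X\<^esub> free_gen R X a) \<in> H"
      by (intro submodule_add[OF F H] v submodule_smult[OF F H] ua g aX)
    ultimately show ?case by simp
  qed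
  from this[of "{x \<in> X. u x \<noteq> \<zero>\<^bsub>R\<^esub>}" u] u show ?thesis by (auto simp: free_module_def)
qed

lemma free_module_lift:
  assumes R: "cring R" and P: "Module.module R P" and \<phi>: "\<phi> \<in> X \<rightarrow> carrier P"
  shows "\<exists>g\<in>module_hom R (free_module R X) P. \<forall>x\<in>X. g (free_gen R X x) = \<phi> x"
proof -
  interpret cring R by fact
  interpret P: Module.module R P by fact
  let ?s = "\<lambda>u. {x \<in> X. u x \<noteq> \<zero>\<^bsub>R\<^esub>}"
  let ?t = "\<lambda>u x. u x \<odot>\<^bsub>P\<^esub> \<phi> x"
  define g where "g u = (\<Oplus>\<^bsub>P\<^esub>x\<in>?s u. ?t u x)" for u
  have t: "?t u \<in> A \<rightarrow> carrier P" if "u \<in> carrier (free_module R X)" "A \<subseteq> X" for u A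
    using that \<phi> by (auto simp: free_module_def PiE_def Pi_def)
  \<comment> \<open>The sum may run over any finite set that contains the support. Additivity needs
    this, because two elements and their sum have to be expanded over a common set.\<close>
  have g: "g u = (\<Oplus>\<^bsub>P\<^esub>x\<in>A. ?t u x)"
    if "u \<in> carrier (free_module R X)" "finite A" "A \<subseteq> X" "?s u \<subseteq> A" for u A
    unfolding g_def
  proof (rule P.M.add.finprod_mono_neutral_cong_left[OF that(2,4)])
    show "?t u x = \<zero>\<^bsub>P\<^esub>" if x: "x \<in> A - ?s u" for x
    proof -
      have "u x = \<zero>\<^bsub>R\<^esub>" "\<phi> x \<in> carrier P" using x \<open>A \<subseteq> X\<close> \<phi> by auto
      then show ?thesis by simp
    qed
    show "?t u \<in> A \<rightarrow> carrier P" using that(1,3) by (rule t)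
  qed simp
  have fin: "finite (?s u)" if "u \<in> carrier (free_module R X)" for u using that by (simp add: free_module_def)
  have mem: "u x \<in> carrier R" if "u \<in> carrier (free_module R X)" "x \<in> X" for u x
    using that by (auto simp: free_module_def)
  interpret F: Module.module R "free_module R X" by (rule module_free_module[OF R])
  have "g \<in> module_hom R (free_module R X) P"
  proof (rule module_homI)
    fix u assume u: "u \<in> carrier (free_module R X)"
    show "g u \<in> carrier P" unfolding g_def using t[OF u, of "?s u"] by (intro P.M.finsum_closed) auto
    show "g (a \<odot>\<^bsub>free_module R X\<^esub> u) = a \<odot>\<^bsub>P\<^esub> g u" if a: "a \<in> carrier R" for a
    proof -
      have "g (a \<odot>\<^bsub>free_module R X\<^esub> u) = (\<Oplus>\<^bsub>P\<^esub>x\<in>?s u. ?t (a \<odot>\<^bsub>free_module R X\<^esub> u) x)"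
        using a by (intro g F.smult_closed u fin) (auto simp: free_simps)
      also have "\<dots> = (\<Oplus>\<^bsub>P\<^esub>x\<in>?s u. a \<odot>\<^bsub>P\<^esub> ?t u x)"
        using a u \<phi> mem[OF u] t[OF u, of "?s u"]
        by (intro P.M.finsum_cong') (auto simp: free_simps P.smult_assoc1 Pi_def)
      also have "\<dots> = a \<odot>\<^bsub>P\<^esub> g u"
        unfolding g_def using a t[OF u, of "?s u"] fin[OF u] by (intro P.finsum_smult_ldistr[symmetric]) auto
      finally show ?thesis .
    qed
    fix v assume v: "v \<in> carrier (free_module R X)"
    let ?A = "?s u \<union> ?s v"
    have A: "finite ?A" "?A \<subseteq> X" using fin[OF u] fin[OF v] by auto
    have "g (u \<oplus>\<^bsub>free_module R X\<^esub> v) = (\<Oplus>\<^bsub>P\<^esub>x\<in>?A. ?t (u \<oplus>\<^bsub>free_module R X\<^esub> v) x)"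
      by (intro g F.M.a_closed u v A) (auto simp: free_simps)
    also have "\<dots> = (\<Oplus>\<^bsub>P\<^esub>x\<in>?A. ?t u x \<oplus>\<^bsub>P\<^esub> ?t v x)"
      using \<phi> mem[OF u] mem[OF v] by (intro P.M.finsum_cong') (auto simp: free_simps P.smult_l_distr Pi_def)
    also have "\<dots> = (\<Oplus>\<^bsub>P\<^esub>x\<in>?A. ?t u x) \<oplus>\<^bsub>P\<^esub> (\<Oplus>\<^bsub>P\<^esub>x\<in>?A. ?t v x)"
      by (intro P.M.finsum_addf t u v A)
    also have "\<dots> = g u \<oplus>\<^bsub>P\<^esub> g v" using g[OF u A] g[OF v A] by simp
    finally show "g (u \<oplus>\<^bsub>free_module R X\<^esub> v) = g u \<oplus>\<^bsub>P\<^esub> g v" .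
  qed
  moreover have "g (free_gen R X x) = \<phi> x" if x: "x \<in> X" for x
  proof -
    have "g (free_gen R X x) = (\<Oplus>\<^bsub>P\<^esub>y\<in>{x}. ?t (free_gen R X x) y)"
      using x by (intro g free_gen_in[OF R x]) (auto simp: free_gen_def)
    also have "\<dots> = \<phi> x" using x \<phi> by (simp add: free_gen_def Pi_def)
    finally show ?thesis .
  qed
  ultimately show ?thesis by blast
qed

section \<open>The universal property of the tensor product\<close>

context
  fixes R :: "('a, 'r) ring_scheme" and M :: "('a, 'b, 'k) module_scheme" and N :: "('a, 'c, 'l) module_scheme"
  assumes R: "cring R" and M: "Module.module R M" and N: "Module.module R N"
begin

private abbreviation "X \<equiv> carrier M \<times> carrier N"
private abbreviation "F \<equiv> free_module R X"
private abbreviation "gen \<equiv> free_gen R X"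

lemma tensor_relations_carrier: "tensor_relations R M N \<subseteq> carrier F"
proof -
  interpret M: Module.module R M by (rule M)
  interpret N: Module.module R N by (rule N)
  interpret F: Module.module R F by (rule module_free_module[OF R])
  show ?thesis unfolding tensor_relations_def Let_def
    by (auto intro!: F.M.minus_closed F.M.a_closed F.smult_closed free_gen_in[OF R])
qed

lemma tensor_kernel_submodule: "submodule (tensor_kernel R M N) R F"
  unfolding tensor_kernel_def by (rule span_submodule[OF module_free_module[OF R] tensor_relations_carrier])

lemma module_tensor: "Module.module R (tensor R M N)"
  unfolding tensor_def by (rule module_quot[OF module_free_module[OF R] tensor_kernel_submodule])

lemma tensor_proj_hom: "(\<lambda>u. tensor_kernel R M N +>\<^bsub>F\<^esub> u) \<in> module_hom R F (tensor R M N)"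
  unfolding tensor_def by (rule quot_proj_hom[OF module_free_module[OF R] tensor_kernel_submodule])

lemma pure_tensor_closed: "x \<in> carrier M \<Longrightarrow> y \<in> carrier N \<Longrightarrow> pure_tensor R M N x y \<in> carrier (tensor R M N)"
  unfolding pure_tensor_def by (rule module_hom_closed[OF tensor_proj_hom free_gen_in[OF R]]) simp

lemma pure_tensor_rel:
  assumes "gen p \<ominus>\<^bsub>F\<^esub> z \<in> tensor_relations R M N" and "p \<in> X" and z: "z \<in> carrier F"
  shows "pure_tensor R M N (fst p) (snd p) = tensor_kernel R M N +>\<^bsub>F\<^esub> z"
proof -
  have "gen p \<ominus>\<^bsub>F\<^esub> z \<in> tensor_kernel R M N"
    unfolding tensor_kernel_def using span_incl assms(1) by (rule subsetD)
  then show ?thesis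
    using coset_eq_iff[OF module_free_module[OF R] tensor_kernel_submodule free_gen_in[OF R assms(2)] z]
    by (simp add: pure_tensor_def)
qed

lemma pure_tensor_add_left:
  assumes "x \<in> carrier M" "x' \<in> carrier M" "y \<in> carrier N"
  shows "pure_tensor R M N (x \<oplus>\<^bsub>M\<^esub> x') y = pure_tensor R M N x y \<oplus>\<^bsub>tensor R M N\<^esub> pure_tensor R M N x' y"
proof -
  interpret M: Module.module R M by (rule M)
  interpret F: Module.module R F by (rule module_free_module[OF R])
  have g: "gen (x, y) \<in> carrier F" "gen (x', y) \<in> carrier F" by (use assms in \<open>auto intro!: free_gen_in[OF R]\<close>)
  have "pure_tensor R M N (fst (x \<oplus>\<^bsub>M\<^esub> x', y)) (snd (x \<oplus>\<^bsub>M\<^esub> x', y)) =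
      tensor_kernel R M N +>\<^bsub>F\<^esub> (gen (x, y) \<oplus>\<^bsub>F\<^esub> gen (x', y))"
  proof (rule pure_tensor_rel)
    show "gen (x \<oplus>\<^bsub>M\<^esub> x', y) \<ominus>\<^bsub>F\<^esub> (gen (x, y) \<oplus>\<^bsub>F\<^esub> gen (x', y)) \<in> tensor_relations R M N"
      unfolding tensor_relations_def Let_def using assms by blast
  qed (use assms g in auto)
  then show ?thesis using module_hom_add[OF tensor_proj_hom g] by (simp add: pure_tensor_def)
qed

lemma pure_tensor_add_right:
  assumes "x \<in> carrier M" "y \<in> carrier N" "y' \<in> carrier N"
  shows "pure_tensor R M N x (y \<oplus>\<^bsub>N\<^esub> y') = pure_tensor R M N x y \<oplus>\<^bsub>tensor R M N\<^esub> pure_tensor R M N x y'"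
proof -
  interpret N: Module.module R N by (rule N)
  interpret F: Module.module R F by (rule module_free_module[OF R])
  have g: "gen (x, y) \<in> carrier F" "gen (x, y') \<in> carrier F" by (use assms in \<open>auto intro!: free_gen_in[OF R]\<close>)
  have "pure_tensor R M N (fst (x, y \<oplus>\<^bsub>N\<^esub> y')) (snd (x, y \<oplus>\<^bsub>N\<^esub> y')) =
      tensor_kernel R M N +>\<^bsub>F\<^esub> (gen (x, y) \<oplus>\<^bsub>F\<^esub> gen (x, y'))"
  proof (rule pure_tensor_rel)
    show "gen (x, y \<oplus>\<^bsub>N\<^esub> y') \<ominus>\<^bsub>F\<^esub> (gen (x, y) \<oplus>\<^bsub>F\<^esub> gen (x, y')) \<in> tensor_relations R M N"
      unfolding tensor_relations_def Let_def using assms by blast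
  qed (use assms g in auto)
  then show ?thesis using module_hom_add[OF tensor_proj_hom g] by (simp add: pure_tensor_def)
qed

lemma pure_tensor_smult_left:
  assumes "a \<in> carrier R" "x \<in> carrier M" "y \<in> carrier N"
  shows "pure_tensor R M N (a \<odot>\<^bsub>M\<^esub> x) y = a \<odot>\<^bsub>tensor R M N\<^esub> pure_tensor R M N x y"
proof -
  interpret M: Module.module R M by (rule M)
  interpret F: Module.module R F by (rule module_free_module[OF R])
  have g: "gen (x, y) \<in> carrier F" by (use assms in \<open>auto intro!: free_gen_in[OF R]\<close>)
  have "pure_tensor R M N (fst (a \<odot>\<^bsub>M\<^esub> x, y)) (snd (a \<odot>\<^bsub>M\<^esub> x, y)) =
      tensor_kernel R M N +>\<^bsub>F\<^esub> (a \<odot>\<^bsub>F\<^esub> gen (x, y))"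
  proof (rule pure_tensor_rel)
    show "gen (a \<odot>\<^bsub>M\<^esub> x, y) \<ominus>\<^bsub>F\<^esub> a \<odot>\<^bsub>F\<^esub> gen (x, y) \<in> tensor_relations R M N"
      unfolding tensor_relations_def Let_def using assms by blast
  qed (use assms g in auto)
  then show ?thesis using module_hom_smult[OF tensor_proj_hom assms(1) g] by (simp add: pure_tensor_def)
qed

lemma pure_tensor_smult_right:
  assumes "a \<in> carrier R" "x \<in> carrier M" "y \<in> carrier N"
  shows "pure_tensor R M N x (a \<odot>\<^bsub>N\<^esub> y) = a \<odot>\<^bsub>tensor R M N\<^esub> pure_tensor R M N x y"
proof -
  interpret N: Module.module R N by (rule N)
  interpret F: Module.module R F by (rule module_free_module[OF R])
  have g: "gen (x, y) \<in> carrier F" by (use assms in \<open>auto intro!: free_gen_in[OF R]\<close>)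
  have "pure_tensor R M N (fst (x, a \<odot>\<^bsub>N\<^esub> y)) (snd (x, a \<odot>\<^bsub>N\<^esub> y)) =
      tensor_kernel R M N +>\<^bsub>F\<^esub> (a \<odot>\<^bsub>F\<^esub> gen (x, y))"
  proof (rule pure_tensor_rel)
    show "gen (x, a \<odot>\<^bsub>N\<^esub> y) \<ominus>\<^bsub>F\<^esub> a \<odot>\<^bsub>F\<^esub> gen (x, y) \<in> tensor_relations R M N"
      unfolding tensor_relations_def Let_def using assms by blast
  qed (use assms g in auto)
  then show ?thesis using module_hom_smult[OF tensor_proj_hom assms(1) g] by (simp add: pure_tensor_def)
qed

lemma pure_tensor_hom_left: "y \<in> carrier N \<Longrightarrow> (\<lambda>x. pure_tensor R M N x y) \<in> module_hom R M (tensor R M N)"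
  by (rule module_homI) (simp_all add: pure_tensor_closed pure_tensor_add_left pure_tensor_smult_left)

lemma pure_tensor_hom_right: "x \<in> carrier M \<Longrightarrow> (\<lambda>y. pure_tensor R M N x y) \<in> module_hom R N (tensor R M N)"
  by (rule module_homI) (simp_all add: pure_tensor_closed pure_tensor_add_right pure_tensor_smult_right)

text \<open>The generators of the free module on pairs map to pure tensors, so
  \<open>free_module_least\<close> becomes induction over pure tensors.\<close>

lemma tensor_least:
  assumes H: "submodule H R (tensor R M N)"
    and p: "\<And>x y. x \<in> carrier M \<Longrightarrow> y \<in> carrier N \<Longrightarrow> pure_tensor R M N x y \<in> H"
    and t: "t \<in> carrier (tensor R M N)"
  shows "t \<in> H"
proof -
  let ?K = "{u \<in> carrier F. tensor_kernel R M N +>\<^bsub>F\<^esub> u \<in> H}"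
  obtain u where u: "u \<in> carrier F" "t = tensor_kernel R M N +>\<^bsub>F\<^esub> u"
    using t unfolding tensor_def quot_module_carrier by blast
  have "u \<in> ?K"
  proof (rule free_module_least[OF R _ _ u(1)])
    show "submodule ?K R F"
      by (rule submodule_vimage[OF module_free_module[OF R] module_tensor tensor_proj_hom H])
    show "gen z \<in> ?K" if "z \<in> X" for z
      using that p free_gen_in[OF R that] by (cases z) (simp add: pure_tensor_def)
  qed
  then show ?thesis using u(2) by simp
qed

lemma tensor_hom_eq:
  assumes P: "Module.module R P" and f: "f \<in> module_hom R (tensor R M N) P" and g: "g \<in> module_hom R (tensor R M N) P"
    and eq: "\<And>x y. x \<in> carrier M \<Longrightarrow> y \<in> carrier N \<Longrightarrow> f (pure_tensor R M N x y) = g (pure_tensor R M N x y)"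
    and t: "t \<in> carrier (tensor R M N)"
  shows "f t = g t"
proof -
  interpret P: Module.module R P by (rule P)
  let ?K = "a_kernel (tensor R M N) P (\<lambda>t. f t \<ominus>\<^bsub>P\<^esub> g t)"
  have "t \<in> ?K"
    by (rule tensor_least[OF submodule_kernel[OF module_tensor P module_hom_diff[OF module_tensor P f g]] _ t])
      (simp add: a_kernel_eq eq pure_tensor_closed module_hom_closed[OF g] a_minus_def P.M.r_neg)
  then show ?thesis using module_hom_closed[OF f t] module_hom_closed[OF g t]
    by (simp add: a_kernel_eq P.M.diff_eq_zero_iff)
qed

text \<open>The extension of \<phi> to the free module on pairs kills the four kinds of relations by
  bilinearity, and so factors through the quotient.\<close>

lemma tensor_lift:
  assumes P: "Module.module R P"
    and l: "\<And>y. y \<in> carrier N \<Longrightarrow> (\<lambda>x. \<phi> x y) \<in> module_hom R M P"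
    and r: "\<And>x. x \<in> carrier M \<Longrightarrow> (\<lambda>y. \<phi> x y) \<in> module_hom R N P"
  shows "\<exists>g\<in>module_hom R (tensor R M N) P. \<forall>x\<in>carrier M. \<forall>y\<in>carrier N. g (pure_tensor R M N x y) = \<phi> x y"
proof -
  interpret M: Module.module R M by (rule M)
  interpret N: Module.module R N by (rule N)
  interpret P: Module.module R P by (rule P)
  note F = module_free_module[OF R, of X]
  interpret F: Module.module R F by (rule F)
  have c: "\<phi> x y \<in> carrier P" if "x \<in> carrier M" "y \<in> carrier N" for x y
    using module_hom_closed[OF l] that by simp
  have "(\<lambda>p. \<phi> (fst p) (snd p)) \<in> X \<rightarrow> carrier P" using c by auto
  from free_module_lift[OF R P this] obtain f where f: "f \<in> module_hom R F P"
    and fg: "\<And>x y. x \<in> carrier M \<Longrightarrow> y \<in> carrier N \<Longrightarrow> f (gen (x, y)) = \<phi> x y" by auto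
  have gc: "gen (x, y) \<in> carrier F" if "x \<in> carrier M" "y \<in> carrier N" for x y
    using that by (intro free_gen_in[OF R]) simp
  have dz: "f (u \<ominus>\<^bsub>F\<^esub> v) = \<zero>\<^bsub>P\<^esub>" if "u \<in> carrier F" "v \<in> carrier F" "f u = f v" for u v
    using that module_hom_closed[OF f] by (simp add: module_hom_minus[OF F P f] P.M.diff_eq_zero_iff)
  have "tensor_kernel R M N \<subseteq> a_kernel F P f"
    unfolding tensor_kernel_def
  proof (rule span_least[OF submodule_kernel[OF F P f]], rule subsetI)
    fix z assume z: "z \<in> tensor_relations R M N"
    then have zc: "z \<in> carrier F" using tensor_relations_carrier by blast
    have "f z = \<zero>\<^bsub>P\<^esub>" using z unfolding tensor_relations_def Let_def
    proof (elim UnE CollectE exE conjE)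
      fix x x' y assume xy: "x \<in> carrier M" "x' \<in> carrier M" "y \<in> carrier N"
        and z: "z = gen (x \<oplus>\<^bsub>M\<^esub> x', y) \<ominus>\<^bsub>F\<^esub> (gen (x, y) \<oplus>\<^bsub>F\<^esub> gen (x', y))"
      show "f z = \<zero>\<^bsub>P\<^esub>" unfolding z
        by (rule dz) (use xy gc in \<open>simp_all add: module_hom_add[OF f] fg module_hom_add[OF l]\<close>)
    next
      fix x y y' assume xy: "x \<in> carrier M" "y \<in> carrier N" "y' \<in> carrier N"
        and z: "z = gen (x, y \<oplus>\<^bsub>N\<^esub> y') \<ominus>\<^bsub>F\<^esub> (gen (x, y) \<oplus>\<^bsub>F\<^esub> gen (x, y'))"
      show "f z = \<zero>\<^bsub>P\<^esub>" unfolding z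
        by (rule dz) (use xy gc in \<open>simp_all add: module_hom_add[OF f] fg module_hom_add[OF r]\<close>)
    next
      fix a x y assume xy: "a \<in> carrier R" "x \<in> carrier M" "y \<in> carrier N"
        and z: "z = gen (a \<odot>\<^bsub>M\<^esub> x, y) \<ominus>\<^bsub>F\<^esub> a \<odot>\<^bsub>F\<^esub> gen (x, y)"
      show "f z = \<zero>\<^bsub>P\<^esub>" unfolding z
        by (rule dz) (use xy gc in \<open>simp_all add: module_hom_smult[OF f] fg module_hom_smult[OF l]\<close>)
    next
      fix a x y assume xy: "a \<in> carrier R" "x \<in> carrier M" "y \<in> carrier N"
        and z: "z = gen (x, a \<odot>\<^bsub>N\<^esub> y) \<ominus>\<^bsub>F\<^esub> a \<odot>\<^bsub>F\<^esub> gen (x, y)"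
      show "f z = \<zero>\<^bsub>P\<^esub>" unfolding z
        by (rule dz) (use xy gc in \<open>simp_all add: module_hom_smult[OF f] fg module_hom_smult[OF r]\<close>)
    qed
    then show "z \<in> a_kernel F P f" using zc by (simp add: a_kernel_eq)
  qed
  then have ker: "\<And>h. h \<in> tensor_kernel R M N \<Longrightarrow> f h = \<zero>\<^bsub>P\<^esub>" by (auto simp: a_kernel_eq)
  from quot_lift[OF F tensor_kernel_submodule P f ker]
  obtain g where g: "g \<in> module_hom R (quot_module F (tensor_kernel R M N)) P"
    and gf: "\<And>u. u \<in> carrier F \<Longrightarrow> g (tensor_kernel R M N +>\<^bsub>F\<^esub> u) = f u" by auto
  show ?thesis
    by (rule bexI[of _ g]) (use g gf gc fg in \<open>simp_all add: tensor_def pure_tensor_def\<close>)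
qed

end

text \<open>The universal property shows that the choice in the definition of
  \<open>tensor_map\<close> has a candidate; both claims are then properties of the chosen
  map.\<close>

lemma tensor_map:
  assumes R: "cring R" and M: "Module.module R M" and M': "Module.module R M'" and N: "Module.module R N"
    and f: "f \<in> module_hom R M M'"
  shows tensor_map_hom: "tensor_map R M M' N f \<in> module_hom R (tensor R M N) (tensor R M' N)"
    and tensor_map_pure: "x \<in> carrier M \<Longrightarrow> y \<in> carrier N \<Longrightarrow>
      tensor_map R M M' N f (pure_tensor R M N x y) = pure_tensor R M' N (f x) y"
proof -
  have "\<exists>g. g \<in> module_hom R (tensor R M N) (tensor R M' N) \<and>
      (\<forall>x\<in>carrier M. \<forall>y\<in>carrier N. g (pure_tensor R M N x y) = pure_tensor R M' N (f x) y)"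
    using tensor_lift[OF R M N module_tensor[OF R M' N], of "\<lambda>x y. pure_tensor R M' N (f x) y"]
      module_hom_comp[OF f pure_tensor_hom_left[OF R M' N]]
      pure_tensor_hom_right[OF R M' N module_hom_closed[OF f]] by blast
  from someI_ex[OF this]
  show "tensor_map R M M' N f \<in> module_hom R (tensor R M N) (tensor R M' N)"
    and "x \<in> carrier M \<Longrightarrow> y \<in> carrier N \<Longrightarrow>
      tensor_map R M M' N f (pure_tensor R M N x y) = pure_tensor R M' N (f x) y"
    unfolding tensor_map_def by blast+
qed

section \<open>Tensoring with a finite free module\<close>

context
  fixes R :: "('a, 'r) ring_scheme" and N :: "('a, 'c, 'l) module_scheme"
  assumes R: "cring R" and N: "Module.module R N"
begin

text \<open>The isomorphism from R^X \<otimes> N to N^X, obtained from the universal property;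
  \<open>free_tensor_inv\<close> is its inverse.\<close>

definition free_tensor :: "'x set \<Rightarrow> (('x \<Rightarrow> 'a) \<times> 'c \<Rightarrow> 'a) set \<Rightarrow> 'x \<Rightarrow> 'c" where
  "free_tensor X = (SOME g. g \<in> module_hom R (tensor R (free_module R X) N) (pow_module X N) \<and>
     (\<forall>u\<in>carrier (free_module R X). \<forall>y\<in>carrier N.
        g (pure_tensor R (free_module R X) N u y) = (\<lambda>i\<in>X. u i \<odot>\<^bsub>N\<^esub> y)))"

lemma free_tensor:
  assumes X: "finite X"
  shows free_tensor_hom: "free_tensor X \<in> module_hom R (tensor R (free_module R X) N) (pow_module X N)"
    and free_tensor_pure: "u \<in> carrier (free_module R X) \<Longrightarrow> y \<in> carrier N \<Longrightarrow>
        free_tensor X (pure_tensor R (free_module R X) N u y) = (\<lambda>i\<in>X. u i \<odot>\<^bsub>N\<^esub> y)"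
proof -
  interpret N: Module.module R N by (rule N)
  have s: "(\<lambda>a. a \<odot>\<^bsub>N\<^esub> y) \<in> module_hom R (regular_module R) N" if "y \<in> carrier N" for y
    using that by (intro module_homI) (simp_all add: N.smult_l_distr N.smult_assoc1)
  have l: "(\<lambda>u. \<lambda>i\<in>X. u i \<odot>\<^bsub>N\<^esub> y) \<in> module_hom R (free_module R X) (pow_module X N)" if "y \<in> carrier N" for y
    by (rule dprod_hom) (rule module_hom_comp[OF free_proj_hom[OF X] s[OF that]])
  have r: "(\<lambda>y. \<lambda>i\<in>X. u i \<odot>\<^bsub>N\<^esub> y) \<in> module_hom R N (pow_module X N)" if "u \<in> carrier (free_module R X)" for u
    by (rule dprod_hom) (rule module_hom_scalar[OF N free_mem[OF X that]])
  have "\<exists>g. g \<in> module_hom R (tensor R (free_module R X) N) (pow_module X N) \<and>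
     (\<forall>u\<in>carrier (free_module R X). \<forall>y\<in>carrier N.
        g (pure_tensor R (free_module R X) N u y) = (\<lambda>i\<in>X. u i \<odot>\<^bsub>N\<^esub> y))"
    using tensor_lift[OF R module_free[OF R X] N module_dprod[OF R N] l r] by blast
  from someI_ex[OF this]
  show "free_tensor X \<in> module_hom R (tensor R (free_module R X) N) (pow_module X N)"
    and "u \<in> carrier (free_module R X) \<Longrightarrow> y \<in> carrier N \<Longrightarrow>
        free_tensor X (pure_tensor R (free_module R X) N u y) = (\<lambda>i\<in>X. u i \<odot>\<^bsub>N\<^esub> y)"
    unfolding free_tensor_def by blast+
qed

definition free_tensor_inv :: "'x set \<Rightarrow> ('x \<Rightarrow> 'c) \<Rightarrow> (('x \<Rightarrow> 'a) \<times> 'c \<Rightarrow> 'a) set" where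
  "free_tensor_inv X v =
     (\<Oplus>\<^bsub>tensor R (free_module R X) N\<^esub>i\<in>X. pure_tensor R (free_module R X) N (free_gen R X i) (v i))"

lemma free_tensor_inv_hom:
  assumes X: "finite X"
  shows "free_tensor_inv X \<in> module_hom R (pow_module X N) (tensor R (free_module R X) N)"
proof -
  note T = module_tensor[OF R module_free[OF R X] N]
  have "(\<lambda>v. pure_tensor R (free_module R X) N (free_gen R X i) (v i)) \<in>
      module_hom R (pow_module X N) (tensor R (free_module R X) N)" if "i \<in> X" for i
    by (rule module_hom_comp[OF pow_proj_hom[OF that]
        pure_tensor_hom_right[OF R module_free[OF R X] N free_gen_closed[OF R X]]])
  from module_hom_sum[OF module_dprod[OF R N] T X this]
  show ?thesis unfolding free_tensor_inv_def[abs_def] .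
qed

lemma free_tensor_inv_left:
  assumes X: "finite X" and t: "t \<in> carrier (tensor R (free_module R X) N)"
  shows "free_tensor_inv X (free_tensor X t) = t"
proof -
  let ?F = "free_module R X" and ?T = "tensor R (free_module R X) N"
  note F = module_free[OF R X] and T = module_tensor[OF R module_free[OF R X] N]
  interpret N: Module.module R N by (rule N)
  interpret T: Module.module R ?T by (rule T)
  show ?thesis
  proof (rule tensor_hom_eq[OF R F N T module_hom_comp[OF free_tensor_hom[OF X] free_tensor_inv_hom[OF X]] module_hom_id _ t])
    fix u y assume u: "u \<in> carrier ?F" and y: "y \<in> carrier N"
    note pc = pure_tensor_closed[OF R F N]
    have "free_tensor_inv X (free_tensor X (pure_tensor R ?F N u y)) =
        (\<Oplus>\<^bsub>?T\<^esub>i\<in>X. u i \<odot>\<^bsub>?T\<^esub> pure_tensor R ?F N (free_gen R X i) y)"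
      unfolding free_tensor_inv_def free_tensor_pure[OF X u y]
      by (rule T.M.finsum_cong')
        (use free_mem[OF X u] y pc in \<open>auto simp: pure_tensor_smult_right[OF R F N] free_gen_closed[OF R X]\<close>)
    also have "\<dots> = comb ?T X (\<lambda>i. pure_tensor R ?F N (free_gen R X i) y) u" by (simp add: comb_def)
    also have "\<dots> = pure_tensor R ?F N u y"
      by (rule hom_free_eq[OF R T X pure_tensor_hom_left[OF R F N y] u, symmetric])
    finally show "free_tensor_inv X (free_tensor X (pure_tensor R ?F N u y)) = pure_tensor R ?F N u y" .
  qed
qed

lemma free_tensor_inv_right:
  assumes X: "finite X" and v: "v \<in> carrier (pow_module X N)"
  shows "free_tensor X (free_tensor_inv X v) = v"
proof -
  let ?F = "free_module R X" and ?T = "tensor R (free_module R X) N"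
  note F = module_free[OF R X] and T = module_tensor[OF R module_free[OF R X] N]
  interpret cring R by (rule R)
  interpret N: Module.module R N by (rule N)
  have vN: "v i \<in> carrier N" if "i \<in> X" for i using v that by (auto simp: dprod_simps)
  have "free_tensor X (free_tensor_inv X v) =
      (\<Oplus>\<^bsub>pow_module X N\<^esub>i\<in>X. free_tensor X (pure_tensor R ?F N (free_gen R X i) (v i)))"
    unfolding free_tensor_inv_def
    by (rule module_hom_finsum[OF T module_dprod[OF R N] free_tensor_hom[OF X] X])
      (use pure_tensor_closed[OF R F N free_gen_closed[OF R X] vN] in auto)
  also have "\<dots> = (\<Oplus>\<^bsub>pow_module X N\<^esub>i\<in>X. inj_at X (\<lambda>_. N) i (v i))"
  proof -
    interpret P: Module.module R "pow_module X N" by (rule module_dprod[OF R N])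
    have "free_tensor X (pure_tensor R ?F N (free_gen R X i) (v i)) = inj_at X (\<lambda>_. N) i (v i)" if i: "i \<in> X" for i
      unfolding free_tensor_pure[OF X free_gen_closed[OF R X] vN[OF i]] inj_at_def
      by (rule restrict_ext) (use vN[OF i] in \<open>simp add: free_gen_def\<close>)
    moreover have "inj_at X (\<lambda>_. N) i (v i) \<in> carrier (pow_module X N)" if i: "i \<in> X" for i
      by (rule module_hom_closed[OF inj_at_hom[where Mf = "\<lambda>_. N", OF N i] vN[OF i]])
    ultimately show ?thesis by (intro P.M.finsum_cong') auto
  qed
  also have "\<dots> = v" by (rule dprod_expand[OF R N X v])
  finally show ?thesis .
qed

text \<open>Two homomorphisms on a tensor product are compared on pure tensors. There the claim is
  naturality of the matrix \<open>f\<close> with respect to r \<mapsto> r y.\<close>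

lemma free_tensor_map:
  assumes X: "finite X" and Y: "finite Y" and f: "f \<in> module_hom R (free_module R X) (free_module R Y)"
    and t: "t \<in> carrier (tensor R (free_module R X) N)"
  shows "free_tensor Y (tensor_map R (free_module R X) (free_module R Y) N f t) = act R N X Y f (free_tensor X t)"
proof -
  let ?F = "free_module R X" and ?G = "free_module R Y"
  note F = module_free[OF R X] and G = module_free[OF R Y]
  interpret N: Module.module R N by (rule N)
  note tm = tensor_map_hom[OF R F G N f]
  show ?thesis
  proof (rule tensor_hom_eq[OF R F N module_dprod[OF R N] module_hom_comp[OF tm free_tensor_hom[OF Y]]
      module_hom_comp[OF free_tensor_hom[OF X] act_hom[OF R X Y f N]] _ t])
    fix u y assume u: "u \<in> carrier ?F" and y: "y \<in> carrier N"
    have s: "(\<lambda>a. a \<odot>\<^bsub>N\<^esub> y) \<in> module_hom R (regular_module R) N"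
      using y by (intro module_homI) (simp_all add: N.smult_l_distr N.smult_assoc1)
    have "act R N X Y f (\<lambda>i\<in>X. u i \<odot>\<^bsub>N\<^esub> y) = (\<lambda>k\<in>Y. act R (regular_module R) X Y f u k \<odot>\<^bsub>N\<^esub> y)"
      by (rule act_natural[OF R X Y f module_regular[OF R] N s]) (use free_mem[OF X u] in auto)
    then show "free_tensor Y (tensor_map R ?F ?G N f (pure_tensor R ?F N u y)) =
        act R N X Y f (free_tensor X (pure_tensor R ?F N u y))"
      by (simp add: tensor_map_pure[OF R F G N f u y] free_tensor_pure[OF X u y]
          free_tensor_pure[OF Y module_hom_closed[OF f u] y] act_regular[OF R X Y f u])
  qed
qed

text \<open>A cycle in the power of N is carried to a tensor whose class in homology must be the
  zero coset. The zero of the quotient is the set of boundaries itself, so the tensor is a boundary,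
  and a tensor that it bounds is carried back.\<close>

lemma tensor_homology_zero:
  assumes dif: "\<And>i. dif F i \<in> module_hom R (res_term R F (Suc i)) (res_term R F i)"
    and z: "zero_module (tensor_homology R F N (Suc k))"
    and v: "v \<in> carrier (pow_module {..<rk F (Suc k)} N)"
    and dv: "act R N {..<rk F (Suc k)} {..<rk F k} (dif F k) v = \<zero>\<^bsub>pow_module {..<rk F k} N\<^esub>"
  shows "v \<in> act R N {..<rk F (Suc (Suc k))} {..<rk F (Suc k)} (dif F (Suc k)) `
    carrier (pow_module {..<rk F (Suc (Suc k))} N)"
proof -
  let ?X = "\<lambda>i. {..<rk F i}"
  let ?T = "\<lambda>i. tensor R (res_term R F i) N"
  let ?tm = "\<lambda>i. tensor_map R (res_term R F (Suc i)) (res_term R F i) N (dif F i)"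
  note F = module_free[OF R finite_lessThan]
  note T = module_tensor[OF R F N]
  note tm = tensor_map_hom[OF R F F N dif]
  let ?t = "free_tensor_inv (?X (Suc k)) v"
  let ?B = "tensor_boundaries R F N (Suc k)"
  interpret T: Module.module R "?T (Suc k)" by (rule T)
  have t: "?t \<in> carrier (?T (Suc k))" by (rule module_hom_closed[OF free_tensor_inv_hom v]) simp
  have dt: "?tm k ?t \<in> carrier (?T k)" by (rule module_hom_closed[OF tm t])
  have "free_tensor (?X k) (?tm k ?t) = \<zero>\<^bsub>pow_module (?X k) N\<^esub>"
    using free_tensor_map[OF finite_lessThan finite_lessThan dif t] free_tensor_inv_right[OF finite_lessThan v] dv by simp
  then have "?tm k ?t = free_tensor_inv (?X k) \<zero>\<^bsub>pow_module (?X k) N\<^esub>"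
    using free_tensor_inv_left[OF finite_lessThan dt] by simp
  also have "\<dots> = \<zero>\<^bsub>?T k\<^esub>"
    by (rule module_hom_zero[OF module_dprod[OF R N] T free_tensor_inv_hom]) simp
  finally have cyc: "?t \<in> tensor_cycles R F N (Suc k)" using t by (simp add: tensor_cycles_def a_kernel_eq)
  let ?Q = "(?T (Suc k))\<lparr>carrier := tensor_cycles R F N (Suc k)\<rparr>"
  have "?B +>\<^bsub>?Q\<^esub> ?t \<in> carrier (tensor_homology R F N (Suc k))"
    unfolding tensor_homology_def quot_module_carrier using cyc by auto
  then have "?B +>\<^bsub>?Q\<^esub> ?t = ?B" using z by (simp add: zero_module_def tensor_homology_def quot_module_simps)
  moreover have "\<zero>\<^bsub>?T (Suc k)\<^esub> \<oplus>\<^bsub>?T (Suc k)\<^esub> ?t \<in> ?B +>\<^bsub>?Q\<^esub> ?t"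
  proof -
    have "?tm (Suc k) \<zero>\<^bsub>?T (Suc (Suc k))\<^esub> = \<zero>\<^bsub>?T (Suc k)\<^esub>" by (rule module_hom_zero[OF T T tm])
    moreover have "\<zero>\<^bsub>?T (Suc (Suc k))\<^esub> \<in> carrier (?T (Suc (Suc k)))"
      by (rule submodule_carrier[OF T zero_submodule[OF T]]) simp
    ultimately have "\<zero>\<^bsub>?T (Suc k)\<^esub> \<in> ?B" unfolding tensor_boundaries_def by (metis image_eqI)
    then show ?thesis by (auto simp: a_r_coset_def')
  qed
  ultimately have "?t \<in> ?B" using t by simp
  then obtain w where w: "w \<in> carrier (?T (Suc (Suc k)))" "?t = ?tm (Suc k) w"
    unfolding tensor_boundaries_def by blast
  have "v = act R N (?X (Suc (Suc k))) (?X (Suc k)) (dif F (Suc k)) (free_tensor (?X (Suc (Suc k))) w)"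
    using free_tensor_map[OF finite_lessThan finite_lessThan dif w(1)] w(2) free_tensor_inv_right[OF finite_lessThan v] by simp
  moreover have "free_tensor (?X (Suc (Suc k))) w \<in> carrier (pow_module (?X (Suc (Suc k))) N)"
    by (rule module_hom_closed[OF free_tensor_hom w(1)]) simp
  ultimately show ?thesis by blast
qed

end

section \<open>Balancing Tor\<close>

lemma act_zero:
  assumes R: "cring R" and X: "finite X" and Y: "finite Y" and M: "Module.module R M"
    and f: "\<And>x. x \<in> X \<Longrightarrow> f (free_gen R X x) = \<zero>\<^bsub>free_module R Y\<^esub>"
    and u: "u \<in> carrier (pow_module X M)"
  shows "act R M X Y f u = \<zero>\<^bsub>pow_module Y M\<^esub>"
  unfolding act_def dprod_simps
proof (rule restrict_ext)
  interpret cring R by fact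
  interpret M: Module.module R M by fact
  fix y assume y: "y \<in> Y"
  have uM: "u \<in> X \<rightarrow> carrier M" using u by (auto simp: dprod_simps)
  have "comb M X u (\<lambda>x\<in>X. f (free_gen R X x) y) = (\<Oplus>\<^bsub>M\<^esub>x\<in>X. \<zero>\<^bsub>M\<^esub>)"
    unfolding comb_def by (rule M.M.finsum_cong') (use uM y in \<open>auto simp: f free_simps Pi_def\<close>)
  then show "comb M X u (\<lambda>x\<in>X. f (free_gen R X x) y) = \<zero>\<^bsub>M\<^esub>" by simp
qed

text \<open>On (R^L)^X the map \<open>f\<close> acts column by column, so preimages may be found for
  each column and assembled.\<close>

lemma act_free_image:
  assumes R: "cring R" and X: "finite X" and Y: "finite Y" and L: "finite L"
    and f: "f \<in> module_hom R (free_module R X) (free_module R Y)"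
    and x: "x \<in> carrier (pow_module Y (free_module R L))"
    and col: "\<And>l. l \<in> L \<Longrightarrow> (\<lambda>i\<in>Y. x i l) \<in> f ` carrier (free_module R X)"
  shows "x \<in> act R (free_module R L) X Y f ` carrier (pow_module X (free_module R L))"
proof -
  have "\<exists>w. w \<in> carrier (free_module R X) \<and> (\<lambda>i\<in>Y. x i l) = f w" if "l \<in> L" for l using col[OF that] by auto
  then obtain w where w: "\<And>l. l \<in> L \<Longrightarrow> w l \<in> carrier (free_module R X)"
    and fw: "\<And>l. l \<in> L \<Longrightarrow> (\<lambda>i\<in>Y. x i l) = f (w l)" by metis
  let ?u = "\<lambda>i\<in>X. \<lambda>l\<in>L. w l i"
  have u: "?u \<in> carrier (pow_module X (free_module R L))"
    using free_mem[OF X w] by (auto simp: dprod_simps carrier_free X L)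
  have col: "(\<lambda>i\<in>X. ?u i l) = w l" if "l \<in> L" for l
    by (rule PiE_ext[of _ X]) (use that w[OF that] in \<open>auto simp: carrier_free X\<close>)
  have "x = act R (free_module R L) X Y f ?u"
  proof (rule PiE_ext[of _ Y])
    show "x \<in> Y \<rightarrow>\<^sub>E carrier (free_module R L)" using x by (simp add: dprod_simps)
    show a: "act R (free_module R L) X Y f ?u \<in> Y \<rightarrow>\<^sub>E carrier (free_module R L)"
      using module_hom_closed[OF act_hom[OF R X Y f module_free[OF R L]] u] by (simp add: dprod_simps)
    fix y assume y: "y \<in> Y"
    show "x y = act R (free_module R L) X Y f ?u y"
    proof (rule PiE_ext[of _ L])
      show "x y \<in> L \<rightarrow>\<^sub>E carrier R" using x y by (auto simp: dprod_simps carrier_free L)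
      show "act R (free_module R L) X Y f ?u y \<in> L \<rightarrow>\<^sub>E carrier R" using a y by (auto simp: carrier_free L)
      fix l assume l: "l \<in> L"
      have "x y l = (\<lambda>i\<in>Y. x i l) y" using y by simp
      also have "\<dots> = f (\<lambda>i\<in>X. ?u i l) y" unfolding col[OF l] fw[OF l] ..
      also have "\<dots> = act R (free_module R L) X Y f ?u y l" by (rule act_free[OF R X Y f L u y l, symmetric])
      finally show "x y l = act R (free_module R L) X Y f ?u y l" .
    qed
  qed
  then show ?thesis using u by blast
qed

text \<open>Exactness in degrees at least 1; what happens in degree 0 is the content of
  \<open>presents\<close>.\<close>

definition exact_seq :: "('a, 'r) ring_scheme \<Rightarrow> (nat \<Rightarrow> nat) \<Rightarrow> (nat \<Rightarrow> (nat \<Rightarrow> 'a) \<Rightarrow> nat \<Rightarrow> 'a) \<Rightarrow> bool" where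
  "exact_seq R a D \<longleftrightarrow> (\<forall>p. \<forall>u\<in>carrier (free_module R {..<a (Suc p)}). D p u = \<zero>\<^bsub>free_module R {..<a p}\<^esub> \<longrightarrow>
     u \<in> D (Suc p) ` carrier (free_module R {..<a (Suc (Suc p))}))"

text \<open>The right end of a resolution: \<epsilon> makes M the cokernel of
  \<open>D 0\<close>.\<close>

definition presents :: "('a, 'r) ring_scheme \<Rightarrow> (nat \<Rightarrow> nat) \<Rightarrow> (nat \<Rightarrow> (nat \<Rightarrow> 'a) \<Rightarrow> nat \<Rightarrow> 'a) \<Rightarrow>
    ('a, 'b, 'k) module_scheme \<Rightarrow> ((nat \<Rightarrow> 'a) \<Rightarrow> 'b) \<Rightarrow> bool" where
  "presents R a D M \<epsilon> \<longleftrightarrow> Module.module R M \<and> \<epsilon> \<in> module_hom R (free_module R {..<a 0}) M \<and>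
     \<epsilon> ` carrier (free_module R {..<a 0}) = carrier M \<and>
     a_kernel (free_module R {..<a 0}) M \<epsilon> = D 0 ` carrier (free_module R {..<a 1})"

text \<open>Index \<open>k\<close> stands for degree k + 1 of the complex tensored with M; for a
  free resolution this is the vanishing of Tor in degree k + 1.\<close>

definition act_exact :: "('a, 'r) ring_scheme \<Rightarrow> (nat \<Rightarrow> nat) \<Rightarrow> (nat \<Rightarrow> (nat \<Rightarrow> 'a) \<Rightarrow> nat \<Rightarrow> 'a) \<Rightarrow>
    ('a, 'b, 'k) module_scheme \<Rightarrow> nat \<Rightarrow> bool" where
  "act_exact R a D M k \<longleftrightarrow> (\<forall>v\<in>carrier (pow_module {..<a (Suc k)} M).
     act R M {..<a (Suc k)} {..<a k} (D k) v = \<zero>\<^bsub>pow_module {..<a k} M\<^esub> \<longrightarrow>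
     v \<in> act R M {..<a (Suc (Suc k))} {..<a (Suc k)} (D (Suc k)) ` carrier (pow_module {..<a (Suc (Suc k))} M))"

section \<open>The tensor product of two complexes of free modules\<close>

locale tensor_bicomplex =
  fixes R :: "('a, 'r) ring_scheme" and a b :: "nat \<Rightarrow> nat" and D E :: "nat \<Rightarrow> (nat \<Rightarrow> 'a) \<Rightarrow> nat \<Rightarrow> 'a"
  assumes cr: "cring R"
    and D: "\<And>p. D p \<in> module_hom R (free_module R {..<a (Suc p)}) (free_module R {..<a p})"
    and E: "\<And>q. E q \<in> module_hom R (free_module R {..<b (Suc q)}) (free_module R {..<b q})"
    and D2: "\<And>p u. u \<in> carrier (free_module R {..<a (Suc (Suc p))}) \<Longrightarrow>
      D p (D (Suc p) u) = \<zero>\<^bsub>free_module R {..<a p}\<^esub>"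
    and E2: "\<And>q u. u \<in> carrier (free_module R {..<b (Suc (Suc q))}) \<Longrightarrow>
      E q (E (Suc q) u) = \<zero>\<^bsub>free_module R {..<b q}\<^esub>"
begin

abbreviation FA where "FA p \<equiv> free_module R {..<a p}"
abbreviation FB where "FB q \<equiv> free_module R {..<b q}"

lemma FA: "Module.module R (FA p)" by (rule module_free[OF cr]) simp
lemma FB: "Module.module R (FB p)" by (rule module_free[OF cr]) simp

text \<open>The product of R^(a p) and R^(b q) is encoded as a power of the second factor, so its
  elements are matrices with \<open>a p\<close> rows of length \<open>b q\<close>; \<open>D\<close>
  acts across the rows, \<open>E\<close> within each row.\<close>

definition X :: "nat \<Rightarrow> nat \<Rightarrow> ('a, nat \<Rightarrow> nat \<Rightarrow> 'a) module" where "X p q = pow_module {..<a p} (FB q)"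
definition DF :: "nat \<Rightarrow> nat \<Rightarrow> (nat \<Rightarrow> nat \<Rightarrow> 'a) \<Rightarrow> nat \<Rightarrow> nat \<Rightarrow> 'a" where
  "DF p q = act R (FB q) {..<a (Suc p)} {..<a p} (D p)"
text \<open>The sign depends on the first degree and makes the squares anticommute.\<close>

definition Es :: "nat \<Rightarrow> nat \<Rightarrow> (nat \<Rightarrow> 'a) \<Rightarrow> nat \<Rightarrow> 'a" where
  "Es p q v = (if even p then E q v else \<ominus>\<^bsub>FB q\<^esub> E q v)"
definition EF :: "nat \<Rightarrow> nat \<Rightarrow> (nat \<Rightarrow> nat \<Rightarrow> 'a) \<Rightarrow> nat \<Rightarrow> nat \<Rightarrow> 'a" where
  "EF p q x = (\<lambda>i\<in>{..<a p}. Es p q (x i))"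

lemma X_mem: "x \<in> carrier (X p q) \<Longrightarrow> i < a p \<Longrightarrow> x i \<in> carrier (FB q)"
  by (auto simp: X_def dprod_simps)

lemma XI: "(\<And>i. i < a p \<Longrightarrow> x i \<in> carrier (FB q)) \<Longrightarrow> (\<lambda>i\<in>{..<a p}. x i) \<in> carrier (X p q)"
  by (auto simp: X_def dprod_simps)

lemma X_eqI:
  assumes "x \<in> carrier (X p q)" and "y \<in> carrier (X p q)" and "\<And>i. i < a p \<Longrightarrow> x i = y i"
  shows "x = y"
  by (rule PiE_ext[of _ "{..<a p}" "\<lambda>_. carrier (FB q)"]) (use assms in \<open>auto simp: X_def dprod_simps\<close>)

lemma Es_hom: "Es p q \<in> module_hom R (FB (Suc q)) (FB q)"
  unfolding Es_def[abs_def] using E module_hom_neg[OF FB FB E] by (cases "even p") simp_all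

lemma Es_zero: "u \<in> carrier (FB (Suc (Suc q))) \<Longrightarrow> Es p q (Es p (Suc q) u) = \<zero>\<^bsub>FB q\<^esub>"
proof -
  interpret FB: Module.module R "FB q" by (rule FB)
  assume u: "u \<in> carrier (FB (Suc (Suc q)))"
  show ?thesis
    using module_hom_a_inv[OF FB FB E module_hom_closed[OF E u]] E2[OF u] by (simp add: Es_def)
qed

lemma Es_eq_zero: "u \<in> carrier (FB (Suc q)) \<Longrightarrow> Es p q u = \<zero>\<^bsub>FB q\<^esub> \<longleftrightarrow> E q u = \<zero>\<^bsub>FB q\<^esub>"
proof -
  interpret FB: Module.module R "FB q" by (rule FB)
  assume u: "u \<in> carrier (FB (Suc q))"
  show ?thesis using module_hom_closed[OF E u] by (auto simp: Es_def)
qed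

lemma Es_image: "Es p q ` carrier (FB (Suc q)) = E q ` carrier (FB (Suc q))"
proof -
  interpret FB: Module.module R "FB (Suc q)" by (rule FB)
  have "Es p q u \<in> E q ` carrier (FB (Suc q))" if u: "u \<in> carrier (FB (Suc q))" for u
  proof (cases "even p")
    case False
    then have "Es p q u = E q (\<ominus>\<^bsub>FB (Suc q)\<^esub> u)" using module_hom_a_inv[OF FB FB E u] by (simp add: Es_def)
    then show ?thesis using FB.M.a_inv_closed[OF u] by (rule image_eqI)
  qed (use u in \<open>simp add: Es_def\<close>)
  moreover have "E q u \<in> Es p q ` carrier (FB (Suc q))" if u: "u \<in> carrier (FB (Suc q))" for u
  proof (cases "even p")
    case False
    then have "Es p q (\<ominus>\<^bsub>FB (Suc q)\<^esub> u) = E q (\<ominus>\<^bsub>FB (Suc q)\<^esub> (\<ominus>\<^bsub>FB (Suc q)\<^esub> u))"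
      using module_hom_a_inv[OF FB FB E FB.M.a_inv_closed[OF u]] by (simp add: Es_def)
    then have "E q u = Es p q (\<ominus>\<^bsub>FB (Suc q)\<^esub> u)" using FB.M.minus_minus[OF u] by simp
    then show ?thesis using FB.M.a_inv_closed[OF u] by (rule image_eqI)
  qed (use u in \<open>simp add: Es_def\<close>)
  ultimately show ?thesis by auto
qed

sublocale bicomplex R X DF EF
proof (rule bicomplex.intro)
  show modX: "Module.module R (X p q)" for p q unfolding X_def by (rule module_dprod[OF cr FB])
  show Dh: "DF p q \<in> module_hom R (X (Suc p) q) (X p q)" for p q
    unfolding X_def DF_def by (rule act_hom[OF cr _ _ D FB]) simp_all
  show Eh: "EF p q \<in> module_hom R (X p (Suc q)) (X p q)" for p q
    unfolding X_def EF_def[abs_def] by (rule dprod_hom) (rule module_hom_comp[OF pow_proj_hom Es_hom])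
  show "DF p q (DF (Suc p) q x) = \<zero>\<^bsub>X p q\<^esub>" if x: "x \<in> carrier (X (Suc (Suc p)) q)" for p q x
  proof -
    have x': "x \<in> carrier (pow_module {..<a (Suc (Suc p))} (FB q))" using x by (simp add: X_def)
    have "DF p q (DF (Suc p) q x) = act R (FB q) {..<a (Suc (Suc p))} {..<a p} (\<lambda>v. D p (D (Suc p) v)) x"
      unfolding DF_def by (rule act_comp[OF cr _ _ _ FB D D x']) simp_all
    also have "\<dots> = \<zero>\<^bsub>X p q\<^esub>"
      unfolding X_def by (rule act_zero[OF cr _ _ FB _ x']) (simp_all add: D2 free_gen_closed[OF cr])
    finally show ?thesis .
  qed
  show "EF p q (EF p (Suc q) x) = \<zero>\<^bsub>X p q\<^esub>" if x: "x \<in> carrier (X p (Suc (Suc q)))" for p q x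
    unfolding EF_def X_def dprod_simps by (rule restrict_ext) (use x in \<open>simp add: Es_zero X_mem\<close>)
  show "DF p q (EF (Suc p) q x) = \<ominus>\<^bsub>X p q\<^esub> EF p q (DF p (Suc q) x)" if x: "x \<in> carrier (X (Suc p) (Suc q))" for p q x
  proof -
    interpret X: Module.module R "X p q" by (rule modX)
    interpret FB: Module.module R "FB q" by (rule FB)
    have x': "x \<in> {..<a (Suc p)} \<rightarrow> carrier (FB (Suc q))" using X_mem[OF x] by auto
    \<comment> \<open>Naturality of the matrix \<open>D p\<close> moves the map
      \<open>Es (Suc p) q\<close> past it unchanged. The required minus sign appears because
      \<open>Es p q\<close> carries the opposite sign.\<close>
    have "DF p q (EF (Suc p) q x) = (\<lambda>y\<in>{..<a p}. Es (Suc p) q (DF p (Suc q) x y))"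
      unfolding DF_def EF_def by (rule act_natural[OF cr _ _ D FB FB Es_hom x']) simp_all
    moreover have Dx: "DF p (Suc q) x \<in> carrier (X p (Suc q))" by (rule module_hom_closed[OF Dh x])
    have "EF p q (DF p (Suc q) x) \<oplus>\<^bsub>X p q\<^esub> (\<lambda>y\<in>{..<a p}. Es (Suc p) q (DF p (Suc q) x y)) = \<zero>\<^bsub>X p q\<^esub>"
      unfolding X_def dprod_simps EF_def
    proof (rule restrict_ext)
      fix y assume y: "y \<in> {..<a p}"
      have "E q (DF p (Suc q) x y) \<in> carrier (FB q)"
        by (rule module_hom_closed[OF E X_mem[OF Dx]]) (use y in simp)
      then show "(\<lambda>i\<in>{..<a p}. Es p q (DF p (Suc q) x i)) y \<oplus>\<^bsub>FB q\<^esub> (\<lambda>y\<in>{..<a p}. Es (Suc p) q (DF p (Suc q) x y)) y = \<zero>\<^bsub>FB q\<^esub>"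
        using y by (simp add: Es_def FB.M.r_neg FB.M.l_neg)
    qed
    moreover have "EF p q (DF p (Suc q) x) \<in> carrier (X p q)" by (rule module_hom_closed[OF Eh Dx])
    moreover have "(\<lambda>y\<in>{..<a p}. Es (Suc p) q (DF p (Suc q) x y)) \<in> carrier (X p q)"
      by (rule XI) (rule module_hom_closed[OF Es_hom X_mem[OF Dx]])
    ultimately show ?thesis by (metis X.M.minus_equality X.M.a_comm)
  qed
qed

lemma EF_image:
  assumes x: "x \<in> carrier (X p q)" and im: "\<And>i. i < a p \<Longrightarrow> x i \<in> E q ` carrier (FB (Suc q))"
  shows "x \<in> EF p q ` carrier (X p (Suc q))"
proof -
  have "\<exists>w. w \<in> carrier (FB (Suc q)) \<and> x i = Es p q w" if "i < a p" for i
    using im[OF that] unfolding Es_image[of p q, symmetric] by auto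
  then obtain w where w: "\<And>i. i < a p \<Longrightarrow> w i \<in> carrier (FB (Suc q))" "\<And>i. i < a p \<Longrightarrow> x i = Es p q (w i)" by metis
  have wX: "(\<lambda>i\<in>{..<a p}. w i) \<in> carrier (X p (Suc q))" by (rule XI) (rule w)
  have "x = EF p q (\<lambda>i\<in>{..<a p}. w i)"
    by (rule X_eqI[OF x module_hom_closed[OF Ehom wX]]) (simp add: EF_def w(2))
  then show ?thesis using wX by blast
qed

lemma col_exactI:
  assumes "exact_seq R b E"
  shows col_exact
  unfolding col_exact_def
proof (intro allI impI)
  fix p q x assume x: "x \<in> carrier (X p (Suc q))" and z: "EF p q x = \<zero>\<^bsub>X p q\<^esub>"
  show "x \<in> EF p (Suc q) ` carrier (X p (Suc (Suc q)))"
  proof (rule EF_image[OF x])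
    fix i assume i: "i < a p"
    have "EF p q x i = \<zero>\<^bsub>FB q\<^esub>" using i unfolding z by (simp add: X_def dprod_simps)
    then have "E q (x i) = \<zero>\<^bsub>FB q\<^esub>" using i X_mem[OF x i] by (simp add: EF_def Es_eq_zero)
    then show "x i \<in> E (Suc q) ` carrier (FB (Suc (Suc q)))"
      using assms X_mem[OF x i] unfolding exact_seq_def by blast
  qed
qed

text \<open>A row consists of \<open>b q\<close> copies of the complex \<open>D\<close>, one for
  each coordinate of R^(b q), and \<open>act_free\<close> separates them.\<close>

lemma row_exactI:
  assumes "exact_seq R a D"
  shows row_exact
  unfolding row_exact_def
proof (intro allI impI)
  fix p q x assume x: "x \<in> carrier (X (Suc p) q)" and z: "DF p q x = \<zero>\<^bsub>X p q\<^esub>"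
  have x': "x \<in> carrier (pow_module {..<a (Suc p)} (FB q))" using x by (simp add: X_def)
  show "x \<in> DF (Suc p) q ` carrier (X (Suc (Suc p)) q)"
    unfolding DF_def X_def
  proof (rule act_free_image[OF cr _ _ _ D x'])
    fix l assume l: "l \<in> {..<b q}"
    have c: "(\<lambda>i\<in>{..<a (Suc p)}. x i l) \<in> carrier (FA (Suc p))"
      using X_mem[OF x] l by (auto simp: carrier_free)
    moreover have "D p (\<lambda>i\<in>{..<a (Suc p)}. x i l) = \<zero>\<^bsub>FA p\<^esub>"
    proof (rule PiE_ext[of _ "{..<a p}" "\<lambda>_. carrier R"])
      interpret cring R by (rule cr)
      show "D p (\<lambda>i\<in>{..<a (Suc p)}. x i l) \<in> {..<a p} \<rightarrow>\<^sub>E carrier R"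
        using module_hom_closed[OF D c] by (simp add: carrier_free)
      show "\<zero>\<^bsub>FA p\<^esub> \<in> {..<a p} \<rightarrow>\<^sub>E carrier R" by (auto simp: free_simps)
      fix i assume i: "i \<in> {..<a p}"
      have "D p (\<lambda>i\<in>{..<a (Suc p)}. x i l) i = DF p q x i l"
        unfolding DF_def by (rule act_free[OF cr _ _ D _ x' i l, symmetric]) simp_all
      also have "\<dots> = \<zero>\<^bsub>FA p\<^esub> i" using i l unfolding z by (simp add: X_def dprod_simps free_simps)
      finally show "D p (\<lambda>i\<in>{..<a (Suc p)}. x i l) i = \<zero>\<^bsub>FA p\<^esub> i" .
    qed
    ultimately show "(\<lambda>i\<in>{..<a (Suc p)}. x i l) \<in> D (Suc p) ` carrier (FA (Suc (Suc p)))"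
      using assms unfolding exact_seq_def by blast
  qed simp_all
qed

text \<open>Applying \<epsilon> to every row turns the cokernels of the maps \<open>EF p 0\<close>
  into the powers of N that occur in D \<otimes> N. The image of x is a cycle there, hence a
  boundary; after subtracting \<open>DF\<close> of a lift, x has its rows in the kernel of
  \<epsilon>, which is the image of \<open>E 0\<close>.\<close>

lemma bottom_exactI:
  assumes pr: "presents R b E N \<epsilon>" and ex: "act_exact R a D N n"
  shows "bottom_exact (Suc n)"
  unfolding bottom_exact_def
proof (intro ballI impI)
  fix x assume x: "x \<in> carrier (X (Suc n) 0)"
    and Dx: "\<forall>k. Suc n = Suc k \<longrightarrow> DF k 0 x \<in> EF k 0 ` carrier (X k 1)"
  have N: "Module.module R N" and \<epsilon>: "\<epsilon> \<in> module_hom R (FB 0) N" and surj: "\<epsilon> ` carrier (FB 0) = carrier N"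
    and ker: "a_kernel (FB 0) N \<epsilon> = E 0 ` carrier (FB (Suc 0))" using pr by (auto simp: presents_def)
  interpret N: Module.module R N by (rule N)
  interpret X: Module.module R "X (Suc n) 0" by (rule modX)
  interpret FB: Module.module R "FB 0" by (rule FB)
  have act\<epsilon>: "act R N {..<a (Suc p)} {..<a p} (D p) (\<lambda>i\<in>{..<a (Suc p)}. \<epsilon> (y i)) = (\<lambda>i\<in>{..<a p}. \<epsilon> (DF p 0 y i))"
    if "y \<in> carrier (X (Suc p) 0)" for p y
    unfolding DF_def by (rule act_natural[OF cr _ _ D FB N \<epsilon>]) (use X_mem[OF that] in auto)
  obtain z where z: "z \<in> carrier (X n (Suc 0))" "DF n 0 x = EF n 0 z" using Dx by auto
  let ?v = "\<lambda>i\<in>{..<a (Suc n)}. \<epsilon> (x i)"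
  have v: "?v \<in> carrier (pow_module {..<a (Suc n)} N)"
    using X_mem[OF x] module_hom_closed[OF \<epsilon>] by (auto simp: dprod_simps)
  have "Es n 0 w \<in> a_kernel (FB 0) N \<epsilon>" if "w \<in> carrier (FB (Suc 0))" for w
    unfolding ker Es_image[of n 0, symmetric] using that by blast
  then have "\<epsilon> (Es n 0 w) = \<zero>\<^bsub>N\<^esub>" if "w \<in> carrier (FB (Suc 0))" for w using that by (simp add: a_kernel_eq)
  then have "act R N {..<a (Suc n)} {..<a n} (D n) ?v = \<zero>\<^bsub>pow_module {..<a n} N\<^esub>"
    unfolding act\<epsilon>[OF x] z(2) EF_def dprod_simps by (intro restrict_ext) (use X_mem[OF z(1)] in simp)
  then obtain w where w: "w \<in> carrier (pow_module {..<a (Suc (Suc n))} N)"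
    "?v = act R N {..<a (Suc (Suc n))} {..<a (Suc n)} (D (Suc n)) w"
    using ex v unfolding act_exact_def by blast
  have "\<exists>y. y \<in> carrier (FB 0) \<and> \<epsilon> y = w i" if "i < a (Suc (Suc n))" for i
  proof -
    have "w i \<in> \<epsilon> ` carrier (FB 0)" unfolding surj using w(1) that by (auto simp: dprod_simps)
    then show ?thesis by auto
  qed
  then obtain y where y: "\<And>i. i < a (Suc (Suc n)) \<Longrightarrow> y i \<in> carrier (FB 0)"
    "\<And>i. i < a (Suc (Suc n)) \<Longrightarrow> \<epsilon> (y i) = w i" by metis
  let ?y = "\<lambda>i\<in>{..<a (Suc (Suc n))}. y i"
  have yX: "?y \<in> carrier (X (Suc (Suc n)) 0)" by (rule XI) (rule y)
  have "w = (\<lambda>i\<in>{..<a (Suc (Suc n))}. \<epsilon> (?y i))"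
    by (rule PiE_ext[of _ "{..<a (Suc (Suc n))}" "\<lambda>_. carrier N"])
      (use w(1) y module_hom_closed[OF \<epsilon>] in \<open>auto simp: dprod_simps\<close>)
  then have eq: "?v = (\<lambda>i\<in>{..<a (Suc n)}. \<epsilon> (DF (Suc n) 0 ?y i))" using w(2) act\<epsilon>[OF yX] by simp
  have DyX: "DF (Suc n) 0 ?y \<in> carrier (X (Suc n) 0)" by (rule module_hom_closed[OF Dhom yX])
  have "x \<ominus>\<^bsub>X (Suc n) 0\<^esub> DF (Suc n) 0 ?y \<in> EF (Suc n) 0 ` carrier (X (Suc n) (Suc 0))"
  proof (rule EF_image)
    show "x \<ominus>\<^bsub>X (Suc n) 0\<^esub> DF (Suc n) 0 ?y \<in> carrier (X (Suc n) 0)" using x DyX by simp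
    fix i assume i: "i < a (Suc n)"
    have "(\<lambda>u. u i) \<in> module_hom R (X (Suc n) 0) (FB 0)" unfolding X_def by (rule pow_proj_hom) (use i in simp)
    from module_hom_minus[OF modX FB this x DyX]
    have c: "(x \<ominus>\<^bsub>X (Suc n) 0\<^esub> DF (Suc n) 0 ?y) i = x i \<ominus>\<^bsub>FB 0\<^esub> DF (Suc n) 0 ?y i" .
    have "\<epsilon> (x i) = \<epsilon> (DF (Suc n) 0 ?y i)" using fun_cong[OF eq, of i] i by simp
    then have "\<epsilon> (x i \<ominus>\<^bsub>FB 0\<^esub> DF (Suc n) 0 ?y i) = \<zero>\<^bsub>N\<^esub>"
      using module_hom_minus[OF FB N \<epsilon> X_mem[OF x i] X_mem[OF DyX i]] module_hom_closed[OF \<epsilon> X_mem[OF DyX i]]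
      by (simp add: N.M.diff_eq_zero_iff)
    then show "(x \<ominus>\<^bsub>X (Suc n) 0\<^esub> DF (Suc n) 0 ?y) i \<in> E 0 ` carrier (FB (Suc 0))"
      unfolding c ker[symmetric] using X_mem[OF x i] X_mem[OF DyX i] by (simp add: a_kernel_eq)
  qed
  then obtain t where t: "t \<in> carrier (X (Suc n) (Suc 0))" "x \<ominus>\<^bsub>X (Suc n) 0\<^esub> DF (Suc n) 0 ?y = EF (Suc n) 0 t" by blast
  have "x = DF (Suc n) 0 ?y \<oplus>\<^bsub>X (Suc n) 0\<^esub> (x \<ominus>\<^bsub>X (Suc n) 0\<^esub> DF (Suc n) 0 ?y)"
    using x DyX by (simp add: a_minus_def X.M.a_lcomm X.M.r_neg)
  then show "\<exists>y\<in>carrier (X (Suc (Suc n)) 0). \<exists>z\<in>carrier (X (Suc n) 1).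
      x = DF (Suc n) 0 y \<oplus>\<^bsub>X (Suc n) 0\<^esub> EF (Suc n) 0 z"
    using t yX unfolding One_nat_def by metis
qed

section \<open>The left edge and its augmentation to M\<close>

context
  fixes M :: "('a, 'b, 'k) module_scheme" and \<epsilon> :: "(nat \<Rightarrow> 'a) \<Rightarrow> 'b"
  assumes pr: "presents R a D M \<epsilon>"
begin

text \<open>The map \<epsilon> \<otimes> R^(b q), applied to the columns of x. It identifies the
  cokernel of \<open>DF 0 q\<close> with M^(b q), as the next lemmas show.\<close>

definition left_aug :: "nat \<Rightarrow> (nat \<Rightarrow> nat \<Rightarrow> 'a) \<Rightarrow> nat \<Rightarrow> 'b" where
  "left_aug q x = (\<lambda>l\<in>{..<b q}. \<epsilon> (\<lambda>i\<in>{..<a 0}. x i l))"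

lemma presents_module: "Module.module R M" and presents_hom: "\<epsilon> \<in> module_hom R (FA 0) M"
  and presents_surj: "\<epsilon> ` carrier (FA 0) = carrier M"
  and presents_ker: "a_kernel (FA 0) M \<epsilon> = D 0 ` carrier (FA (Suc 0))"
  using pr by (auto simp: presents_def)

lemma column_closed: "x \<in> carrier (X p q) \<Longrightarrow> l < b q \<Longrightarrow> (\<lambda>i\<in>{..<a p}. x i l) \<in> carrier (FA p)"
  using X_mem[of x p q] by (auto simp: carrier_free)

lemma left_aug_hom: "left_aug q \<in> module_hom R (X 0 q) (pow_module {..<b q} M)"
  unfolding left_aug_def[abs_def]
proof (rule dprod_hom, rule module_hom_comp[OF _ presents_hom])
  fix l assume l: "l \<in> {..<b q}"
  show "(\<lambda>x. \<lambda>i\<in>{..<a 0}. x i l) \<in> module_hom R (X 0 q) (FA 0)"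
    unfolding X_def free_module_eq_dprod[OF finite_lessThan[of "a 0"]]
    by (rule dprod_hom) (rule module_hom_comp[OF pow_proj_hom free_proj_hom[OF finite_lessThan l]])
qed

lemma left_aug_surj:
  assumes v: "v \<in> carrier (pow_module {..<b q} M)"
  shows "\<exists>x\<in>carrier (X 0 q). left_aug q x = v"
proof -
  have "\<exists>y. y \<in> carrier (FA 0) \<and> \<epsilon> y = v l" if "l < b q" for l
  proof -
    have "v l \<in> \<epsilon> ` carrier (FA 0)" unfolding presents_surj using v that by (auto simp: dprod_simps)
    then show ?thesis by auto
  qed
  then obtain y where y: "\<And>l. l < b q \<Longrightarrow> y l \<in> carrier (FA 0)" "\<And>l. l < b q \<Longrightarrow> \<epsilon> (y l) = v l" by metis
  let ?x = "\<lambda>i\<in>{..<a 0}. \<lambda>l\<in>{..<b q}. y l i"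
  have "?x \<in> carrier (X 0 q)" by (rule XI) (use y free_mem in \<open>auto simp: carrier_free\<close>)
  moreover have "left_aug q ?x = v"
  proof (rule PiE_ext[of _ "{..<b q}" "\<lambda>_. carrier M"])
    show "v \<in> {..<b q} \<rightarrow>\<^sub>E carrier M" using v by (simp add: dprod_simps)
    show "left_aug q ?x \<in> {..<b q} \<rightarrow>\<^sub>E carrier M"
      using module_hom_closed[OF left_aug_hom \<open>?x \<in> _\<close>] by (simp add: dprod_simps)
    fix l assume l: "l \<in> {..<b q}"
    then have yl: "y l \<in> {..<a 0} \<rightarrow>\<^sub>E carrier R" using y(1)[of l] by (simp add: carrier_free)
    have "(\<lambda>i\<in>{..<a 0}. ?x i l) = (\<lambda>i\<in>{..<a 0}. y l i)" by (rule restrict_ext) (use l in simp)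
    also have "\<dots> = y l" using yl by (simp add: PiE_restrict)
    finally have "(\<lambda>i\<in>{..<a 0}. ?x i l) = y l" .
    then show "left_aug q ?x l = v l" using l y(2)[of l] by (simp add: left_aug_def)
  qed
  ultimately show ?thesis by blast
qed

lemma left_aug_ker:
  assumes x: "x \<in> carrier (X 0 q)" and z: "left_aug q x = \<zero>\<^bsub>pow_module {..<b q} M\<^esub>"
  shows "x \<in> DF 0 q ` carrier (X (Suc 0) q)"
proof -
  have x': "x \<in> carrier (pow_module {..<a 0} (FB q))" using x by (simp add: X_def)
  show ?thesis unfolding DF_def X_def
  proof (rule act_free_image[OF cr _ _ _ D x'])
    fix l assume l: "l \<in> {..<b q}"
    have "\<epsilon> (\<lambda>i\<in>{..<a 0}. x i l) = \<zero>\<^bsub>M\<^esub>"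
      using fun_cong[OF z, of l] l by (simp add: left_aug_def dprod_simps)
    then show "(\<lambda>i\<in>{..<a 0}. x i l) \<in> D 0 ` carrier (FA (Suc 0))"
      unfolding presents_ker[symmetric] using column_closed[OF x] l by (simp add: a_kernel_eq)
  qed simp_all
qed

lemma left_aug_DF:
  assumes w: "w \<in> carrier (X (Suc 0) q)"
  shows "left_aug q (DF 0 q w) = \<zero>\<^bsub>pow_module {..<b q} M\<^esub>"
  unfolding left_aug_def dprod_simps
proof (rule restrict_ext)
  fix l assume l: "l \<in> {..<b q}"
  have c: "(\<lambda>i\<in>{..<a (Suc 0)}. w i l) \<in> carrier (FA (Suc 0))" using column_closed[OF w] l by simp
  have w': "w \<in> carrier (pow_module {..<a (Suc 0)} (FB q))" using w by (simp add: X_def)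
  have "(\<lambda>i\<in>{..<a 0}. DF 0 q w i l) = D 0 (\<lambda>i\<in>{..<a (Suc 0)}. w i l)"
  proof (rule PiE_ext[of _ "{..<a 0}" "\<lambda>_. carrier R"])
    show "D 0 (\<lambda>i\<in>{..<a (Suc 0)}. w i l) \<in> {..<a 0} \<rightarrow>\<^sub>E carrier R"
      using module_hom_closed[OF D c] by (simp add: carrier_free)
    show "(\<lambda>i\<in>{..<a 0}. DF 0 q w i l) \<in> {..<a 0} \<rightarrow>\<^sub>E carrier R"
      using column_closed[OF module_hom_closed[OF Dhom w]] l by (simp add: carrier_free)
    show "(\<lambda>i\<in>{..<a 0}. DF 0 q w i l) i = D 0 (\<lambda>i\<in>{..<a (Suc 0)}. w i l) i" if "i \<in> {..<a 0}" for i
      using that act_free[OF cr finite_lessThan finite_lessThan D finite_lessThan w' that l] by (simp add: DF_def)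
  qed
  moreover have "D 0 (\<lambda>i\<in>{..<a (Suc 0)}. w i l) \<in> a_kernel (FA 0) M \<epsilon>" unfolding presents_ker using c by blast
  ultimately show "\<epsilon> (\<lambda>i\<in>{..<a 0}. DF 0 q w i l) = \<zero>\<^bsub>M\<^esub>" by (simp add: a_kernel_eq)
qed

text \<open>Naturality of the matrix \<open>E k\<close> with respect to \<epsilon>, applied to the
  transpose of x: \<open>E\<close> works on rows while \<open>left_aug\<close> collects columns. For
  p = 0 the vertical map has sign +1.\<close>

lemma left_aug_EF:
  assumes x: "x \<in> carrier (X 0 (Suc k))"
  shows "left_aug k (EF 0 k x) = act R M {..<b (Suc k)} {..<b k} (E k) (left_aug (Suc k) x)"
proof -
  let ?xt = "\<lambda>l\<in>{..<b (Suc k)}. \<lambda>i\<in>{..<a 0}. x i l"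
  have xt: "?xt \<in> carrier (pow_module {..<b (Suc k)} (FA 0))"
    unfolding dprod_simps by (intro restrict_PiE_iff[THEN iffD2] ballI column_closed[OF x]) simp
  have "left_aug (Suc k) x = (\<lambda>l\<in>{..<b (Suc k)}. \<epsilon> (?xt l))" unfolding left_aug_def by (rule restrict_ext) simp
  then have "act R M {..<b (Suc k)} {..<b k} (E k) (left_aug (Suc k) x) =
      (\<lambda>y\<in>{..<b k}. \<epsilon> (act R (FA 0) {..<b (Suc k)} {..<b k} (E k) ?xt y))"
    using act_natural[OF cr finite_lessThan finite_lessThan E FA presents_module presents_hom, of ?xt k] xt
    by (simp add: dprod_simps PiE_def)
  also have "\<dots> = left_aug k (EF 0 k x)" unfolding left_aug_def
  proof (rule restrict_ext)
    fix y assume y: "y \<in> {..<b k}"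
    have "act R (FA 0) {..<b (Suc k)} {..<b k} (E k) ?xt y = (\<lambda>i\<in>{..<a 0}. EF 0 k x i y)"
    proof (rule PiE_ext[of _ "{..<a 0}" "\<lambda>_. carrier R"])
      show "act R (FA 0) {..<b (Suc k)} {..<b k} (E k) ?xt y \<in> {..<a 0} \<rightarrow>\<^sub>E carrier R"
        using module_hom_closed[OF act_hom[OF cr finite_lessThan finite_lessThan E FA] xt] y
        by (auto simp: dprod_simps carrier_free)
      show "(\<lambda>i\<in>{..<a 0}. EF 0 k x i y) \<in> {..<a 0} \<rightarrow>\<^sub>E carrier R"
        using column_closed[OF module_hom_closed[OF Ehom x]] y by (simp add: carrier_free)
      fix i assume i: "i \<in> {..<a 0}"
      have "act R (FA 0) {..<b (Suc k)} {..<b k} (E k) ?xt y i = E k (\<lambda>l\<in>{..<b (Suc k)}. ?xt l i) y"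
        by (rule act_free[OF cr _ _ E _ xt y i]) simp_all
      also have "(\<lambda>l\<in>{..<b (Suc k)}. ?xt l i) = (\<lambda>l\<in>{..<b (Suc k)}. x i l)"
        by (rule restrict_ext) (use i in simp)
      also have "\<dots> = x i" using X_mem[OF x, of i] i by (intro PiE_restrict) (simp add: carrier_free)
      finally show "act R (FA 0) {..<b (Suc k)} {..<b k} (E k) ?xt y i = (\<lambda>i\<in>{..<a 0}. EF 0 k x i y) i"
        using i by (simp only: EF_def Es_def restrict_apply' even_zero if_True)
    qed
    then show "\<epsilon> (act R (FA 0) {..<b (Suc k)} {..<b k} (E k) ?xt y) = \<epsilon> (\<lambda>i\<in>{..<a 0}. EF 0 k x i y)" by simp
  qed
  finally show ?thesis by simp
qed

text \<open>A cycle in the power of M is lifted along \<open>left_aug\<close>. Exactness of the left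
  edge splits the lift into a \<open>DF\<close> part, which the augmentation kills, and an
  \<open>EF\<close> part, which becomes the desired boundary.\<close>

lemma act_exactI:
  assumes left: "left_exact (Suc k)"
  shows "act_exact R b E M k"
  unfolding act_exact_def
proof (intro ballI impI)
  fix v assume v: "v \<in> carrier (pow_module {..<b (Suc k)} M)"
    and z: "act R M {..<b (Suc k)} {..<b k} (E k) v = \<zero>\<^bsub>pow_module {..<b k} M\<^esub>"
  obtain x where x: "x \<in> carrier (X 0 (Suc k))" "left_aug (Suc k) x = v" using left_aug_surj[OF v] by (elim bexE)
  have "left_aug k (EF 0 k x) = \<zero>\<^bsub>pow_module {..<b k} M\<^esub>" using left_aug_EF[OF x(1)] x(2) z by simp
  from left_aug_ker[OF module_hom_closed[OF Ehom x(1)] this]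
  have "\<forall>k'. Suc k = Suc k' \<longrightarrow> EF 0 k' x \<in> DF 0 k' ` carrier (X 1 k')" by simp
  then obtain y w where y: "y \<in> carrier (X 0 (Suc (Suc k)))" and w: "w \<in> carrier (X (Suc 0) (Suc k))"
    and eq: "x = DF 0 (Suc k) w \<oplus>\<^bsub>X 0 (Suc k)\<^esub> EF 0 (Suc k) y"
    using left x(1) unfolding left_exact_def One_nat_def by blast
  interpret P: Module.module R "pow_module {..<b (Suc k)} M" by (rule module_dprod[OF cr presents_module])
  have "v = left_aug (Suc k) (DF 0 (Suc k) w) \<oplus>\<^bsub>pow_module {..<b (Suc k)} M\<^esub> left_aug (Suc k) (EF 0 (Suc k) y)"
    unfolding x(2)[symmetric] using module_hom_add[OF left_aug_hom module_hom_closed[OF Dhom w] module_hom_closed[OF Ehom y]]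
    by (simp add: eq[symmetric])
  also have "\<dots> = left_aug (Suc k) (EF 0 (Suc k) y)"
    unfolding left_aug_DF[OF w] by (rule P.M.l_zero) (rule module_hom_closed[OF left_aug_hom module_hom_closed[OF Ehom y]])
  finally have "v = act R M {..<b (Suc (Suc k))} {..<b (Suc k)} (E (Suc k)) (left_aug (Suc (Suc k)) y)"
    unfolding left_aug_EF[OF y] .
  then show "v \<in> act R M {..<b (Suc (Suc k))} {..<b (Suc k)} (E (Suc k)) ` carrier (pow_module {..<b (Suc (Suc k))} M)"
    using module_hom_closed[OF left_aug_hom y] by blast
qed

text \<open>Subtracting a lift of the bounding element leaves something in the kernel of the
  augmentation, which is the image of \<open>DF\<close>. Stated for every \<open>q\<close>, since
  degree 0 is needed besides \<open>left_exactI\<close>.\<close>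

lemma left_aug_image:
  assumes x: "x \<in> carrier (X 0 q)"
    and im: "left_aug q x \<in> act R M {..<b (Suc q)} {..<b q} (E q) ` carrier (pow_module {..<b (Suc q)} M)"
  shows "\<exists>y\<in>carrier (X 0 (Suc q)). \<exists>z\<in>carrier (X (Suc 0) q). x = DF 0 q z \<oplus>\<^bsub>X 0 q\<^esub> EF 0 q y"
proof -
  interpret X: Module.module R "X 0 q" by (rule modX)
  interpret P: Module.module R "pow_module {..<b q} M" by (rule module_dprod[OF cr presents_module])
  obtain w where w: "w \<in> carrier (pow_module {..<b (Suc q)} M)"
    "left_aug q x = act R M {..<b (Suc q)} {..<b q} (E q) w" using im by blast
  obtain y where y: "y \<in> carrier (X 0 (Suc q))" "left_aug (Suc q) y = w" using left_aug_surj[OF w(1)] by blast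
  have Ey: "EF 0 q y \<in> carrier (X 0 q)" by (rule module_hom_closed[OF Ehom y(1)])
  have "left_aug q (x \<ominus>\<^bsub>X 0 q\<^esub> EF 0 q y) = \<zero>\<^bsub>pow_module {..<b q} M\<^esub>"
    using module_hom_minus[OF modX P.module_axioms left_aug_hom x Ey] left_aug_EF[OF y(1)] w(2) y(2)
      module_hom_closed[OF left_aug_hom x] by (simp add: P.M.diff_eq_zero_iff)
  from left_aug_ker[OF _ this] obtain z where z: "z \<in> carrier (X (Suc 0) q)"
    "x \<ominus>\<^bsub>X 0 q\<^esub> EF 0 q y = DF 0 q z" using x Ey by auto
  have "x = (x \<ominus>\<^bsub>X 0 q\<^esub> EF 0 q y) \<oplus>\<^bsub>X 0 q\<^esub> EF 0 q y"
    using x Ey by (simp add: a_minus_def X.M.a_assoc X.M.l_neg)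
  then show ?thesis using y(1) z by metis
qed

lemma left_exactI:
  assumes ex: "act_exact R b E M k"
  shows "left_exact (Suc k)"
  unfolding left_exact_def One_nat_def
proof (intro ballI impI)
  fix x assume x: "x \<in> carrier (X 0 (Suc k))"
    and "\<forall>k'. Suc k = Suc k' \<longrightarrow> EF 0 k' x \<in> DF 0 k' ` carrier (X (Suc 0) k')"
  then obtain w where w: "w \<in> carrier (X (Suc 0) k)" "EF 0 k x = DF 0 k w" by auto
  have "act R M {..<b (Suc k)} {..<b k} (E k) (left_aug (Suc k) x) = \<zero>\<^bsub>pow_module {..<b k} M\<^esub>"
    using left_aug_EF[OF x] left_aug_DF[OF w(1)] w(2) by simp
  then have "left_aug (Suc k) x \<in> act R M {..<b (Suc (Suc k))} {..<b (Suc k)} (E (Suc k)) `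
      carrier (pow_module {..<b (Suc (Suc k))} M)"
    using ex module_hom_closed[OF left_aug_hom x] unfolding act_exact_def by blast
  from left_aug_image[OF x this]
  show "\<exists>y\<in>carrier (X 0 (Suc (Suc k))). \<exists>z\<in>carrier (X (Suc 0) (Suc k)).
      x = DF 0 (Suc k) z \<oplus>\<^bsub>X 0 (Suc k)\<^esub> EF 0 (Suc k) y" .
qed

end

end

lemma free_resolutionD:
  assumes M: "Module.module R M" and F: "free_resolution R M F"
  shows free_resolution_dif: "dif F i \<in> module_hom R (res_term R F (Suc i)) (res_term R F i)"
    and free_resolution_exact: "exact_seq R (rk F) (dif F)"
    and free_resolution_presents: "presents R (rk F) (dif F) M (aug F)"
    and free_resolution_dif2: "u \<in> carrier (res_term R F (Suc (Suc i))) \<Longrightarrow>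
      dif F i (dif F (Suc i) u) = \<zero>\<^bsub>res_term R F i\<^esub>"
proof -
  show "dif F i \<in> module_hom R (res_term R F (Suc i)) (res_term R F i)" using F by (simp add: free_resolution_def)
  have im: "dif F i ` carrier (res_term R F (Suc i)) = res_kernel R M F i" for i using F by (simp add: free_resolution_def)
  have im': "dif F (Suc i) ` carrier (res_term R F (Suc (Suc i))) = a_kernel (res_term R F (Suc i)) (res_term R F i) (dif F i)" for i
    using im[of "Suc i"] by (simp add: res_kernel_def)
  show "exact_seq R (rk F) (dif F)" unfolding exact_seq_def using im' by (auto simp: a_kernel_eq)
  show "presents R (rk F) (dif F) M (aug F)"
    unfolding presents_def using M F im[of 0] by (simp add: free_resolution_def res_kernel_def)
  assume "u \<in> carrier (res_term R F (Suc (Suc i)))"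
  then have "dif F (Suc i) u \<in> a_kernel (res_term R F (Suc i)) (res_term R F i) (dif F i)" using im'[of i] by blast
  then show "dif F i (dif F (Suc i) u) = \<zero>\<^bsub>res_term R F i\<^esub>" by (simp add: a_kernel_eq)
qed

lemma tensor_bicomplex_resolutions:
  assumes R: "cring R" and M: "Module.module R M" and F: "free_resolution R M F"
    and N: "Module.module R N" and G: "free_resolution R N G"
  shows "tensor_bicomplex R (rk F) (rk G) (dif F) (dif G)"
    and "tensor_bicomplex R (rk F) (\<lambda>q. rk G (Suc q)) (dif F) (\<lambda>q. dif G (Suc q))"
  by (simp_all add: tensor_bicomplex_def R free_resolution_dif[OF M F] free_resolution_dif[OF N G]
      free_resolution_dif2[OF M F] free_resolution_dif2[OF N G])

text \<open>Balancing: \<open>Tor\<close> computed from a resolution of \<open>M\<close> is also computed by a resolution of \<open>N\<close>.\<close>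

lemma Tor_zero_act_exact:
  assumes R: "cring R" and M: "Module.module R M" and ex: "\<exists>F. free_resolution R M F"
    and N: "Module.module R N" and G: "free_resolution R N G"
    and Tor: "zero_module (Tor R M N (Suc k))"
  shows "act_exact R (rk G) (dif G) M k"
proof -
  define F where "F = (SOME F. free_resolution R M F)"
  have F: "free_resolution R M F" unfolding F_def by (rule someI_ex[OF ex])
  interpret tensor_bicomplex R "rk F" "rk G" "dif F" "dif G"
    by (rule tensor_bicomplex_resolutions[OF R M F N G])
  have z: "zero_module (tensor_homology R F N (Suc k))" using Tor by (simp add: Tor_def F_def)
  have "act_exact R (rk F) (dif F) N k"
    unfolding act_exact_def
    using tensor_homology_zero[OF R N, where F = F, OF free_resolution_dif[OF M F] z] by blast
  from bottom_exactI[OF free_resolution_presents[OF N G] this]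
  have "tot_exact (Suc k)" by (rule tot_exact_if_bottom_exact[OF col_exactI[OF free_resolution_exact[OF N G]]])
  from left_exact_if_tot_exact[OF row_exactI[OF free_resolution_exact[OF M F]] this]
  show ?thesis by (rule act_exactI[OF free_resolution_presents[OF M F]])
qed

section \<open>Syzygies with a free reduction\<close>

text \<open>Finite sums depend only on the additive part of a record; this moves them between
  modules with different scalars and between the ring and its regular module.\<close>

lemma finsum_transfer:
  assumes "carrier M = carrier N" and "\<zero>\<^bsub>M\<^esub> = \<zero>\<^bsub>N\<^esub>" and "ring.add M = ring.add N"
  shows "finsum M f A = finsum N f A"
  using assms by (simp add: finsum_def finprod_def)

text \<open>A basis of a reduction is not known to be finite beforehand, so the expansion in
  generators runs over the support of \<open>u\<close>.\<close>

lemma free_hom_supp: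
  assumes R: "cring R" and P: "Module.module R P" and h: "h \<in> module_hom R (free_module R X) P"
    and u: "u \<in> carrier (free_module R X)"
  shows "h u = (\<Oplus>\<^bsub>P\<^esub>x\<in>{x \<in> X. u x \<noteq> \<zero>\<^bsub>R\<^esub>}. u x \<odot>\<^bsub>P\<^esub> h (free_gen R X x))"
proof -
  let ?F = "free_module R X"
  let ?A = "{x \<in> X. u x \<noteq> \<zero>\<^bsub>R\<^esub>}"
  interpret cring R by fact
  interpret F: Module.module R ?F by (rule module_free_module[OF R])
  have A: "finite ?A" using u by (simp add: free_module_def)
  have ux: "u x \<in> carrier R" if "x \<in> X" for x using u that by (auto simp: free_module_def)
  have g: "free_gen R X x \<in> carrier ?F" if "x \<in> X" for x by (rule free_gen_in[OF R that])
  have fs: "(\<lambda>x. u x \<odot>\<^bsub>?F\<^esub> free_gen R X x) \<in> B \<rightarrow> carrier ?F" if "B \<subseteq> X" for B using ux g that by auto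
  let ?S = "\<lambda>B. \<Oplus>\<^bsub>?F\<^esub>x\<in>B. u x \<odot>\<^bsub>?F\<^esub> free_gen R X x"
  have "?S B = (\<lambda>y\<in>X. if y \<in> B then u y else \<zero>\<^bsub>R\<^esub>)" if "finite B" "B \<subseteq> X" for B
    using that
  proof (induction B)
    case empty
    then show ?case by (simp add: free_simps)
  next
    case (insert b B)
    have "?S (insert b B) = u b \<odot>\<^bsub>?F\<^esub> free_gen R X b \<oplus>\<^bsub>?F\<^esub> ?S B"
      using insert fs[of B] ux g by (intro F.M.finsum_insert) auto
    also have "?S B = (\<lambda>y\<in>X. if y \<in> B then u y else \<zero>\<^bsub>R\<^esub>)"
      by (rule insert.IH) (use insert.prems in blast)
    also have "u b \<odot>\<^bsub>?F\<^esub> free_gen R X b \<oplus>\<^bsub>?F\<^esub> \<dots> = (\<lambda>y\<in>X. if y \<in> insert b B then u y else \<zero>\<^bsub>R\<^esub>)"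
      unfolding free_simps by (rule restrict_ext) (use insert.hyps insert.prems ux in \<open>auto simp: free_gen_def\<close>)
    finally show ?case .
  qed
  from this[OF A] have "?S ?A = (\<lambda>y\<in>X. u y)" by (auto intro!: restrict_ext)
  also have "\<dots> = u" using u by (intro PiE_restrict) (auto simp: free_module_def)
  finally have "h u = h (?S ?A)" by simp
  also have "\<dots> = (\<Oplus>\<^bsub>P\<^esub>x\<in>?A. h (u x \<odot>\<^bsub>?F\<^esub> free_gen R X x))"
    by (rule module_hom_finsum[OF F.module_axioms P h A fs]) auto
  also have "\<dots> = (\<Oplus>\<^bsub>P\<^esub>x\<in>?A. u x \<odot>\<^bsub>P\<^esub> h (free_gen R X x))"
  proof -
    interpret P: Module.module R P by fact
    show ?thesis
      by (intro P.M.finsum_cong') (use ux g in \<open>auto simp: module_hom_smult[OF h] module_hom_closed[OF h]\<close>)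
  qed
  finally show ?thesis .
qed

text \<open>A coset of I acts on L/IL through any one of its members, so a basis over R/I can be
  described with coefficients in R: spanning is unchanged, and a coefficient that vanishes over R/I
  is one that lies in I.\<close>

lemma ideal_freeD:
  assumes R: "cring R" and I: "ideal I R" and L: "Module.module R L" and fr: "ideal_free R I L"
  defines "Q \<equiv> quot_module L (ideal_smult R I L)"
  obtains B where "B \<subseteq> carrier Q" and "module_span R Q B = carrier Q"
    and "\<And>A a. finite A \<Longrightarrow> A \<subseteq> B \<Longrightarrow> a \<in> A \<rightarrow> carrier R \<Longrightarrow> (\<Oplus>\<^bsub>Q\<^esub>x\<in>A. a x \<odot>\<^bsub>Q\<^esub> x) = \<zero>\<^bsub>Q\<^esub> \<Longrightarrow> \<forall>x\<in>A. a x \<in> I"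
proof -
  interpret cring R by fact
  interpret L: Module.module R L by fact
  interpret I: ideal I R by fact
  let ?H = "ideal_smult R I L"
  let ?T = "reduction R I L"
  let ?RI = "R Quot I"
  have genI: "{a \<odot>\<^bsub>L\<^esub> x | a x. a \<in> I \<and> x \<in> carrier L} \<subseteq> carrier L" by (auto simp: I.a_subset[THEN subsetD])
  have H: "submodule ?H R L" unfolding ideal_smult_def by (rule span_submodule[OF L genI])
  have QM: "Module.module R Q" unfolding Q_def by (rule module_quot[OF L H])
  interpret Q: Module.module R Q by (rule QM)
  have T: "carrier ?T = carrier Q" "\<zero>\<^bsub>?T\<^esub> = \<zero>\<^bsub>Q\<^esub>" "ring.add ?T = ring.add Q"
    by (simp_all add: reduction_def Q_def)
  have sm: "(I +>\<^bsub>R\<^esub> a) \<odot>\<^bsub>?T\<^esub> X = a \<odot>\<^bsub>Q\<^esub> X" if a: "a \<in> carrier R" and X: "X \<in> carrier Q" for a X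
  proof -
    obtain x where x: "x \<in> carrier L" "X = ?H +>\<^bsub>L\<^esub> x" using X unfolding Q_def quot_module_carrier by blast
    have const: "a' \<odot>\<^bsub>Q\<^esub> X = a \<odot>\<^bsub>Q\<^esub> X" if a': "a' \<in> I +>\<^bsub>R\<^esub> a" for a'
    proof -
      obtain i where i: "i \<in> I" "a' = i \<oplus>\<^bsub>R\<^esub> a" using a' by (auto simp: a_r_coset_def')
      have ic: "i \<in> carrier R" using i(1) I.a_subset by auto
      have "i \<odot>\<^bsub>L\<^esub> x \<in> ?H" unfolding ideal_smult_def by (rule subsetD[OF span_incl]) (use i x in auto)
      then have "i \<odot>\<^bsub>Q\<^esub> X = \<zero>\<^bsub>Q\<^esub>"
        using quot_proj_eq_zero[OF L H, of "i \<odot>\<^bsub>L\<^esub> x"] module_hom_smult[OF quot_proj_hom[OF L H] ic x(1)] x ic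
        by (simp add: Q_def)
      then show ?thesis using i ic a X by (simp add: Q.smult_l_distr)
    qed
    have "(\<Union>a'\<in>I +>\<^bsub>R\<^esub> a. a' \<odot>\<^bsub>Q\<^esub> X) = a \<odot>\<^bsub>Q\<^esub> X"
      by (rule UN_constant_eq[OF I.a_rcos_self[OF a] ballI[OF const]])
    then show ?thesis by (simp add: reduction_def Q_def)
  qed
  have RIc: "carrier ?RI = {I +>\<^bsub>R\<^esub> a | a. a \<in> carrier R}" by (auto simp: FactRing_def A_RCOSETS_def')
  obtain B where B: "B \<subseteq> carrier Q" and li: "lin_indep ?RI ?T B" and sp: "module_span ?RI ?T B = carrier Q"
    using fr unfolding ideal_free_def is_free_def T by blast
  show ?thesis
  proof (rule that[OF B])
    let ?K = "module_span R Q B"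
    have K: "submodule ?K R Q" by (rule span_submodule[OF QM B])
    have inv: "inv\<^bsub>add_monoid ?T\<^esub> x = \<ominus>\<^bsub>Q\<^esub> x" for x by (simp add: a_inv_def m_inv_def T)
    have "subgroup ?K (add_monoid ?T)"
    proof (rule subgroup.intro)
      show "?K \<subseteq> carrier (add_monoid ?T)"
        unfolding partial_object.simps T by (rule subsetI) (rule submodule_carrier[OF QM K])
      show "x \<otimes>\<^bsub>add_monoid ?T\<^esub> y \<in> ?K" if "x \<in> ?K" "y \<in> ?K" for x y
        unfolding monoid.simps T by (rule submodule_add[OF QM K that])
      show "\<one>\<^bsub>add_monoid ?T\<^esub> \<in> ?K" unfolding monoid.simps T by (rule submodule_zero[OF QM K])
      show "inv\<^bsub>add_monoid ?T\<^esub> x \<in> ?K" if "x \<in> ?K" for x unfolding inv by (rule submodule_neg[OF QM K that])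
    qed
    moreover have "A \<odot>\<^bsub>?T\<^esub> x \<in> ?K" if A: "A \<in> carrier ?RI" and x: "x \<in> ?K" for A x
    proof -
      obtain a where "a \<in> carrier R" "A = I +>\<^bsub>R\<^esub> a" using A unfolding RIc by blast
      then show ?thesis using sm[OF _ submodule_carrier[OF QM K x], of a] submodule_smult[OF QM K _ x, of a] by metis
    qed
    ultimately have "submodule ?K ?RI ?T" by (simp add: submodule_def submodule_axioms_def)
    then have "carrier Q \<subseteq> ?K" unfolding sp[symmetric] by (rule span_least) (rule span_incl)
    then show "?K = carrier Q" using submodule_carrier[OF QM K] by blast
  next
    fix A a assume A: "finite A" "A \<subseteq> B" "a \<in> A \<rightarrow> carrier R" and z: "(\<Oplus>\<^bsub>Q\<^esub>x\<in>A. a x \<odot>\<^bsub>Q\<^esub> x) = \<zero>\<^bsub>Q\<^esub>"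
    have "(\<Oplus>\<^bsub>?T\<^esub>x\<in>A. (I +>\<^bsub>R\<^esub> a x) \<odot>\<^bsub>?T\<^esub> x) = (\<Oplus>\<^bsub>Q\<^esub>x\<in>A. (I +>\<^bsub>R\<^esub> a x) \<odot>\<^bsub>?T\<^esub> x)"
      by (rule finsum_transfer[OF T])
    also have "\<dots> = (\<Oplus>\<^bsub>Q\<^esub>x\<in>A. a x \<odot>\<^bsub>Q\<^esub> x)"
      by (rule Q.M.finsum_cong') (use A B sm in \<open>auto simp: Pi_def subset_iff\<close>)
    finally have "(\<Oplus>\<^bsub>?T\<^esub>x\<in>A. (I +>\<^bsub>R\<^esub> a x) \<odot>\<^bsub>?T\<^esub> x) = \<zero>\<^bsub>?T\<^esub>" using z T by simp
    moreover have "(\<lambda>x. I +>\<^bsub>R\<^esub> a x) \<in> A \<rightarrow> carrier ?RI" using A(3) RIc by blast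
    ultimately have "\<forall>x\<in>A. I +>\<^bsub>R\<^esub> a x = \<zero>\<^bsub>?RI\<^esub>" using li A(1,2) unfolding lin_indep_def by blast
    then have "\<forall>x\<in>A. I +>\<^bsub>R\<^esub> a x = I" by (simp add: FactRing_def)
    then show "\<forall>x\<in>A. a x \<in> I" using I.a_rcos_self A(3) by blast
  qed
qed

text \<open>The images of the generators form the basis. A basis is a set, so the generators must
  have distinct images; this uses injectivity of \<open>f\<close> and 1 \<noteq> 0.\<close>

lemma free_if_iso:
  assumes R: "cring R" and one: "\<one>\<^bsub>R\<^esub> \<noteq> \<zero>\<^bsub>R\<^esub>" and X: "finite X" and M: "Module.module R M"
    and f: "f \<in> module_hom R (free_module R X) M"
    and surj: "f ` carrier (free_module R X) = carrier M"
    and ker: "\<And>u. u \<in> carrier (free_module R X) \<Longrightarrow> f u = \<zero>\<^bsub>M\<^esub> \<Longrightarrow> u = \<zero>\<^bsub>free_module R X\<^esub>"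
  shows "is_free R M"
proof -
  let ?F = "free_module R X" and ?g = "\<lambda>x. f (free_gen R X x)"
  interpret cring R by fact
  interpret F: Module.module R ?F by (rule module_free[OF R X])
  interpret M: Module.module R M by fact
  note FM = F.module_axioms
  have gc: "free_gen R X x \<in> carrier ?F" for x by (rule free_gen_closed[OF R X])
  have gM: "?g \<in> X \<rightarrow> carrier M" using module_hom_closed[OF f gc] by simp
  have inj: "inj_on ?g X"
  proof (rule inj_onI)
    fix x y assume x: "x \<in> X" and y: "y \<in> X" and eq: "?g x = ?g y"
    have "f (free_gen R X x \<ominus>\<^bsub>?F\<^esub> free_gen R X y) = \<zero>\<^bsub>M\<^esub>"
      using module_hom_minus[OF FM M f gc gc] eq module_hom_closed[OF f gc] by (simp add: M.M.diff_eq_zero_iff)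
    then have "free_gen R X x \<ominus>\<^bsub>?F\<^esub> free_gen R X y = \<zero>\<^bsub>?F\<^esub>" by (intro ker F.M.minus_closed gc)
    then have "free_gen R X x = free_gen R X y" using gc F.M.diff_eq_zero_iff by blast
    from fun_cong[OF this, of x] show "x = y" using x one by (simp add: free_gen_def split: if_splits)
  qed
  show ?thesis unfolding is_free_def
  proof (intro exI[of _ "?g ` X"] conjI)
    show "?g ` X \<subseteq> carrier M" using gM by auto
    show "module_span R M (?g ` X) = carrier M"
      unfolding span_comb[OF M X gM] surj[symmetric] by (rule image_cong[OF refl]) (rule hom_free_eq[OF R M X f, symmetric])
    show "lin_indep R M (?g ` X)" unfolding lin_indep_def
    proof (intro allI impI ballI, elim conjE)
      fix A c m assume A: "finite A" "A \<subseteq> ?g ` X" "c \<in> A \<rightarrow> carrier R" "(\<Oplus>\<^bsub>M\<^esub>x\<in>A. c x \<odot>\<^bsub>M\<^esub> x) = \<zero>\<^bsub>M\<^esub>" and m: "m \<in> A"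
      let ?K = "{x \<in> X. ?g x \<in> A}"
      let ?u = "\<lambda>x\<in>X. if ?g x \<in> A then c (?g x) else \<zero>\<^bsub>R\<^esub>"
      have u: "?u \<in> carrier ?F" using A(3) by (auto simp: carrier_free[OF X])
      have "f ?u = (\<Oplus>\<^bsub>M\<^esub>x\<in>X. ?u x \<odot>\<^bsub>M\<^esub> ?g x)" using hom_free_eq[OF R M X f u] by (simp add: comb_def)
      also have "\<dots> = (\<Oplus>\<^bsub>M\<^esub>x\<in>?K. c (?g x) \<odot>\<^bsub>M\<^esub> ?g x)"
        by (rule M.M.add.finprod_mono_neutral_cong_right[OF X]) (use gM A(3) in \<open>auto simp: Pi_def\<close>)
      also have "\<dots> = (\<Oplus>\<^bsub>M\<^esub>y\<in>?g ` ?K. c y \<odot>\<^bsub>M\<^esub> y)"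
      proof (rule M.M.finsum_reindex[symmetric])
        show "(\<lambda>y. c y \<odot>\<^bsub>M\<^esub> y) \<in> ?g ` ?K \<rightarrow> carrier M" using gM A(3) by (auto simp: Pi_def)
        show "inj_on ?g ?K" by (rule inj_on_subset[OF inj]) auto
      qed
      also have "?g ` ?K = A" using A(2) by auto
      finally have "f ?u = \<zero>\<^bsub>M\<^esub>" unfolding A(4) .
      then have "?u = \<zero>\<^bsub>?F\<^esub>" by (rule ker[OF u])
      moreover obtain x where "x \<in> X" "m = ?g x" using m A(2) by auto
      ultimately have x: "x \<in> X" "m = ?g x" and "?u x = \<zero>\<^bsub>?F\<^esub> x" by simp_all
      then show "c m = \<zero>\<^bsub>R\<^esub>" using m by (simp add: free_simps)
    qed
  qed
qed

section \<open>Entries and ranks of minimal resolutions\<close>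

context finite_length_local_ring
begin

lemma proper_ideal_subset:
  assumes I: "ideal I R" and "I \<subset> carrier R"
  shows "I \<subseteq> \<mm>"
proof
  interpret I: ideal I R by fact
  fix a assume a: "a \<in> I"
  then have ac: "a \<in> carrier R" using I.a_subset by auto
  show "a \<in> \<mm>"
  proof (rule ccontr)
    assume "a \<notin> \<mm>"
    then have "a \<in> Units R" using unit_if_notin ac by blast
    then have "\<one> \<in> I" using I.I_r_closed[OF a Units_inv_closed] Units_r_inv by metis
    then show False using I.one_imp_carrier assms(2) by blast
  qed
qed

text \<open>Lift a basis of L/IL to elements of R^b. By Nakayama the lifts generate R^b, because the
  cover is minimal. Write an element of the kernel as a combination of the lifts: its image in L/IL
  is a relation among basis elements, so all the coefficients lie in I.\<close>

lemma kernel_in_ideal: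
  assumes I: "ideal I R" and I\<mm>: "I \<subseteq> \<mm>" and L: "Module.module R L" and fr: "ideal_free R I L"
    and f: "f \<in> module_hom R (free_module R {..<b::nat}) L"
    and surj: "f ` carrier (free_module R {..<b}) = carrier L"
    and min: "\<And>u i. u \<in> carrier (free_module R {..<b}) \<Longrightarrow> f u = \<zero>\<^bsub>L\<^esub> \<Longrightarrow> i < b \<Longrightarrow> u i \<in> \<mm>"
    and u: "u \<in> carrier (free_module R {..<b})" "f u = \<zero>\<^bsub>L\<^esub>" and i: "i < b"
  shows "u i \<in> I"
proof -
  let ?F = "free_module R {..<b}"
  let ?H = "ideal_smult R I L"
  let ?Q = "quot_module L ?H"
  interpret L: Module.module R L by fact
  interpret F: Module.module R ?F by (rule free) simp
  note F = F.module_axioms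
  have Ic: "a \<in> carrier R" if "a \<in> I" for a using that I\<mm> mm_closed by blast
  have genL: "{a \<odot>\<^bsub>L\<^esub> x | a x. a \<in> I \<and> x \<in> carrier L} \<subseteq> carrier L" using Ic by auto
  have H: "submodule ?H R L" unfolding ideal_smult_def by (rule span_submodule[OF L genL])
  have genF: "{a \<odot>\<^bsub>?F\<^esub> x | a x. a \<in> I \<and> x \<in> carrier ?F} \<subseteq> carrier ?F" using Ic by auto
  obtain B where B: "B \<subseteq> carrier ?Q" and sp: "module_span R ?Q B = carrier ?Q"
    and li: "\<And>A a. finite A \<Longrightarrow> A \<subseteq> B \<Longrightarrow> a \<in> A \<rightarrow> carrier R \<Longrightarrow> (\<Oplus>\<^bsub>?Q\<^esub>x\<in>A. a x \<odot>\<^bsub>?Q\<^esub> x) = \<zero>\<^bsub>?Q\<^esub> \<Longrightarrow> \<forall>x\<in>A. a x \<in> I"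
    using ideal_freeD[OF cr I L fr] by blast
  have Q: "Module.module R ?Q" by (rule module_quot[OF L H])
  interpret Q: Module.module R ?Q by (rule Q)
  let ?g = "\<lambda>v. ?H +>\<^bsub>L\<^esub> f v"
  have g: "?g \<in> module_hom R ?F ?Q" by (rule module_hom_comp[OF f quot_proj_hom[OF L H]])
  have gsurj: "?g ` carrier ?F = carrier ?Q"
    unfolding quot_module_carrier surj[symmetric] by auto
  have "\<exists>v. v \<in> carrier ?F \<and> ?g v = \<beta>" if "\<beta> \<in> B" for \<beta>
  proof -
    have "\<beta> \<in> ?g ` carrier ?F" using that B unfolding gsurj by blast
    then show ?thesis by auto
  qed
  then obtain w where w: "\<And>\<beta>. \<beta> \<in> B \<Longrightarrow> w \<beta> \<in> carrier ?F" "\<And>\<beta>. \<beta> \<in> B \<Longrightarrow> ?g (w \<beta>) = \<beta>" by metis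
  let ?P = "free_module R B"
  note P = module_free_module[OF cr, of B]
  obtain \<phi> where \<phi>: "\<phi> \<in> module_hom R ?P ?F" and \<phi>g: "\<And>\<beta>. \<beta> \<in> B \<Longrightarrow> \<phi> (free_gen R B \<beta>) = w \<beta>"
    using free_module_lift[OF cr F, of w B] w(1) by auto
  let ?U = "\<phi> ` carrier ?P"
  have U: "submodule ?U R ?F" by (rule submodule_image[OF P F \<phi> carrier_submodule[OF P]])
  have "B \<subseteq> ?g ` ?U"
  proof
    fix \<beta> assume \<beta>: "\<beta> \<in> B"
    show "\<beta> \<in> ?g ` ?U"
      using \<phi>g[OF \<beta>] w(2)[OF \<beta>] free_gen_in[OF cr \<beta>] by (intro image_eqI[of _ ?g "w \<beta>"] image_eqI[of _ \<phi> "free_gen R B \<beta>"]) auto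
  qed
  then have gU: "carrier ?Q \<subseteq> ?g ` ?U"
    unfolding sp[symmetric] by (intro span_least submodule_image[OF F Q g U])
  let ?e = "free_gen R {..<b}"
  let ?S = "?e ` {..<b}"
  let ?V = "module_span R ?F (?U \<union> {c \<odot>\<^bsub>?F\<^esub> s | c s. c \<in> \<mm> \<and> s \<in> ?S})"
  have ec: "?e k \<in> carrier ?F" for k by (rule free_gen_closed[OF cr]) simp
  have Vgen: "?U \<union> {c \<odot>\<^bsub>?F\<^esub> s | c s. c \<in> \<mm> \<and> s \<in> ?S} \<subseteq> carrier ?F"
    using submodule_carrier[OF F U] ec mm_closed by auto
  have V: "submodule ?V R ?F" by (rule span_submodule[OF F Vgen])
  have mmV: "y \<in> ?V" if y: "y \<in> carrier ?F" "\<And>i. i < b \<Longrightarrow> y i \<in> \<mm>" for y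
  proof -
    have "comb ?F {..<b} ?e y \<in> ?V" unfolding comb_def
    proof (rule submodule_finsum[OF F V], rule Pi_I)
      fix k assume "k \<in> {..<b}"
      then show "y k \<odot>\<^bsub>?F\<^esub> ?e k \<in> ?V" using y(2)
        by (intro subsetD[OF span_incl] UnI2 CollectI exI[of _ "y k"] exI[of _ "?e k"] conjI refl imageI) auto
    qed
    then show ?thesis by (simp add: free_expand[OF cr finite_lessThan y(1)])
  qed
  have IF: "ideal_smult R I ?F = {u \<in> carrier ?F. \<forall>i<b. u i \<in> I}" by (rule ideal_smult_free[OF I])
  have fIF: "f ` ideal_smult R I ?F = ?H"
  proof -
    have "f ` {a \<odot>\<^bsub>?F\<^esub> x | a x. a \<in> I \<and> x \<in> carrier ?F} = {a \<odot>\<^bsub>L\<^esub> x | a x. a \<in> I \<and> x \<in> f ` carrier ?F}"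
    proof (intro subset_antisym subsetI)
      fix z assume "z \<in> f ` {a \<odot>\<^bsub>?F\<^esub> x | a x. a \<in> I \<and> x \<in> carrier ?F}"
      then obtain a x where ax: "a \<in> I" "x \<in> carrier ?F" "z = f (a \<odot>\<^bsub>?F\<^esub> x)" by blast
      then have "z = a \<odot>\<^bsub>L\<^esub> f x" using module_hom_smult[OF f Ic] by simp
      then show "z \<in> {a \<odot>\<^bsub>L\<^esub> x | a x. a \<in> I \<and> x \<in> f ` carrier ?F}" using ax by blast
    next
      fix z assume "z \<in> {a \<odot>\<^bsub>L\<^esub> x | a x. a \<in> I \<and> x \<in> f ` carrier ?F}"
      then obtain a x where ax: "a \<in> I" "x \<in> carrier ?F" "z = a \<odot>\<^bsub>L\<^esub> f x" by blast
      then have "z = f (a \<odot>\<^bsub>?F\<^esub> x)" using module_hom_smult[OF f Ic] by simp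
      then show "z \<in> f ` {a \<odot>\<^bsub>?F\<^esub> x | a x. a \<in> I \<and> x \<in> carrier ?F}" using ax by blast
    qed
    then show ?thesis unfolding ideal_smult_def span_image[OF F L f genF] surj by simp
  qed
  \<comment> \<open>Each generator is a sum of an element of \<open>?U\<close>, an element with
    coordinates in I, and an element of the kernel of \<open>f\<close>; by minimality the last also
    has its coordinates in \<mm>.\<close>
  have "?S \<subseteq> ?V"
  proof
    fix s assume "s \<in> ?S"
    then obtain k where k: "s = ?e k" by auto
    have sc: "s \<in> carrier ?F" unfolding k by (rule ec)
    have "?g s \<in> ?g ` ?U" using gU gsurj sc by auto
    then obtain y where y: "y \<in> ?U" "?g s = ?g y" by auto
    have yc: "y \<in> carrier ?F" by (rule submodule_carrier[OF F U y(1)])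
    have "f s \<ominus>\<^bsub>L\<^esub> f y \<in> ?H" using coset_eq_iff[OF L H module_hom_closed[OF f sc] module_hom_closed[OF f yc]] y(2) by simp
    then obtain t where t: "t \<in> ideal_smult R I ?F" "f s \<ominus>\<^bsub>L\<^esub> f y = f t" unfolding fIF[symmetric] by blast
    have tc: "t \<in> carrier ?F" using t(1) IF by blast
    let ?r = "s \<ominus>\<^bsub>?F\<^esub> y \<ominus>\<^bsub>?F\<^esub> t"
    have "f ?r = \<zero>\<^bsub>L\<^esub>"
      using t(2) sc yc tc module_hom_closed[OF f] by (simp add: module_hom_minus[OF F L f] L.M.diff_eq_zero_iff)
    then have "?r \<in> ?V" using min sc yc tc by (intro mmV) simp_all
    moreover have "t \<in> ?V" using t(1) I\<mm> unfolding IF by (intro mmV) auto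
    moreover have "y \<in> ?V" using y(1) by (intro subsetD[OF span_incl]) auto
    ultimately have "y \<oplus>\<^bsub>?F\<^esub> (t \<oplus>\<^bsub>?F\<^esub> ?r) \<in> ?V" by (intro submodule_add[OF F V])
    moreover have "y \<oplus>\<^bsub>?F\<^esub> (t \<oplus>\<^bsub>?F\<^esub> ?r) = s"
      using sc yc tc by (simp add: a_minus_def F.M.a_ac F.M.r_neg F.M.r_neg1 F.M.r_neg2)
    ultimately show "s \<in> ?V" by simp
  qed
  from nakayama[OF F U _ _ this] have SU: "?S \<subseteq> ?U" using ec by auto
  have "comb ?F {..<b} ?e u \<in> ?U" unfolding comb_def
    by (rule submodule_finsum[OF F U], rule Pi_I, rule submodule_smult[OF F U]) (use SU free_mem[OF _ u(1)] in auto)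
  then have "u \<in> ?U" by (simp add: free_expand[OF cr finite_lessThan u(1)])
  then obtain p where p: "p \<in> carrier ?P" "u = \<phi> p" by blast
  let ?A = "{\<beta> \<in> B. p \<beta> \<noteq> \<zero>}"
  have A: "finite ?A" using p(1) by (simp add: free_module_def)
  have pc: "p \<beta> \<in> carrier R" if "\<beta> \<in> B" for \<beta> using p(1) that by (auto simp: free_module_def)
  have "?g u = (\<Oplus>\<^bsub>?Q\<^esub>\<beta>\<in>?A. p \<beta> \<odot>\<^bsub>?Q\<^esub> ?g (\<phi> (free_gen R B \<beta>)))"
    unfolding p(2) by (rule free_hom_supp[OF cr Q module_hom_comp[OF \<phi> g] p(1)])
  also have "\<dots> = (\<Oplus>\<^bsub>?Q\<^esub>\<beta>\<in>?A. p \<beta> \<odot>\<^bsub>?Q\<^esub> \<beta>)"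
    by (rule Q.M.finsum_cong') (use pc B \<phi>g w(2) in auto)
  finally have "(\<Oplus>\<^bsub>?Q\<^esub>\<beta>\<in>?A. p \<beta> \<odot>\<^bsub>?Q\<^esub> \<beta>) = \<zero>\<^bsub>?Q\<^esub>"
    using u(2) module_hom_zero[OF L Q quot_proj_hom[OF L H]] by simp
  from li[OF A _ _ this] pc have pI: "\<forall>\<beta>\<in>?A. p \<beta> \<in> I" by auto
  have "u = (\<Oplus>\<^bsub>?F\<^esub>\<beta>\<in>?A. p \<beta> \<odot>\<^bsub>?F\<^esub> \<phi> (free_gen R B \<beta>))"
    unfolding p(2) by (rule free_hom_supp[OF cr F \<phi> p(1)])
  also have "\<dots> \<in> ideal_smult R I ?F"
  proof (rule submodule_finsum[OF F], unfold ideal_smult_def, rule span_submodule[OF F genF], rule Pi_I)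
    fix \<beta> assume \<beta>: "\<beta> \<in> ?A"
    then show "p \<beta> \<odot>\<^bsub>?F\<^esub> \<phi> (free_gen R B \<beta>) \<in> module_span R ?F {a \<odot>\<^bsub>?F\<^esub> x | a x. a \<in> I \<and> x \<in> carrier ?F}"
      using pI \<phi>g w(1)
      by (intro subsetD[OF span_incl] CollectI exI[of _ "p \<beta>"] exI[of _ "\<phi> (free_gen R B \<beta>)"] conjI refl) auto
  qed
  finally show ?thesis using i unfolding IF by blast
qed

context
  fixes L :: "('a, 'b, 'k) module_scheme" and F :: "('a, 'b) resolution"
  assumes L: "Module.module R L" and F: "minimal_free_resolution R \<mm> L F"
begin

lemma min_free_resolution: "free_resolution R L F"
  using F by (simp add: minimal_free_resolution_def)

lemma min_res_kernel:
  assumes "u \<in> res_kernel R L F k" and "i < rk F k" shows "u i \<in> \<mm>"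
proof -
  have "u \<in> ideal_smult R \<mm> (res_term R F k)" using F assms(1) by (auto simp: minimal_free_resolution_def)
  then show ?thesis using assms(2) ideal_smult_free[OF mm_ideal, of "rk F k"] by blast
qed

lemma res_kernel_image: "res_kernel R L F k = dif F k ` carrier (res_term R F (Suc k))"
  using min_free_resolution by (simp add: free_resolution_def)

lemma min_res_dif:
  assumes "u \<in> carrier (res_term R F (Suc k))" and "i < rk F k" shows "dif F k u i \<in> \<mm>"
  by (rule min_res_kernel[OF _ assms(2)]) (use assms(1) res_kernel_image in blast)

text \<open>The syzygy L_t sits inside the term of degree t - 1 and is minimally covered by the term
  of degree t. The kernel of that cover is the image of \<open>dif F t\<close>, so
  \<open>kernel_in_ideal\<close> concerns exactly this map.\<close>

lemma dif_in_ideal: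
  assumes I: "ideal I R" and I\<mm>: "I \<subseteq> \<mm>" and "t > 0"
    and fr: "ideal_free R I ((res_term R F (t - 1))\<lparr>carrier := res_kernel R L F (t - 1)\<rparr>)"
    and u: "u \<in> carrier (res_term R F (Suc t))" and i: "i < rk F t"
  shows "dif F t u i \<in> I"
proof -
  obtain k where t: "t = Suc k" using \<open>t > 0\<close> by (cases t) auto
  note fr = min_free_resolution
  let ?K = "res_kernel R L F k" and ?T = "res_term R F k"
  let ?L = "?T\<lparr>carrier := ?K\<rparr>"
  have T: "Module.module R ?T" by (rule free) simp
  have P: "Module.module R (res_term R F (Suc k))" by (rule free) simp
  have K: "submodule ?K R ?T"
    unfolding res_kernel_image by (rule submodule_image[OF P T free_resolution_dif[OF L fr] carrier_submodule[OF P]])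
  have Lm: "Module.module R ?L" by (rule submodule.submodule_is_module[OF K T])
  have f: "dif F k \<in> module_hom R (res_term R F (Suc k)) ?L"
    using free_resolution_dif[OF L fr, of k] res_kernel_image[of k] by (auto simp: module_hom_def)
  have ker: "u \<in> res_kernel R L F (Suc k)"
    if "u \<in> carrier (res_term R F (Suc k))" "dif F k u = \<zero>\<^bsub>?L\<^esub>" for u
    using that by (simp add: res_kernel_def a_kernel_eq)
  show ?thesis unfolding t
  proof (rule kernel_in_ideal[OF I I\<mm> Lm _ f])
    show "ideal_free R I ?L" using assms(4) t by simp
    show "dif F k ` carrier (res_term R F (Suc k)) = carrier ?L" by (simp add: res_kernel_image)
    show "u i \<in> \<mm>" if "u \<in> carrier (res_term R F (Suc k))" "dif F k u = \<zero>\<^bsub>?L\<^esub>" "i < rk F (Suc k)" for u i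
      by (rule min_res_kernel[OF ker[OF that(1,2)] that(3)])
    show "dif F (Suc k) u \<in> carrier (res_term R F (Suc k))"
      using module_hom_closed[OF free_resolution_dif[OF L fr] u] t by simp
    show "dif F k (dif F (Suc k) u) = \<zero>\<^bsub>?L\<^esub>" using free_resolution_dif2[OF L fr, of u k] u t by simp
    show "i < rk F (Suc k)" using i t by simp
  qed
qed

text \<open>If the term in degree 1 had rank 0, the augmentation would be an isomorphism and L free.
  Later terms: \<open>s\<close> times a generator is nonzero, yet a differential with entries in
  \<mm> sends it to zero, so the kernel is not zero and needs a further term.\<close>

lemma rank_pos:
  assumes nf: "\<not> is_free R L" and s: "s \<in> carrier R" "s \<noteq> \<zero>" "\<And>a. a \<in> \<mm> \<Longrightarrow> a \<otimes> s = \<zero>"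
  shows "rk F (Suc i) > 0"
proof (induction i)
  note fr = min_free_resolution
  case 0
  show ?case
  proof (rule ccontr)
    assume "\<not> rk F (Suc 0) > 0"
    then have z: "rk F (Suc 0) = 0" by simp
    have "is_free R L"
    proof (rule free_if_iso[OF cr _ _ L])
      show "aug F \<in> module_hom R (res_term R F 0) L" "aug F ` carrier (res_term R F 0) = carrier L"
        using fr by (simp_all add: free_resolution_def)
      show "\<one> \<noteq> \<zero>" using one_notin submodule_zero[OF regular mm_sub] by auto
      fix u assume "u \<in> carrier (res_term R F 0)" "aug F u = \<zero>\<^bsub>L\<^esub>"
      then have "u \<in> res_kernel R L F 0" by (simp add: res_kernel_def a_kernel_eq)
      then obtain v where v: "v \<in> carrier (res_term R F (Suc 0))" "u = dif F 0 v" unfolding res_kernel_image by blast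
      have "v = \<zero>\<^bsub>res_term R F (Suc 0)\<^esub>" using v(1) z by (auto simp: carrier_free free_simps)
      then show "u = \<zero>\<^bsub>res_term R F 0\<^esub>" using v(2) module_hom_zero[OF free free free_resolution_dif[OF L fr]] by simp
    qed simp
    then show False using nf by simp
  qed
next
  case (Suc i)
  note fr = min_free_resolution
  show ?case
  proof (rule ccontr)
    assume "\<not> rk F (Suc (Suc i)) > 0"
    then have z: "rk F (Suc (Suc i)) = 0" by simp
    let ?T = "res_term R F (Suc i)" and ?e = "free_gen R {..<rk F (Suc i)} 0"
    interpret T: Module.module R ?T by (rule free) simp
    have e: "?e \<in> carrier ?T" by (rule free_gen_closed[OF cr]) simp
    have de: "dif F i ?e \<in> carrier (res_term R F i)" by (rule module_hom_closed[OF free_resolution_dif[OF L fr] e])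
    have "dif F i (s \<odot>\<^bsub>?T\<^esub> ?e) = s \<odot>\<^bsub>res_term R F i\<^esub> dif F i ?e"
      by (rule module_hom_smult[OF free_resolution_dif[OF L fr] s(1) e])
    also have "\<dots> = \<zero>\<^bsub>res_term R F i\<^esub>" unfolding free_simps
    proof (rule restrict_ext)
      fix k assume "k \<in> {..<rk F i}"
      then have "dif F i ?e k \<in> \<mm>" using min_res_dif[OF e] by simp
      then show "s \<otimes> dif F i ?e k = \<zero>" using s(3) m_comm[OF s(1) mm_closed] by simp
    qed
    finally have "s \<odot>\<^bsub>?T\<^esub> ?e \<in> res_kernel R L F (Suc i)" using s(1) e by (simp add: res_kernel_def a_kernel_eq)
    then obtain v where v: "v \<in> carrier (res_term R F (Suc (Suc i)))" "s \<odot>\<^bsub>?T\<^esub> ?e = dif F (Suc i) v"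
      unfolding res_kernel_image by blast
    have "v = \<zero>\<^bsub>res_term R F (Suc (Suc i))\<^esub>" using v(1) z by (auto simp: carrier_free free_simps)
    then have "s \<odot>\<^bsub>?T\<^esub> ?e = \<zero>\<^bsub>?T\<^esub>" using v(2) module_hom_zero[OF free free free_resolution_dif[OF L fr]] by simp
    from fun_cong[OF this, of 0] show False using Suc.IH s(1,2) by (simp add: free_simps free_gen_def)
  qed
qed

end

end

section \<open>Total complexes and dual chains\<close>

lemma ideal_smult_submodule:
  assumes M: "Module.module R M" and J: "J \<subseteq> carrier R"
  shows "submodule (ideal_smult R J M) R M"
proof -
  interpret M: Module.module R M by fact
  show ?thesis unfolding ideal_smult_def by (rule span_submodule[OF M]) (use J in auto)
qed

lemma ideal_smultI: "a \<in> J \<Longrightarrow> x \<in> carrier M \<Longrightarrow> a \<odot>\<^bsub>M\<^esub> x \<in> ideal_smult R J M"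
  unfolding ideal_smult_def by (rule subsetD[OF span_incl]) blast

lemma ideal_smult_least:
  assumes "submodule H R M" and "\<And>a x. a \<in> J \<Longrightarrow> x \<in> carrier M \<Longrightarrow> a \<odot>\<^bsub>M\<^esub> x \<in> H"
  shows "ideal_smult R J M \<subseteq> H"
  unfolding ideal_smult_def by (rule span_least) (use assms in auto)

lemma ideal_smult_hom:
  assumes M: "Module.module R M" and N: "Module.module R N" and f: "f \<in> module_hom R M N" and J: "J \<subseteq> carrier R"
    and y: "y \<in> ideal_smult R J M"
  shows "f y \<in> ideal_smult R J N"
proof -
  interpret M: Module.module R M by fact
  have "ideal_smult R J M \<subseteq> {x \<in> carrier M. f x \<in> ideal_smult R J N}"
  proof (rule ideal_smult_least)
    show "submodule {x \<in> carrier M. f x \<in> ideal_smult R J N} R M"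
      by (rule submodule_vimage[OF M N f ideal_smult_submodule[OF N J]])
    fix a x assume ax: "a \<in> J" "x \<in> carrier M"
    then have "a \<in> carrier R" using J by auto
    then show "a \<odot>\<^bsub>M\<^esub> x \<in> {x \<in> carrier M. f x \<in> ideal_smult R J N}"
      using ax ideal_smultI[OF ax(1) module_hom_closed[OF f ax(2)]] by (simp add: module_hom_smult[OF f])
  qed
  then show ?thesis using y by blast
qed

lemma ideal_smult_dprod:
  assumes R: "cring R" and mods: "\<And>x. x \<in> X \<Longrightarrow> Module.module R (Mf x)" and X: "finite X" and J: "J \<subseteq> carrier R"
    and u: "u \<in> carrier (dprod X Mf)" and uJ: "\<And>x. x \<in> X \<Longrightarrow> u x \<in> ideal_smult R J (Mf x)"
  shows "u \<in> ideal_smult R J (dprod X Mf)"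
proof -
  note P = module_dprod[where Mf = Mf, OF R mods]
  have "(\<Oplus>\<^bsub>dprod X Mf\<^esub>x\<in>X. inj_at X Mf x (u x)) \<in> ideal_smult R J (dprod X Mf)"
  proof (rule submodule_finsum[OF P ideal_smult_submodule[OF P J]])
    show "(\<lambda>x. inj_at X Mf x (u x)) \<in> X \<rightarrow> ideal_smult R J (dprod X Mf)"
    proof (rule Pi_I)
      fix x assume x: "x \<in> X"
      show "inj_at X Mf x (u x) \<in> ideal_smult R J (dprod X Mf)"
        by (rule ideal_smult_hom[OF mods[OF x] P inj_at_hom[where Mf = Mf, OF mods x] J uJ[OF x]])
    qed
  qed
  then show ?thesis using dprod_expand[where Mf = Mf, OF R mods X u] by simp
qed

lemma comb_in_submodule:
  assumes M: "Module.module R M" and H: "submodule H R M"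
    and "\<And>i. i \<in> X \<Longrightarrow> x i \<in> H" and "\<And>i. i \<in> X \<Longrightarrow> u i \<in> carrier R"
  shows "comb M X x u \<in> H"
  unfolding comb_def by (rule submodule_finsum[OF M H], rule Pi_I, rule submodule_smult[OF M H]) (use assms in auto)

lemma comb_ideal_smult:
  assumes M: "Module.module R M" and J: "J \<subseteq> carrier R" and x: "x \<in> X \<rightarrow> carrier M" and u: "u \<in> X \<rightarrow> J"
  shows "comb M X x u \<in> ideal_smult R J M"
  unfolding comb_def
  by (rule submodule_finsum[OF M ideal_smult_submodule[OF M J]], rule Pi_I, rule ideal_smultI) (use x u in auto)

section \<open>The total complex as a complex of modules\<close>

context bicomplex
begin

definition tot :: "nat \<Rightarrow> ('a, nat \<Rightarrow> 'b) module" where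
  "tot n = dprod {..n} (\<lambda>p. X p (n - p))"

definition tot_d :: "nat \<Rightarrow> (nat \<Rightarrow> 'b) \<Rightarrow> nat \<Rightarrow> 'b" where
  "tot_d n g = (\<lambda>p\<in>{..n}. D p (n - p) (g (Suc p)) \<oplus>\<^bsub>X p (n - p)\<^esub> E p (n - p) (g p))"

lemma tot_mem: "g \<in> carrier (tot n) \<Longrightarrow> p \<le> n \<Longrightarrow> g p \<in> carrier (X p (n - p))"
  by (auto simp: tot_def dprod_simps)

lemma cring: "cring R"
proof -
  interpret X: Module.module R "X 0 0" by (rule modX)
  show ?thesis by (rule X.R.cring_axioms)
qed

lemma module_tot: "Module.module R (tot n)"
  unfolding tot_def by (rule module_dprod[OF cring modX])

lemma tot_d_hom: "tot_d n \<in> module_hom R (tot (Suc n)) (tot n)"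
  unfolding tot_def tot_d_def[abs_def]
proof (rule dprod_hom)
  fix p assume p: "p \<in> {..n}"
  let ?P = "dprod {..Suc n} (\<lambda>p. X p (Suc n - p))"
  have "Suc n - Suc p = n - p" "Suc n - p = Suc (n - p)" using p by auto
  then have 1: "(\<lambda>g. g (Suc p)) \<in> module_hom R ?P (X (Suc p) (n - p))"
    and 2: "(\<lambda>g. g p) \<in> module_hom R ?P (X p (Suc (n - p)))"
    using dprod_proj_hom[of "Suc p" "{..Suc n}" R "\<lambda>p. X p (Suc n - p)"]
      dprod_proj_hom[of p "{..Suc n}" R "\<lambda>p. X p (Suc n - p)"] p by simp_all
  show "(\<lambda>g. D p (n - p) (g (Suc p)) \<oplus>\<^bsub>X p (n - p)\<^esub> E p (n - p) (g p)) \<in> module_hom R ?P (X p (n - p))"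
    by (rule module_hom_plus[OF module_dprod[OF cring modX] modX module_hom_comp[OF 1 Dhom] module_hom_comp[OF 2 Ehom]])
qed

lemma tot_dd:
  assumes g: "g \<in> carrier (tot (Suc (Suc n)))"
  shows "tot_d n (tot_d (Suc n) g) = \<zero>\<^bsub>tot n\<^esub>"
  unfolding tot_d_def[of n] unfolding tot_def dprod_simps
proof (rule restrict_ext)
  fix p assume p: "p \<in> {..n}"
  obtain q where q: "n = p + q" using p le_Suc_ex by auto
  interpret X: Module.module R "X p q" by (rule modX)
  have g0: "g p \<in> carrier (X p (Suc (Suc q)))" and g1: "g (Suc p) \<in> carrier (X (Suc p) (Suc q))"
    and g2: "g (Suc (Suc p)) \<in> carrier (X (Suc (Suc p)) q)"
    using tot_mem[OF g, of p] tot_mem[OF g, of "Suc p"] tot_mem[OF g, of "Suc (Suc p)"] q by (simp_all add: Suc_diff_le)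
  have d1: "tot_d (Suc n) g (Suc p) = D (Suc p) q (g (Suc (Suc p))) \<oplus>\<^bsub>X (Suc p) q\<^esub> E (Suc p) q (g (Suc p))"
    and d0: "tot_d (Suc n) g p = D p (Suc q) (g (Suc p)) \<oplus>\<^bsub>X p (Suc q)\<^esub> E p (Suc q) (g p)"
    using q by (simp_all add: tot_d_def Suc_diff_le)
  have DE': "D p q (E (Suc p) q (g (Suc p))) = \<ominus>\<^bsub>X p q\<^esub> E p q (D p (Suc q) (g (Suc p)))" by (rule DE[OF g1])
  have c: "E p q (D p (Suc q) (g (Suc p))) \<in> carrier (X p q)"
    by (rule module_hom_closed[OF Ehom module_hom_closed[OF Dhom g1]])
  have "D p q (tot_d (Suc n) g (Suc p)) = \<ominus>\<^bsub>X p q\<^esub> E p q (D p (Suc q) (g (Suc p)))"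
    unfolding d1 module_hom_add[OF Dhom module_hom_closed[OF Dhom g2] module_hom_closed[OF Ehom g1]] DD[OF g2] DE'
    using c by simp
  moreover have "E p q (tot_d (Suc n) g p) = E p q (D p (Suc q) (g (Suc p)))"
    unfolding d0 module_hom_add[OF Ehom module_hom_closed[OF Dhom g1] module_hom_closed[OF Ehom g0]] EE[OF g0]
    using c by simp
  ultimately show "D p (n - p) (tot_d (Suc n) g (Suc p)) \<oplus>\<^bsub>X p (n - p)\<^esub> E p (n - p) (tot_d (Suc n) g p) = \<zero>\<^bsub>X p (n - p)\<^esub>"
    using c q by (simp add: X.M.l_neg)
qed

lemma tot_exactD:
  assumes ex: "tot_exact (Suc n)" and g: "g \<in> carrier (tot (Suc n))" and z: "tot_d n g = \<zero>\<^bsub>tot n\<^esub>"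
  shows "g \<in> tot_d (Suc n) ` carrier (tot (Suc (Suc n)))"
proof -
  have "\<forall>p\<le>Suc n. g p \<in> carrier (X p (Suc n - p))" using tot_mem[OF g] by blast
  moreover have "D p (Suc n - Suc p) (g (Suc p)) \<oplus>\<^bsub>X p (Suc n - Suc p)\<^esub> E p (Suc n - Suc p) (g p) = \<zero>\<^bsub>X p (Suc n - Suc p)\<^esub>"
    if "p < Suc n" for p
    using fun_cong[OF z, of p] that by (simp add: tot_d_def tot_def dprod_simps)
  ultimately have "\<exists>h. (\<forall>p\<le>Suc (Suc n). h p \<in> carrier (X p (Suc (Suc n) - p))) \<and>
      (\<forall>p\<le>Suc n. g p = D p (Suc n - p) (h (Suc p)) \<oplus>\<^bsub>X p (Suc n - p)\<^esub> E p (Suc n - p) (h p))"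
    using ex unfolding tot_exact_def by blast
  then obtain h where h: "\<And>p. p \<le> Suc (Suc n) \<Longrightarrow> h p \<in> carrier (X p (Suc (Suc n) - p))"
    and gh: "\<And>p. p \<le> Suc n \<Longrightarrow> g p = D p (Suc n - p) (h (Suc p)) \<oplus>\<^bsub>X p (Suc n - p)\<^esub> E p (Suc n - p) (h p)" by blast
  let ?h = "restrict h {..Suc (Suc n)}"
  have hc: "?h \<in> carrier (tot (Suc (Suc n)))" using h by (auto simp: tot_def dprod_simps)
  have "g = tot_d (Suc n) ?h"
  proof (rule PiE_ext[of _ "{..Suc n}" "\<lambda>p. carrier (X p (Suc n - p))"])
    show "g \<in> (\<Pi>\<^sub>E p\<in>{..Suc n}. carrier (X p (Suc n - p)))" using g by (simp add: tot_def dprod_simps)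
    show "tot_d (Suc n) ?h \<in> (\<Pi>\<^sub>E p\<in>{..Suc n}. carrier (X p (Suc n - p)))"
      using module_hom_closed[OF tot_d_hom hc] by (simp add: tot_def dprod_simps)
    show "g p = tot_d (Suc n) ?h p" if "p \<in> {..Suc n}" for p using that gh[of p] by (simp add: tot_d_def)
  qed
  then show ?thesis using hc by blast
qed

end

section \<open>Chains of functionals, square roots, and a telescoping sum\<close>

context finite_length_local_ring
begin

lemma mm_carrier: "\<mm> \<subseteq> carrier R"
  using mm_closed by blast

lemma mm_prime:
  assumes "a \<in> carrier R" and "b \<in> carrier R" and "a \<notin> \<mm>" and "b \<notin> \<mm>"
  shows "a \<otimes> b \<notin> \<mm>"
proof
  assume ab: "a \<otimes> b \<in> \<mm>"
  have a: "a \<in> Units R" and b: "b \<in> Units R" using assms unit_if_notin by auto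
  interpret m: ideal \<mm> R by (rule mm_ideal)
  have u: "a \<otimes> b \<in> Units R" by (rule Units_m_closed[OF a b])
  have "inv (a \<otimes> b) \<otimes> (a \<otimes> b) \<in> \<mm>" by (rule m.I_l_closed[OF ab Units_inv_closed[OF u]])
  then show False using one_notin Units_l_inv[OF u] by metis
qed

lemma hom_free_in_ideal:
  assumes K: "ideal K R" and f: "f \<in> module_hom R (free_module R {..<n::nat}) (regular_module R)"
    and u: "u \<in> carrier (free_module R {..<n})" and uK: "\<And>i. i < n \<Longrightarrow> u i \<in> K"
  shows "f u \<in> K"
proof -
  interpret K: ideal K R by (rule K)
  have Ks: "submodule K R (regular_module R)" using K ideal_iff_submodule[OF cr] by simp
  have "f u = comb (regular_module R) {..<n} (\<lambda>i. f (free_gen R {..<n} i)) u"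
    by (rule hom_free_eq[OF cr regular _ f u]) simp
  also have "\<dots> \<in> K" unfolding comb_def
  proof (rule submodule_finsum[OF regular Ks], rule Pi_I)
    fix i assume "i \<in> {..<n}"
    then have "u i \<in> K" using uK by simp
    moreover have "f (free_gen R {..<n} i) \<in> carrier R" using module_hom_closed[OF f free_gen_closed[OF cr]] by simp
    ultimately show "u i \<odot>\<^bsub>regular_module R\<^esub> f (free_gen R {..<n} i) \<in> K" by (simp add: K.I_r_closed)
  qed
  finally show ?thesis .
qed

text \<open>Start with a coordinate function. The composite \<theta>_p D_p takes values in \<mm>,
  which is y_p R + J, so dividing by y_p modulo J on generators defines \<theta>_(p+1). The chain
  ends at the first P for which \<theta>_P D_P has values in J, at the latest P = n, and is zero
  from there on. Up to P no member takes all its values in \<mm>: otherwise y_p \<theta>_(p+1), and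
  with it \<theta>_p D_p, would have values in J.\<close>

lemma dual_chain:
  fixes a :: "nat \<Rightarrow> nat"
  assumes D: "\<And>p. D p \<in> module_hom R (free_module R {..<a (Suc p)}) (free_module R {..<a p})"
    and Dn: "\<And>u i. u \<in> carrier (free_module R {..<a (Suc n)}) \<Longrightarrow> i < a n \<Longrightarrow> D n u i \<in> J"
    and Dm: "\<And>p u i. u \<in> carrier (free_module R {..<a (Suc p)}) \<Longrightarrow> i < a p \<Longrightarrow> D p u i \<in> \<mm>"
    and a0: "a 0 > 0" and J: "ideal J R" and mmJ: "\<And>b c. b \<in> \<mm> \<Longrightarrow> c \<in> \<mm> \<Longrightarrow> b \<otimes> c \<in> J"
    and y: "\<And>p. y p \<in> \<mm>" and yJ: "\<And>p b. b \<in> \<mm> \<Longrightarrow> \<exists>c\<in>carrier R. b \<ominus> y p \<otimes> c \<in> J"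
  obtains \<theta> P where "P \<le> n" and "\<And>p. \<theta> p \<in> module_hom R (free_module R {..<a p}) (regular_module R)"
    and "\<And>p. p \<le> P \<Longrightarrow> \<exists>u\<in>carrier (free_module R {..<a p}). \<theta> p u \<notin> \<mm>"
    and "\<And>p u. p > P \<Longrightarrow> u \<in> carrier (free_module R {..<a p}) \<Longrightarrow> \<theta> p u = \<zero>"
    and "\<And>p u. u \<in> carrier (free_module R {..<a (Suc p)}) \<Longrightarrow> \<theta> p (D p u) \<ominus> y p \<otimes> \<theta> (Suc p) u \<in> J"
proof -
  let ?F = "\<lambda>p. free_module R {..<a p}" and ?L = "regular_module R"
  have F: "Module.module R (?F p)" for p by (rule free) simp
  interpret L: Module.module R ?L by (rule regular)
  interpret J: ideal J R by (rule J)
  have Js: "submodule J R ?L" using J ideal_iff_submodule[OF cr] by simp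
  have yc: "y p \<in> carrier R" for p using y mm_closed by blast
  let ?P = "\<lambda>p \<theta>. \<theta> \<in> module_hom R (?F p) ?L \<and> (p = 0 \<longrightarrow> (\<exists>u\<in>carrier (?F p). \<theta> u \<notin> \<mm>))"
  let ?Q = "\<lambda>p \<theta> \<theta>'. (\<forall>u\<in>carrier (?F (Suc p)). \<theta> (D p u) \<ominus> y p \<otimes> \<theta>' u \<in> J) \<and>
    ((\<forall>u\<in>carrier (?F (Suc p)). \<theta> (D p u) \<in> J) \<longrightarrow> (\<forall>u\<in>carrier (?F (Suc p)). \<theta>' u = \<zero>))"
  have "\<exists>\<theta>. \<forall>p. ?P p (\<theta> p) \<and> ?Q p (\<theta> p) (\<theta> (Suc p))"
  proof (rule dependent_nat_choice)
    have "(\<lambda>u. u 0) \<in> module_hom R (?F 0) ?L" by (rule free_proj_hom) (use a0 in simp_all)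
    moreover have "free_gen R {..<a 0} 0 \<in> carrier (?F 0)" by (rule free_gen_closed[OF cr]) simp
    moreover have "free_gen R {..<a 0} 0 0 \<notin> \<mm>" using a0 one_notin by (simp add: free_gen_def)
    ultimately show "\<exists>\<theta>. ?P 0 \<theta>" by blast
  next
    fix \<theta> p assume "?P p \<theta>"
    then have \<theta>: "\<theta> \<in> module_hom R (?F p) ?L" by blast
    note \<theta>D = module_hom_comp[OF D \<theta>]
    have \<theta>Dc: "\<theta> (D p u) \<in> carrier R" if "u \<in> carrier (?F (Suc p))" for u
      using module_hom_closed[OF \<theta>D that] by simp
    show "\<exists>\<theta>'. ?P (Suc p) \<theta>' \<and> ?Q p \<theta> \<theta>'"
    proof (cases "\<forall>u\<in>carrier (?F (Suc p)). \<theta> (D p u) \<in> J")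
      case True
      have "(\<lambda>_. \<zero>) \<in> module_hom R (?F (Suc p)) ?L" using module_hom_const_zero[OF F regular] by simp
      then show ?thesis using True yc[of p] \<theta>Dc by (intro exI[of _ "\<lambda>_. \<zero>"]) (simp add: a_minus_def)
    next
      case False
      let ?e = "free_gen R {..<a (Suc p)}"
      have ec: "?e k \<in> carrier (?F (Suc p))" for k by (rule free_gen_closed[OF cr]) simp
      have "\<theta> (D p (?e k)) \<in> \<mm>" for k
        by (rule hom_free_in_ideal[OF mm_ideal \<theta> module_hom_closed[OF D ec] Dm[OF ec]])
      then have "\<exists>c. \<forall>k. c k \<in> carrier R \<and> \<theta> (D p (?e k)) \<ominus> y p \<otimes> c k \<in> J" using yJ by (intro choice) blast
      then obtain c where c: "\<And>k. c k \<in> carrier R" and cJ: "\<And>k. \<theta> (D p (?e k)) \<ominus> y p \<otimes> c k \<in> J" by blast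
      let ?\<theta> = "comb ?L {..<a (Suc p)} c"
      have \<theta>': "?\<theta> \<in> module_hom R (?F (Suc p)) ?L" by (rule comb_hom[OF regular]) (use c in auto)
      have \<theta>'e: "?\<theta> (?e k) = c k" if "k < a (Suc p)" for k by (rule comb_gen[OF regular]) (use c that in auto)
      let ?f = "\<lambda>u. \<theta> (D p u) \<ominus>\<^bsub>?L\<^esub> (y p \<odot>\<^bsub>?L\<^esub> ?\<theta> u)"
      have f: "?f \<in> module_hom R (?F (Suc p)) ?L"
        by (rule module_hom_diff[OF F regular \<theta>D module_hom_comp[OF \<theta>' module_hom_scalar[OF regular yc]]])
      have "\<theta> (D p u) \<ominus> y p \<otimes> ?\<theta> u \<in> J" if u: "u \<in> carrier (?F (Suc p))" for u
      proof -
        have "?f u = comb ?L {..<a (Suc p)} (\<lambda>k. ?f (?e k)) u" by (rule hom_free_eq[OF cr regular _ f u]) simp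
        also have "\<dots> \<in> J"
        proof (rule comb_in_submodule[OF regular Js])
          fix k assume k: "k \<in> {..<a (Suc p)}"
          then show "?f (?e k) \<in> J" using cJ[of k] \<theta>Dc[OF ec] c yc by (simp add: \<theta>'e regular_minus)
          show "u k \<in> carrier R" using free_mem[OF _ u k] by simp
        qed
        finally show ?thesis using \<theta>Dc[OF u] module_hom_closed[OF \<theta>' u] yc by (simp add: regular_minus)
      qed
      then show ?thesis using \<theta>' False by (intro exI[of _ ?\<theta>]) auto
    qed
  qed
  then obtain \<theta> where \<theta>P: "\<And>p. ?P p (\<theta> p)" and \<theta>Q: "\<And>p. ?Q p (\<theta> p) (\<theta> (Suc p))" by blast
  have \<theta>: "\<theta> p \<in> module_hom R (?F p) ?L" for p using \<theta>P by blast
  have \<theta>Dc: "\<theta> p (D p u) \<in> carrier R" if "u \<in> carrier (?F (Suc p))" for u p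
    using module_hom_closed[OF module_hom_comp[OF D \<theta>] that] by simp
  let ?B = "\<lambda>p. \<forall>u\<in>carrier (?F (Suc p)). \<theta> p (D p u) \<in> J"
  have Bn: "?B n" using hom_free_in_ideal[OF J \<theta> module_hom_closed[OF D] Dn] by blast
  define P where "P = (LEAST p. ?B p)"
  have P: "?B P" unfolding P_def by (rule LeastI[of ?B, OF Bn])
  have Pn: "P \<le> n" unfolding P_def by (rule Least_le[of ?B, OF Bn])
  have big: "\<exists>u\<in>carrier (?F p). \<theta> p u \<notin> \<mm>" if "p \<le> P" for p
  proof (cases p)
    case 0
    then show ?thesis using \<theta>P[of 0] by blast
  next
    case (Suc k)
    then have "\<not> ?B k" using that not_less_Least[of k ?B] unfolding P_def by simp
    then obtain u where u: "u \<in> carrier (?F (Suc k))" "\<theta> k (D k u) \<notin> J" by blast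
    have d: "\<theta> k (D k u) \<ominus> y k \<otimes> \<theta> (Suc k) u \<in> J" using \<theta>Q[of k] u(1) by blast
    have "\<theta> (Suc k) u \<notin> \<mm>"
    proof
      assume m: "\<theta> (Suc k) u \<in> \<mm>"
      then have "(\<theta> k (D k u) \<ominus> y k \<otimes> \<theta> (Suc k) u) \<oplus> y k \<otimes> \<theta> (Suc k) u \<in> J"
        using d mmJ[OF y] by (intro J.a_closed)
      then show False using u \<theta>Dc[OF u(1)] mm_closed[OF m] yc by (simp add: a_minus_def a_assoc l_neg)
    qed
    then show ?thesis using u(1) Suc by blast
  qed
  have small: "\<forall>u\<in>carrier (?F p). \<theta> p u = \<zero>" if "p > P" for p
    using that
  proof (induction p)
    case (Suc k)
    have "?B k"
    proof (cases "k = P")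
      case False
      then have "P < k" using Suc.prems by simp
      then have "\<theta> k (D k u) = \<zero>" if "u \<in> carrier (?F (Suc k))" for u
        using Suc.IH module_hom_closed[OF D that] by blast
      then show ?thesis using J.zero_closed by simp
    qed (use P in simp)
    then show ?case using \<theta>Q[of k] by blast
  qed simp
  show ?thesis by (rule that[OF Pn \<theta> big]) (use small \<theta>Q in auto)
qed

text \<open>The matrix is built by the recursion \<open>S \<mapsto> [[S, v], [w, -S]]\<close>, starting with \<open>(x)\<close>; modulo \<open>J\<close> it is
  lower triangular with diagonal entries \<open>\<plusminus>x\<close>.\<close>

lemma square_matrix:
  assumes J: "ideal J R" and J\<mm>: "J \<subseteq> \<mm>" and mmJ: "\<And>b c. b \<in> \<mm> \<Longrightarrow> c \<in> \<mm> \<Longrightarrow> b \<otimes> c \<in> J"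
    and x: "x \<in> \<mm>" and xJ: "\<And>b. b \<in> carrier R \<Longrightarrow> x \<otimes> b \<in> J \<Longrightarrow> b \<in> \<mm>"
    and v: "\<And>k. k < n \<Longrightarrow> v k \<in> J" and w: "\<And>k. k < (n::nat) \<Longrightarrow> w k \<in> \<mm>"
  shows "\<exists>(q::nat) S. q > 0 \<and> S \<in> module_hom R (free_module R {..<q}) (free_module R {..<q}) \<and>
    (\<forall>t\<in>carrier (free_module R {..<q}). (\<forall>i<q. S t i \<in> \<mm>) \<and>
       S (S t) = (x \<otimes> x \<oplus> (\<Oplus>k\<in>{..<n}. v k \<otimes> w k)) \<odot>\<^bsub>free_module R {..<q}\<^esub> t \<and>
       ((\<forall>i<q. S t i \<in> J) \<longrightarrow> (\<forall>i<q. t i \<in> \<mm>)))"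
  using v w
proof (induction n)
  interpret m: ideal \<mm> R by (rule mm_ideal)
  case 0
  let ?F = "free_module R {..<Suc 0}"
  have xc: "x \<in> carrier R" using x mm_closed by blast
  interpret F: Module.module R ?F by (rule free) simp
  show ?case
  proof (intro exI[of _ "Suc 0"] exI[of _ "\<lambda>t. x \<odot>\<^bsub>?F\<^esub> t"] conjI ballI)
    show "(\<lambda>t. x \<odot>\<^bsub>?F\<^esub> t) \<in> module_hom R ?F ?F" by (rule module_hom_scalar[OF F.module_axioms xc])
    fix t assume t: "t \<in> carrier ?F"
    have t0: "t 0 \<in> carrier R" using free_mem[OF _ t] by simp
    show "\<forall>i<Suc 0. (x \<odot>\<^bsub>?F\<^esub> t) i \<in> \<mm>" using t0 x by (simp add: free_simps m.I_r_closed)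
    show "x \<odot>\<^bsub>?F\<^esub> (x \<odot>\<^bsub>?F\<^esub> t) = (x \<otimes> x \<oplus> (\<Oplus>k\<in>{..<0}. v k \<otimes> w k)) \<odot>\<^bsub>?F\<^esub> t"
      using xc t by (simp add: F.smult_assoc1)
    show "(\<forall>i<Suc 0. (x \<odot>\<^bsub>?F\<^esub> t) i \<in> J) \<longrightarrow> (\<forall>i<Suc 0. t i \<in> \<mm>)" using t0 xJ by (simp add: free_simps)
  qed simp
next
  interpret m: ideal \<mm> R by (rule mm_ideal)
  interpret J: ideal J R by (rule J)
  case (Suc n)
  let ?c = "x \<otimes> x \<oplus> (\<Oplus>k\<in>{..<n}. v k \<otimes> w k)"
  have vJ: "v n \<in> J" and wm: "w n \<in> \<mm>" and vs: "\<And>k. k < Suc n \<Longrightarrow> v k \<in> carrier R"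
    and ws: "\<And>k. k < Suc n \<Longrightarrow> w k \<in> carrier R" using Suc.prems J\<mm> mm_closed by blast+
  have vc: "v n \<in> carrier R" and wc: "w n \<in> carrier R" using vs ws by simp_all
  have xc: "x \<in> carrier R" using x mm_closed by blast
  have sc: "(\<Oplus>k\<in>{..<n}. v k \<otimes> w k) \<in> carrier R" using vs ws by (intro finsum_closed) auto
  have cc: "?c \<in> carrier R" using sc xc by simp
  have c': "x \<otimes> x \<oplus> (\<Oplus>k\<in>{..<Suc n}. v k \<otimes> w k) = ?c \<oplus> v n \<otimes> w n"
  proof -
    have "(\<Oplus>k\<in>{..<Suc n}. v k \<otimes> w k) = v n \<otimes> w n \<oplus> (\<Oplus>k\<in>{..<n}. v k \<otimes> w k)"
      unfolding lessThan_Suc by (rule finsum_insert) (use vs ws in auto)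
    then show ?thesis using sc xc vc wc by (simp add: a_ac)
  qed
  have "\<exists>(q::nat) S. q > 0 \<and> S \<in> module_hom R (free_module R {..<q}) (free_module R {..<q}) \<and>
    (\<forall>t\<in>carrier (free_module R {..<q}). (\<forall>i<q. S t i \<in> \<mm>) \<and>
       S (S t) = ?c \<odot>\<^bsub>free_module R {..<q}\<^esub> t \<and> ((\<forall>i<q. S t i \<in> J) \<longrightarrow> (\<forall>i<q. t i \<in> \<mm>)))"
    by (rule Suc.IH) (use Suc.prems in simp_all)
  then obtain q :: nat and S where q: "q > 0" and S: "S \<in> module_hom R (free_module R {..<q}) (free_module R {..<q})"
    and Sm: "\<And>t i. t \<in> carrier (free_module R {..<q}) \<Longrightarrow> i < q \<Longrightarrow> S t i \<in> \<mm>"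
    and SS: "\<And>t. t \<in> carrier (free_module R {..<q}) \<Longrightarrow> S (S t) = ?c \<odot>\<^bsub>free_module R {..<q}\<^esub> t"
    and SJ: "\<And>t i. t \<in> carrier (free_module R {..<q}) \<Longrightarrow> (\<And>i. i < q \<Longrightarrow> S t i \<in> J) \<Longrightarrow> i < q \<Longrightarrow> t i \<in> \<mm>"
    by (elim exE conjE) blast
  let ?F = "free_module R {..<q}" and ?G = "free_module R {..<q + q}"
  interpret F: Module.module R ?F by (rule free) simp
  interpret G: Module.module R ?G by (rule free) simp
  define lo hi where "lo t = (\<lambda>i\<in>{..<q}. t i)" and "hi t = (\<lambda>i\<in>{..<q}. t (q + i))" for t :: "nat \<Rightarrow> 'a"
  define glue where "glue r s = (\<lambda>i\<in>{..<q + q}. if i < q then r i else s (i - q))" for r s :: "nat \<Rightarrow> 'a"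
  have lo: "lo \<in> module_hom R ?G ?F" and hi: "hi \<in> module_hom R ?G ?F"
    unfolding lo_def[abs_def] hi_def[abs_def] free_module_eq_dprod[OF finite_lessThan]
    by (rule dprod_hom, rule pow_proj_hom, simp)+
  have lo_glue: "lo (glue r s) = r" and hi_glue: "hi (glue r s) = s" if "r \<in> carrier ?F" "s \<in> carrier ?F" for r s
  proof -
    have r: "r \<in> {..<q} \<rightarrow>\<^sub>E carrier R" and s: "s \<in> {..<q} \<rightarrow>\<^sub>E carrier R" using that by (simp_all add: carrier_free)
    have "lo (glue r s) = restrict r {..<q}" unfolding lo_def by (rule restrict_ext) (simp add: glue_def)
    then show "lo (glue r s) = r" using PiE_restrict[OF r] by simp
    have "hi (glue r s) = restrict s {..<q}" unfolding hi_def by (rule restrict_ext) (simp add: glue_def)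
    then show "hi (glue r s) = s" using PiE_restrict[OF s] by simp
  qed
  have glue_eta: "glue (lo t) (hi t) = t" if "t \<in> carrier ?G" for t
  proof -
    have t: "t \<in> {..<q + q} \<rightarrow>\<^sub>E carrier R" using that by (simp add: carrier_free)
    have "glue (lo t) (hi t) = restrict t {..<q + q}"
      unfolding glue_def by (rule restrict_ext) (auto simp: lo_def hi_def)
    then show ?thesis using PiE_restrict[OF t] by simp
  qed
  let ?A = "\<lambda>t. S (lo t) \<oplus>\<^bsub>?F\<^esub> v n \<odot>\<^bsub>?F\<^esub> hi t" and ?B = "\<lambda>t. w n \<odot>\<^bsub>?F\<^esub> lo t \<ominus>\<^bsub>?F\<^esub> S (hi t)"
  let ?S = "\<lambda>t. glue (?A t) (?B t)"
  note Fm = F.module_axioms and Gm = G.module_axioms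
  have A: "?A \<in> module_hom R ?G ?F"
    by (rule module_hom_plus[OF Gm Fm module_hom_comp[OF lo S] module_hom_comp[OF hi module_hom_scalar[OF Fm vc]]])
  have B: "?B \<in> module_hom R ?G ?F"
    by (rule module_hom_diff[OF Gm Fm module_hom_comp[OF lo module_hom_scalar[OF Fm wc]] module_hom_comp[OF hi S]])
  have S': "?S \<in> module_hom R ?G ?G"
  proof -
    have "(\<lambda>t. if i < q then ?A t i else ?B t (i - q)) \<in> module_hom R ?G (regular_module R)" if "i \<in> {..<q + q}" for i
      using that module_hom_comp[OF A free_proj_hom[of "{..<q}" i]] module_hom_comp[OF B free_proj_hom[of "{..<q}" "i - q"]]
      by (cases "i < q") auto
    from dprod_hom[of "{..<q + q}", OF this] show ?thesis
      unfolding glue_def free_module_eq_dprod[of "{..<q + q}", OF finite_lessThan] .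
  qed
  have loc: "lo t \<in> carrier ?F" and hic: "hi t \<in> carrier ?F" if "t \<in> carrier ?G" for t
    using module_hom_closed[OF lo that] module_hom_closed[OF hi that] by simp_all
  have comp: "(r \<oplus>\<^bsub>?F\<^esub> s) i = r i \<oplus> s i" "(b \<odot>\<^bsub>?F\<^esub> r) i = b \<otimes> r i" "(r \<ominus>\<^bsub>?F\<^esub> s) i = r i \<ominus> s i"
    if "r \<in> carrier ?F" "s \<in> carrier ?F" "i < q" for r s i b
  proof -
    show "(r \<oplus>\<^bsub>?F\<^esub> s) i = r i \<oplus> s i" "(b \<odot>\<^bsub>?F\<^esub> r) i = b \<otimes> r i" using that by (simp_all add: free_simps)
    have d: "r \<ominus>\<^bsub>?F\<^esub> s \<in> carrier ?F" using that by simp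
    have e: "(r \<ominus>\<^bsub>?F\<^esub> s) \<oplus>\<^bsub>?F\<^esub> s = r" using that by (simp add: a_minus_def F.M.a_assoc F.M.l_neg)
    have "(r \<ominus>\<^bsub>?F\<^esub> s) i \<oplus> s i = r i" using fun_cong[OF e, of i] that(3) by (simp add: free_simps(2))
    moreover have "(r \<ominus>\<^bsub>?F\<^esub> s) i \<in> carrier R" "s i \<in> carrier R" using free_mem[OF _ d] free_mem[OF _ that(2)] that(3) by simp_all
    ultimately show "(r \<ominus>\<^bsub>?F\<^esub> s) i = r i \<ominus> s i" by (metis a_minus_def a_assoc a_inv_closed r_neg r_zero)
  qed
  show ?case
  proof (intro exI[of _ "q + q"] exI[of _ ?S] conjI ballI)
    show "q + q > 0" using q by simp
    show "?S \<in> module_hom R ?G ?G" by (rule S')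
    fix t assume t: "t \<in> carrier ?G"
    let ?a = "lo t" and ?b = "hi t"
    note a = loc[OF t] and b = hic[OF t]
    have Sa: "S ?a \<in> carrier ?F" and Sb: "S ?b \<in> carrier ?F" using a b module_hom_closed[OF S] by simp_all
    have At: "?A t \<in> carrier ?F" and Bt: "?B t \<in> carrier ?F" using module_hom_closed[OF A t] module_hom_closed[OF B t] by simp_all
    have ai: "?a i \<in> carrier R" and bi: "?b i \<in> carrier R" if "i < q" for i
      using free_mem[OF _ a] free_mem[OF _ b] that by simp_all
    have Ai: "?A t i = S ?a i \<oplus> v n \<otimes> ?b i" and Bi: "?B t i = w n \<otimes> ?a i \<ominus> S ?b i" if "i < q" for i
      using comp that a b Sa Sb vc wc by simp_all
    show "\<forall>i<q + q. ?S t i \<in> \<mm>"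
    proof (intro allI impI)
      fix i assume i: "i < q + q"
      show "?S t i \<in> \<mm>"
      proof (cases "i < q")
        case True
        then show ?thesis using i Ai[OF True] Sm[OF a True] vJ J\<mm> bi[OF True]
          by (auto simp: glue_def intro!: m.a_closed m.I_r_closed)
      next
        case False
        then have k: "i - q < q" using i by simp
        show ?thesis using False i Bi[OF k] Sm[OF b k] wm ai[OF k]
          by (auto simp: glue_def a_minus_def intro!: m.a_closed m.I_r_closed m.a_inv_closed)
      qed
    qed
    have StG: "?S t \<in> carrier ?G" by (rule module_hom_closed[OF S' t])
    have e1: "lo (?S t) = ?A t" and e2: "hi (?S t) = ?B t" using lo_glue[OF At Bt] hi_glue[OF At Bt] by simp_all
    \<comment> \<open>Block multiplication: both diagonal blocks of the square are S^2 + v w, and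
      the other two cancel because v and w are scalars and commute with S.\<close>
    have "?A (?S t) = S (S ?a \<oplus>\<^bsub>?F\<^esub> v n \<odot>\<^bsub>?F\<^esub> ?b) \<oplus>\<^bsub>?F\<^esub> v n \<odot>\<^bsub>?F\<^esub> (w n \<odot>\<^bsub>?F\<^esub> ?a \<ominus>\<^bsub>?F\<^esub> S ?b)"
      unfolding e1 e2 ..
    also have "\<dots> = (?c \<oplus> v n \<otimes> w n) \<odot>\<^bsub>?F\<^esub> ?a"
      using a b Sa Sb vc wc cc
      by (simp add: module_hom_add[OF S] module_hom_smult[OF S] SS a_minus_def F.smult_r_distr F.smult_l_distr
          F.smult_assoc1 F.smult_r_minus F.M.a_ac F.M.r_neg F.M.r_neg1 F.M.r_neg2)
    finally have f1: "?A (?S t) = lo ((?c \<oplus> v n \<otimes> w n) \<odot>\<^bsub>?G\<^esub> t)"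
      using module_hom_smult[OF lo _ t, of "?c \<oplus> v n \<otimes> w n"] cc vc wc by simp
    have cancel: "u \<oplus>\<^bsub>?F\<^esub> (z \<oplus>\<^bsub>?F\<^esub> (\<ominus>\<^bsub>?F\<^esub> u \<oplus>\<^bsub>?F\<^esub> z')) = z \<oplus>\<^bsub>?F\<^esub> z'"
      if "u \<in> carrier ?F" "z \<in> carrier ?F" "z' \<in> carrier ?F" for u z z'
      using that by (simp add: F.M.a_lcomm[of u z] F.M.r_neg2)
    have "?B (?S t) = w n \<odot>\<^bsub>?F\<^esub> (S ?a \<oplus>\<^bsub>?F\<^esub> v n \<odot>\<^bsub>?F\<^esub> ?b) \<ominus>\<^bsub>?F\<^esub> S (w n \<odot>\<^bsub>?F\<^esub> ?a \<ominus>\<^bsub>?F\<^esub> S ?b)"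
      unfolding e1 e2 ..
    also have "S (w n \<odot>\<^bsub>?F\<^esub> ?a \<ominus>\<^bsub>?F\<^esub> S ?b) = w n \<odot>\<^bsub>?F\<^esub> S ?a \<ominus>\<^bsub>?F\<^esub> ?c \<odot>\<^bsub>?F\<^esub> ?b"
      using module_hom_minus[OF Fm Fm S F.smult_closed[OF wc a] Sb] by (simp add: module_hom_smult[OF S wc a] SS[OF b])
    also have "w n \<odot>\<^bsub>?F\<^esub> (S ?a \<oplus>\<^bsub>?F\<^esub> v n \<odot>\<^bsub>?F\<^esub> ?b) \<ominus>\<^bsub>?F\<^esub> (w n \<odot>\<^bsub>?F\<^esub> S ?a \<ominus>\<^bsub>?F\<^esub> ?c \<odot>\<^bsub>?F\<^esub> ?b) =
        (?c \<oplus> v n \<otimes> w n) \<odot>\<^bsub>?F\<^esub> ?b"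
      using a b Sa Sb vc wc cc
      by (simp add: cancel a_minus_def F.smult_r_distr F.smult_l_distr
          F.smult_assoc1[symmetric] F.smult_r_minus F.M.minus_add F.M.a_ac F.M.r_neg F.M.r_neg1 F.M.r_neg2 m_comm)
    finally have f2: "?B (?S t) = hi ((?c \<oplus> v n \<otimes> w n) \<odot>\<^bsub>?G\<^esub> t)"
      using module_hom_smult[OF hi _ t, of "?c \<oplus> v n \<otimes> w n"] cc vc wc by simp
    have "?S (?S t) = (?c \<oplus> v n \<otimes> w n) \<odot>\<^bsub>?G\<^esub> t"
      unfolding f1 f2 by (rule glue_eta) (use t cc vc wc in simp)
    then show "?S (?S t) = (x \<otimes> x \<oplus> (\<Oplus>k\<in>{..<Suc n}. v k \<otimes> w k)) \<odot>\<^bsub>?G\<^esub> t" unfolding c' .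
    show "(\<forall>i<q + q. ?S t i \<in> J) \<longrightarrow> (\<forall>i<q + q. t i \<in> \<mm>)"
    proof (intro impI allI)
      \<comment> \<open>The upper block v vanishes modulo J. So S a is in J and a is in \<mm>; then
        w a lies in J, being a product of elements of \<mm>, which leaves S b in J and b in
        \<mm>.\<close>
      assume SJ': "\<forall>i<q + q. ?S t i \<in> J"
      have Sac: "S ?a i \<in> carrier R" and Sbc: "S ?b i \<in> carrier R" if "i < q" for i
        using free_mem[OF _ Sa] free_mem[OF _ Sb] that by simp_all
      have "S ?a i \<in> J" if i: "i < q" for i
      proof -
        have 1: "S ?a i \<oplus> v n \<otimes> ?b i \<in> J" using SJ'[rule_format, of i] i Ai[OF i] by (simp add: glue_def)
        have "(S ?a i \<oplus> v n \<otimes> ?b i) \<oplus> (\<ominus> (v n \<otimes> ?b i)) \<in> J"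
          by (rule J.a_closed[OF 1 J.a_inv_closed[OF J.I_r_closed[OF vJ bi[OF i]]]])
        then show ?thesis using Sac[OF i] vc bi[OF i] by (simp add: a_assoc r_neg)
      qed
      then have am: "?a i \<in> \<mm>" if "i < q" for i using SJ[OF a _ that] by blast
      have "S ?b i \<in> J" if i: "i < q" for i
      proof -
        have 1: "w n \<otimes> ?a i \<ominus> S ?b i \<in> J" using SJ'[rule_format, of "q + i"] i Bi[OF i] by (simp add: glue_def)
        have 2: "w n \<otimes> ?a i \<in> J" by (rule mmJ[OF wm am[OF i]])
        have "w n \<otimes> ?a i \<oplus> (\<ominus> (w n \<otimes> ?a i \<ominus> S ?b i)) \<in> J" by (intro J.a_closed J.a_inv_closed 1 2)
        then show ?thesis using Sbc[OF i] wc ai[OF i] by (simp add: a_minus_def minus_add a_assoc[symmetric] r_neg)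
      qed
      then have bm: "?b i \<in> \<mm>" if "i < q" for i using SJ[OF b _ that] by blast
      fix i assume i: "i < q + q"
      show "t i \<in> \<mm>"
      proof (cases "i < q")
        case True
        then show ?thesis using am[OF True] by (simp add: lo_def)
      next
        case False
        then have "i - q < q" using i by simp
        then show ?thesis using bm[of "i - q"] False by (simp add: hi_def)
      qed
    qed
  qed
qed

text \<open>Modulo J the terms are y_p T(p+1) and y_p T(p). As y alternates in sign, the second term
  at p + 1 cancels the first term at p, and only the ends survive.\<close>

lemma telescope_in_ideal:
  assumes J: "ideal J R"
    and c: "\<And>p. A p \<in> carrier R" "\<And>p. B p \<in> carrier R" "\<And>p. T p \<in> carrier R" "\<And>p. y p \<in> carrier R"
    and A: "\<And>p. p \<le> m \<Longrightarrow> A p \<ominus> y p \<otimes> T (Suc p) \<in> J" and B: "\<And>p. p \<le> m \<Longrightarrow> B p \<ominus> y p \<otimes> T p \<in> J"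
    and y: "\<And>p. y (Suc p) = \<ominus> y p" and T0: "T 0 = \<zero>"
  shows "(\<Oplus>p\<in>{..m::nat}. A p \<oplus> B p) \<ominus> y m \<otimes> T (Suc m) \<in> J"
  using A B
proof (induction m)
  interpret J: ideal J R by (rule J)
  case 0
  have "(A 0 \<ominus> y 0 \<otimes> T (Suc 0)) \<oplus> (B 0 \<ominus> y 0 \<otimes> T 0) \<in> J" using 0 by (intro J.a_closed) auto
  then show ?case using c T0 by (simp add: a_minus_def a_ac)
next
  interpret J: ideal J R by (rule J)
  case (Suc m)
  let ?s = "\<Oplus>p\<in>{..m}. A p \<oplus> B p"
  have sc: "?s \<in> carrier R" using c by (intro finsum_closed) auto
  have fs: "(\<Oplus>p\<in>{..Suc m}. A p \<oplus> B p) = (A (Suc m) \<oplus> B (Suc m)) \<oplus> ?s"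
    by (rule finsum_Suc) (use c in auto)
  have 1: "?s \<ominus> y m \<otimes> T (Suc m) \<in> J" by (rule Suc.IH) (use Suc.prems in auto)
  have 2: "(?s \<ominus> y m \<otimes> T (Suc m)) \<oplus> ((A (Suc m) \<ominus> y (Suc m) \<otimes> T (Suc (Suc m))) \<oplus> (B (Suc m) \<ominus> y (Suc m) \<otimes> T (Suc m))) \<in> J"
    by (intro J.a_closed 1 Suc.prems) simp_all
  have cancel: "u \<oplus> (z \<oplus> \<ominus> u) = z" if "u \<in> carrier R" "z \<in> carrier R" for u z
    using that by (simp add: a_lcomm[of u] r_neg)
  have "(\<Oplus>p\<in>{..Suc m}. A p \<oplus> B p) \<ominus> y (Suc m) \<otimes> T (Suc (Suc m)) =
      (?s \<ominus> y m \<otimes> T (Suc m)) \<oplus> ((A (Suc m) \<ominus> y (Suc m) \<otimes> T (Suc (Suc m))) \<oplus> (B (Suc m) \<ominus> y (Suc m) \<otimes> T (Suc m)))"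
    unfolding fs y using c sc cancel by (simp add: a_minus_def l_minus a_ac r_neg1 r_neg2 r_neg)
  then show ?case using 2 by simp
qed

end

section \<open>Cocycles on tensor products of resolutions\<close>

locale local_tensor_bicomplex = finite_length_local_ring R \<mm> + B: tensor_bicomplex R a b D E
  for R :: "('a, 'r) ring_scheme" (structure) and \<mm> a b D E +
  assumes Dm: "\<And>p u i. u \<in> carrier (free_module R {..<a (Suc p)}) \<Longrightarrow> i < a p \<Longrightarrow> D p u i \<in> \<mm>"
    and Em: "\<And>q u i. u \<in> carrier (free_module R {..<b (Suc q)}) \<Longrightarrow> i < b q \<Longrightarrow> E q u i \<in> \<mm>"
begin

text \<open>The functional \<theta> \<otimes> \<eta>: apply \<eta> to each row, then \<theta> to the
  resulting vector.\<close>

definition pairing :: "nat \<Rightarrow> ((nat \<Rightarrow> 'a) \<Rightarrow> 'a) \<Rightarrow> ((nat \<Rightarrow> 'a) \<Rightarrow> 'a) \<Rightarrow> (nat \<Rightarrow> nat \<Rightarrow> 'a) \<Rightarrow> 'a" where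
  "pairing p \<theta> \<eta> x = \<theta> (\<lambda>i\<in>{..<a p}. \<eta> (x i))"

lemma pairing_arg_hom:
  assumes "\<eta> \<in> module_hom R (B.FB q) (regular_module R)"
  shows "(\<lambda>x. \<lambda>i\<in>{..<a p}. \<eta> (x i)) \<in> module_hom R (B.X p q) (B.FA p)"
  unfolding B.X_def free_module_eq_dprod[OF finite_lessThan[of "a p"]]
  by (rule dprod_hom) (rule module_hom_comp[OF pow_proj_hom assms])

lemma pairing_hom:
  assumes "\<theta> \<in> module_hom R (B.FA p) (regular_module R)" and "\<eta> \<in> module_hom R (B.FB q) (regular_module R)"
  shows "pairing p \<theta> \<eta> \<in> module_hom R (B.X p q) (regular_module R)"
  unfolding pairing_def[abs_def] by (rule module_hom_comp[OF pairing_arg_hom[OF assms(2)] assms(1)])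

lemma pairing_DF:
  assumes \<eta>: "\<eta> \<in> module_hom R (B.FB q) (regular_module R)" and x: "x \<in> carrier (B.X (Suc p) q)"
  shows "pairing p \<theta> \<eta> (B.DF p q x) = \<theta> (D p (\<lambda>i\<in>{..<a (Suc p)}. \<eta> (x i)))"
proof -
  let ?w = "\<lambda>i\<in>{..<a (Suc p)}. \<eta> (x i)"
  have w: "?w \<in> carrier (B.FA (Suc p))" by (rule module_hom_closed[OF pairing_arg_hom[OF \<eta>] x])
  have "act R (regular_module R) {..<a (Suc p)} {..<a p} (D p) ?w = (\<lambda>y\<in>{..<a p}. \<eta> (B.DF p q x y))"
    unfolding B.DF_def
    by (rule act_natural[OF cr _ _ B.D B.FB regular \<eta>]) (use B.X_mem[OF x] in auto)
  then show ?thesis unfolding pairing_def by (simp add: act_regular[OF cr _ _ B.D w])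
qed

lemma pairing_simple:
  assumes \<theta>: "\<theta> \<in> module_hom R (B.FA p) (regular_module R)" and \<eta>: "\<eta> \<in> module_hom R (B.FB q) (regular_module R)"
    and u: "u \<in> carrier (B.FA p)" and v: "v \<in> carrier (B.FB q)"
  shows "pairing p \<theta> \<eta> (\<lambda>i\<in>{..<a p}. u i \<odot>\<^bsub>B.FB q\<^esub> v) = \<eta> v \<otimes> \<theta> u"
proof -
  have c: "\<eta> v \<in> carrier R" using module_hom_closed[OF \<eta> v] by simp
  have "(\<lambda>i\<in>{..<a p}. \<eta> ((\<lambda>i\<in>{..<a p}. u i \<odot>\<^bsub>B.FB q\<^esub> v) i)) = \<eta> v \<odot>\<^bsub>B.FA p\<^esub> u"
    unfolding free_simps(3)[where a = "\<eta> v"]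
  proof (rule restrict_ext)
    fix i assume i: "i \<in> {..<a p}"
    have ui: "u i \<in> carrier R" using free_mem[OF _ u i] by simp
    have "\<eta> (u i \<odot>\<^bsub>B.FB q\<^esub> v) = u i \<otimes> \<eta> v" using module_hom_smult[OF \<eta> ui v] by simp
    then show "\<eta> ((\<lambda>i\<in>{..<a p}. u i \<odot>\<^bsub>B.FB q\<^esub> v) i) = \<eta> v \<otimes> u i" using i ui c by (simp add: m_comm)
  qed
  then show ?thesis unfolding pairing_def using module_hom_smult[OF \<theta> c u] by simp
qed

text \<open>Both component complexes are minimal, so every entry of the total differential is an
  entry of \<open>D\<close> or, up to sign, of \<open>E\<close>.\<close>

lemma tot_d_mm:
  assumes g: "g \<in> carrier (B.tot (Suc n))"
  shows "B.tot_d n g \<in> ideal_smult R \<mm> (B.tot n)"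
  unfolding B.tot_def
proof (rule ideal_smult_dprod[OF cr B.modX _ mm_carrier])
  show "B.tot_d n g \<in> carrier (dprod {..n} (\<lambda>p. B.X p (n - p)))"
    using module_hom_closed[OF B.tot_d_hom g] by (simp add: B.tot_def)
  fix p assume p: "p \<in> {..n}"
  let ?q = "n - p"
  have g1: "g (Suc p) \<in> carrier (B.X (Suc p) ?q)" and g0: "g p \<in> carrier (B.X p (Suc ?q))"
    using B.tot_mem[OF g, of "Suc p"] B.tot_mem[OF g, of p] p by (simp_all add: Suc_diff_le)
  have "B.DF p ?q (g (Suc p)) \<in> ideal_smult R \<mm> (B.X p ?q)"
    unfolding B.X_def
  proof (rule ideal_smult_dprod[OF cr B.FB _ mm_carrier])
    show "B.DF p ?q (g (Suc p)) \<in> carrier (pow_module {..<a p} (B.FB ?q))"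
      using module_hom_closed[OF B.Dhom g1] by (simp add: B.X_def)
    fix i assume i: "i \<in> {..<a p}"
    show "B.DF p ?q (g (Suc p)) i \<in> ideal_smult R \<mm> (B.FB ?q)"
      using i unfolding B.DF_def act_def restrict_apply'[OF i]
      by (intro comb_ideal_smult[OF B.FB mm_carrier])
        (use B.X_mem[OF g1] Dm[OF free_gen_closed[OF cr]] in auto)
  qed simp
  moreover have "B.EF p ?q (g p) \<in> ideal_smult R \<mm> (B.X p ?q)"
    unfolding B.X_def
  proof (rule ideal_smult_dprod[OF cr B.FB _ mm_carrier])
    show "B.EF p ?q (g p) \<in> carrier (pow_module {..<a p} (B.FB ?q))"
      using module_hom_closed[OF B.Ehom g0] by (simp add: B.X_def)
    fix i assume i: "i \<in> {..<a p}"
    have c: "g p i \<in> carrier (B.FB (Suc ?q))" using B.X_mem[OF g0] i by simp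
    have "E ?q (g p i) \<in> ideal_smult R \<mm> (B.FB ?q)"
      unfolding ideal_smult_free[OF mm_ideal] using Em[OF c] module_hom_closed[OF B.E c] by simp
    then show "B.EF p ?q (g p) i \<in> ideal_smult R \<mm> (B.FB ?q)"
      using i submodule_neg[OF B.FB ideal_smult_submodule[OF B.FB mm_carrier]] by (simp add: B.EF_def B.Es_def)
  qed simp
  ultimately have "B.DF p ?q (g (Suc p)) \<oplus>\<^bsub>B.X p ?q\<^esub> B.EF p ?q (g p) \<in> ideal_smult R \<mm> (B.X p ?q)"
    by (rule submodule_add[OF B.modX ideal_smult_submodule[OF B.modX mm_carrier]])
  then show "B.tot_d n g p \<in> ideal_smult R \<mm> (B.X p ?q)" using p by (simp add: B.tot_d_def)
qed simp

text \<open>S acts on \<open>q\<close> copies of the total complex, with the sign (-1)^p in degree p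
  so that it anticommutes with the differential. Its entries lie in \<mm>, and \<open>bot\<close>
  says that \<mm> kills the homology in degree 0, so S vanishes there. \<open>cocycle_in\<close> is
  then applied to \<open>q\<close> copies of \<Theta>, with values in R^q and with vectors having
  coordinates in J and in \<mm>.\<close>

lemma no_large_cocycle:
  fixes q :: nat
  assumes J: "ideal J R" and J\<mm>: "J \<subseteq> \<mm>" and mmJ: "\<And>b c. b \<in> \<mm> \<Longrightarrow> c \<in> \<mm> \<Longrightarrow> b \<otimes> c \<in> J"
    and q: "q > 0" and S: "S \<in> module_hom R (free_module R {..<q}) (free_module R {..<q})"
    and Sm: "\<And>t i. t \<in> carrier (free_module R {..<q}) \<Longrightarrow> i < q \<Longrightarrow> S t i \<in> \<mm>"
    and SS: "\<And>t. t \<in> carrier (free_module R {..<q}) \<Longrightarrow> S (S t) = \<zero>\<^bsub>free_module R {..<q}\<^esub>"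
    and SJ: "\<And>t i. t \<in> carrier (free_module R {..<q}) \<Longrightarrow> (\<And>i. i < q \<Longrightarrow> S t i \<in> J) \<Longrightarrow> i < q \<Longrightarrow> t i \<in> \<mm>"
    and exact: "\<And>k. k < n \<Longrightarrow> B.tot_exact (Suc k)"
    and bot: "\<And>s x. s \<in> \<mm> \<Longrightarrow> x \<in> carrier (B.X 0 0) \<Longrightarrow>
      \<exists>y\<in>carrier (B.X 0 (Suc 0)). \<exists>z\<in>carrier (B.X (Suc 0) 0). s \<odot>\<^bsub>B.X 0 0\<^esub> x = B.DF 0 0 z \<oplus>\<^bsub>B.X 0 0\<^esub> B.EF 0 0 y"
    and \<Theta>: "\<Theta> \<in> module_hom R (B.tot n) (regular_module R)"
    and \<Theta>d: "\<And>g. g \<in> carrier (B.tot (Suc n)) \<Longrightarrow> \<Theta> (B.tot_d n g) \<in> J"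
    and g: "g \<in> carrier (B.tot n)"
  shows "\<Theta> g \<in> \<mm>"
proof -
  let ?Q = "{..<q}"
  let ?T = "free_module R ?Q"
  let ?G = "\<lambda>p. pow_module ?Q (B.tot p)"
  let ?d = "\<lambda>p x. \<lambda>i\<in>?Q. B.tot_d p (x i)"
  let ?A = "\<lambda>p. act R (B.tot p) ?Q ?Q S"
  define Sp where "Sp p x = (if even p then ?A p x else \<ominus>\<^bsub>?G p\<^esub> ?A p x)" for p x
  have T: "Module.module R ?T" by (rule free) simp
  have G: "Module.module R (?G p)" for p by (rule module_dprod[OF cr B.module_tot])
  have A: "?A p \<in> module_hom R (?G p) (?G p)" for p by (rule act_hom[OF cr _ _ S B.module_tot]) simp_all
  have d: "?d p \<in> module_hom R (?G (Suc p)) (?G p)" for p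
    by (rule dprod_hom) (rule module_hom_comp[OF pow_proj_hom B.tot_d_hom])
  have Gm: "x i \<in> carrier (B.tot p)" if "x \<in> carrier (?G p)" "i < q" for x i p using that by (auto simp: dprod_simps)
  have AA: "?A p (?A p x) = \<zero>\<^bsub>?G p\<^esub>" if x: "x \<in> carrier (?G p)" for p x
  proof -
    have "?A p (?A p x) = act R (B.tot p) ?Q ?Q (\<lambda>v. S (S v)) x"
      by (rule act_comp[OF cr _ _ _ B.module_tot S S x]) simp_all
    also have "\<dots> = \<zero>\<^bsub>?G p\<^esub>"
      by (rule act_zero[OF cr _ _ B.module_tot _ x]) (simp_all add: SS free_gen_closed[OF cr])
    finally show ?thesis .
  qed
  have dA: "?d p (?A (Suc p) x) = ?A p (?d p x)" if x: "x \<in> carrier (?G (Suc p))" for p x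
    by (rule act_natural[OF cr _ _ S B.module_tot B.module_tot B.tot_d_hom, symmetric]) (use Gm[OF x] in auto)
  interpret Z: square_zero_complex R ?G ?d Sp n
  proof (rule square_zero_complex.intro)
    show "Module.module R (?G p)" for p by (rule G)
    show "?d p \<in> module_hom R (?G (Suc p)) (?G p)" for p by (rule d)
    show "?d p (?d (Suc p) x) = \<zero>\<^bsub>?G p\<^esub>" if x: "x \<in> carrier (?G (Suc (Suc p)))" for p x
      unfolding dprod_simps by (rule restrict_ext) (use B.tot_dd[OF Gm[OF x]] in simp)
    show "x \<in> ?d (Suc p) ` carrier (?G (Suc (Suc p)))"
      if p: "p < n" and x: "x \<in> carrier (?G (Suc p))" and z: "?d p x = \<zero>\<^bsub>?G p\<^esub>" for p x
    proof -
      have "\<exists>w. w \<in> carrier (B.tot (Suc (Suc p))) \<and> x i = B.tot_d (Suc p) w" if i: "i < q" for i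
      proof -
        have "B.tot_d p (x i) = \<zero>\<^bsub>B.tot p\<^esub>" using fun_cong[OF z, of i] i by (simp add: dprod_simps)
        from B.tot_exactD[OF exact[OF p] Gm[OF x i] this] show ?thesis by blast
      qed
      then obtain w where w: "\<And>i. i < q \<Longrightarrow> w i \<in> carrier (B.tot (Suc (Suc p)))" "\<And>i. i < q \<Longrightarrow> x i = B.tot_d (Suc p) (w i)" by metis
      have wc: "restrict w ?Q \<in> carrier (?G (Suc (Suc p)))" using w(1) by (auto simp: dprod_simps)
      have "x = restrict x ?Q" using x by (simp add: dprod_simps PiE_restrict)
      also have "\<dots> = ?d (Suc p) (restrict w ?Q)" by (rule restrict_ext) (use w(2) in simp)
      finally show ?thesis using wc by (rule image_eqI)
    qed
    show Sph: "Sp p \<in> module_hom R (?G p) (?G p)" for p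
      unfolding Sp_def[abs_def] using A module_hom_neg[OF G G A] by (cases "even p") simp_all
    show "Sp p (Sp p x) = \<zero>\<^bsub>?G p\<^esub>" if x: "x \<in> carrier (?G p)" for p x
    proof -
      interpret G: Module.module R "?G p" by (rule G)
      show ?thesis using AA[OF x] module_hom_a_inv[OF G G A module_hom_closed[OF A x]] by (simp add: Sp_def)
    qed
    show "?d p (Sp (Suc p) x) = \<ominus>\<^bsub>?G p\<^esub> Sp p (?d p x)" if x: "x \<in> carrier (?G (Suc p))" for p x
    proof -
      interpret G: Module.module R "?G p" by (rule G)
      have dx: "?A p (?d p x) \<in> carrier (?G p)" by (rule module_hom_closed[OF A module_hom_closed[OF d x]])
      show ?thesis
      proof (cases "even p")
        case True
        have "?d p (\<ominus>\<^bsub>?G (Suc p)\<^esub> ?A (Suc p) x) = \<ominus>\<^bsub>?G p\<^esub> ?d p (?A (Suc p) x)"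
          by (rule module_hom_a_inv[OF G G d module_hom_closed[OF A x]])
        then show ?thesis unfolding dA[OF x] using True by (simp only: Sp_def even_Suc if_True if_False simp_thms)
      next
        case False
        then show ?thesis using dA[OF x] dx by (simp only: Sp_def even_Suc if_True if_False simp_thms G.M.minus_minus)
      qed
    qed
    show "Sp 0 x \<in> ?d 0 ` carrier (?G (Suc 0))" if x: "x \<in> carrier (?G 0)" for x
    proof -
      let ?H = "B.tot_d 0 ` carrier (B.tot (Suc 0))"
      have H: "submodule ?H R (B.tot 0)" by (rule submodule_image[OF B.module_tot B.module_tot B.tot_d_hom carrier_submodule[OF B.module_tot]])
      have sH: "s \<odot>\<^bsub>B.tot 0\<^esub> u \<in> ?H" if s: "s \<in> \<mm>" and u: "u \<in> carrier (B.tot 0)" for s u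
      proof -
        have u0: "u 0 \<in> carrier (B.X 0 0)" using B.tot_mem[OF u, of 0] by simp
        obtain y z where y: "y \<in> carrier (B.X 0 (Suc 0))" and z: "z \<in> carrier (B.X (Suc 0) 0)"
          and eq: "s \<odot>\<^bsub>B.X 0 0\<^esub> u 0 = B.DF 0 0 z \<oplus>\<^bsub>B.X 0 0\<^esub> B.EF 0 0 y" using bot[OF s u0] by blast
        let ?h = "\<lambda>p\<in>{..Suc 0}. if p = 0 then y else z"
        have h: "?h \<in> carrier (B.tot (Suc 0))" using y z by (auto simp: B.tot_def dprod_simps le_Suc_eq)
        have "s \<odot>\<^bsub>B.tot 0\<^esub> u = B.tot_d 0 ?h"
          unfolding B.tot_d_def by (subst B.tot_def, subst dprod_simps, rule restrict_ext) (use eq in simp)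
        then show ?thesis using h by blast
      qed
      have "?A 0 x i \<in> ?H" if i: "i < q" for i
      proof -
        have "?A 0 x i = comb (B.tot 0) ?Q x (\<lambda>k\<in>?Q. S (free_gen R ?Q k) i)" using i by (simp add: act_def)
        also have "\<dots> \<in> ?H" unfolding comb_def
        proof (rule submodule_finsum[OF B.module_tot H], rule Pi_I)
          fix k assume k: "k \<in> ?Q"
          show "(\<lambda>k\<in>?Q. S (free_gen R ?Q k) i) k \<odot>\<^bsub>B.tot 0\<^esub> x k \<in> ?H"
            using k Gm[OF x] sH Sm[OF free_gen_closed[OF cr] i] by simp
        qed
        finally show ?thesis .
      qed
      then have "\<exists>w. w \<in> carrier (B.tot (Suc 0)) \<and> ?A 0 x i = B.tot_d 0 w" if "i < q" for i using that by blast
      then obtain w where w: "\<And>i. i < q \<Longrightarrow> w i \<in> carrier (B.tot (Suc 0))" "\<And>i. i < q \<Longrightarrow> ?A 0 x i = B.tot_d 0 (w i)" by metis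
      have wc: "restrict w ?Q \<in> carrier (?G (Suc 0))" using w(1) by (auto simp: dprod_simps)
      have "Sp 0 x = restrict (?A 0 x) ?Q"
        using module_hom_closed[OF A x] by (simp add: Sp_def dprod_simps PiE_restrict)
      also have "\<dots> = ?d 0 (restrict w ?Q)" by (rule restrict_ext) (use w(2) in simp)
      finally show ?thesis using wc by (rule image_eqI)
    qed
    show "liftable R (?G p) (?G (Suc k)) (?G k) (?d k)" for p k
    proof -
      \<comment> \<open>The terms are finite products nested over free modules of finite rank, and
        liftability passes through each layer.\<close>
      note l1 = liftable_free[OF cr finite_lessThan G G d]
      have l2: "liftable R (B.X p' r) (?G (Suc k)) (?G k) (?d k)" for p' r
        unfolding B.X_def[of p' r] by (rule liftable_dprod[OF cr B.FB finite_lessThan G G d l1])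
      have l3: "liftable R (B.tot p) (?G (Suc k)) (?G k) (?d k)" for p
        unfolding B.tot_def[of p] by (rule liftable_dprod[OF cr B.modX finite_atMost G G d l2])
      show ?thesis by (rule liftable_dprod[OF cr B.module_tot finite_lessThan G G d l3])
    qed
  qed
  let ?Th = "\<lambda>x. \<lambda>i\<in>?Q. \<Theta> (x i)"
  let ?V = "\<lambda>K. {u \<in> carrier ?T. \<forall>i<q. u i \<in> K}"
  have V: "ideal_smult R K ?T = ?V K" if "ideal K R" for K by (rule ideal_smult_free[OF that])
  have Jc: "J \<subseteq> carrier R" using J\<mm> mm_carrier by blast
  have Th: "?Th \<in> module_hom R (?G n) ?T"
    unfolding free_module_eq_dprod[OF finite_lessThan] by (rule dprod_hom) (rule module_hom_comp[OF pow_proj_hom \<Theta>])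
  have "?Th ` carrier (?G n) \<subseteq> ?V \<mm>"
  proof (rule Z.cocycle_in[OF T Th])
    fix x assume x: "x \<in> carrier (?G n)"
    have c: "?Th x \<in> carrier ?T" by (rule module_hom_closed[OF Th x])
    have "act R (regular_module R) ?Q ?Q S (?Th x) = ?Th (?A n x)"
      by (rule act_natural[OF cr _ _ S B.module_tot regular \<Theta>]) (use Gm[OF x] in auto)
    then have e: "?Th (?A n x) = S (?Th x)" by (simp add: act_regular[OF cr _ _ S c])
    show "?Th (Sp n x) = (if even n then S (?Th x) else \<ominus>\<^bsub>?T\<^esub> S (?Th x))"
    proof (cases "even n")
      case False
      have "?Th (\<ominus>\<^bsub>?G n\<^esub> ?A n x) = \<ominus>\<^bsub>?T\<^esub> ?Th (?A n x)" by (rule module_hom_a_inv[OF G T Th module_hom_closed[OF A x]])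
      then show ?thesis unfolding e using False by (simp only: Sp_def if_False)
    next
      case True
      then show ?thesis using e by (simp only: Sp_def if_True)
    qed
  next
    fix x assume x: "x \<in> carrier (?G (Suc n))"
    have "?Th (?d n x) \<in> carrier ?T" by (rule module_hom_closed[OF Th module_hom_closed[OF d x]])
    moreover have "?Th (?d n x) i \<in> J" if "i < q" for i using \<Theta>d[OF Gm[OF x that]] that by simp
    ultimately show "?Th (?d n x) \<in> ?V J" by blast
  next
    show VJ: "submodule (?V J) R ?T" using ideal_smult_submodule[OF T Jc] unfolding V[OF J] .
    fix t assume t: "t \<in> carrier ?T" and St: "(if even n then S t else \<ominus>\<^bsub>?T\<^esub> S t) \<in> ?V J"
    interpret T: Module.module R ?T by (rule T)
    have "S t \<in> ?V J"
    proof (cases "even n")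
      case False
      then have "\<ominus>\<^bsub>?T\<^esub> S t \<in> ?V J" using St by (simp only: if_False)
      from submodule_neg[OF T VJ this] show ?thesis using T.M.minus_minus[OF module_hom_closed[OF S t]] by (simp only:)
    qed (use St in \<open>simp only: if_True\<close>)
    then show "t \<in> ?V \<mm>" using t SJ[OF t] by blast
  next
    fix p h x assume h: "h \<in> module_hom R (?G p) ?T" and hm: "h ` carrier (?G p) \<subseteq> ?V \<mm>" and x: "x \<in> carrier (?G (Suc p))"
    have VJ: "submodule (?V J) R ?T" using ideal_smult_submodule[OF T Jc] unfolding V[OF J] .
    \<comment> \<open>A multiple s y with s in \<mm> goes to s times a vector with coordinates in
      \<mm>, hence into J. By minimality all values of the differential are sums of such
      multiples.\<close>
    have "ideal_smult R \<mm> (?G p) \<subseteq> {y \<in> carrier (?G p). h y \<in> ?V J}"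
    proof (rule ideal_smult_least[OF submodule_vimage[OF G T h VJ]])
      interpret G: Module.module R "?G p" by (rule G)
      interpret T: Module.module R ?T by (rule T)
      fix s y assume s: "s \<in> \<mm>" and y: "y \<in> carrier (?G p)"
      have sc: "s \<in> carrier R" by (rule mm_closed[OF s])
      have hy: "h y \<in> ?V \<mm>" using hm y by blast
      have "h (s \<odot>\<^bsub>?G p\<^esub> y) = s \<odot>\<^bsub>?T\<^esub> h y" by (rule module_hom_smult[OF h sc y])
      moreover have "(s \<odot>\<^bsub>?T\<^esub> h y) i \<in> J" if "i < q" for i using mmJ[OF s, of "h y i"] hy that by (simp add: free_simps)
      moreover have "s \<odot>\<^bsub>?T\<^esub> h y \<in> carrier ?T" using sc hy by simp
      ultimately have "h (s \<odot>\<^bsub>?G p\<^esub> y) \<in> ?V J" by simp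
      then show "s \<odot>\<^bsub>?G p\<^esub> y \<in> {y \<in> carrier (?G p). h y \<in> ?V J}" using G.smult_closed[OF sc y] by blast
    qed
    moreover have "?d p x \<in> ideal_smult R \<mm> (?G p)"
      by (rule ideal_smult_dprod[OF cr B.module_tot finite_lessThan mm_carrier module_hom_closed[OF d x]])
        (use tot_d_mm[OF Gm[OF x]] in simp)
    ultimately show "h (?d p x) \<in> ?V J" by blast
  qed
  moreover have "(\<lambda>i\<in>?Q. g) \<in> carrier (?G n)" using g by (simp add: dprod_simps)
  ultimately have "?Th (\<lambda>i\<in>?Q. g) \<in> ?V \<mm>" by blast
  then show ?thesis using q by auto
qed

end

context local_tensor_bicomplex
begin

text \<open>The sign in the recursion for \<open>\<theta>\<close> compensates the sign \<open>(-1)\<^sup>p\<close> of the vertical differential, so that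
  the terms of \<open>functional \<theta> \<eta> n \<circ> d\<close> cancel modulo \<open>J\<close>.\<close>

definition functional :: "(nat \<Rightarrow> (nat \<Rightarrow> 'a) \<Rightarrow> 'a) \<Rightarrow> (nat \<Rightarrow> (nat \<Rightarrow> 'a) \<Rightarrow> 'a) \<Rightarrow> nat \<Rightarrow> (nat \<Rightarrow> nat \<Rightarrow> nat \<Rightarrow> 'a) \<Rightarrow> 'a" where
  "functional \<theta> \<eta> n g = (\<Oplus>\<^bsub>regular_module R\<^esub>p\<in>{..n}. pairing p (\<theta> p) (\<eta> (n - p)) (g p))"

context
  fixes \<theta> \<eta> :: "nat \<Rightarrow> (nat \<Rightarrow> 'a) \<Rightarrow> 'a" and x :: 'a and J :: "'a set" and P Q :: nat
  assumes J: "ideal J R" and J\<mm>: "J \<subseteq> \<mm>" and x: "x \<in> carrier R"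
    and \<theta>: "\<And>p. \<theta> p \<in> module_hom R (B.FA p) (regular_module R)"
    and \<eta>: "\<And>q. \<eta> q \<in> module_hom R (B.FB q) (regular_module R)"
    and \<theta>0: "\<And>p u. p > P \<Longrightarrow> u \<in> carrier (B.FA p) \<Longrightarrow> \<theta> p u = \<zero>"
    and \<eta>0: "\<And>q u. q > Q \<Longrightarrow> u \<in> carrier (B.FB q) \<Longrightarrow> \<eta> q u = \<zero>"
    and \<theta>D: "\<And>p u. u \<in> carrier (B.FA (Suc p)) \<Longrightarrow>
      \<theta> p (D p u) \<ominus> (if even p then x else \<ominus> x) \<otimes> \<theta> (Suc p) u \<in> J"
    and \<eta>E: "\<And>q u. u \<in> carrier (B.FB (Suc q)) \<Longrightarrow> \<eta> q (E q u) \<ominus> x \<otimes> \<eta> (Suc q) u \<in> J"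
begin

private abbreviation "y p \<equiv> if even p then x else \<ominus> x"

lemma functional_hom: "functional \<theta> \<eta> n \<in> module_hom R (B.tot n) (regular_module R)"
  unfolding functional_def[abs_def]
proof (rule module_hom_sum[OF B.module_tot regular])
  fix p assume p: "p \<in> {..n}"
  have "(\<lambda>g. g p) \<in> module_hom R (B.tot n) (B.X p (n - p))" unfolding B.tot_def by (rule dprod_proj_hom[OF p])
  then show "(\<lambda>g. pairing p (\<theta> p) (\<eta> (n - p)) (g p)) \<in> module_hom R (B.tot n) (regular_module R)"
    by (rule module_hom_comp[OF _ pairing_hom[OF \<theta> \<eta>]])
qed simp

lemma pairing_EF:
  assumes z: "z \<in> carrier (B.X p (Suc q))"
  shows "pairing p (\<theta> p) (\<eta> q) (B.EF p q z) \<ominus> y p \<otimes> pairing p (\<theta> p) (\<eta> (Suc q)) z \<in> J"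
proof -
  interpret J: ideal J R by (rule J)
  interpret F: Module.module R "B.FA p" by (rule B.FA)
  interpret L: Module.module R "regular_module R" by (rule regular)
  have yc: "y p \<in> carrier R" using x by simp
  let ?w1 = "\<lambda>i\<in>{..<a p}. \<eta> q (B.EF p q z i)" and ?w2 = "\<lambda>i\<in>{..<a p}. \<eta> (Suc q) (z i)"
  have w1: "?w1 \<in> carrier (B.FA p)" by (rule module_hom_closed[OF pairing_arg_hom[OF \<eta>] module_hom_closed[OF B.Ehom z]])
  have w2: "?w2 \<in> carrier (B.FA p)" by (rule module_hom_closed[OF pairing_arg_hom[OF \<eta>] z])
  have yw2: "y p \<odot>\<^bsub>B.FA p\<^esub> ?w2 \<in> carrier (B.FA p)" by (rule F.smult_closed[OF yc w2])
  have "\<theta> p (?w1 \<ominus>\<^bsub>B.FA p\<^esub> y p \<odot>\<^bsub>B.FA p\<^esub> ?w2) \<in> J"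
  proof (rule hom_free_in_ideal[OF J \<theta> F.M.minus_closed[OF w1 yw2]])
    fix i assume i: "i < a p"
    have zi: "z i \<in> carrier (B.FB (Suc q))" by (rule B.X_mem[OF z i])
    have Ec: "E q (z i) \<in> carrier (B.FB q)" by (rule module_hom_closed[OF B.E zi])
    have e: "\<eta> q (E q (z i)) \<ominus> x \<otimes> \<eta> (Suc q) (z i) \<in> J" by (rule \<eta>E[OF zi])
    have c1: "\<eta> q (E q (z i)) \<in> carrier R" and c2: "\<eta> (Suc q) (z i) \<in> carrier R"
      using module_hom_closed[OF \<eta> Ec] module_hom_closed[OF \<eta> zi] by simp_all
    have "(\<lambda>u. u i) \<in> module_hom R (B.FA p) (regular_module R)" by (rule free_proj_hom) (use i in simp_all)
    from module_hom_minus[OF B.FA regular this w1 yw2]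
    have "(?w1 \<ominus>\<^bsub>B.FA p\<^esub> y p \<odot>\<^bsub>B.FA p\<^esub> ?w2) i = \<eta> q (B.Es p q (z i)) \<ominus>\<^bsub>regular_module R\<^esub> y p \<otimes> \<eta> (Suc q) (z i)"
      using i by (simp add: free_simps B.EF_def)
    also have "\<dots> = \<eta> q (B.Es p q (z i)) \<ominus> y p \<otimes> \<eta> (Suc q) (z i)"
      using module_hom_closed[OF \<eta> module_hom_closed[OF B.Es_hom zi]] c2 yc by (intro regular_minus) simp_all
    also have "\<dots> \<in> J"
    proof (cases "even p")
      case True
      then show ?thesis using e by (simp add: B.Es_def)
    next
      case False
      have "\<eta> q (\<ominus>\<^bsub>B.FB q\<^esub> E q (z i)) = \<ominus> \<eta> q (E q (z i))"
        using module_hom_a_inv[OF B.FB regular \<eta> Ec] L.M.minus_equality[of "\<ominus> \<eta> q (E q (z i))" "\<eta> q (E q (z i))"] c1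
        by (simp add: l_neg)
      then have "\<eta> q (B.Es p q (z i)) \<ominus> y p \<otimes> \<eta> (Suc q) (z i) = \<ominus> (\<eta> q (E q (z i)) \<ominus> x \<otimes> \<eta> (Suc q) (z i))"
        using False c1 c2 x by (simp add: B.Es_def a_minus_def minus_add l_minus)
      then show ?thesis using J.a_inv_closed[OF e] by simp
    qed
    finally show "(?w1 \<ominus>\<^bsub>B.FA p\<^esub> y p \<odot>\<^bsub>B.FA p\<^esub> ?w2) i \<in> J" .
  qed
  moreover have "\<theta> p (?w1 \<ominus>\<^bsub>B.FA p\<^esub> y p \<odot>\<^bsub>B.FA p\<^esub> ?w2) = \<theta> p ?w1 \<ominus>\<^bsub>regular_module R\<^esub> y p \<otimes> \<theta> p ?w2"
    using module_hom_minus[OF B.FA regular \<theta> w1 yw2] module_hom_smult[OF \<theta> yc w2] by simp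
  moreover have "\<dots> = \<theta> p ?w1 \<ominus> y p \<otimes> \<theta> p ?w2"
    using module_hom_closed[OF \<theta> w1] module_hom_closed[OF \<theta> w2] yc by (intro regular_minus) simp_all
  ultimately show ?thesis by (simp add: pairing_def)
qed

text \<open>By \<open>telescope_in_ideal\<close> only the two ends could contribute: one involves
  \<eta>_(n+1), zero as Q \<le> n, the other \<theta>_(n+1), zero as P \<le> n.\<close>

lemma functional_cocycle:
  assumes nP: "P \<le> n" and nQ: "Q \<le> n" and g: "g \<in> carrier (B.tot (Suc n))"
  shows "functional \<theta> \<eta> n (B.tot_d n g) \<in> J"
proof -
  interpret L: Module.module R "regular_module R" by (rule regular)
  \<comment> \<open>\<open>telescope_in_ideal\<close> asks for sequences of ring elements without a
    bound on the index; the value zero beyond the relevant degrees provides them.\<close>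
  define A where "A p = (if p \<le> n then pairing p (\<theta> p) (\<eta> (n - p)) (B.DF p (n - p) (g (Suc p))) else \<zero>)" for p
  define B where "B p = (if p \<le> n then pairing p (\<theta> p) (\<eta> (n - p)) (B.EF p (n - p) (g p)) else \<zero>)" for p
  define T where "T p = (if p \<le> Suc n then pairing p (\<theta> p) (\<eta> (Suc n - p)) (g p) else \<zero>)" for p
  have g1: "g (Suc p) \<in> carrier (B.X (Suc p) (n - p))" and g0: "g p \<in> carrier (B.X p (Suc (n - p)))" if "p \<le> n" for p
    using B.tot_mem[OF g, of "Suc p"] B.tot_mem[OF g, of p] that by (simp_all add: Suc_diff_le)
  have pc: "pairing p (\<theta> p) (\<eta> q) z \<in> carrier R" if "z \<in> carrier (B.X p q)" for p q z
    using module_hom_closed[OF pairing_hom[OF \<theta> \<eta>] that] by simp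
  have Ac: "A p \<in> carrier R" for p unfolding A_def using pc[OF module_hom_closed[OF B.Dhom g1]] by simp
  have Bc: "B p \<in> carrier R" for p unfolding B_def using pc[OF module_hom_closed[OF B.Ehom g0]] by simp
  have Tc: "T p \<in> carrier R" for p unfolding T_def using pc[OF B.tot_mem[OF g]] by simp
  have yc: "y p \<in> carrier R" for p using x by simp
  have T0: "T 0 = \<zero>"
  proof -
    have g00: "g 0 \<in> carrier (B.X 0 (Suc n))" using B.tot_mem[OF g, of 0] by simp
    have "(\<lambda>i\<in>{..<a 0}. \<eta> (Suc n) (g 0 i)) = \<zero>\<^bsub>B.FA 0\<^esub>"
      unfolding free_simps by (rule restrict_ext) (use \<eta>0 nQ B.X_mem[OF g00] in simp)
    then show ?thesis using module_hom_zero[OF B.FA regular \<theta>] by (simp add: T_def pairing_def)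
  qed
  have TS: "T (Suc n) = \<zero>"
  proof -
    have gS: "g (Suc n) \<in> carrier (B.X (Suc n) 0)" using B.tot_mem[OF g, of "Suc n"] by simp
    have "(\<lambda>i\<in>{..<a (Suc n)}. \<eta> 0 (g (Suc n) i)) \<in> carrier (B.FA (Suc n))"
      by (rule module_hom_closed[OF pairing_arg_hom[OF \<eta>] gS])
    then show ?thesis using \<theta>0 nP by (simp add: T_def pairing_def)
  qed
  have "(\<Oplus>p\<in>{..n}. A p \<oplus> B p) \<ominus> y n \<otimes> T (Suc n) \<in> J"
  proof (rule telescope_in_ideal[where y = "\<lambda>p. if even p then x else \<ominus> x" and A = A and B = B and T = T, OF J Ac Bc Tc yc _ _ _ T0])
    fix p assume p: "p \<le> n"
    have w: "(\<lambda>i\<in>{..<a (Suc p)}. \<eta> (n - p) (g (Suc p) i)) \<in> carrier (B.FA (Suc p))"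
      by (rule module_hom_closed[OF pairing_arg_hom[OF \<eta>] g1[OF p]])
    show "A p \<ominus> y p \<otimes> T (Suc p) \<in> J"
    proof -
      have "A p = \<theta> p (D p (\<lambda>i\<in>{..<a (Suc p)}. \<eta> (n - p) (g (Suc p) i)))"
        unfolding A_def using p by (simp add: pairing_DF[OF \<eta> g1[OF p]])
      moreover have "T (Suc p) = \<theta> (Suc p) (\<lambda>i\<in>{..<a (Suc p)}. \<eta> (n - p) (g (Suc p) i))"
        unfolding T_def using p by (simp add: pairing_def)
      ultimately show ?thesis using \<theta>D[OF w] by (simp only:)
    qed
    show "B p \<ominus> y p \<otimes> T p \<in> J"
      using pairing_EF[OF g0[OF p]] p unfolding B_def T_def by (simp add: Suc_diff_le)
  next
    show "y (Suc p) = \<ominus> y p" for p using x by simp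
  qed
  then have J1: "(\<Oplus>p\<in>{..n}. A p \<oplus> B p) \<in> J" unfolding TS r_null[OF yc]
    using Ac Bc finsum_closed[of "\<lambda>p. A p \<oplus> B p" "{..n}"] by (simp add: a_minus_def)
  have "functional \<theta> \<eta> n (B.tot_d n g) = (\<Oplus>\<^bsub>regular_module R\<^esub>p\<in>{..n}. A p \<oplus> B p)"
    unfolding functional_def
  proof (rule L.M.finsum_cong')
    show "(\<lambda>p. A p \<oplus> B p) \<in> {..n} \<rightarrow> carrier (regular_module R)" using Ac Bc by simp
    fix p assume "p \<in> {..n}"
    then have p: "p \<le> n" by simp
    have "B.tot_d n g p = B.DF p (n - p) (g (Suc p)) \<oplus>\<^bsub>B.X p (n - p)\<^esub> B.EF p (n - p) (g p)"
      using p by (simp add: B.tot_d_def)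
    then show "pairing p (\<theta> p) (\<eta> (n - p)) (B.tot_d n g p) = A p \<oplus> B p"
      using module_hom_add[OF pairing_hom[OF \<theta> \<eta>] module_hom_closed[OF B.Dhom g1[OF p]] module_hom_closed[OF B.Ehom g0[OF p]]] p
      by (simp add: A_def B_def)
  qed simp
  also have "\<dots> = (\<Oplus>p\<in>{..n}. A p \<oplus> B p)" by (rule finsum_transfer) (simp_all add: regular_module_def)
  finally show ?thesis using J1 by simp
qed

text \<open>On u \<otimes> v placed in bidegree (p, n - p) a single summand survives, and its value
  is a product of two elements outside \<mm>.\<close>

lemma functional_large:
  assumes p: "p \<le> n" and u: "u \<in> carrier (B.FA p)" "\<theta> p u \<notin> \<mm>" and v: "v \<in> carrier (B.FB (n - p))" "\<eta> (n - p) v \<notin> \<mm>"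
  shows "\<exists>g\<in>carrier (B.tot n). functional \<theta> \<eta> n g \<notin> \<mm>"
proof -
  interpret L: Module.module R "regular_module R" by (rule regular)
  interpret F: Module.module R "B.FB (n - p)" by (rule B.FB)
  let ?Y = "\<lambda>p. B.X p (n - p)"
  let ?w = "\<lambda>i\<in>{..<a p}. u i \<odot>\<^bsub>B.FB (n - p)\<^esub> v"
  have w: "?w \<in> carrier (B.X p (n - p))" by (rule B.XI) (use free_mem[OF _ u(1)] v(1) in simp)
  let ?g = "inj_at {..n} ?Y p ?w"
  have pn: "p \<in> {..n}" using p by simp
  have g: "?g \<in> carrier (B.tot n)" unfolding B.tot_def by (rule module_hom_closed[OF inj_at_hom[where Mf = ?Y, OF B.modX pn] w])
  have c: "pairing p (\<theta> p) (\<eta> (n - p)) ?w \<in> carrier R" using module_hom_closed[OF pairing_hom[OF \<theta> \<eta>] w] by simp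
  have "functional \<theta> \<eta> n ?g = (\<Oplus>\<^bsub>regular_module R\<^esub>k\<in>{..n}. if p = k then pairing p (\<theta> p) (\<eta> (n - p)) ?w else \<zero>\<^bsub>regular_module R\<^esub>)"
    unfolding functional_def
  proof (rule L.M.finsum_cong')
    fix k assume k: "k \<in> {..n}"
    show "pairing k (\<theta> k) (\<eta> (n - k)) (?g k) = (if p = k then pairing p (\<theta> p) (\<eta> (n - p)) ?w else \<zero>\<^bsub>regular_module R\<^esub>)"
    proof (cases "p = k")
      case True
      have "?g p = ?w" using pn by (simp add: inj_at_def del: restrict_apply) (simp add: restrict_def)
      then show ?thesis using True by simp
    next
      case False
      then have "?g k = \<zero>\<^bsub>?Y k\<^esub>" using k by (simp add: inj_at_def)
      then show ?thesis using False module_hom_zero[OF B.modX regular pairing_hom[OF \<theta> \<eta>]] by simp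
    qed
  qed (use c in auto)
  also have "\<dots> = pairing p (\<theta> p) (\<eta> (n - p)) ?w" by (rule L.M.finsum_singleton[OF pn]) (use c in auto)
  also have "\<dots> = \<eta> (n - p) v \<otimes> \<theta> p u" by (rule pairing_simple[OF \<theta> \<eta> u(1) v(1)])
  also have "\<dots> \<notin> \<mm>" using module_hom_closed[OF \<theta> u(1)] module_hom_closed[OF \<eta> v(1)] u(2) v(2) by (intro mm_prime) simp_all
  finally show ?thesis using g by blast
qed

end

text \<open>The two chains of functionals may stop at different degrees P and Q. The degree n = max
  P Q is large enough for the ends of the telescope to vanish, and it still contains a bidegree
  where both functionals are nonzero modulo \<mm>: (P, 0) if Q \<le> P, and (0, Q) otherwise. It is
  at most \<open>j\<close>, so total exactness is available in degrees 1 to n.\<close>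

lemma ideal_eq_maximal:
  assumes I: "ideal I R" and I\<mm>: "I \<subseteq> \<mm>"
    and DI: "\<And>u i. u \<in> carrier (free_module R {..<a (Suc j)}) \<Longrightarrow> i < a j \<Longrightarrow> D j u i \<in> I"
    and EI: "\<And>u i. u \<in> carrier (free_module R {..<b (Suc k)}) \<Longrightarrow> i < b k \<Longrightarrow> E k u i \<in> I" and kj: "k \<le> j"
    and a0: "a 0 > 0" and b0: "b 0 > 0"
    and prod: "\<And>r s. r \<in> \<mm> \<Longrightarrow> s \<in> \<mm> \<Longrightarrow>
      \<exists>(l::nat) v w. (\<forall>i<l. v i \<in> I \<and> w i \<in> \<mm>) \<and> r \<otimes> s = (\<Oplus>i\<in>{..<l}. v i \<otimes> w i)"
    and exact: "\<And>i. i < j \<Longrightarrow> B.tot_exact (Suc i)"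
    and bot: "\<And>s x. s \<in> \<mm> \<Longrightarrow> x \<in> carrier (B.X 0 0) \<Longrightarrow>
      \<exists>y\<in>carrier (B.X 0 (Suc 0)). \<exists>z\<in>carrier (B.X (Suc 0) 0). s \<odot>\<^bsub>B.X 0 0\<^esub> x = B.DF 0 0 z \<oplus>\<^bsub>B.X 0 0\<^esub> B.EF 0 0 y"
  shows "I = \<mm>"
proof (rule ccontr)
  assume ne: "I \<noteq> \<mm>"
  interpret I: ideal I R by (rule I)
  interpret m: ideal \<mm> R by (rule mm_ideal)
  let ?L = "regular_module R"
  interpret L: Module.module R ?L by (rule regular)
  have Is: "submodule I R ?L" using I ideal_iff_submodule[OF cr] by simp
  let ?\<F> = "{H. submodule H R ?L \<and> I \<subseteq> H \<and> H \<subset> \<mm>}"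
  have "?\<F> \<noteq> {}" using Is I\<mm> ne by blast
  then have "\<exists>J\<in>?\<F>. \<forall>K\<in>?\<F>. J \<subseteq> K \<longrightarrow> K = J" by (rule max_submodule) blast
  then obtain J where JF: "J \<in> ?\<F>" and JK: "\<forall>K\<in>?\<F>. J \<subseteq> K \<longrightarrow> K = J" by (elim bexE)
  have Js: "submodule J R ?L" and IJ: "I \<subseteq> J" and J\<mm>': "J \<subset> \<mm>" using JF by blast+
  have max: "K = J" if "submodule K R ?L" "I \<subseteq> K" "K \<subset> \<mm>" "J \<subseteq> K" for K
    using JK that by blast
  have J: "ideal J R" using Js ideal_iff_submodule[OF cr] by simp
  interpret J: ideal J R by (rule J)
  have J\<mm>: "J \<subseteq> \<mm>" using J\<mm>' by blast
  obtain x where x: "x \<in> \<mm>" "x \<notin> J" using J\<mm>' by blast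
  have xc: "x \<in> carrier R" by (rule mm_closed[OF x(1)])
  have mmJ: "r \<otimes> s \<in> J" if "r \<in> \<mm>" "s \<in> \<mm>" for r s
  proof -
    obtain l :: nat and v w where vw: "\<And>i. i < l \<Longrightarrow> v i \<in> I" "\<And>i. i < l \<Longrightarrow> w i \<in> \<mm>"
      and eq: "r \<otimes> s = (\<Oplus>i\<in>{..<l}. v i \<otimes> w i)" using prod[OF \<open>r \<in> \<mm>\<close> \<open>s \<in> \<mm>\<close>] by auto
    have "(\<Oplus>\<^bsub>?L\<^esub>i\<in>{..<l}. v i \<otimes> w i) \<in> J"
      by (rule submodule_finsum[OF regular Js]) (use vw IJ mm_closed in \<open>auto intro!: J.I_r_closed\<close>)
    moreover have "(\<Oplus>\<^bsub>?L\<^esub>i\<in>{..<l}. v i \<otimes> w i) = (\<Oplus>i\<in>{..<l}. v i \<otimes> w i)"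
      by (rule finsum_transfer) (simp_all add: regular_module_def)
    ultimately show ?thesis using eq by simp
  qed
  have xJ: "c \<in> \<mm>" if c: "c \<in> carrier R" "x \<otimes> c \<in> J" for c
  proof (rule ccontr)
    assume "c \<notin> \<mm>"
    then have cu: "c \<in> Units R" using unit_if_notin c(1) by blast
    have "(x \<otimes> c) \<otimes> inv c \<in> J" by (rule J.I_r_closed[OF c(2) Units_inv_closed[OF cu]])
    then have "x \<in> J" using xc c(1) cu by (simp add: m_assoc)
    then show False using x(2) by simp
  qed
  \<comment> \<open>The ideal J + xR lies inside \<mm> and is larger than J, so by maximality of J
    it is \<mm>.\<close>
  have decomp: "\<exists>c\<in>carrier R. r \<ominus> x \<otimes> c \<in> J" if r: "r \<in> \<mm>" for r
  proof -
    let ?K = "{z \<in> carrier R. \<exists>c\<in>carrier R. z \<ominus> x \<otimes> c \<in> J}"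
    have K: "submodule ?K R ?L"
    proof (rule submoduleI'[OF regular])
      show "?K \<subseteq> carrier ?L" by auto
      have "\<zero> \<ominus> x \<otimes> \<zero> \<in> J" using xc J.zero_closed by (simp add: a_minus_def)
      then show "\<zero>\<^bsub>?L\<^esub> \<in> ?K" by auto
      fix z assume "z \<in> ?K"
      then obtain c where z: "z \<in> carrier R" "c \<in> carrier R" "z \<ominus> x \<otimes> c \<in> J" by blast
      show "t \<odot>\<^bsub>?L\<^esub> z \<in> ?K" if t: "t \<in> carrier R" for t
      proof -
        have "t \<otimes> (z \<ominus> x \<otimes> c) \<in> J" by (rule J.I_l_closed[OF z(3) t])
        also have "t \<otimes> (z \<ominus> x \<otimes> c) = t \<otimes> z \<ominus> x \<otimes> (t \<otimes> c)"
          using t z xc by (simp add: a_minus_def r_distr r_minus m_lcomm)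
        finally show ?thesis using t z by auto
      qed
      fix z' assume "z' \<in> ?K"
      then obtain c' where z': "z' \<in> carrier R" "c' \<in> carrier R" "z' \<ominus> x \<otimes> c' \<in> J" by blast
      have "(z \<ominus> x \<otimes> c) \<oplus> (z' \<ominus> x \<otimes> c') \<in> J" by (rule J.a_closed[OF z(3) z'(3)])
      also have "(z \<ominus> x \<otimes> c) \<oplus> (z' \<ominus> x \<otimes> c') = (z \<oplus> z') \<ominus> x \<otimes> (c \<oplus> c')"
        using z z' xc by (simp add: a_minus_def r_distr minus_add a_ac)
      finally show "z \<oplus>\<^bsub>?L\<^esub> z' \<in> ?K" using z z' by auto
    qed
    have JK: "J \<subseteq> ?K"
    proof
      fix z assume z: "z \<in> J"
      then have "z \<ominus> x \<otimes> \<zero> = z" using xc J.a_subset by (auto simp: a_minus_def)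
      then show "z \<in> ?K" using z J.a_subset by (intro CollectI conjI bexI[of _ \<zero>]) auto
    qed
    have xK: "x \<in> ?K" using xc J.zero_closed by (intro CollectI conjI bexI[of _ \<one>]) (simp_all add: a_minus_def r_neg)
    have K\<mm>: "?K \<subseteq> \<mm>"
    proof
      fix z assume "z \<in> ?K"
      then obtain c where z: "z \<in> carrier R" "c \<in> carrier R" "z \<ominus> x \<otimes> c \<in> J" by blast
      have "(z \<ominus> x \<otimes> c) \<oplus> x \<otimes> c \<in> \<mm>" using z J\<mm> by (intro m.a_closed m.I_r_closed x(1)) auto
      then show "z \<in> \<mm>" using z xc by (simp add: a_minus_def a_assoc l_neg)
    qed
    have "?K = \<mm>"
    proof (rule ccontr)
      assume "?K \<noteq> \<mm>"
      then have "?K \<subset> \<mm>" using K\<mm> by (rule psubsetI[rotated])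
      from max[OF K subset_trans[OF IJ JK] this JK] xK have "x \<in> J" by (rule subst)
      then show False using x(2) by simp
    qed
    then have "r \<in> ?K" using r by (rule ssubst)
    then show ?thesis by blast
  qed
  have decomp': "\<exists>c\<in>carrier R. r \<ominus> (if even p then x else \<ominus> x) \<otimes> c \<in> J" if r: "r \<in> \<mm>" for r and p :: nat
  proof -
    obtain c where c: "c \<in> carrier R" "r \<ominus> x \<otimes> c \<in> J" using decomp[OF r] by blast
    show ?thesis
    proof (cases "even p")
      case True
      then show ?thesis using c by auto
    next
      case False
      then show ?thesis using c xc by (intro bexI[of _ "\<ominus> c"]) (simp_all add: l_minus r_minus)
    qed
  qed
  obtain \<theta> P where P: "P \<le> j" and \<theta>: "\<And>p. \<theta> p \<in> module_hom R (B.FA p) ?L"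
    and \<theta>big: "\<And>p. p \<le> P \<Longrightarrow> \<exists>u\<in>carrier (B.FA p). \<theta> p u \<notin> \<mm>"
    and \<theta>0: "\<And>p u. p > P \<Longrightarrow> u \<in> carrier (B.FA p) \<Longrightarrow> \<theta> p u = \<zero>"
    and \<theta>D: "\<And>p u. u \<in> carrier (B.FA (Suc p)) \<Longrightarrow>
      \<theta> p (D p u) \<ominus> (if even p then x else \<ominus> x) \<otimes> \<theta> (Suc p) u \<in> J"
  proof (rule dual_chain[of D a j J "\<lambda>p. if even p then x else \<ominus> x", OF B.D _ Dm a0 J mmJ _ decomp'])
    show "D j u i \<in> J" if "u \<in> carrier (free_module R {..<a (Suc j)})" "i < a j" for u i using DI[OF that] IJ by blast
    show "(if even p then x else \<ominus> x) \<in> \<mm>" for p :: nat using x(1) m.a_inv_closed by simp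
  qed (assumption | blast)+
  obtain \<eta> Q where Q: "Q \<le> k" and \<eta>: "\<And>q. \<eta> q \<in> module_hom R (B.FB q) ?L"
    and \<eta>big: "\<And>q. q \<le> Q \<Longrightarrow> \<exists>u\<in>carrier (B.FB q). \<eta> q u \<notin> \<mm>"
    and \<eta>0: "\<And>q u. q > Q \<Longrightarrow> u \<in> carrier (B.FB q) \<Longrightarrow> \<eta> q u = \<zero>"
    and \<eta>E: "\<And>q u. u \<in> carrier (B.FB (Suc q)) \<Longrightarrow> \<eta> q (E q u) \<ominus> x \<otimes> \<eta> (Suc q) u \<in> J"
  proof (rule dual_chain[of E b k J "\<lambda>p. x", OF B.E _ Em b0 J mmJ x(1) decomp])
    show "E k u i \<in> J" if "u \<in> carrier (free_module R {..<b (Suc k)})" "i < b k" for u i using EI[OF that] IJ by blast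
  qed (assumption | blast)+
  define n where "n = max P Q"
  have nj: "n \<le> j" using P Q kj by (simp add: n_def)
  obtain q :: nat and S where q: "q > 0" and S: "S \<in> module_hom R (free_module R {..<q}) (free_module R {..<q})"
    and Sprops: "\<And>t. t \<in> carrier (free_module R {..<q}) \<Longrightarrow> (\<forall>i<q. S t i \<in> \<mm>) \<and>
       S (S t) = \<zero>\<^bsub>free_module R {..<q}\<^esub> \<and> ((\<forall>i<q. S t i \<in> J) \<longrightarrow> (\<forall>i<q. t i \<in> \<mm>))"
  proof -
    \<comment> \<open>The expansion is taken of (-x) x, so that x^2 plus the sum is zero and the
      matrix built from these v and w has square zero.\<close>
    obtain l :: nat and v w where v: "\<And>i. i < l \<Longrightarrow> v i \<in> I" and w: "\<And>i. i < l \<Longrightarrow> w i \<in> \<mm>"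
      and eq: "\<ominus> x \<otimes> x = (\<Oplus>i\<in>{..<l}. v i \<otimes> w i)" using prod[OF m.a_inv_closed[OF x(1)] x(1)] by auto
    have z: "x \<otimes> x \<oplus> (\<Oplus>i\<in>{..<l}. v i \<otimes> w i) = \<zero>" unfolding eq[symmetric] using xc by (simp add: l_minus r_neg)
    have vJ: "v i \<in> J" if "i < l" for i using v[OF that] IJ by blast
    have "\<exists>(q::nat) S. q > 0 \<and> S \<in> module_hom R (free_module R {..<q}) (free_module R {..<q}) \<and>
      (\<forall>t\<in>carrier (free_module R {..<q}). (\<forall>i<q. S t i \<in> \<mm>) \<and>
       S (S t) = \<zero> \<odot>\<^bsub>free_module R {..<q}\<^esub> t \<and> ((\<forall>i<q. S t i \<in> J) \<longrightarrow> (\<forall>i<q. t i \<in> \<mm>)))"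
      using square_matrix[where n = l and v = v and w = w and x = x, OF J J\<mm> mmJ x(1) xJ vJ w] unfolding z .
    then obtain q :: nat and S where "q > 0" and S: "S \<in> module_hom R (free_module R {..<q}) (free_module R {..<q})"
      and Sp: "\<forall>t\<in>carrier (free_module R {..<q}). (\<forall>i<q. S t i \<in> \<mm>) \<and>
       S (S t) = \<zero> \<odot>\<^bsub>free_module R {..<q}\<^esub> t \<and> ((\<forall>i<q. S t i \<in> J) \<longrightarrow> (\<forall>i<q. t i \<in> \<mm>))"
      by (elim exE conjE)
    show thesis
    proof (rule that[OF \<open>q > 0\<close> S])
      fix t assume t: "t \<in> carrier (free_module R {..<q})"
      interpret F: Module.module R "free_module R {..<q}" by (rule free) simp
      show "(\<forall>i<q. S t i \<in> \<mm>) \<and> S (S t) = \<zero>\<^bsub>free_module R {..<q}\<^esub> \<and> ((\<forall>i<q. S t i \<in> J) \<longrightarrow> (\<forall>i<q. t i \<in> \<mm>))"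
        using Sp t F.smult_l_null[OF t] by metis
    qed
  qed
  have "\<exists>g\<in>carrier (B.tot n). functional \<theta> \<eta> n g \<notin> \<mm>"
  proof (cases "Q \<le> P")
    case True
    then have n: "n = P" by (simp add: n_def)
    obtain u v where uv: "u \<in> carrier (B.FA n)" "\<theta> n u \<notin> \<mm>" "v \<in> carrier (B.FB (n - n))" "\<eta> (n - n) v \<notin> \<mm>"
      using \<theta>big[of P] \<eta>big[of 0] n by auto
    show ?thesis
      by (rule functional_large[where P = P and Q = Q and x = x and J = J and \<theta> = \<theta> and \<eta> = \<eta>, OF J J\<mm> xc \<theta> \<eta> \<theta>0 \<eta>0 \<theta>D \<eta>E le_refl uv])
  next
    case False
    then have n: "n = Q" by (simp add: n_def)
    obtain u v where uv: "u \<in> carrier (B.FA 0)" "\<theta> 0 u \<notin> \<mm>" "v \<in> carrier (B.FB (n - 0))" "\<eta> (n - 0) v \<notin> \<mm>"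
      using \<theta>big[of 0] \<eta>big[of Q] n by auto
    show ?thesis
      by (rule functional_large[where P = P and Q = Q and x = x and J = J and \<theta> = \<theta> and \<eta> = \<eta>, OF J J\<mm> xc \<theta> \<eta> \<theta>0 \<eta>0 \<theta>D \<eta>E le0 uv])
  qed
  then obtain g where g: "g \<in> carrier (B.tot n)" "functional \<theta> \<eta> n g \<notin> \<mm>" by blast
  have "functional \<theta> \<eta> n g \<in> \<mm>"
  proof (rule no_large_cocycle[OF J J\<mm> mmJ q S _ _ _ _ bot _ _ g(1)])
    show "functional \<theta> \<eta> n (B.tot_d n f) \<in> J" if "f \<in> carrier (B.tot (Suc n))" for f
      by (rule functional_cocycle[where P = P and Q = Q and x = x and J = J and \<theta> = \<theta> and \<eta> = \<eta>, OF J J\<mm> xc \<theta> \<eta> \<theta>0 \<eta>0 \<theta>D \<eta>E _ _ that]) (simp_all add: n_def)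
    show "functional \<theta> \<eta> n \<in> module_hom R (B.tot n) ?L" by (rule functional_hom[where P = P and Q = Q and x = x and J = J and \<theta> = \<theta> and \<eta> = \<eta>, OF J J\<mm> xc \<theta> \<eta> \<theta>0 \<eta>0 \<theta>D \<eta>E])
    show "B.tot_exact (Suc i)" if "i < n" for i using exact that nj by simp
    show "S (S t) = \<zero>\<^bsub>free_module R {..<q}\<^esub>" if "t \<in> carrier (free_module R {..<q})" for t using Sprops[OF that] by blast
    show "S t i \<in> \<mm>" if "t \<in> carrier (free_module R {..<q})" "i < q" for t i using Sprops[OF that(1)] that(2) by blast
    show "t i \<in> \<mm>" if "t \<in> carrier (free_module R {..<q})" "\<And>i. i < q \<Longrightarrow> S t i \<in> J" "i < q" for t i
      using Sprops[OF that(1)] that(2,3) by blast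
  qed
  then show False using g(2) by simp
qed

end

section \<open>Length\<close>

text \<open>A chain need not begin at A or end at B, so images, preimages, sums and intersections of
  chains need no adjustment at their ends.\<close>

definition submodule_chain :: "('a, 'r) ring_scheme \<Rightarrow> ('a, 'b, 'k) module_scheme \<Rightarrow> 'b set \<Rightarrow> 'b set \<Rightarrow> nat \<Rightarrow>
    (nat \<Rightarrow> 'b set) \<Rightarrow> bool" where
  "submodule_chain R M A B n C \<longleftrightarrow>
     (\<forall>i\<le>n. submodule (C i) R M \<and> A \<subseteq> C i \<and> C i \<subseteq> B) \<and> (\<forall>i<n. C i \<subset> C (Suc i))"

text \<open>The length of \<open>B/A\<close>.\<close>

definition len :: "('a, 'r) ring_scheme \<Rightarrow> ('a, 'b, 'k) module_scheme \<Rightarrow> 'b set \<Rightarrow> 'b set \<Rightarrow> enat" where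
  "len R M A B = Sup {enat n | n. \<exists>C. submodule_chain R M A B n C}"

lemma len_ge: "submodule_chain R M A B n C \<Longrightarrow> enat n \<le> len R M A B"
  unfolding len_def by (rule Sup_upper) blast

lemma len_le: "(\<And>n C. submodule_chain R M A B n C \<Longrightarrow> enat n \<le> l) \<Longrightarrow> len R M A B \<le> l"
  unfolding len_def by (rule Sup_least) auto

text \<open>A finite supremum of a nonempty subset of \<open>enat\<close> is a maximum.\<close>

lemma len_attained:
  assumes "submodule A R M" and "A \<subseteq> B" and "len R M A B \<noteq> \<infinity>"
  obtains n C where "submodule_chain R M A B n C" and "len R M A B = enat n"
proof -
  let ?S = "{enat n | n. \<exists>C. submodule_chain R M A B n C}"
  have "submodule_chain R M A B 0 (\<lambda>_. A)" using assms(1,2) by (simp add: submodule_chain_def)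
  then have ne: "?S \<noteq> {}" by blast
  have fin: "finite ?S" using assms(3) ne unfolding len_def Sup_enat_def by (metis (no_types, lifting))
  have "Sup ?S = Max ?S" unfolding Sup_enat_def if_not_P[OF ne] if_P[OF fin] ..
  then have "Sup ?S \<in> ?S" using Max_in[OF fin ne] by (simp only:)
  then show ?thesis using that unfolding len_def by blast
qed

text \<open>The formula for the new length records whether the step was strict;
  \<open>len_additive\<close> counts strict steps with it.\<close>

lemma submodule_chain_extend:
  assumes "submodule_chain R M A B n C" and "submodule D R M" and "C n \<subseteq> D" and "D \<subseteq> B"
  obtains n' C' where "submodule_chain R M A B n' C'" and "C' n' = D" and "n' = (if C n = D then n else Suc n)"
proof (cases "C n = D")
  case True
  then show ?thesis using that assms(1) by simp
next
  case False
  have "submodule_chain R M A B (Suc n) (C(Suc n := D))"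
    unfolding submodule_chain_def
  proof (intro conjI allI impI)
    fix i assume i: "i \<le> Suc n"
    have "A \<subseteq> C n" using assms(1) by (simp add: submodule_chain_def)
    then show "submodule ((C(Suc n := D)) i) R M" "A \<subseteq> (C(Suc n := D)) i" "(C(Suc n := D)) i \<subseteq> B"
      using i assms by (auto simp: submodule_chain_def le_Suc_eq)
  next
    fix i assume i: "i < Suc n"
    show "(C(Suc n := D)) i \<subset> (C(Suc n := D)) (Suc i)"
      using i assms(1,3) False by (cases "i = n") (auto simp: submodule_chain_def)
  qed
  then show ?thesis using that False by simp
qed

definition submodule_sum :: "('a, 'b, 'k) module_scheme \<Rightarrow> 'b set \<Rightarrow> 'b set \<Rightarrow> 'b set" where
  "submodule_sum M A B = {x \<oplus>\<^bsub>M\<^esub> y | x y. x \<in> A \<and> y \<in> B}"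

lemma submodule_sum_submodule:
  assumes M: "Module.module R M" and A: "submodule A R M" and B: "submodule B R M"
  shows "submodule (submodule_sum M A B) R M"
proof (rule submoduleI'[OF M])
  interpret M: Module.module R M by (rule M)
  have Ac: "x \<in> carrier M" if "x \<in> A" for x by (rule submodule_carrier[OF M A that])
  have Bc: "x \<in> carrier M" if "x \<in> B" for x by (rule submodule_carrier[OF M B that])
  show "submodule_sum M A B \<subseteq> carrier M" using Ac Bc by (auto simp: submodule_sum_def)
  show "\<zero>\<^bsub>M\<^esub> \<in> submodule_sum M A B"
    unfolding submodule_sum_def using submodule_zero[OF M A] submodule_zero[OF M B]
    by (intro CollectI exI[of _ "\<zero>\<^bsub>M\<^esub>"]) simp
  fix x assume "x \<in> submodule_sum M A B"
  then obtain x1 x2 where x: "x1 \<in> A" "x2 \<in> B" "x = x1 \<oplus>\<^bsub>M\<^esub> x2" by (auto simp: submodule_sum_def)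
  show "a \<odot>\<^bsub>M\<^esub> x \<in> submodule_sum M A B" if a: "a \<in> carrier R" for a
  proof -
    have "a \<odot>\<^bsub>M\<^esub> x = a \<odot>\<^bsub>M\<^esub> x1 \<oplus>\<^bsub>M\<^esub> a \<odot>\<^bsub>M\<^esub> x2" using x a Ac Bc by (simp add: M.smult_r_distr)
    then show ?thesis using submodule_smult[OF M A a x(1)] submodule_smult[OF M B a x(2)] by (auto simp: submodule_sum_def)
  qed
  fix y assume "y \<in> submodule_sum M A B"
  then obtain y1 y2 where y: "y1 \<in> A" "y2 \<in> B" "y = y1 \<oplus>\<^bsub>M\<^esub> y2" by (auto simp: submodule_sum_def)
  have "x \<oplus>\<^bsub>M\<^esub> y = (x1 \<oplus>\<^bsub>M\<^esub> y1) \<oplus>\<^bsub>M\<^esub> (x2 \<oplus>\<^bsub>M\<^esub> y2)" using x y Ac Bc by (simp add: M.M.a_ac)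
  then show "x \<oplus>\<^bsub>M\<^esub> y \<in> submodule_sum M A B"
    using submodule_add[OF M A x(1) y(1)] submodule_add[OF M B x(2) y(2)] by (auto simp: submodule_sum_def)
qed

text \<open>An element d of D is c + b with c in C and b in B; then b = d - c lies in D and B, hence
  in C.\<close>

lemma submodule_modular:
  assumes M: "Module.module R M" and C: "submodule C R M" and D: "submodule D R M" and B: "submodule B R M"
    and CD: "C \<subseteq> D" and int: "C \<inter> B = D \<inter> B" and sum: "submodule_sum M C B = submodule_sum M D B"
  shows "C = D"
proof
  interpret M: Module.module R M by (rule M)
  show "D \<subseteq> C"
  proof
    fix d assume d: "d \<in> D"
    have dc: "d \<in> carrier M" by (rule submodule_carrier[OF M D d])
    have "d \<oplus>\<^bsub>M\<^esub> \<zero>\<^bsub>M\<^esub> \<in> submodule_sum M D B" using d submodule_zero[OF M B] unfolding submodule_sum_def by blast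
    then have "d \<in> submodule_sum M C B" using dc sum by simp
    then obtain c b where cb: "c \<in> C" "b \<in> B" "d = c \<oplus>\<^bsub>M\<^esub> b" unfolding submodule_sum_def by blast
    have c: "c \<in> carrier M" and b: "b \<in> carrier M" using submodule_carrier[OF M C cb(1)] submodule_carrier[OF M B cb(2)] by simp_all
    have "d \<ominus>\<^bsub>M\<^esub> c \<in> D" using d cb(1) CD by (intro submodule_diff[OF M D]) auto
    moreover have "d \<ominus>\<^bsub>M\<^esub> c = b" unfolding cb(3) using b c by (simp add: a_minus_def M.M.a_ac M.M.r_neg1 M.M.r_neg2 M.M.r_neg)
    ultimately have "b \<in> C" using int cb(2) by blast
    then show "d \<in> C" unfolding cb(3) by (rule submodule_add[OF M C cb(1)])
  qed
qed (rule CD)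

text \<open>By \<open>submodule_modular\<close> every strict step of a chain from A to D is strict
  after intersecting with B or after adding B. A chain of length n thus yields two chains whose
  lengths add up to at least n. The converse is concatenation.\<close>

lemma len_additive:
  assumes M: "Module.module R M" and A: "submodule A R M" and B: "submodule B R M" and D: "submodule D R M"
    and AB: "A \<subseteq> B" and BD: "B \<subseteq> D"
  shows "len R M A D = len R M A B + len R M B D"
proof (rule antisym)
  interpret M: Module.module R M by (rule M)
  have Bc: "x \<in> carrier M" if "x \<in> B" for x by (rule submodule_carrier[OF M B that])
  show "len R M A D \<le> len R M A B + len R M B D"
  proof (rule len_le)
    fix n C assume C: "submodule_chain R M A D n C"
    have Ci: "submodule (C i) R M" "A \<subseteq> C i" "C i \<subseteq> D" if "i \<le> n" for i using C that by (auto simp: submodule_chain_def)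
    have sumB: "B \<subseteq> submodule_sum M K B" if "submodule K R M" for K
    proof
      fix z assume z: "z \<in> B"
      have "\<zero>\<^bsub>M\<^esub> \<oplus>\<^bsub>M\<^esub> z \<in> submodule_sum M K B" using z submodule_zero[OF M that] unfolding submodule_sum_def by blast
      then show "z \<in> submodule_sum M K B" using Bc[OF z] by simp
    qed
    have sumD: "submodule_sum M (C i) B \<subseteq> D" if "i \<le> n" for i
    proof
      fix z assume "z \<in> submodule_sum M (C i) B"
      then obtain c b where "c \<in> C i" "b \<in> B" "z = c \<oplus>\<^bsub>M\<^esub> b" unfolding submodule_sum_def by blast
      then show "z \<in> D" using submodule_add[OF M D, of c b] Ci(3)[OF that] BD by blast
    qed
    have "\<exists>p q P Q. k \<le> p + q \<and> submodule_chain R M A B p P \<and> P p = C k \<inter> B \<and>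
        submodule_chain R M B D q Q \<and> Q q = submodule_sum M (C k) B" if "k \<le> n" for k
      using that
    proof (induction k)
      case 0
      have c1: "submodule_chain R M A B 0 (\<lambda>_. C 0 \<inter> B)"
        using Ci[of 0] submodule_Int[OF M Ci(1)[of 0] B] AB by (simp add: submodule_chain_def)
      have c2: "submodule_chain R M B D 0 (\<lambda>_. submodule_sum M (C 0) B)"
        using submodule_sum_submodule[OF M Ci(1)[of 0] B] sumB[OF Ci(1)[of 0]] sumD[of 0] by (simp add: submodule_chain_def)
      show ?case
        by (rule exI[of _ 0], rule exI[of _ 0], rule exI[of _ "\<lambda>_. C 0 \<inter> B"],
            rule exI[of _ "\<lambda>_. submodule_sum M (C 0) B"]) (simp add: c1 c2)
    next
      case (Suc k)
      have k: "k \<le> n" and Sk: "Suc k \<le> n" using Suc.prems by simp_all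
      from Suc.IH[OF k] obtain p q P Q where pq: "k \<le> p + q" and P: "submodule_chain R M A B p P" "P p = C k \<inter> B"
        and Q: "submodule_chain R M B D q Q" "Q q = submodule_sum M (C k) B" by blast
      have CC: "C k \<subset> C (Suc k)" using C Sk by (simp add: submodule_chain_def)
      obtain p' P' where P': "submodule_chain R M A B p' P'" "P' p' = C (Suc k) \<inter> B"
        "p' = (if P p = C (Suc k) \<inter> B then p else Suc p)"
        by (rule submodule_chain_extend[OF P(1) submodule_Int[OF M Ci(1)[OF Sk] B]]) (use CC P(2) in auto)
      obtain q' Q' where Q': "submodule_chain R M B D q' Q'" "Q' q' = submodule_sum M (C (Suc k)) B"
        "q' = (if Q q = submodule_sum M (C (Suc k)) B then q else Suc q)"
      proof (rule submodule_chain_extend[OF Q(1) submodule_sum_submodule[OF M Ci(1)[OF Sk] B]])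
        show "Q q \<subseteq> submodule_sum M (C (Suc k)) B" using CC unfolding Q(2) submodule_sum_def by blast
        show "submodule_sum M (C (Suc k)) B \<subseteq> D" by (rule sumD[OF Sk])
      qed
      have "\<not> (C k \<inter> B = C (Suc k) \<inter> B \<and> submodule_sum M (C k) B = submodule_sum M (C (Suc k)) B)"
        using submodule_modular[OF M Ci(1)[OF k] Ci(1)[OF Sk] B] CC by blast
      then have "Suc k \<le> p' + q'" using pq P(2) P'(3) Q(2) Q'(3) by (auto split: if_splits)
      then show ?case using P'(1,2) Q'(1,2) by blast
    qed
    from this[OF le_refl] obtain p q P Q where "n \<le> p + q" "submodule_chain R M A B p P" "submodule_chain R M B D q Q" by blast
    then have "enat n \<le> enat p + enat q" and "enat p \<le> len R M A B" and "enat q \<le> len R M B D"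
      by (simp_all add: len_ge)
    then show "enat n \<le> len R M A B + len R M B D" by (meson add_mono order_trans)
  qed
  have cat: "enat (p + q) \<le> len R M A D" if P: "submodule_chain R M A B p P" and Q: "submodule_chain R M B D q Q" for p q P Q
  proof (rule len_ge)
    \<comment> \<open>The last term of the first chain is left out, as it may coincide with the
      first term of the second; it lies in B, which is contained in that term.\<close>
    show "submodule_chain R M A D (p + q) (\<lambda>i. if i < p then P i else Q (i - p))"
      unfolding submodule_chain_def
    proof (intro conjI allI impI)
      fix i assume i: "i \<le> p + q"
      have P': "submodule (P i) R M \<and> A \<subseteq> P i \<and> P i \<subseteq> B" if "i < p" using P that by (auto simp: submodule_chain_def)
      have Q': "submodule (Q (i - p)) R M \<and> B \<subseteq> Q (i - p) \<and> Q (i - p) \<subseteq> D" if "\<not> i < p"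
        using Q that i by (auto simp: submodule_chain_def)
      show "submodule (if i < p then P i else Q (i - p)) R M" using P' Q' by simp
      show "A \<subseteq> (if i < p then P i else Q (i - p))" using P' Q' AB by (cases "i < p") auto
      show "(if i < p then P i else Q (i - p)) \<subseteq> D" using P' Q' BD by (cases "i < p") auto
    next
      fix i assume i: "i < p + q"
      consider "Suc i < p" | "Suc i = p" | "p \<le> i" by linarith
      then show "(if i < p then P i else Q (i - p)) \<subset> (if Suc i < p then P (Suc i) else Q (Suc i - p))"
      proof cases
        case 1
        then show ?thesis using P by (simp add: submodule_chain_def)
      next
        case 2
        have "P i \<subset> P p" using P 2 by (auto simp: submodule_chain_def)
        moreover have "P p \<subseteq> B" using P by (simp add: submodule_chain_def)
        moreover have "B \<subseteq> Q 0" using Q by (simp add: submodule_chain_def)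
        ultimately have "P i \<subset> Q 0" by blast
        then show ?thesis using 2 by auto
      next
        case 3
        then show ?thesis using Q i by (simp add: submodule_chain_def Suc_diff_le)
      qed
    qed
  qed
  show "len R M A B + len R M B D \<le> len R M A D"
  proof (cases "len R M A D = \<infinity>")
    case False
    have c1: "submodule_chain R M A B 0 (\<lambda>_. A)" and c2: "submodule_chain R M B D 0 (\<lambda>_. B)"
      using A B AB BD by (simp_all add: submodule_chain_def)
    have le1: "len R M A B \<le> len R M A D" by (rule len_le) (use cat[OF _ c2] in simp)
    have le2: "len R M B D \<le> len R M A D" by (rule len_le) (use cat[OF c1] in simp)
    have "len R M A B \<noteq> \<infinity>" using le1 False by (cases "len R M A B"; cases "len R M A D") auto
    moreover have "len R M B D \<noteq> \<infinity>" using le2 False by (cases "len R M B D"; cases "len R M A D") auto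
    ultimately obtain p q P Q where "submodule_chain R M A B p P" "len R M A B = enat p"
      "submodule_chain R M B D q Q" "len R M B D = enat q"
      using len_attained[OF A AB] len_attained[OF B BD] by metis
    then show ?thesis using cat by simp
  qed simp
qed

text \<open>The part of the kernel inside B lies in A, so taking images and taking preimages within
  B both preserve strict inclusions between submodules lying over A.\<close>

lemma len_image:
  assumes M: "Module.module R M" and N: "Module.module R N" and f: "f \<in> module_hom R M N"
    and A: "submodule A R M" and B: "submodule B R M" and AB: "A \<subseteq> B"
    and ker: "\<And>x. x \<in> B \<Longrightarrow> f x = \<zero>\<^bsub>N\<^esub> \<Longrightarrow> x \<in> A"
  shows "len R N (f ` A) (f ` B) = len R M A B"
proof (rule antisym)
  interpret M: Module.module R M by (rule M)
  interpret N: Module.module R N by (rule N)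
  have Bc: "x \<in> carrier M" if "x \<in> B" for x by (rule submodule_carrier[OF M B that])
  have diff: "y \<in> C" if C: "submodule C R M" "A \<subseteq> C" and x: "x \<in> C" "x \<in> B" and y: "y \<in> B" and eq: "f x = f y" for x y C
  proof -
    have "f (y \<ominus>\<^bsub>M\<^esub> x) = \<zero>\<^bsub>N\<^esub>"
      using module_hom_minus[OF M N f Bc[OF y] Bc[OF x(2)]] eq module_hom_closed[OF f Bc[OF y]] by (simp add: N.M.diff_eq_zero_iff)
    then have "y \<ominus>\<^bsub>M\<^esub> x \<in> C" using ker[OF submodule_diff[OF M B y x(2)]] C(2) by blast
    then have "(y \<ominus>\<^bsub>M\<^esub> x) \<oplus>\<^bsub>M\<^esub> x \<in> C" by (rule submodule_add[OF M C(1) _ x(1)])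
    then show ?thesis using Bc[OF x(2)] Bc[OF y] by (simp add: a_minus_def M.M.a_assoc M.M.l_neg)
  qed
  show "len R M A B \<le> len R N (f ` A) (f ` B)"
  proof (rule len_le, rule len_ge)
    fix n C assume C: "submodule_chain R M A B n C"
    show "submodule_chain R N (f ` A) (f ` B) n (\<lambda>i. f ` C i)"
      unfolding submodule_chain_def
    proof (intro conjI allI impI)
      fix i assume "i \<le> n"
      then have Ci: "submodule (C i) R M" "A \<subseteq> C i" "C i \<subseteq> B" using C by (auto simp: submodule_chain_def)
      show "submodule (f ` C i) R N" by (rule submodule_image[OF M N f Ci(1)])
      show "f ` A \<subseteq> f ` C i" "f ` C i \<subseteq> f ` B" using Ci by auto
    next
      fix i assume i: "i < n"
      then have Ci: "submodule (C i) R M" "A \<subseteq> C i" "C i \<subset> C (Suc i)" "C (Suc i) \<subseteq> B"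
        using C by (auto simp: submodule_chain_def)
      then obtain y where y: "y \<in> C (Suc i)" "y \<notin> C i" by blast
      have "f y \<notin> f ` C i"
      proof
        assume "f y \<in> f ` C i"
        then obtain x where "x \<in> C i" "f x = f y" by auto
        then show False using diff[OF Ci(1,2), of x y] Ci(3,4) y by blast
      qed
      then show "f ` C i \<subset> f ` C (Suc i)" using Ci(3) y(1) by blast
    qed
  qed
  show "len R N (f ` A) (f ` B) \<le> len R M A B"
  proof (rule len_le, rule len_ge)
    fix n C assume C: "submodule_chain R N (f ` A) (f ` B) n C"
    show "submodule_chain R M A B n (\<lambda>i. B \<inter> {x \<in> carrier M. f x \<in> C i})"
      unfolding submodule_chain_def
    proof (intro conjI allI impI)
      fix i assume "i \<le> n"
      then have Ci: "submodule (C i) R N" "f ` A \<subseteq> C i" "C i \<subseteq> f ` B" using C by (auto simp: submodule_chain_def)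
      show "submodule (B \<inter> {x \<in> carrier M. f x \<in> C i}) R M"
        by (rule submodule_Int[OF M B submodule_vimage[OF M N f Ci(1)]])
      show "A \<subseteq> B \<inter> {x \<in> carrier M. f x \<in> C i}" using AB Ci(2) Bc by auto
    next
      fix i assume i: "i < n"
      then have Ci: "C i \<subset> C (Suc i)" "C (Suc i) \<subseteq> f ` B" using C by (auto simp: submodule_chain_def)
      then obtain y where y: "y \<in> C (Suc i)" "y \<notin> C i" by blast
      then obtain x where "x \<in> B" "y = f x" using Ci(2) by blast
      then show "B \<inter> {x \<in> carrier M. f x \<in> C i} \<subset> B \<inter> {x \<in> carrier M. f x \<in> C (Suc i)}"
        using y Ci(1) Bc by blast
    qed blast
  qed
qed

lemma submodule_pow:
  assumes R: "cring R" and M: "Module.module R M" and A: "\<And>x. x \<in> X \<Longrightarrow> submodule (A x) R M"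
  shows "submodule (\<Pi>\<^sub>E x\<in>X. A x) R (pow_module X M)"
proof (rule submoduleI'[OF module_dprod[OF R M]])
  note c = submodule_carrier[OF M A]
  show "(\<Pi>\<^sub>E x\<in>X. A x) \<subseteq> carrier (pow_module X M)" unfolding dprod_simps by (rule PiE_mono) (use c in blast)
  show "\<zero>\<^bsub>pow_module X M\<^esub> \<in> (\<Pi>\<^sub>E x\<in>X. A x)" using submodule_zero[OF M A] by (auto simp: dprod_simps)
  show "u \<oplus>\<^bsub>pow_module X M\<^esub> v \<in> (\<Pi>\<^sub>E x\<in>X. A x)" if "u \<in> (\<Pi>\<^sub>E x\<in>X. A x)" "v \<in> (\<Pi>\<^sub>E x\<in>X. A x)" for u v
    using submodule_add[OF M A] that by (auto simp: dprod_simps PiE_mem)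
  show "a \<odot>\<^bsub>pow_module X M\<^esub> u \<in> (\<Pi>\<^sub>E x\<in>X. A x)" if "a \<in> carrier R" "u \<in> (\<Pi>\<^sub>E x\<in>X. A x)" for a u
    using submodule_smult[OF M A] that by (auto simp: dprod_simps PiE_mem)
qed

text \<open>The coordinates are enlarged from A to B one at a time; projecting to the coordinate
  just enlarged computes the length of each step.\<close>

lemma len_pow:
  assumes R: "cring R" and M: "Module.module R M" and A: "submodule A R M" and B: "submodule B R M" and AB: "A \<subseteq> B"
    and X: "finite X"
  shows "len R (pow_module X M) (X \<rightarrow>\<^sub>E A) (X \<rightarrow>\<^sub>E B) = of_nat (card X) * len R M A B"
proof -
  let ?P = "pow_module X M"
  let ?W = "\<lambda>Y. \<Pi>\<^sub>E x\<in>X. if x \<in> Y then B else A"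
  have P: "Module.module R ?P" by (rule module_dprod[OF R M])
  have W: "submodule (?W Y) R ?P" for Y by (rule submodule_pow[OF R M]) (use A B in auto)
  have Wmono: "?W Y \<subseteq> ?W Z" if "Y \<subseteq> Z" for Y Z by (rule PiE_mono) (use that AB in auto)
  have "len R ?P (?W {}) (?W Y) = of_nat (card Y) * len R M A B" if "finite Y" "Y \<subseteq> X" for Y
    using that
  proof (induction Y)
    case empty
    have "len R ?P (?W {}) (?W {}) = len R ?P (?W {}) (?W {}) + len R ?P (?W {}) (?W {})"
      by (rule len_additive[OF P W W W order_refl order_refl])
    moreover have "len R ?P (?W {}) (?W {}) \<le> 0"
    proof (rule len_le)
      fix n C assume C: "submodule_chain R ?P (?W {}) (?W {}) n C"
      have "n = 0"
      proof (rule ccontr)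
        assume "n \<noteq> 0"
        then have "C 0 \<subset> C (Suc 0)" "?W {} \<subseteq> C 0" "C (Suc 0) \<subseteq> ?W {}" using C by (auto simp: submodule_chain_def)
        then show False by blast
      qed
      then show "enat n \<le> 0" by (simp add: zero_enat_def)
    qed
    ultimately show ?case by simp
  next
    case (insert y Y)
    have yX: "y \<in> X" and YX: "Y \<subseteq> X" using insert.prems by auto
    let ?pr = "\<lambda>u. u y"
    have pr: "?pr \<in> module_hom R ?P M" by (rule pow_proj_hom[OF yX])
    have img: "?pr ` ?W Z = (if y \<in> Z then B else A)" for Z
    proof
      show "?pr ` ?W Z \<subseteq> (if y \<in> Z then B else A)"
      proof (rule image_subsetI)
        fix u assume "u \<in> ?W Z"
        then show "u y \<in> (if y \<in> Z then B else A)" using yX by (rule PiE_mem)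
      qed
      show "(if y \<in> Z then B else A) \<subseteq> ?pr ` ?W Z"
      proof
        fix v assume v: "v \<in> (if y \<in> Z then B else A)"
        let ?u = "\<lambda>x\<in>X. if x = y then v else \<zero>\<^bsub>M\<^esub>"
        have u: "?u \<in> ?W Z" using v submodule_zero[OF M A] submodule_zero[OF M B] by auto
        have "v = ?pr ?u" using yX by simp
        then show "v \<in> ?pr ` ?W Z" by (rule image_eqI[where x = ?u]) (rule u)
      qed
    qed
    have "len R M (?pr ` ?W Y) (?pr ` ?W (insert y Y)) = len R ?P (?W Y) (?W (insert y Y))"
    proof (rule len_image[OF P M pr W W Wmono])
      fix u assume u: "u \<in> ?W (insert y Y)" "u y = \<zero>\<^bsub>M\<^esub>"
      have "u x \<in> (if x \<in> Y then B else A)" if "x \<in> X" for x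
        using PiE_mem[OF u(1) that] u(2) insert.hyps submodule_zero[OF M A] by (cases "x = y") auto
      then show "u \<in> ?W Y" using u(1) by (auto simp: PiE_def)
    qed auto
    then have step: "len R ?P (?W Y) (?W (insert y Y)) = len R M A B"
      unfolding img using insert.hyps by simp
    have "len R ?P (?W {}) (?W (insert y Y)) = len R ?P (?W {}) (?W Y) + len R ?P (?W Y) (?W (insert y Y))"
      by (rule len_additive[OF P W W W]) (rule Wmono, blast)+
    also have "\<dots> = of_nat (card (insert y Y)) * len R M A B"
      unfolding step insert.IH[OF YX] using insert.hyps by (simp add: distrib_right add.commute)
    finally show ?case .
  qed
  from this[OF X order_refl] show ?thesis by (simp cong: PiE_cong)
qed

lemma len_eq_zeroD:
  assumes "submodule A R M" and "submodule B R M" and "A \<subseteq> B" and z: "len R M A B = 0"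
  shows "A = B"
proof (rule ccontr)
  assume "A \<noteq> B"
  then have "submodule_chain R M A B (Suc 0) (\<lambda>i. if i = 0 then A else B)"
    using assms(1-3) by (auto simp: submodule_chain_def)
  from len_ge[OF this] show False using z by (simp add: zero_enat_def)
qed

lemma module_length_eq_len:
  assumes "Module.module R M"
  shows "module_length R M = len R M {\<zero>\<^bsub>M\<^esub>} (carrier M)"
proof -
  have *: "submodule_chain R M {\<zero>\<^bsub>M\<^esub>} (carrier M) n C \<longleftrightarrow> (\<forall>i\<le>n. submodule (C i) R M) \<and> (\<forall>i<n. C i \<subset> C (Suc i))" for n C
    unfolding submodule_chain_def
    using submodule_zero[OF assms] submodule_carrier[OF assms] by blast
  show ?thesis unfolding len_def module_length_def * ..
qed

section \<open>The case of a maximal ideal\<close>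

text \<open>The first two equations give b2^2 = b1 b3, so t = b2/b1 satisfies t^2 - e t + w = 0. In
  lowest terms its denominator divides the square of its numerator, hence is 1. From w = t (e - t)
  with 0 < t < e it would follow that w is at least e - 1, against the inequality; so t = e.\<close>

lemma length_arithmetic:
  fixes b1 b2 b3 c d e w :: nat
  assumes 1: "b2 * c = b1 * d" and 2: "b3 * c = b2 * d" and 3: "b2 * e = b3 + b1 * w"
    and 4: "1 + e + w < 2 * e" and b1: "b1 > 0" and b2: "b2 > 0" and c: "c > 0"
  shows "d = e * c" and "w = 0"
proof -
  have "b2 * b2 * c = b1 * b3 * c" using 1 2 by (metis mult.assoc mult.commute)
  then have sq: "b2 * b2 = b1 * b3" using c by simp
  define g p q where "g = gcd b1 b2" and "p = b1 div g" and "q = b2 div g"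
  have g: "g > 0" and b1': "b1 = g * p" and b2': "b2 = g * q" and pq: "coprime p q"
    using b1 by (simp_all add: g_def p_def q_def div_gcd_coprime)
  have "b1 * (b2 * e) = b2 * b2 + b1 * b1 * w" unfolding 3 sq by (simp add: algebra_simps)
  then have "g * g * (p * q * e) = g * g * (q * q + p * p * w)" unfolding b1' b2' by (simp add: algebra_simps)
  then have eq: "p * q * e = q * q + p * p * w" using g by simp
  then have "p dvd q * q" by (metis dvd_add_left_iff dvd_triv_left mult.assoc)
  then have "p dvd 1" using pq by (metis coprime_dvd_mult_left_iff coprime_common_divisor dvd_refl)
  then have p: "p = 1" by simp
  then have eq: "q * e = q * q + w" using eq by simp
  have q: "q > 0" using b2 b2' by simp
  have qe: "q \<le> e" using eq q by (metis le_add1 mult_le_cancel1)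
  have w: "w = q * (e - q)" using eq by (simp add: diff_mult_distrib2)
  have "q = e"
  proof (rule ccontr)
    assume "q \<noteq> e"
    \<comment> \<open>With e = q + k + 1 the product q (e - q) is q + q k, which is at least q + k =
      e - 1.\<close>
    then obtain k where k: "e = q + Suc k" using qe by (metis le_neq_implies_less less_iff_Suc_add add_Suc_right)
    have "w = q + q * k" using w k by simp
    moreover have "q * k \<ge> k" using q by simp
    ultimately show False using 4 k by linarith
  qed
  then show "w = 0" using w by simp
  have "b2 = b1 * e" using b1' b2' p \<open>q = e\<close> by simp
  then have "b1 * (e * c) = b1 * d" using 1 by (metis mult.assoc)
  then show "d = e * c" using b1 by auto
qed

section \<open>The square of the maximal ideal\<close>

context finite_length_local_ring
begin

definition m_squared :: "'a set" where
  "m_squared = module_span R (regular_module R) {a \<otimes> b | a b. a \<in> \<mm> \<and> b \<in> \<mm>}"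

lemma m_squared_sub: "submodule m_squared R (regular_module R)"
  unfolding m_squared_def by (rule span_submodule[OF regular]) (use mm_closed in auto)

lemma m_squared_ideal: "ideal m_squared R"
  using m_squared_sub ideal_iff_submodule[OF cr] by simp

lemma m_squaredI: "a \<in> \<mm> \<Longrightarrow> b \<in> \<mm> \<Longrightarrow> a \<otimes> b \<in> m_squared"
  unfolding m_squared_def by (rule subsetD[OF span_incl]) blast

lemma m_squared_least:
  assumes "submodule H R (regular_module R)" and "\<And>a b. a \<in> \<mm> \<Longrightarrow> b \<in> \<mm> \<Longrightarrow> a \<otimes> b \<in> H"
  shows "m_squared \<subseteq> H"
  unfolding m_squared_def by (rule span_least) (use assms in auto)

lemma m_squared_mm: "m_squared \<subseteq> \<mm>"
proof (rule m_squared_least[OF mm_sub])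
  interpret m: ideal \<mm> R by (rule mm_ideal)
  show "a \<otimes> b \<in> \<mm>" if "a \<in> \<mm>" "b \<in> \<mm>" for a b using that mm_closed by (intro m.I_r_closed) auto
qed

lemma m_squared_smult_zero:
  assumes M: "Module.module R M" and z: "\<And>a b u. a \<in> \<mm> \<Longrightarrow> b \<in> \<mm> \<Longrightarrow> u \<in> carrier M \<Longrightarrow> (a \<otimes> b) \<odot>\<^bsub>M\<^esub> u = \<zero>\<^bsub>M\<^esub>"
    and u: "u \<in> carrier M" and a: "a \<in> m_squared"
  shows "a \<odot>\<^bsub>M\<^esub> u = \<zero>\<^bsub>M\<^esub>"
proof -
  interpret M: Module.module R M by (rule M)
  have f: "(\<lambda>a. a \<odot>\<^bsub>M\<^esub> u) \<in> module_hom R (regular_module R) M"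
    using u by (intro module_homI) (simp_all add: M.smult_l_distr M.smult_assoc1)
  have "m_squared \<subseteq> a_kernel (regular_module R) M (\<lambda>a. a \<odot>\<^bsub>M\<^esub> u)"
    by (rule m_squared_least[OF submodule_kernel[OF regular M f]]) (use z u mm_closed in \<open>simp add: a_kernel_eq\<close>)
  then show ?thesis using a by (auto simp: a_kernel_eq)
qed

lemma mm_smult_mm:
  assumes M: "Module.module R M" and z: "\<And>a b u. a \<in> \<mm> \<Longrightarrow> b \<in> \<mm> \<Longrightarrow> u \<in> carrier M \<Longrightarrow> (a \<otimes> b) \<odot>\<^bsub>M\<^esub> u = \<zero>\<^bsub>M\<^esub>"
    and u: "u \<in> ideal_smult R \<mm> M" and a: "a \<in> \<mm>"
  shows "a \<odot>\<^bsub>M\<^esub> u = \<zero>\<^bsub>M\<^esub>"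
proof -
  interpret M: Module.module R M by (rule M)
  have "ideal_smult R \<mm> M \<subseteq> a_kernel M M (\<lambda>u. a \<odot>\<^bsub>M\<^esub> u)"
  proof (rule ideal_smult_least[OF submodule_kernel[OF M M module_hom_scalar[OF M mm_closed[OF a]]]])
    fix b v assume "b \<in> \<mm>" "v \<in> carrier M"
    then show "b \<odot>\<^bsub>M\<^esub> v \<in> a_kernel M M (\<lambda>u. a \<odot>\<^bsub>M\<^esub> u)"
      using z[OF a] a mm_closed by (simp add: a_kernel_eq M.smult_assoc1[symmetric])
  qed
  then show ?thesis using u by (auto simp: a_kernel_eq)
qed

text \<open>Nakayama's lemma for the zero submodule: a finitely generated M with M = \<mm>M would be
  zero.\<close>

lemma mm_smult_ne:
  assumes M: "Module.module R M" and fg: "finitely_generated R M" and nz: "\<not> zero_module M"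
  obtains u where "u \<in> carrier M" and "u \<notin> ideal_smult R \<mm> M"
proof -
  interpret M: Module.module R M by (rule M)
  have "\<exists>u\<in>carrier M. u \<notin> ideal_smult R \<mm> M"
  proof (rule ccontr)
    assume "\<not> ?thesis"
    then have all: "carrier M \<subseteq> ideal_smult R \<mm> M" by blast
    obtain S where S: "finite S" "S \<subseteq> carrier M" "module_span R M S = carrier M"
      using fg unfolding finitely_generated_def by blast
    let ?A = "{\<zero>\<^bsub>M\<^esub>} \<union> {c \<odot>\<^bsub>M\<^esub> s | c s. c \<in> \<mm> \<and> s \<in> S}"
    have Ac: "?A \<subseteq> carrier M" using S(2) mm_closed by auto
    have As: "submodule (module_span R M ?A) R M" by (rule span_submodule[OF M Ac])
    have "ideal_smult R \<mm> M \<subseteq> module_span R M ?A"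
    proof (rule ideal_smult_least[OF As])
      fix a x assume a: "a \<in> \<mm>" and x: "x \<in> carrier M"
      have "module_span R M S \<subseteq> {x \<in> carrier M. a \<odot>\<^bsub>M\<^esub> x \<in> module_span R M ?A}"
      proof (rule span_least[OF submodule_vimage[OF M M module_hom_scalar[OF M mm_closed[OF a]] As]], rule subsetI)
        fix s assume s: "s \<in> S"
        have "a \<odot>\<^bsub>M\<^esub> s \<in> ?A" using a s by blast
        then show "s \<in> {x \<in> carrier M. a \<odot>\<^bsub>M\<^esub> x \<in> module_span R M ?A}" using s S(2) span_incl[of ?A R M] by blast
      qed
      then show "a \<odot>\<^bsub>M\<^esub> x \<in> module_span R M ?A" using x S(3) by blast
    qed
    then have "S \<subseteq> module_span R M ?A" using S(2) all by blast
    from nakayama[OF M zero_submodule[OF M] S(1,2) this] have "S \<subseteq> {\<zero>\<^bsub>M\<^esub>}" .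
    then have "carrier M \<subseteq> {\<zero>\<^bsub>M\<^esub>}" unfolding S(3)[symmetric] by (rule span_least[OF zero_submodule[OF M]])
    then show False using nz M.M.zero_closed unfolding zero_module_def by blast
  qed
  then show thesis using that by blast
qed

text \<open>If the components of \<open>E y\<close> kill \<open>M\<close> then \<open>y \<otimes> u\<close> lies in the kernel of \<open>E \<otimes> M\<close> for every \<open>u\<close> in \<open>M\<close>,
  so a unit component of \<open>y\<close> would give \<open>M = \<mm>M\<close>.\<close>

lemma preimage_in_mm:
  assumes M: "Module.module R M" and u: "u \<in> carrier M" "u \<notin> ideal_smult R \<mm> M"
    and E: "E \<in> module_hom R (free_module R {..<a::nat}) (free_module R {..<b::nat})"
    and ker: "\<And>v i. v \<in> carrier (pow_module {..<a} M) \<Longrightarrow> act R M {..<a} {..<b} E v = \<zero>\<^bsub>pow_module {..<b} M\<^esub> \<Longrightarrow>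
      i < a \<Longrightarrow> v i \<in> ideal_smult R \<mm> M"
    and y: "y \<in> carrier (free_module R {..<a})" and Ey: "\<And>i. i < b \<Longrightarrow> E y i \<odot>\<^bsub>M\<^esub> u = \<zero>\<^bsub>M\<^esub>" and i: "i < a"
  shows "y i \<in> \<mm>"
proof (rule ccontr)
  interpret M: Module.module R M by (rule M)
  have yc: "y k \<in> carrier R" if "k < a" for k using free_mem[OF _ y] that by simp
  assume "y i \<notin> \<mm>"
  then have yu: "y i \<in> Units R" using unit_if_notin yc[OF i] by blast
  have f: "(\<lambda>a. a \<odot>\<^bsub>M\<^esub> u) \<in> module_hom R (regular_module R) M"
    using u(1) by (intro module_homI) (simp_all add: M.smult_l_distr M.smult_assoc1)
  let ?v = "\<lambda>k\<in>{..<a}. y k \<odot>\<^bsub>M\<^esub> u"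
  have v: "?v \<in> carrier (pow_module {..<a} M)" using yc u(1) by (auto simp: dprod_simps)
  have "act R M {..<a} {..<b} E ?v = (\<lambda>k\<in>{..<b}. act R (regular_module R) {..<a} {..<b} E y k \<odot>\<^bsub>M\<^esub> u)"
    by (rule act_natural[OF cr _ _ E regular M f]) (use yc in auto)
  also have "\<dots> = \<zero>\<^bsub>pow_module {..<b} M\<^esub>"
    unfolding act_regular[OF cr finite_lessThan finite_lessThan E y] dprod_simps by (rule restrict_ext) (use Ey in simp)
  finally have "?v i \<in> ideal_smult R \<mm> M" by (rule ker[OF v _ i])
  then have yiu: "y i \<odot>\<^bsub>M\<^esub> u \<in> ideal_smult R \<mm> M" using i by simp
  have "inv (y i) \<odot>\<^bsub>M\<^esub> (y i \<odot>\<^bsub>M\<^esub> u) \<in> ideal_smult R \<mm> M"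
    by (rule submodule_smult[OF M ideal_smult_submodule[OF M mm_carrier] Units_inv_closed[OF yu] yiu])
  moreover have "inv (y i) \<odot>\<^bsub>M\<^esub> (y i \<odot>\<^bsub>M\<^esub> u) = u"
    using yu yc[OF i] u(1) by (simp add: M.smult_assoc1[symmetric])
  ultimately show False using u(2) by simp
qed

lemma act_in_ideal_smult:
  assumes M: "Module.module R M" and J: "J \<subseteq> carrier R"
    and EJ: "\<And>i k. i < a \<Longrightarrow> k < b \<Longrightarrow> E (free_gen R {..<a::nat} i) k \<in> J"
    and v: "v \<in> carrier (pow_module {..<a} M)" and k: "k < (b::nat)"
  shows "act R M {..<a} {..<b} E v k \<in> ideal_smult R J M"
proof -
  have "comb M {..<a} v (\<lambda>x\<in>{..<a}. E (free_gen R {..<a} x) k) \<in> ideal_smult R J M"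
    by (rule comb_ideal_smult[OF M J]) (use v EJ k in \<open>auto simp: dprod_simps\<close>)
  then show ?thesis using k by (simp add: act_def)
qed

lemma len_residue: "len R (regular_module R) \<mm> (carrier R) = 1"
proof (rule antisym)
  have Rs: "submodule (carrier R) R (regular_module R)" using carrier_submodule[OF regular] by simp
  have ne: "\<mm> \<subset> carrier R" using mm_carrier one_notin by blast
  have "submodule_chain R (regular_module R) \<mm> (carrier R) (Suc 0) (\<lambda>i. if i = 0 then \<mm> else carrier R)"
    using mm_sub Rs ne by (auto simp: submodule_chain_def)
  from len_ge[OF this] show "1 \<le> len R (regular_module R) \<mm> (carrier R)" by (simp add: one_enat_def)
  show "len R (regular_module R) \<mm> (carrier R) \<le> 1"
  proof (rule len_le)
    fix n C assume C: "submodule_chain R (regular_module R) \<mm> (carrier R) n C"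
    have "n \<le> 1"
    proof (rule ccontr)
      assume n: "\<not> n \<le> 1"
      have i: "0 < n" "1 < n" "1 \<le> n" "2 \<le> n" using n by linarith+
      have sub: "\<And>i. i \<le> n \<Longrightarrow> submodule (C i) R (regular_module R) \<and> \<mm> \<subseteq> C i \<and> C i \<subseteq> carrier R"
        and step: "\<And>i. i < n \<Longrightarrow> C i \<subset> C (Suc i)" using C by (auto simp: submodule_chain_def)
      have "C 0 \<subset> C 1" "C 1 \<subset> C 2" using step[OF i(1)] step[OF i(2)] by (simp_all add: numeral_2_eq_2)
      then have C1: "submodule (C 1) R (regular_module R)" "\<mm> \<subset> C 1" "C 1 \<subset> carrier R"
        using sub[of 0] sub[of 1] sub[of 2] i by auto
      have "ideal (C 1) R" using C1(1) ideal_iff_submodule[OF cr] by simp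
      then have "C 1 = \<mm> \<or> C 1 = carrier R"
        using maximalideal.I_maximal[OF maximal, of "C 1"] C1(2,3) by blast
      then show False using C1(2,3) by blast
    qed
    then show "enat n \<le> 1" by (simp add: one_enat_def)
  qed
qed


section \<open>Lengths in free modules\<close>

lemma pow_eq_ideal_smult:
  assumes "ideal J R"
  shows "({..<n::nat} \<rightarrow>\<^sub>E J) = ideal_smult R J (free_module R {..<n})"
proof -
  interpret J: ideal J R by fact
  show ?thesis unfolding ideal_smult_free[OF assms] using J.a_subset by (auto simp: carrier_free PiE_iff extensional_def)
qed

lemma image_pow_mm:
  assumes N: "Module.module R N" and f: "f \<in> module_hom R (free_module R {..<n::nat}) N"
  shows "f ` ({..<n} \<rightarrow>\<^sub>E \<mm>) = module_span R N {a \<odot>\<^bsub>N\<^esub> x | a x. a \<in> \<mm> \<and> x \<in> f ` carrier (free_module R {..<n})}"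
proof -
  let ?F = "free_module R {..<n}"
  let ?S = "{a \<odot>\<^bsub>?F\<^esub> x | a x. a \<in> \<mm> \<and> x \<in> carrier ?F}"
  interpret F: Module.module R ?F by (rule free) simp
  have "?S \<subseteq> carrier ?F" using mm_closed by auto
  note im = span_image[OF F.module_axioms N f this]
  have "f ` ?S = {a \<odot>\<^bsub>N\<^esub> x | a x. a \<in> \<mm> \<and> x \<in> f ` carrier ?F}"
  proof (intro subset_antisym subsetI)
    fix z assume "z \<in> f ` ?S"
    then obtain a x where ax: "a \<in> \<mm>" "x \<in> carrier ?F" "z = f (a \<odot>\<^bsub>?F\<^esub> x)" by blast
    then have "z = a \<odot>\<^bsub>N\<^esub> f x" using module_hom_smult[OF f mm_closed] by simp
    then show "z \<in> {a \<odot>\<^bsub>N\<^esub> x | a x. a \<in> \<mm> \<and> x \<in> f ` carrier ?F}" using ax by blast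
  next
    fix z assume "z \<in> {a \<odot>\<^bsub>N\<^esub> x | a x. a \<in> \<mm> \<and> x \<in> f ` carrier ?F}"
    then obtain a x where ax: "a \<in> \<mm>" "x \<in> carrier ?F" "z = a \<odot>\<^bsub>N\<^esub> f x" by blast
    then have "z = f (a \<odot>\<^bsub>?F\<^esub> x)" using module_hom_smult[OF f mm_closed] by simp
    then show "z \<in> f ` ?S" using ax by blast
  qed
  then show ?thesis using im unfolding pow_eq_ideal_smult[OF mm_ideal] ideal_smult_def by simp
qed

lemma hom_free_in_m_squared:
  assumes f: "f \<in> module_hom R (free_module R {..<n::nat}) (regular_module R)"
    and fm: "\<And>i. i < n \<Longrightarrow> f (free_gen R {..<n} i) \<in> \<mm>"
    and u: "u \<in> carrier (free_module R {..<n})" and um: "\<And>i. i < n \<Longrightarrow> u i \<in> \<mm>"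
  shows "f u \<in> m_squared"
proof -
  have "f u = comb (regular_module R) {..<n} (\<lambda>i. f (free_gen R {..<n} i)) u"
    by (rule hom_free_eq[OF cr regular _ f u]) simp
  also have "\<dots> \<in> m_squared" unfolding comb_def
    by (rule submodule_finsum[OF regular m_squared_sub]) (use fm um m_squaredI in auto)
  finally show ?thesis .
qed

lemma hom_free_zero:
  assumes f: "f \<in> module_hom R (free_module R {..<n::nat}) (regular_module R)"
    and u: "u \<in> carrier (free_module R {..<n})" and z: "\<And>i. i < n \<Longrightarrow> u i \<otimes> f (free_gen R {..<n} i) = \<zero>"
  shows "f u = \<zero>"
proof -
  have "f u = comb (regular_module R) {..<n} (\<lambda>i. f (free_gen R {..<n} i)) u"
    by (rule hom_free_eq[OF cr regular _ f u]) simp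
  also have "\<dots> \<in> {\<zero>\<^bsub>regular_module R\<^esub>}" unfolding comb_def
    by (rule submodule_finsum[OF regular zero_submodule[OF regular]]) (use z in auto)
  finally show ?thesis by simp
qed

lemma free_carrier_eq: "carrier (free_module R {..<n::nat}) = {..<n} \<rightarrow>\<^sub>E carrier R"
  by (simp add: carrier_free)

lemma len_free_pow:
  assumes "submodule A R (regular_module R)" and "submodule B R (regular_module R)" and "A \<subseteq> B"
  shows "len R (free_module R {..<n::nat}) ({..<n} \<rightarrow>\<^sub>E A) ({..<n} \<rightarrow>\<^sub>E B) = enat n * len R (regular_module R) A B"
  using len_pow[OF cr regular assms, of "{..<n}"] by (simp add: free_module_eq_dprod of_nat_eq_enat)

lemma len_free_residue:
  "len R (free_module R {..<n::nat}) ({..<n} \<rightarrow>\<^sub>E \<mm>) (carrier (free_module R {..<n})) = enat n"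
  using len_free_pow[OF mm_sub carrier_submodule[OF regular], of n] mm_carrier len_residue by (simp add: free_carrier_eq)

text \<open>Here \<open>e\<close>, \<open>w\<close>, \<open>d\<close> are the lengths of \<open>\<mm>/\<mm>\<^sup>2\<close>, \<open>\<mm>\<^sup>2\<close>, \<open>\<mm>M\<close>, and \<open>c\<close> is the rank of the projective cover of \<open>M\<close>.
  The map \<open>E \<otimes> M\<close> identifies \<open>(M/\<mm>M)\<^sup>b\<close> with \<open>(\<mm>M)\<^sup>b\<close> for consecutive ranks, whereas \<open>E\<close> maps
  \<open>\<mm>R\<^sup>b\<close> onto \<open>\<mm>\<^sup>2R\<^sup>b\<close>; counting lengths gives the equations of \<open>length_arithmetic\<close>.\<close>

lemma free_if_square_kills:
  fixes b :: "nat \<Rightarrow> nat" and f :: "(nat \<Rightarrow> 'a) \<Rightarrow> 'a"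
  assumes M: "Module.module R M" and fg: "finitely_generated R M" and nz: "\<not> zero_module M"
    and F: "minimal_free_resolution R \<mm> M F"
    and z: "\<And>a b u. a \<in> \<mm> \<Longrightarrow> b \<in> \<mm> \<Longrightarrow> u \<in> carrier M \<Longrightarrow> (a \<otimes> b) \<odot>\<^bsub>M\<^esub> u = \<zero>\<^bsub>M\<^esub>"
    and m3: "\<And>a b. a \<in> m_squared \<Longrightarrow> b \<in> \<mm> \<Longrightarrow> a \<otimes> b = \<zero>"
    and E: "\<And>q. E q \<in> module_hom R (free_module R {..<b (Suc q)}) (free_module R {..<b q})"
    and E2: "\<And>q u. u \<in> carrier (free_module R {..<b (Suc (Suc q))}) \<Longrightarrow> E q (E (Suc q) u) = \<zero>\<^bsub>free_module R {..<b q}\<^esub>"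
    and Em: "\<And>q u i. u \<in> carrier (free_module R {..<b (Suc q)}) \<Longrightarrow> i < b q \<Longrightarrow> E q u i \<in> \<mm>"
    and exE: "exact_seq R b E" and exM: "\<And>k. k \<le> 2 \<Longrightarrow> act_exact R b E M k"
    and b1: "b 1 > 0" and b2: "b 2 > 0"
    and f: "f \<in> module_hom R (free_module R {..<h}) (regular_module R)" and fim: "f ` carrier (free_module R {..<h}) = \<mm>"
    and fker: "\<And>u i. u \<in> carrier (free_module R {..<h}) \<Longrightarrow> f u = \<zero> \<Longrightarrow> i < h \<Longrightarrow> u i \<in> \<mm>"
    and short: "module_length R (regular_module R) < 2 * enat h"
  shows "is_free R M"
proof -
  let ?L = "regular_module R" and ?FB = "\<lambda>q. free_module R {..<b q}" and ?mM = "ideal_smult R \<mm> M"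
  let ?FA = "res_term R F 0"
  interpret M: Module.module R M by (rule M)
  have FB: "Module.module R (?FB q)" for q by (rule free) simp
  have FA: "Module.module R ?FA" by (rule free) simp
  have P: "Module.module R (pow_module {..<n::nat} M)" for n by (rule module_dprod[OF cr M])
  note mMs = ideal_smult_submodule[OF M mm_carrier] and zL = zero_submodule[OF regular] and zM = zero_submodule[OF M]
    and carM = carrier_submodule[OF M] and carL = carrier_submodule[OF regular]
  have mMc: "?mM \<subseteq> carrier M" using submodule_carrier[OF M mMs] by blast
  have zmM: "{\<zero>\<^bsub>M\<^esub>} \<subseteq> ?mM" using submodule_zero[OF M mMs] by simp
  have zsq: "{\<zero>} \<subseteq> m_squared" using submodule_zero[OF regular m_squared_sub] by simp
  have pow_car: "carrier (pow_module {..<n::nat} M) = {..<n} \<rightarrow>\<^sub>E carrier M" for n by (simp add: dprod_simps)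
  have gen: "free_gen R {..<n::nat} i \<in> carrier (free_module R {..<n})" for n i by (rule free_gen_closed[OF cr]) simp
  obtain u where u: "u \<in> carrier M" "u \<notin> ?mM" by (rule mm_smult_ne[OF M fg nz])
  define e w where "e = len R ?L m_squared \<mm>" and "w = len R ?L {\<zero>} m_squared"
  define d where "d = len R M {\<zero>\<^bsub>M\<^esub>} ?mM"
  let ?c = "rk F 0"
  \<comment> \<open>The minimal cover \<open>f\<close> of \<mm> maps \<mm>R^h onto \<mm>^2 and has
    its kernel inside \<mm>R^h, so \<mm>/\<mm>^2 has the length of R^h/\<mm>R^h.\<close>
  have eh: "e = enat h"
  proof -
    have H: "Module.module R (free_module R {..<h})" by (rule free) simp
    have "f ` ({..<h} \<rightarrow>\<^sub>E \<mm>) = m_squared" unfolding image_pow_mm[OF regular f] fim m_squared_def by simp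
    then have "e = len R ?L (f ` ({..<h} \<rightarrow>\<^sub>E \<mm>)) (f ` carrier (free_module R {..<h}))" by (simp add: fim e_def)
    also have "\<dots> = len R (free_module R {..<h}) ({..<h} \<rightarrow>\<^sub>E \<mm>) (carrier (free_module R {..<h}))"
    proof (rule len_image[OF H regular f _ carrier_submodule[OF H]])
      show "submodule ({..<h} \<rightarrow>\<^sub>E \<mm>) R (free_module R {..<h})"
        unfolding pow_eq_ideal_smult[OF mm_ideal] by (rule ideal_smult_submodule[OF H mm_carrier])
      show "({..<h} \<rightarrow>\<^sub>E \<mm>) \<subseteq> carrier (free_module R {..<h})" unfolding free_carrier_eq by (rule PiE_mono) (use mm_carrier in auto)
      show "v \<in> {..<h} \<rightarrow>\<^sub>E \<mm>" if "v \<in> carrier (free_module R {..<h})" "f v = \<zero>\<^bsub>?L\<^esub>" for v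
        using fker[OF that(1)] that by (auto simp: free_carrier_eq PiE_iff)
    qed
    finally show ?thesis by (simp add: len_free_residue)
  qed
  \<comment> \<open>The filtration of R by \<mm>^2 and \<mm> has factors of lengths w, e and 1, and
    e = h; the length hypothesis also makes w finite.\<close>
  have wfin: "w < enat h \<and> 1 + h + the_enat w < 2 * h"
  proof -
    have "module_length R ?L = len R ?L {\<zero>} \<mm> + len R ?L \<mm> (carrier R)"
      using len_additive[OF regular zL mm_sub carL] submodule_zero[OF regular mm_sub] mm_carrier
      by (simp add: module_length_eq_len[OF regular])
    also have "len R ?L {\<zero>} \<mm> = w + e"
      using len_additive[OF regular zL m_squared_sub mm_sub] zsq m_squared_mm by (simp add: w_def e_def)
    finally have "w + enat h + 1 < 2 * enat h" using short eh len_residue by simp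
    then have "w + enat h + 1 < enat (2 * h)" by (metis numeral_eq_enat times_enat_simps(1))
    then show ?thesis by (cases w) (simp_all add: one_enat_def)
  qed
  then obtain w' where w': "w = enat w'" by (cases w) auto
  have mMsub: "submodule ({..<n::nat} \<rightarrow>\<^sub>E ?mM) R (pow_module {..<n} M)" for n by (rule submodule_pow[OF cr M mMs])
  have act: "act R M {..<b (Suc k)} {..<b k} (E k) \<in> module_hom R (pow_module {..<b (Suc k)} M) (pow_module {..<b k} M)" for k
    by (rule act_hom[OF cr _ _ E M]) simp_all
  have act_mm: "act R M {..<b (Suc k)} {..<b k} (E k) v \<in> {..<b k} \<rightarrow>\<^sub>E ?mM"
    if v: "v \<in> carrier (pow_module {..<b (Suc k)} M)" for k v
  proof -
    have "act R M {..<b (Suc k)} {..<b k} (E k) v i \<in> ?mM" if "i < b k" for i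
      by (rule act_in_ideal_smult[OF M mm_carrier _ v that]) (rule Em[OF gen])
    then show ?thesis using module_hom_closed[OF act v] by (auto simp: pow_car PiE_iff)
  qed
  have ker_mm: "v \<in> {..<b (Suc k)} \<rightarrow>\<^sub>E ?mM"
    if k: "k \<le> 2" and v: "v \<in> carrier (pow_module {..<b (Suc k)} M)"
      "act R M {..<b (Suc k)} {..<b k} (E k) v = \<zero>\<^bsub>pow_module {..<b k} M\<^esub>" for k v
  proof -
    obtain t where "t \<in> carrier (pow_module {..<b (Suc (Suc k))} M)" "v = act R M {..<b (Suc (Suc k))} {..<b (Suc k)} (E (Suc k)) t"
      using exM[OF k] v unfolding act_exact_def by blast
    then show ?thesis using act_mm by blast
  qed
  have act_zero_mm: "act R M {..<b (Suc k)} {..<b k} (E k) v = \<zero>\<^bsub>pow_module {..<b k} M\<^esub>"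
    if v: "v \<in> {..<b (Suc k)} \<rightarrow>\<^sub>E ?mM" for k v
    unfolding act_def dprod_simps
  proof (rule restrict_ext)
    fix i assume i: "i \<in> {..<b k}"
    have "comb M {..<b (Suc k)} v (\<lambda>x\<in>{..<b (Suc k)}. E k (free_gen R {..<b (Suc k)} x) i) \<in> {\<zero>\<^bsub>M\<^esub>}"
      unfolding comb_def
    proof (rule submodule_finsum[OF M zM], rule Pi_I)
      fix x assume x: "x \<in> {..<b (Suc k)}"
      then have "v x \<in> ?mM" using v by auto
      then show "(\<lambda>x\<in>{..<b (Suc k)}. E k (free_gen R {..<b (Suc k)} x) i) x \<odot>\<^bsub>M\<^esub> v x \<in> {\<zero>\<^bsub>M\<^esub>}"
        using mm_smult_mm[OF M z _ Em[OF gen]] x i by simp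
    qed
    then show "comb M {..<b (Suc k)} v (\<lambda>x\<in>{..<b (Suc k)}. E k (free_gen R {..<b (Suc k)} x) i) = \<zero>\<^bsub>M\<^esub>" by simp
  qed
  have aug: "aug F \<in> module_hom R ?FA M" and augs: "aug F ` carrier ?FA = carrier M"
    using min_free_resolution[OF M F] by (simp_all add: free_resolution_def)
  have augk: "v \<in> {..<?c} \<rightarrow>\<^sub>E \<mm>" if "v \<in> carrier ?FA" "aug F v = \<zero>\<^bsub>M\<^esub>" for v
  proof -
    have "v \<in> res_kernel R M F 0" using that by (simp add: res_kernel_def a_kernel_eq)
    then show ?thesis using min_res_kernel[OF M F] that(1) by (auto simp: free_carrier_eq PiE_iff)
  qed
  have augm: "aug F ` ({..<?c} \<rightarrow>\<^sub>E \<mm>) = ?mM" unfolding image_pow_mm[OF M aug] augs ideal_smult_def ..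
  have mmS: "submodule ({..<n::nat} \<rightarrow>\<^sub>E \<mm>) R (free_module R {..<n})" for n
    unfolding pow_eq_ideal_smult[OF mm_ideal] by (rule ideal_smult_submodule[OF free mm_carrier]) simp
  have sqS: "submodule ({..<n::nat} \<rightarrow>\<^sub>E m_squared) R (free_module R {..<n})" for n
    unfolding pow_eq_ideal_smult[OF m_squared_ideal]
    by (rule ideal_smult_submodule[OF free]) (use m_squared_mm mm_carrier in auto)
  have mmC: "({..<n::nat} \<rightarrow>\<^sub>E \<mm>) \<subseteq> carrier (free_module R {..<n})" for n
    unfolding free_carrier_eq by (rule PiE_mono) (use mm_carrier in auto)
  have sqmm: "({..<n::nat} \<rightarrow>\<^sub>E m_squared) \<subseteq> ({..<n} \<rightarrow>\<^sub>E \<mm>)" for n by (rule PiE_mono) (use m_squared_mm in auto)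
  have lenM: "len R M ?mM (carrier M) = enat ?c"
    using len_image[OF FA M aug mmS carrier_submodule[OF FA] mmC augk] by (simp add: augm augs len_free_residue)
  have c0: "?c > 0"
  proof (rule ccontr)
    assume "\<not> ?c > 0"
    then have "len R M ?mM (carrier M) = 0" using lenM by (simp add: zero_enat_def)
    then show False using len_eq_zeroD[OF mMs carM mMc] u by blast
  qed
  have zpow: "({..<n::nat} \<rightarrow>\<^sub>E {\<zero>\<^bsub>M\<^esub>}) = {\<zero>\<^bsub>pow_module {..<n} M\<^esub>}" for n
    by (auto simp: dprod_simps PiE_eq_singleton)
  \<comment> \<open>The kernel of E \<otimes> M is the part with coordinates in \<mm>M: cycles are
    boundaries, so minimality gives one inclusion, and \<mm>^2 M = 0 the other. The same two facts,
    one degree lower, show that the image is all of the part with coordinates in \<mm>M.\<close>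
  have eqA: "enat (b (Suc (Suc k))) * enat ?c = enat (b (Suc k)) * d" if k: "k \<le> 1" for k
  proof -
    let ?A = "act R M {..<b (Suc (Suc k))} {..<b (Suc k)} (E (Suc k))"
    let ?P = "\<lambda>n. pow_module {..<b n} M"
    have im0: "?A ` ({..<b (Suc (Suc k))} \<rightarrow>\<^sub>E ?mM) = {..<b (Suc k)} \<rightarrow>\<^sub>E {\<zero>\<^bsub>M\<^esub>}"
    proof -
      have "\<zero>\<^bsub>?P (Suc (Suc k))\<^esub> \<in> {..<b (Suc (Suc k))} \<rightarrow>\<^sub>E ?mM" by (rule submodule_zero[OF P mMsub])
      then show ?thesis unfolding zpow using act_zero_mm[of _ "Suc k"] by auto
    qed
    have im1: "?A ` carrier (?P (Suc (Suc k))) = {..<b (Suc k)} \<rightarrow>\<^sub>E ?mM"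
    proof (intro subset_antisym subsetI)
      fix v assume v: "v \<in> {..<b (Suc k)} \<rightarrow>\<^sub>E ?mM"
      then have "v \<in> carrier (?P (Suc k))" using mMc by (auto simp: pow_car PiE_iff)
      then show "v \<in> ?A ` carrier (?P (Suc (Suc k)))"
        using exM[of k] k act_zero_mm[OF v] unfolding act_exact_def by simp
    qed (use act_mm in auto)
    have "len R (?P (Suc k)) (?A ` ({..<b (Suc (Suc k))} \<rightarrow>\<^sub>E ?mM)) (?A ` carrier (?P (Suc (Suc k)))) =
        len R (?P (Suc (Suc k))) ({..<b (Suc (Suc k))} \<rightarrow>\<^sub>E ?mM) (carrier (?P (Suc (Suc k))))"
    proof (rule len_image[OF P P act mMsub carrier_submodule[OF P]])
      show "({..<b (Suc (Suc k))} \<rightarrow>\<^sub>E ?mM) \<subseteq> carrier (?P (Suc (Suc k)))" unfolding pow_car by (rule PiE_mono) (use mMc in auto)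
      show "v \<in> {..<b (Suc (Suc k))} \<rightarrow>\<^sub>E ?mM"
        if "v \<in> carrier (?P (Suc (Suc k)))" "?A v = \<zero>\<^bsub>?P (Suc k)\<^esub>" for v
        using ker_mm[OF _ that] k by simp
    qed
    then have "len R (?P (Suc k)) ({..<b (Suc k)} \<rightarrow>\<^sub>E {\<zero>\<^bsub>M\<^esub>}) ({..<b (Suc k)} \<rightarrow>\<^sub>E ?mM) =
        len R (?P (Suc (Suc k))) ({..<b (Suc (Suc k))} \<rightarrow>\<^sub>E ?mM) ({..<b (Suc (Suc k))} \<rightarrow>\<^sub>E carrier M)"
      unfolding im0 im1 unfolding pow_car .
    then show ?thesis
      unfolding len_pow[OF cr M zM mMs zmM finite_lessThan] len_pow[OF cr M mMs carM mMc finite_lessThan] lenM d_def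
      by (simp add: of_nat_eq_enat)
  qed
  have comp: "(\<lambda>v. E k v i) \<in> module_hom R (?FB (Suc k)) ?L" if "i < b k" for k i
    by (rule module_hom_comp[OF E free_proj_hom]) (use that in simp_all)
  have Esq: "E k v = \<zero>\<^bsub>?FB k\<^esub>" if v: "v \<in> {..<b (Suc k)} \<rightarrow>\<^sub>E m_squared" for k v
  proof (rule PiE_ext[of _ "{..<b k}" "\<lambda>_. carrier R"])
    have vc: "v \<in> carrier (?FB (Suc k))" by (rule subsetD[OF mmC subsetD[OF sqmm v]])
    show "E k v \<in> {..<b k} \<rightarrow>\<^sub>E carrier R" using module_hom_closed[OF E vc] by (simp add: free_carrier_eq)
    show "\<zero>\<^bsub>?FB k\<^esub> \<in> {..<b k} \<rightarrow>\<^sub>E carrier R" by (auto simp: free_simps)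
    fix i assume i: "i \<in> {..<b k}"
    have "E k v i = \<zero>"
    proof (rule hom_free_zero[OF comp vc])
      show "i < b k" using i by simp
      show "v l \<otimes> E k (free_gen R {..<b (Suc k)} l) i = \<zero>" if "l < b (Suc k)" for l
        by (rule m3[OF PiE_mem[OF v] Em[OF gen]]) (use i that in simp_all)
    qed
    then show "E k v i = \<zero>\<^bsub>?FB k\<^esub> i" using i by (simp add: free_simps)
  qed
  have exD: "v \<in> E (Suc k) ` carrier (?FB (Suc (Suc k)))" if "v \<in> carrier (?FB (Suc k))" "E k v = \<zero>\<^bsub>?FB k\<^esub>" for k v
    using exE that unfolding exact_seq_def by blast
  have Eim: "E k v \<in> {..<b k} \<rightarrow>\<^sub>E \<mm>" if v: "v \<in> carrier (?FB (Suc k))" for k v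
    using module_hom_closed[OF E v] Em[OF v] by (auto simp: free_carrier_eq PiE_iff)
  \<comment> \<open>A vector with entries in \<mm>^2 is a cycle because \<mm>^3 = 0, hence it is E
    t. As \<mm>^2 kills M, \<open>preimage_in_mm\<close> forces the entries of t into \<mm>.\<close>
  have img: "E (Suc k) ` ({..<b (Suc (Suc k))} \<rightarrow>\<^sub>E \<mm>) = {..<b (Suc k)} \<rightarrow>\<^sub>E m_squared" if k: "k \<le> 1" for k
  proof (intro subset_antisym subsetI)
    fix v assume "v \<in> E (Suc k) ` ({..<b (Suc (Suc k))} \<rightarrow>\<^sub>E \<mm>)"
    then obtain t where t: "t \<in> {..<b (Suc (Suc k))} \<rightarrow>\<^sub>E \<mm>" "v = E (Suc k) t" by blast
    have tc: "t \<in> carrier (?FB (Suc (Suc k)))" by (rule subsetD[OF mmC t(1)])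
    have "E (Suc k) t i \<in> m_squared" if i: "i < b (Suc k)" for i
      by (rule hom_free_in_m_squared[OF comp[OF i] Em[OF gen i] tc]) (use t(1) in auto)
    then show "v \<in> {..<b (Suc k)} \<rightarrow>\<^sub>E m_squared" unfolding t(2)
      using module_hom_closed[OF E tc] by (auto simp: free_carrier_eq PiE_iff)
  next
    fix v assume v: "v \<in> {..<b (Suc k)} \<rightarrow>\<^sub>E m_squared"
    have vc: "v \<in> carrier (?FB (Suc k))" by (rule subsetD[OF mmC subsetD[OF sqmm v]])
    obtain t where t: "t \<in> carrier (?FB (Suc (Suc k)))" "v = E (Suc k) t" using exD[OF vc Esq[OF v]] by blast
    have "t i \<in> \<mm>" if i: "i < b (Suc (Suc k))" for i
    proof (rule preimage_in_mm[OF M u E _ t(1) _ i])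
      show "y l \<in> ?mM" if "y \<in> carrier (pow_module {..<b (Suc (Suc k))} M)"
        "act R M {..<b (Suc (Suc k))} {..<b (Suc k)} (E (Suc k)) y = \<zero>\<^bsub>pow_module {..<b (Suc k)} M\<^esub>" "l < b (Suc (Suc k))" for y l
        using ker_mm[OF _ that(1,2)] that(3) k by auto
      show "E (Suc k) t l \<odot>\<^bsub>M\<^esub> u = \<zero>\<^bsub>M\<^esub>" if "l < b (Suc k)" for l
        using m_squared_smult_zero[OF M z u(1), of "v l"] v that t(2) by auto
    qed
    then have "t \<in> {..<b (Suc (Suc k))} \<rightarrow>\<^sub>E \<mm>" using t(1) by (auto simp: free_carrier_eq PiE_iff)
    then show "v \<in> E (Suc k) ` ({..<b (Suc (Suc k))} \<rightarrow>\<^sub>E \<mm>)" using t(2) by blast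
  qed
  have zfree: "({..<n::nat} \<rightarrow>\<^sub>E {\<zero>}) = {\<zero>\<^bsub>free_module R {..<n}\<^esub>}" for n
    by (auto simp: free_simps PiE_eq_singleton)
  \<comment> \<open>The kernel K of \<open>E 1\<close> lies between the vectors with entries in
    \<mm>^2 and those with entries in \<mm>. The lower factor is R^b3 modulo \<mm>R^b3, via
    \<open>E 2\<close>; the upper one is carried by \<open>E 1\<close> onto the vectors of length b1
    with entries in \<mm>^2.\<close>
  have eqB: "enat (b 2) * e = enat (b 3) + enat (b 1) * w"
  proof -
    let ?E1 = "E (Suc 0)" and ?E2 = "E (Suc (Suc 0))"
    let ?b1 = "b (Suc 0)" and ?b2 = "b (Suc (Suc 0))" and ?b3 = "b (Suc (Suc (Suc 0)))"
    let ?F2 = "?FB (Suc (Suc 0))"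
    let ?K = "a_kernel ?F2 (?FB (Suc 0)) ?E1"
    have K: "submodule ?K R ?F2" by (rule submodule_kernel[OF FB FB E])
    have KE: "?E2 ` carrier (?FB (Suc (Suc (Suc 0)))) = ?K"
      using exD E2[of _ "Suc 0"] module_hom_closed[OF E, of _ "Suc (Suc 0)"] by (auto simp: a_kernel_eq)
    have sqK: "({..<?b2} \<rightarrow>\<^sub>E m_squared) \<subseteq> ?K" using Esq subsetD[OF mmC subsetD[OF sqmm]] by (auto simp: a_kernel_eq)
    have Kmm: "?K \<subseteq> {..<?b2} \<rightarrow>\<^sub>E \<mm>" unfolding KE[symmetric] using Eim by blast
    have "len R ?F2 ({..<?b2} \<rightarrow>\<^sub>E m_squared) ({..<?b2} \<rightarrow>\<^sub>E \<mm>) =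
        len R ?F2 ({..<?b2} \<rightarrow>\<^sub>E m_squared) ?K + len R ?F2 ?K ({..<?b2} \<rightarrow>\<^sub>E \<mm>)"
      by (rule len_additive[OF FB sqS K mmS sqK Kmm])
    moreover have "len R ?F2 ({..<?b2} \<rightarrow>\<^sub>E m_squared) ({..<?b2} \<rightarrow>\<^sub>E \<mm>) = enat ?b2 * e"
      unfolding e_def by (rule len_free_pow[OF m_squared_sub mm_sub m_squared_mm])
    moreover have "len R ?F2 ({..<?b2} \<rightarrow>\<^sub>E m_squared) ?K = enat ?b3"
    proof -
      have "len R ?F2 (?E2 ` ({..<?b3} \<rightarrow>\<^sub>E \<mm>)) (?E2 ` carrier (?FB (Suc (Suc (Suc 0))))) =
          len R (?FB (Suc (Suc (Suc 0)))) ({..<?b3} \<rightarrow>\<^sub>E \<mm>) (carrier (?FB (Suc (Suc (Suc 0)))))"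
      proof (rule len_image[OF FB FB E mmS carrier_submodule[OF FB] mmC])
        show "v \<in> {..<?b3} \<rightarrow>\<^sub>E \<mm>" if "v \<in> carrier (?FB (Suc (Suc (Suc 0))))" "?E2 v = \<zero>\<^bsub>?F2\<^esub>" for v
          using exD[OF that] Eim by blast
      qed
      then show ?thesis using img[of "Suc 0"] by (simp add: KE len_free_residue)
    qed
    moreover have "len R ?F2 ?K ({..<?b2} \<rightarrow>\<^sub>E \<mm>) = enat ?b1 * w"
    proof -
      have "?E1 ` ?K = {..<?b1} \<rightarrow>\<^sub>E {\<zero>}"
        unfolding zfree using submodule_zero[OF FB K] by (auto simp: a_kernel_eq)
      moreover have "len R (?FB (Suc 0)) (?E1 ` ?K) (?E1 ` ({..<?b2} \<rightarrow>\<^sub>E \<mm>)) = len R ?F2 ?K ({..<?b2} \<rightarrow>\<^sub>E \<mm>)"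
      proof (rule len_image[OF FB FB E K mmS Kmm])
        show "v \<in> ?K" if "v \<in> {..<?b2} \<rightarrow>\<^sub>E \<mm>" "?E1 v = \<zero>\<^bsub>?FB (Suc 0)\<^esub>" for v
          using that(2) subsetD[OF mmC that(1)] by (simp add: a_kernel_eq)
      qed
      ultimately show ?thesis
        using img[of 0] len_free_pow[OF zL m_squared_sub, of ?b1] zsq by (simp add: w_def)
    qed
    ultimately show ?thesis by (simp add: numeral_2_eq_2 numeral_3_eq_3)
  qed
  have A0: "enat (b 2) * enat ?c = enat (b 1) * d" using eqA[of 0] by (simp add: numeral_2_eq_2)
  \<comment> \<open>The left side is finite and \<open>b 1\<close> is positive, so d cannot be
    infinite.\<close>
  then obtain d' where d': "d = enat d'" using b1 by (cases d) (auto simp: zero_enat_def)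
  have n1: "b 2 * ?c = b 1 * d'" using A0 d' by simp
  have n2: "b 3 * ?c = b 2 * d'" using eqA[of 1] d' by (simp add: numeral_2_eq_2 numeral_3_eq_3)
  have n3: "b 2 * h = b 3 + b 1 * w'" using eqB eh w' by simp
  have n4: "1 + h + w' < 2 * h" using wfin w' by simp
  have dh: "d' = h * ?c" and w0: "w' = 0" by (rule length_arithmetic[OF n1 n2 n3 n4 b1 b2 c0])+
  \<comment> \<open>As w = 0, the module \<mm>R^c has length c h. The augmentation maps it onto
    \<mm>M, whose length d is also h c, and the kernel lies inside it; so the kernel has length
    0.\<close>
  let ?K = "a_kernel ?FA M (aug F)"
  have K: "submodule ?K R ?FA" by (rule submodule_kernel[OF FA M aug])
  have Kmm: "?K \<subseteq> {..<?c} \<rightarrow>\<^sub>E \<mm>" using augk by (auto simp: a_kernel_eq)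
  have zs: "submodule {\<zero>\<^bsub>?FA\<^esub>} R ?FA" by (rule zero_submodule[OF FA])
  have zK: "{\<zero>\<^bsub>?FA\<^esub>} \<subseteq> ?K" using submodule_zero[OF FA K] by simp
  have "len R ?FA {\<zero>\<^bsub>?FA\<^esub>} ({..<?c} \<rightarrow>\<^sub>E \<mm>) = len R ?FA {\<zero>\<^bsub>?FA\<^esub>} ?K + len R ?FA ?K ({..<?c} \<rightarrow>\<^sub>E \<mm>)"
    by (rule len_additive[OF FA zs K mmS zK Kmm])
  moreover have "len R ?FA ?K ({..<?c} \<rightarrow>\<^sub>E \<mm>) = d"
  proof -
    have "len R M (aug F ` ?K) (aug F ` ({..<?c} \<rightarrow>\<^sub>E \<mm>)) = len R ?FA ?K ({..<?c} \<rightarrow>\<^sub>E \<mm>)"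
    proof (rule len_image[OF FA M aug K mmS Kmm])
      show "v \<in> ?K" if "v \<in> {..<?c} \<rightarrow>\<^sub>E \<mm>" "aug F v = \<zero>\<^bsub>M\<^esub>" for v
        using that(2) subsetD[OF mmC that(1)] by (simp add: a_kernel_eq)
    qed
    moreover have "aug F ` ?K = {\<zero>\<^bsub>M\<^esub>}" using submodule_zero[OF FA K] by (auto simp: a_kernel_eq)
    ultimately show ?thesis by (simp add: augm d_def)
  qed
  moreover have "len R ?FA {\<zero>\<^bsub>?FA\<^esub>} ({..<?c} \<rightarrow>\<^sub>E \<mm>) = enat (?c * h)"
  proof -
    have "len R ?L {\<zero>} \<mm> = enat h"
      using len_additive[OF regular zL m_squared_sub mm_sub] zsq m_squared_mm eh w' w0
      by (simp add: w_def[symmetric] e_def[symmetric])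
    moreover have "len R ?FA ({..<?c} \<rightarrow>\<^sub>E {\<zero>}) ({..<?c} \<rightarrow>\<^sub>E \<mm>) = enat ?c * len R ?L {\<zero>} \<mm>"
      by (rule len_free_pow) (use zL mm_sub submodule_zero[OF regular mm_sub] in simp_all)
    ultimately show ?thesis unfolding zfree by simp
  qed
  ultimately have "len R ?FA {\<zero>\<^bsub>?FA\<^esub>} ?K = 0"
    using d' dh by (cases "len R ?FA {\<zero>\<^bsub>?FA\<^esub>} ?K") (simp_all add: zero_enat_def mult.commute)
  then have Kz: "?K = {\<zero>\<^bsub>?FA\<^esub>}" using len_eq_zeroD[OF zs K zK] by simp
  show ?thesis
  proof (rule free_if_iso[OF cr _ _ M aug augs])
    show "\<one> \<noteq> \<zero>" using one_notin submodule_zero[OF regular mm_sub] by auto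
    show "v = \<zero>\<^bsub>?FA\<^esub>" if "v \<in> carrier ?FA" "aug F v = \<zero>\<^bsub>M\<^esub>" for v
      using Kz that by (auto simp: a_kernel_eq)
  qed simp
qed

end

section \<open>The theorem\<close>

context finite_length_local_ring
begin

lemma finitely_generated_if_surj:
  assumes M: "Module.module R M" and f: "f \<in> module_hom R (free_module R {..<n::nat}) M"
    and surj: "f ` carrier (free_module R {..<n}) = carrier M"
  shows "finitely_generated R M"
proof -
  let ?x = "\<lambda>i. f (free_gen R {..<n} i)"
  have x: "?x \<in> {..<n} \<rightarrow> carrier M" using module_hom_closed[OF f free_gen_closed[OF cr]] by simp
  have "module_span R M (?x ` {..<n}) = carrier M"
    unfolding span_comb[OF M finite_lessThan x] surj[symmetric]
    by (rule image_cong[OF refl]) (rule hom_free_eq[OF cr M finite_lessThan f, symmetric])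
  then show ?thesis unfolding finitely_generated_def using x by (intro exI[of _ "?x ` {..<n}"]) auto
qed

text \<open>The augmentation of the minimal resolution chosen for I, read as a map into R. Its
  source has rank equal to the Betti number in the hypothesis by definition, so no comparison of
  minimal covers is involved.\<close>

lemma ideal_generators:
  assumes I: "ideal I R"
  defines "K \<equiv> (regular_module R)\<lparr>carrier := I\<rparr>"
  shows "\<exists>f\<in>module_hom R (free_module R {..<betti R \<mm> K 0}) (regular_module R).
    f ` carrier (free_module R {..<betti R \<mm> K 0}) = I \<and>
    (\<forall>u\<in>carrier (free_module R {..<betti R \<mm> K 0}). f u = \<zero> \<longrightarrow> (\<forall>i<betti R \<mm> K 0. u i \<in> \<mm>))"
proof -
  have Is: "submodule I R (regular_module R)" using I ideal_iff_submodule[OF cr] by simp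
  have Ic: "I \<subseteq> carrier R" using submodule_carrier[OF regular Is] by auto
  have K: "Module.module R K" unfolding K_def by (rule submodule.submodule_is_module[OF Is regular])
  obtain n :: nat and f where f: "f \<in> module_hom R (free_module R {..<n}) (regular_module R)"
    and fI: "f ` carrier (free_module R {..<n}) = I"
    using minimal_generators[OF regular fg_ideal[OF Is]] by blast
  have f': "f \<in> module_hom R (free_module R {..<n}) K"
    using f fI by (auto simp: module_hom_def K_def)
  have "finitely_generated R K" by (rule finitely_generated_if_surj[OF K f']) (simp add: fI K_def)
  from min_res[OF K this] have F: "minimal_free_resolution R \<mm> K (min_res R \<mm> K)" .
  let ?F = "min_res R \<mm> K"
  have aug: "aug ?F \<in> module_hom R (res_term R ?F 0) K" and augs: "aug ?F ` carrier (res_term R ?F 0) = carrier K"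
    using min_free_resolution[OF K F] by (simp_all add: free_resolution_def)
  show ?thesis
    unfolding betti_def
  proof (intro bexI[of _ "aug ?F"] conjI ballI allI impI)
    show "aug ?F \<in> module_hom R (res_term R ?F 0) (regular_module R)"
      using aug Ic by (auto simp: module_hom_def K_def)
    show "aug ?F ` carrier (res_term R ?F 0) = I" using augs by (simp add: K_def)
    show "u i \<in> \<mm>" if "u \<in> carrier (res_term R ?F 0)" "aug ?F u = \<zero>" "i < rk ?F 0" for u i
      using that by (intro min_res_kernel[OF K F]) (simp_all add: res_kernel_def a_kernel_eq K_def)
  qed
qed

text \<open>This is the value of s when I = \<mm>; the residue field is a simple module.\<close>

lemma module_length_residue: "module_length R (quot_module (regular_module R) \<mm>) = 1"
proof -
  let ?L = "regular_module R" and ?Q = "quot_module (regular_module R) \<mm>"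
  let ?f = "\<lambda>x. \<mm> +>\<^bsub>?L\<^esub> x"
  have Q: "Module.module R ?Q" by (rule module_quot[OF regular mm_sub])
  have f: "?f \<in> module_hom R ?L ?Q" by (rule quot_proj_hom[OF regular mm_sub])
  have z: "?f x = \<zero>\<^bsub>?Q\<^esub> \<longleftrightarrow> x \<in> \<mm>" if "x \<in> carrier R" for x
    using quot_proj_eq_zero[OF regular mm_sub] that by simp
  have "len R ?Q (?f ` \<mm>) (?f ` carrier ?L) = len R ?L \<mm> (carrier ?L)"
    by (rule len_image[OF regular Q f mm_sub carrier_submodule[OF regular]]) (use mm_carrier z in auto)
  moreover have "?f ` \<mm> = {\<zero>\<^bsub>?Q\<^esub>}" using z mm_closed submodule_zero[OF regular mm_sub] by auto
  moreover have "?f ` carrier ?L = carrier ?Q" unfolding quot_module_carrier by auto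
  ultimately show ?thesis using len_residue by (simp add: module_length_eq_len[OF Q])
qed

lemma rank_zero_pos:
  assumes M: "Module.module R M" and nz: "\<not> zero_module M" and F: "free_resolution R M F"
  shows "rk F 0 > 0"
proof (rule ccontr)
  assume "\<not> rk F 0 > 0"
  then have z: "rk F 0 = 0" by simp
  have aug: "aug F \<in> module_hom R (res_term R F 0) M" and augs: "aug F ` carrier (res_term R F 0) = carrier M"
    using F by (simp_all add: free_resolution_def)
  have "carrier (res_term R F 0) = {\<zero>\<^bsub>res_term R F 0\<^esub>}" using z by (auto simp: carrier_free free_simps restrict_def)
  then have "carrier M = {\<zero>\<^bsub>M\<^esub>}"
    using augs module_hom_zero[OF free M aug] by (metis finite_lessThan image_empty image_insert)
  then show False using nz by (simp add: zero_module_def)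
qed

text \<open>The conditions on products of ideals appear as equations between elements, the form in
  which they meet matrices with entries in I. Balancing moves the vanishing of Tor to the resolution
  of N tensored with M, where such matrices act.\<close>

lemma free_if_Tor_zero:
  fixes M :: "('a, 'b, 'k) module_scheme" and N :: "('a, 'c, 'l) module_scheme" and j :: nat
  assumes I: "ideal I R" and Ic: "I \<subset> carrier R" and I0: "I \<noteq> {\<zero>}"
    and mmI: "\<And>a b i. a \<in> \<mm> \<Longrightarrow> b \<in> \<mm> \<Longrightarrow> i \<in> I \<Longrightarrow> (a \<otimes> b) \<otimes> i = \<zero>"
    and short: "module_length R (regular_module R) <
      2 * module_length R (quot_module (regular_module R) I) * enat (betti R \<mm> ((regular_module R)\<lparr>carrier := I\<rparr>) 0)"
    and M: "Module.module R M" and Mfg: "finitely_generated R M" and Mnz: "\<not> zero_module M"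
    and mIM: "\<And>a i u. a \<in> \<mm> \<Longrightarrow> i \<in> I \<Longrightarrow> u \<in> carrier M \<Longrightarrow> (a \<otimes> i) \<odot>\<^bsub>M\<^esub> u = \<zero>\<^bsub>M\<^esub>"
    and N: "Module.module R N" and Nfg: "finitely_generated R N" and Nnf: "\<not> is_free R N"
    and j: "j > 1" and Mj: "ideal_free R I (syzygy R \<mm> M j)"
    and Nj: "ideal_free R I (syzygy R \<mm> N j)" and Nj1: "ideal_free R I (syzygy R \<mm> N (Suc j))"
    and Tor: "\<And>i. 1 \<le> i \<Longrightarrow> i \<le> j + 2 \<Longrightarrow> zero_module (Tor R M N i)"
  shows "is_free R M"
proof -
  interpret M: Module.module R M by (rule M)
  interpret I: ideal I R by (rule I)
  have I\<mm>: "I \<subseteq> \<mm>" by (rule proper_ideal_subset[OF I Ic])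
  have IR: "I \<subseteq> carrier R" using Ic by blast
  define F G where "F = min_res R \<mm> M" and "G = min_res R \<mm> N"
  have F: "minimal_free_resolution R \<mm> M F" and G: "minimal_free_resolution R \<mm> N G"
    unfolding F_def G_def by (rule min_res[OF M Mfg], rule min_res[OF N Nfg])
  note Fr = min_free_resolution[OF M F] and Gr = min_free_resolution[OF N G]
  let ?b = "rk G" and ?E = "dif G" and ?mM = "ideal_smult R \<mm> M"
  note E = free_resolution_dif[OF N Gr] and E2 = free_resolution_dif2[OF N Gr] and Em = min_res_dif[OF N G]
    and Ex = free_resolution_exact[OF N Gr]
  \<comment> \<open>Index k means degree k + 1, so Tor in degrees 1 to j + 2 covers all k up to j +
    1.\<close>
  have actE: "act_exact R ?b ?E M k" if "k \<le> Suc j" for k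
    by (rule Tor_zero_act_exact[OF cr M _ N Gr Tor]) (use that Fr in auto)
  have gen: "free_gen R {..<n::nat} i \<in> carrier (free_module R {..<n})" for n i by (rule free_gen_closed[OF cr]) simp
  have syz: "syzygy R \<mm> M t = (res_term R F (t - 1))\<lparr>carrier := res_kernel R M F (t - 1)\<rparr>"
    "syzygy R \<mm> N t = (res_term R G (t - 1))\<lparr>carrier := res_kernel R N G (t - 1)\<rparr>" if "t > 0" for t
    using that by (cases t; simp add: syzygy_def F_def G_def)+
  have j0: "j > 0" using j by simp
  have DI: "dif F j u i \<in> I" if "u \<in> carrier (res_term R F (Suc j))" "i < rk F j" for u i
    using dif_in_ideal[OF M F I I\<mm> j0 _ that] Mj syz(1)[OF j0] by simp
  have EI: "?E j u i \<in> I" if "u \<in> carrier (res_term R G (Suc j))" "i < ?b j" for u i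
    using dif_in_ideal[OF N G I I\<mm> j0 _ that] Nj syz(2)[OF j0] by simp
  have EI1: "?E (Suc j) u i \<in> I" if "u \<in> carrier (res_term R G (Suc (Suc j)))" "i < ?b (Suc j)" for u i
    using dif_in_ideal[OF N G I I\<mm> zero_less_Suc _ that] Nj1 syz(2)[of "Suc j"] by simp
  \<comment> \<open>A socle element: a nonzero element of I is killed by \<mm>, or some nonzero
    multiple of it by an element of \<mm> is, because \<mm>^2 I = 0.\<close>
  obtain s where s: "s \<in> carrier R" "s \<noteq> \<zero>" "\<And>a. a \<in> \<mm> \<Longrightarrow> a \<otimes> s = \<zero>"
  proof -
    obtain i where i: "i \<in> I" "i \<noteq> \<zero>" using I0 I.zero_closed by blast
    have ic: "i \<in> carrier R" using i(1) IR by blast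
    show thesis
    proof (cases "\<forall>a\<in>\<mm>. a \<otimes> i = \<zero>")
      case True
      then show ?thesis using that ic i(2) by blast
    next
      case False
      then obtain a where a: "a \<in> \<mm>" "a \<otimes> i \<noteq> \<zero>" by blast
      have "b \<otimes> (a \<otimes> i) = \<zero>" if "b \<in> \<mm>" for b
        using mmI[OF that a(1) i(1)] mm_closed[OF that] mm_closed[OF a(1)] ic by (simp add: m_assoc)
      then show ?thesis using that[of "a \<otimes> i"] a mm_closed[OF a(1)] ic by simp
    qed
  qed
  have bpos: "?b (Suc i) > 0" for i by (rule rank_pos[OF N G Nnf s])
  obtain u0 where u0: "u0 \<in> carrier M" "u0 \<notin> ?mM" by (rule mm_smult_ne[OF M Mfg Mnz])
  have act_zero: "act R M {..<?b (Suc k)} {..<?b k} (?E k) v = \<zero>\<^bsub>pow_module {..<?b k} M\<^esub>"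
    if "\<And>l i. l < ?b (Suc k) \<Longrightarrow> i < ?b k \<Longrightarrow> ?E k (free_gen R {..<?b (Suc k)} l) i \<odot>\<^bsub>M\<^esub> v l = \<zero>\<^bsub>M\<^esub>" for k v
    unfolding act_def dprod_simps
  proof (rule restrict_ext)
    fix i assume i: "i \<in> {..<?b k}"
    have "comb M {..<?b (Suc k)} v (\<lambda>x\<in>{..<?b (Suc k)}. ?E k (free_gen R {..<?b (Suc k)} x) i) \<in> {\<zero>\<^bsub>M\<^esub>}"
      unfolding comb_def by (rule submodule_finsum[OF M zero_submodule[OF M]]) (use that i in auto)
    then show "comb M {..<?b (Suc k)} v (\<lambda>x\<in>{..<?b (Suc k)}. ?E k (free_gen R {..<?b (Suc k)} x) i) = \<zero>\<^bsub>M\<^esub>" by simp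
  qed
  \<comment> \<open>The vector with all coordinates a u is a cycle, since the entries of
    \<open>?E j\<close> lie in I and \<mm>IM = 0. So it is a boundary under
    \<open>?E (Suc j)\<close>, whose entries also lie in I; any coordinate shows that a u lies in
    IM.\<close>
  have mmIM: "a \<odot>\<^bsub>M\<^esub> u \<in> ideal_smult R I M" if a: "a \<in> \<mm>" and u: "u \<in> carrier M" for a u
  proof -
    have ac: "a \<in> carrier R" by (rule mm_closed[OF a])
    let ?v = "\<lambda>l\<in>{..<?b (Suc j)}. a \<odot>\<^bsub>M\<^esub> u"
    have v: "?v \<in> carrier (pow_module {..<?b (Suc j)} M)" using ac u by (simp add: dprod_simps)
    have "act R M {..<?b (Suc j)} {..<?b j} (?E j) ?v = \<zero>\<^bsub>pow_module {..<?b j} M\<^esub>"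
    proof (rule act_zero)
      fix l i assume l: "l < ?b (Suc j)" and i: "i < ?b j"
      let ?e = "?E j (free_gen R {..<?b (Suc j)} l) i"
      have e: "?e \<in> I" by (rule EI[OF gen i])
      then have ec: "?e \<in> carrier R" using IR by blast
      have "?e \<odot>\<^bsub>M\<^esub> (a \<odot>\<^bsub>M\<^esub> u) = (a \<otimes> ?e) \<odot>\<^bsub>M\<^esub> u" using ec ac u by (simp add: M.smult_assoc1[symmetric] m_comm)
      then show "?e \<odot>\<^bsub>M\<^esub> ?v l = \<zero>\<^bsub>M\<^esub>" using mIM[OF a e u] l by simp
    qed
    then obtain w where w: "w \<in> carrier (pow_module {..<?b (Suc (Suc j))} M)"
      "?v = act R M {..<?b (Suc (Suc j))} {..<?b (Suc j)} (?E (Suc j)) w"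
      using actE[of j] v unfolding act_exact_def by auto
    have "?v 0 \<in> ideal_smult R I M" unfolding w(2)
      by (rule act_in_ideal_smult[OF M IR _ w(1) bpos[of j]]) (rule EI1[OF gen])
    then show ?thesis using bpos[of j] by simp
  qed
  have mmM: "(b \<otimes> a) \<odot>\<^bsub>M\<^esub> u = \<zero>\<^bsub>M\<^esub>" if b: "b \<in> \<mm>" and a: "a \<in> \<mm>" and u: "u \<in> carrier M" for a b u
  proof -
    have ac: "a \<in> carrier R" and bc: "b \<in> carrier R" using mm_closed a b by simp_all
    have "ideal_smult R I M \<subseteq> a_kernel M M (\<lambda>u. b \<odot>\<^bsub>M\<^esub> u)"
    proof (rule ideal_smult_least[OF submodule_kernel[OF M M module_hom_scalar[OF M bc]]])
      fix i x assume ix: "i \<in> I" "x \<in> carrier M"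
      then have "i \<in> carrier R" using IR by blast
      then show "i \<odot>\<^bsub>M\<^esub> x \<in> a_kernel M M (\<lambda>u. b \<odot>\<^bsub>M\<^esub> u)"
        using mIM[OF b ix] ix bc by (simp add: a_kernel_eq M.smult_assoc1[symmetric])
    qed
    then have "b \<odot>\<^bsub>M\<^esub> (a \<odot>\<^bsub>M\<^esub> u) = \<zero>\<^bsub>M\<^esub>" using mmIM[OF a u] by (auto simp: a_kernel_eq)
    then show ?thesis using ac bc u by (simp add: M.smult_assoc1)
  qed
  \<comment> \<open>The multiple r t of a generator is a cycle for \<open>?E j\<close> as \<mm>^2 I
    = 0, hence equals \<open>?E (Suc j) y\<close>. The entries of that matrix lie in I, and those of
    y in \<mm> by \<open>preimage_in_mm\<close>, since r t kills M. Coordinate 0 is the required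
    sum.\<close>
  have prod: "\<exists>(l::nat) v w. (\<forall>i<l. v i \<in> I \<and> w i \<in> \<mm>) \<and> r \<otimes> t = (\<Oplus>i\<in>{..<l}. v i \<otimes> w i)"
    if r: "r \<in> \<mm>" and t: "t \<in> \<mm>" for r t
  proof -
    have rt: "r \<otimes> t \<in> carrier R" using mm_closed r t by simp
    let ?T = "\<lambda>q. free_module R {..<?b q}"
    interpret T: Module.module R "?T (Suc j)" by (rule free) simp
    let ?e = "free_gen R {..<?b (Suc j)} 0"
    let ?z = "(r \<otimes> t) \<odot>\<^bsub>?T (Suc j)\<^esub> ?e"
    have z: "?z \<in> carrier (?T (Suc j))" using rt gen by simp
    have "?E j ?z = (r \<otimes> t) \<odot>\<^bsub>?T j\<^esub> ?E j ?e" by (rule module_hom_smult[OF E rt gen])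
    also have "\<dots> = \<zero>\<^bsub>?T j\<^esub>" unfolding free_simps by (rule restrict_ext) (use mmI[OF r t EI[OF gen]] in simp)
    finally have "?z \<in> ?E (Suc j) ` carrier (?T (Suc (Suc j)))" using Ex z unfolding exact_seq_def by blast
    then obtain y where y: "y \<in> carrier (?T (Suc (Suc j)))" "?z = ?E (Suc j) y" by blast
    let ?l = "?b (Suc (Suc j))"
    have y\<mm>: "y i \<in> \<mm>" if i: "i < ?l" for i
    proof (rule preimage_in_mm[OF M u0 E _ y(1) _ i])
      fix v k assume v: "v \<in> carrier (pow_module {..<?b (Suc (Suc j))} M)"
        and z: "act R M {..<?b (Suc (Suc j))} {..<?b (Suc j)} (?E (Suc j)) v = \<zero>\<^bsub>pow_module {..<?b (Suc j)} M\<^esub>" and k: "k < ?b (Suc (Suc j))"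
      obtain w where w: "w \<in> carrier (pow_module {..<?b (Suc (Suc (Suc j)))} M)"
        "v = act R M {..<?b (Suc (Suc (Suc j)))} {..<?b (Suc (Suc j))} (?E (Suc (Suc j))) w"
        using actE[of "Suc j"] v z unfolding act_exact_def by auto
      show "v k \<in> ?mM" unfolding w(2) by (rule act_in_ideal_smult[OF M mm_carrier _ w(1) k]) (rule Em[OF gen])
    next
      fix k assume k: "k < ?b (Suc j)"
      show "?E (Suc j) y k \<odot>\<^bsub>M\<^esub> u0 = \<zero>\<^bsub>M\<^esub>"
        unfolding y(2)[symmetric] using k rt mmM[OF r t u0(1)] u0(1) by (simp add: free_simps free_gen_def)
    qed
    let ?g = "\<lambda>v. ?E (Suc j) v 0"
    have g: "?g \<in> module_hom R (?T (Suc (Suc j))) (regular_module R)"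
      by (rule module_hom_comp[OF E free_proj_hom]) (use bpos in simp_all)
    have gI: "?g (free_gen R {..<?l} i) \<in> I" for i by (rule EI1[OF gen bpos[of j]])
    have yc: "y i \<in> carrier R" if "i < ?l" for i using y\<mm>[OF that] mm_closed by blast
    have gc: "?g (free_gen R {..<?l} i) \<in> carrier R" for i using gI IR by blast
    have "r \<otimes> t = ?z 0" using rt bpos[of j] by (simp add: free_simps free_gen_def)
    also have "\<dots> = ?g y" by (rule fun_cong[OF y(2)])
    also have "\<dots> = comb (regular_module R) {..<?l} (\<lambda>i. ?g (free_gen R {..<?l} i)) y"
      by (rule hom_free_eq[OF cr regular finite_lessThan g y(1)])
    also have "\<dots> = (\<Oplus>i\<in>{..<?l}. y i \<otimes> ?g (free_gen R {..<?l} i))"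
      unfolding comb_def regular_module_simps by (rule finsum_transfer) (simp_all add: regular_module_def)
    also have "\<dots> = (\<Oplus>i\<in>{..<?l}. ?g (free_gen R {..<?l} i) \<otimes> y i)"
      by (rule finsum_cong') (use yc gc m_comm in auto)
    finally have "r \<otimes> t = (\<Oplus>i\<in>{..<?l}. ?g (free_gen R {..<?l} i) \<otimes> y i)" .
    then show ?thesis
      using y\<mm> gI by - (rule exI[of _ ?l], rule exI[of _ "\<lambda>i. ?g (free_gen R {..<?l} i)"], rule exI[of _ y], blast)
  qed
  have tb: "tensor_bicomplex R (rk F) (\<lambda>q. ?b (Suc q)) (dif F) (\<lambda>q. ?E (Suc q))"
    by (rule tensor_bicomplex_resolutions(2)[OF cr M Fr N Gr])
  interpret T: local_tensor_bicomplex R \<mm> "rk F" "\<lambda>q. ?b (Suc q)" "dif F" "\<lambda>q. ?E (Suc q)"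
    by (intro local_tensor_bicomplex.intro local_tensor_bicomplex_axioms.intro finite_length_local_ring_axioms tb
        min_res_dif[OF M F] Em)
  note pr = free_resolution_presents[OF M Fr]
  have "I = \<mm>"
  \<comment> \<open>The complex of N has been shifted by one degree, so its differential with
    entries in I now has index j - 1.\<close>
  proof (rule T.ideal_eq_maximal[OF I I\<mm>, of j "j - 1"])
    show "dif F j u i \<in> I" if "u \<in> carrier (res_term R F (Suc j))" "i < rk F j" for u i by (rule DI[OF that])
    show "?E (Suc (j - 1)) u i \<in> I" if "u \<in> carrier (free_module R {..<?b (Suc (Suc (j - 1)))})" "i < ?b (Suc (j - 1))" for u i
      using EI[of u i] that j0 by simp
    show "j - 1 \<le> j" by simp
    show "rk F 0 > 0" by (rule rank_zero_pos[OF M Mnz Fr])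
    show "?b (Suc 0) > 0" by (rule bpos)
    show "\<exists>(l::nat) v w. (\<forall>i<l. v i \<in> I \<and> w i \<in> \<mm>) \<and> r \<otimes> t = (\<Oplus>i\<in>{..<l}. v i \<otimes> w i)"
      if "r \<in> \<mm>" "t \<in> \<mm>" for r t by (rule prod[OF that])
    show "T.B.tot_exact (Suc i)" if i: "i < j" for i
    proof (rule T.B.tot_exact_if_left_exact[OF T.B.row_exactI[OF free_resolution_exact[OF M Fr]]])
      have "act_exact R (\<lambda>q. ?b (Suc q)) (\<lambda>q. ?E (Suc q)) M i"
        using actE[of "Suc i"] i by (simp add: act_exact_def)
      then show "T.B.left_exact (Suc i)" by (rule T.B.left_exactI[OF pr])
    qed
    \<comment> \<open>The augmentation sends r x to a vector with coordinates in \<mm>M. This is a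
      cycle because the entries of \<open>?E 0\<close> lie in \<mm> and \<mm>^2 M = 0, so it is a
      boundary, and \<open>left_aug_image\<close> pulls this back to the double complex.\<close>
    fix r x assume r: "r \<in> \<mm>" and x: "x \<in> carrier (T.B.X 0 0)"
    have rc: "r \<in> carrier R" by (rule mm_closed[OF r])
    interpret X: Module.module R "T.B.X 0 0" by (rule T.B.modX)
    interpret P: Module.module R "pow_module {..<?b (Suc 0)} M" by (rule module_dprod[OF cr M])
    let ?w = "T.B.left_aug (aug F) 0 (r \<odot>\<^bsub>T.B.X 0 0\<^esub> x)"
    have rx: "r \<odot>\<^bsub>T.B.X 0 0\<^esub> x \<in> carrier (T.B.X 0 0)" using rc x by simp
    have w: "?w = r \<odot>\<^bsub>pow_module {..<?b (Suc 0)} M\<^esub> T.B.left_aug (aug F) 0 x"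
      by (rule module_hom_smult[OF T.B.left_aug_hom[OF pr] rc x])
    have vc: "T.B.left_aug (aug F) 0 x \<in> carrier (pow_module {..<?b (Suc 0)} M)"
      by (rule module_hom_closed[OF T.B.left_aug_hom[OF pr] x])
    have wc: "?w \<in> carrier (pow_module {..<?b (Suc 0)} M)" unfolding w using rc vc by simp
    have "act R M {..<?b (Suc 0)} {..<?b 0} (?E 0) ?w = \<zero>\<^bsub>pow_module {..<?b 0} M\<^esub>"
    proof (rule act_zero)
      fix l i assume l: "l < ?b (Suc 0)" and i: "i < ?b 0"
      let ?e = "?E 0 (free_gen R {..<?b (Suc 0)} l) i"
      have e: "?e \<in> \<mm>" by (rule Em[OF gen i])
      have c: "T.B.left_aug (aug F) 0 x l \<in> carrier M" using vc l by (auto simp: dprod_simps)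
      have "?e \<odot>\<^bsub>M\<^esub> ?w l = (?e \<otimes> r) \<odot>\<^bsub>M\<^esub> T.B.left_aug (aug F) 0 x l"
        unfolding w using l c rc mm_closed[OF e] by (simp add: dprod_simps M.smult_assoc1)
      then show "?e \<odot>\<^bsub>M\<^esub> ?w l = \<zero>\<^bsub>M\<^esub>" using mmM[OF e r c] by simp
    qed
    then have "?w \<in> act R M {..<?b (Suc (Suc 0))} {..<?b (Suc 0)} (?E (Suc 0)) ` carrier (pow_module {..<?b (Suc (Suc 0))} M)"
      using actE[of 0] wc unfolding act_exact_def by blast
    from T.B.left_aug_image[OF pr rx this]
    show "\<exists>y\<in>carrier (T.B.X 0 (Suc 0)). \<exists>z\<in>carrier (T.B.X (Suc 0) 0).
      r \<odot>\<^bsub>T.B.X 0 0\<^esub> x = T.B.DF 0 0 z \<oplus>\<^bsub>T.B.X 0 0\<^esub> T.B.EF 0 0 y" .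
  qed
  then have I\<mm>eq: "\<mm> = I" by simp
  let ?h = "betti R \<mm> ((regular_module R)\<lparr>carrier := I\<rparr>) 0"
  obtain f where f: "f \<in> module_hom R (free_module R {..<?h}) (regular_module R)"
    and fim: "f ` carrier (free_module R {..<?h}) = I"
    and fker: "\<And>u i. u \<in> carrier (free_module R {..<?h}) \<Longrightarrow> f u = \<zero> \<Longrightarrow> i < ?h \<Longrightarrow> u i \<in> \<mm>"
    using ideal_generators[OF I] by blast
  show ?thesis
  proof (rule free_if_square_kills[where E = ?E and b = ?b and f = f and h = ?h, OF M Mfg Mnz F _ _ _ _ _ Ex _ _ _ f])
    show "?E q \<in> module_hom R (res_term R G (Suc q)) (res_term R G q)" for q by (rule E)
    show "?E q (?E (Suc q) v) = \<zero>\<^bsub>res_term R G q\<^esub>" if "v \<in> carrier (res_term R G (Suc (Suc q)))" for q v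
      by (rule E2[OF that])
    show "?E q v i \<in> \<mm>" if "v \<in> carrier (res_term R G (Suc q))" "i < ?b q" for q v i by (rule Em[OF that])
    show "(a \<otimes> b) \<odot>\<^bsub>M\<^esub> v = \<zero>\<^bsub>M\<^esub>" if "a \<in> \<mm>" "b \<in> \<mm>" "v \<in> carrier M" for a b v by (rule mmM[OF that])
    show "v i \<in> \<mm>" if "v \<in> carrier (free_module R {..<?h})" "f v = \<zero>" "i < ?h" for v i by (rule fker[OF that])
    show "act_exact R ?b ?E M k" if "k \<le> 2" for k using actE that j by simp
    show "?b 1 > 0" using bpos[of 0] by simp
    show "?b 2 > 0" using bpos[of 1] by (simp add: numeral_2_eq_2)
    show "f ` carrier (free_module R {..<?h}) = \<mm>" using fim I\<mm>eq by simp
    show "module_length R (regular_module R) < 2 * enat ?h"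
      using short module_length_residue unfolding I\<mm>eq by simp
    fix a b assume a: "a \<in> m_squared" and b: "b \<in> \<mm>"
    have bc: "b \<in> carrier R" by (rule mm_closed[OF b])
    \<comment> \<open>With I = \<mm> the relation \<mm>^2 I = 0 becomes \<mm>^3 = 0.\<close>
    have "m_squared \<subseteq> a_kernel (regular_module R) (regular_module R) (\<lambda>a. b \<odot>\<^bsub>regular_module R\<^esub> a)"
    proof (rule m_squared_least[OF submodule_kernel[OF regular regular module_hom_scalar[OF regular bc]]])
      fix c d assume cd: "c \<in> \<mm>" "d \<in> \<mm>"
      have "(c \<otimes> d) \<otimes> b = \<zero>" using mmI[OF cd] b I\<mm>eq by simp
      then show "c \<otimes> d \<in> a_kernel (regular_module R) (regular_module R) (\<lambda>a. b \<odot>\<^bsub>regular_module R\<^esub> a)"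
        using mm_closed[OF cd(1)] mm_closed[OF cd(2)] bc by (simp add: a_kernel_eq m_comm)
    qed
    then have "b \<otimes> a = \<zero>" and "a \<in> carrier R" using a by (auto simp: a_kernel_eq)
    then show "a \<otimes> b = \<zero>" using bc by (simp add: m_comm)
  qed
qed

end

theorem corollary2p7:
  fixes R :: "('a, 'r) ring_scheme"
    and m I :: "'a set"
    and M :: "('a, 'b, 'k) module_scheme"
    and N :: "('a, 'c, 'l) module_scheme"
    and s :: enat and h j :: nat and \<beta> :: ereal
  assumes "local_ring R m" and "artinian_ring R"
    and "ideal I R" and "I \<subset> carrier R" and "I \<noteq> {\<zero>\<^bsub>R\<^esub>}"
    and "ideal_prod R (ideal_prod R m m) I = {\<zero>\<^bsub>R\<^esub>}"
    and "s = module_length R (quot_module (regular_module R) I)"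
    and "h = betti R m ((regular_module R)\<lparr>carrier := I\<rparr>) 0"
    and "module_length R (regular_module R) < 2 * s * enat h"
    and "Module.module R M" and "finitely_generated R M" and "\<not> zero_module M"
    and "ideal_smult R (ideal_prod R m I) M = {\<zero>\<^bsub>M\<^esub>}"
    and "Module.module R N" and "finitely_generated R N" and "\<not> is_free R N"
    and "j > 1"
    and "\<forall>t\<in>{j, j + 1, j + 2}.
           ideal_free R I (syzygy R m M t) \<and> ideal_free R I (syzygy R m N t)"
    and "\<beta> = Max {log2_plus_one (betti R m M 1), log2_plus_one (betti R m N 1),
                   ereal (real (j + 2))}"
    and "\<forall>i::nat. 1 \<le> i \<and> ereal (real i) \<le> \<beta> \<longrightarrow> zero_module (Tor R M N i)"
  shows "is_free R M \<or> is_free R N"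
proof -
  \<comment> \<open>The left side of a strict inequality in \<open>enat\<close> is finite.\<close>
  have "module_length R (regular_module R) < \<infinity>"
    using assms(9) by (cases "module_length R (regular_module R)") auto
  then interpret finite_length_local_ring R m
    using assms(1) by (simp add: finite_length_local_ring_def)
  \<comment> \<open>N is assumed not to be free, so M is the module to be shown free.\<close>
  have "is_free R M"
  proof (rule free_if_Tor_zero[OF assms(3-5) _ _ assms(10-12) _ assms(14-17)])
    show "module_length R (regular_module R) <
      2 * module_length R (quot_module (regular_module R) I) * enat (betti R m ((regular_module R)\<lparr>carrier := I\<rparr>) 0)"
      using assms(7-9) by simp
    show "(a \<otimes>\<^bsub>R\<^esub> b) \<otimes>\<^bsub>R\<^esub> i = \<zero>\<^bsub>R\<^esub>" if "a \<in> m" "b \<in> m" "i \<in> I" for a b i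
      using ideal_prod.prod[OF ideal_prod.prod[OF that(1,2), of R] that(3), of R] assms(6) by simp
    show "(a \<otimes>\<^bsub>R\<^esub> i) \<odot>\<^bsub>M\<^esub> u = \<zero>\<^bsub>M\<^esub>" if "a \<in> m" "i \<in> I" "u \<in> carrier M" for a i u
      using ideal_smultI[OF ideal_prod.prod[OF that(1,2), of R] that(3), of R] assms(13) by simp
    show "ideal_free R I (syzygy R m M j)" "ideal_free R I (syzygy R m N j)" "ideal_free R I (syzygy R m N (Suc j))"
      using assms(18) by simp_all
    show "zero_module (Tor R M N i)" if "1 \<le> i" "i \<le> j + 2" for i
    proof -
      \<comment> \<open>The maximum that defines \<beta> is at least its entry j + 2.\<close>
      have "ereal (real i) \<le> ereal (real (j + 2))" using that(2) by simp
      also have "\<dots> \<le> \<beta>" unfolding assms(19) by (rule Max_ge) simp_all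
      finally show ?thesis using assms(20) that(1) by blast
    qed
  qed
  then show ?thesis by simp
qed

end
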